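(* Let $n\ge3$ and let $\Gamma<SL(n,\mathbb R)$ be a lattice. Then for every $d\in\mathbb N$, $\lim_{\delta\to0^+}F^{(d)}_\Gamma(\delta)=0$; that is, for every $\varepsilon>0$ there is $\delta>0$ such that every map $\mu:\Gamma\to U(d)$ with $\mu(e)=\mathrm{Id}$ and $\mathrm{def}(\mu)\le\delta$ is within uniform distance $\varepsilon$ of a unitary representation $\Gamma\to U(d)$.
   Context: For maps $\mu,\nu:\Gamma\to U(d)$ put $\|\mu-\nu\|=\sup_\gamma\|\mu(\gamma)-\nu(\gamma)\|$ (operator norm), $D(\mu)=\inf\{\|\mu-\nu\|:\nu\in\mathrm{Hom}(\Gamma,U(d))\}$, $\mathrm{def}(\mu)=\sup_{x,y}\|\mu(xy)-\mu(x)\mu(y)\|$, and $F^{(d)}_\Gamma(\delta)=\sup\{D(\mu):\mathrm{def}(\mu)\le\delta,\ \mu(e)=\mathrm{Id}\}$, supremum over maps $\mu:\Gamma\to U(d)$ ($d$-dimensional Hilbert spaces). *)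

theory Defs
  imports "HOL-Analysis.Analysis"
begin

definition SL :: "(real^'n^'n) set" where
  "SL = {g. det g = 1}"

definition adjoint_mat :: "complex^'d^'d \<Rightarrow> complex^'d^'d" where
  "adjoint_mat A = (\<chi> i j. cnj (A $ j $ i))"

definition unitary_group :: "(complex^'d^'d) set" where
  "unitary_group = {U. U ** adjoint_mat U = mat 1 \<and> adjoint_mat U ** U = mat 1}"

definition op_norm :: "complex^'d^'d \<Rightarrow> real" where
  "op_norm A = onorm (\<lambda>x. A *v x)"

(* Haar measure on SL(n,R) realised as the cone measure:
   mu(A) = Lebesgue measure of {c g | g in A, 0 < c <= 1} *)
definition SL_cone :: "(real^'n^'n) set \<Rightarrow> (real^'n^'n) set" where
  "SL_cone A = {c *\<^sub>R g | c g. g \<in> A \<and> 0 < c \<and> c \<le> 1}"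

definition subgroup_SL :: "(real^'n^'n) set \<Rightarrow> bool" where
  "subgroup_SL \<Gamma> \<longleftrightarrow> \<Gamma> \<subseteq> SL \<and> mat 1 \<in> \<Gamma>
     \<and> (\<forall>x\<in>\<Gamma>. \<forall>y\<in>\<Gamma>. x ** y \<in> \<Gamma>)
     \<and> (\<forall>x\<in>\<Gamma>. matrix_inv x \<in> \<Gamma>)"

definition discrete_set :: "'a::metric_space set \<Rightarrow> bool" where
  "discrete_set S \<longleftrightarrow> (\<forall>g\<in>S. \<exists>e>0. \<forall>h\<in>S. dist h g < e \<longrightarrow> h = g)"

(* finite covolume: some Borel set F \<subseteq> SL of finite Haar measure with F \<Gamma> = SL *)
definition finite_covolume :: "(real^'n^'n) set \<Rightarrow> bool" where
  "finite_covolume \<Gamma> \<longleftrightarrow> (\<exists>F. F \<subseteq> SL \<and> SL_cone F \<in> sets lborel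
      \<and> emeasure lborel (SL_cone F) < \<infinity>
      \<and> (\<forall>g\<in>SL. \<exists>f\<in>F. \<exists>\<gamma>\<in>\<Gamma>. g = f ** \<gamma>))"

definition lattice_SL :: "(real^'n^'n) set \<Rightarrow> bool" where
  "lattice_SL \<Gamma> \<longleftrightarrow> subgroup_SL \<Gamma> \<and> discrete_set \<Gamma> \<and> finite_covolume \<Gamma>"

end

theory Submission
  imports Defs "HOL-Probability.Probability" "HOL-Complex_Analysis.Great_Picard"
begin

text \<open>
  Let \<open>\<mu>\<close> be a near homomorphism. By compactness it is close, on any prescribed finite subset of the
  lattice, to an honest homomorphism \<open>\<nu>\<close>. Then \<open>\<pi> \<gamma> X = \<mu> \<gamma> X (\<nu> \<gamma>)\<^sup>*\<close> is a near representation on matrices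
  for which the unit vector proportional to the identity is almost invariant under that finite set, and
  it remains to see that it is almost invariant under the whole lattice, uniformly.

  For a near representation \<open>\<pi>\<close> and a vector \<open>v\<close>, a Borel fundamental domain turns \<open>v\<close> into a field \<open>\<zeta>\<close> on
  the matrices of positive determinant that is almost equivariant on the right; left translation of
  fields plays the role of the induced representation. A quantitative form of relative property (T)
  for the semidirect product of \<open>SL\<^sub>2(\<int>)\<close> with \<open>\<int>\<^sup>2\<close>, which sits in \<open>SL\<^sub>n\<close> in many ways because \<open>n \<ge> 3\<close>,
  shows that \<open>\<zeta>\<close> is almost invariant in mean under every transvection, hence under all of \<open>SL\<^sub>n\<close> by
  bounded generation. Averaging \<open>\<zeta>\<close> along the powers of a diagonal element gives a field exactly
  invariant under that element, and ergodicity of the element upgrades invariance in mean to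
  invariance almost everywhere, first for its centralizer and then, by comparing different diagonal
  elements, for all transvections. So the averaged field is almost constant; its almost constant value
  is close to \<open>v\<close> and almost fixed by every lattice element.
\<close>

section \<open>Transvections\<close>

text \<open>A cocompact lattice contains no unipotent element, so the shears and translations that
  drive property (T) exist only in the ambient group; this forces the passage from vectors to
  fields. Since \<open>\<pi>\<close> is multiplicative only up to \<delta>, it has no spectral
  measure, and errors may not be added along chains of unbounded length. Hence every comparison is
  arranged to cost a number of \<delta> that does not depend on the group elements involved:
  positive means over Foelner sets stand in for the spectral theorem, and words in transvections
  have a fixed maximal length. Property (T) controls displacement only in the mean over the
  quotient, whereas a single lattice element has to be controlled in the end. A superlevel set of an
  almost invariant function is not invariant, but if the function barely changes along whole orbits,
  the saturation of that set is, and ergodicity then forbids large values outright. The thresholds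
  in \<open>almost_invariant_vectors\<close> are built without reference to the dimension of the
  space; d enters through the compactness of the unitary group and the comparison of matrix
  norms.\<close>

definition transvection :: "'n \<Rightarrow> 'n \<Rightarrow> real \<Rightarrow> real^'n^'n" where
  "transvection i j t = (\<chi> a b. (if a = b then 1 else 0) + (if a = i \<and> b = j then t else 0))"

lemma transvection_mult_left:
  "(transvection i j t ** A) $ a $ b = A $ a $ b + (if a = i then t * A $ j $ b else 0)"
  by (simp add: transvection_def matrix_matrix_mult_def distrib_right sum.distrib if_distrib
      [of "\<lambda>x. x * _"] cong: if_cong)

lemma transvection_mult_right:
  "(A ** transvection i j t) $ a $ b = A $ a $ b + (if b = j then t * A $ a $ i else 0)"
  by (simp add: transvection_def matrix_matrix_mult_def distrib_left sum.distrib if_distrib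
      [of "\<lambda>x. _ * x"] mult.commute cong: if_cong)

lemma transvection_nth:
  "transvection i j t $ a $ b = (if a = b then 1 else 0) + (if a = i \<and> b = j then t else 0)"
  by (simp add: transvection_def)

lemma transvection_0 [simp]: "transvection i j 0 = mat 1"
  by (simp add: transvection_def mat_def vec_eq_iff)

lemma transvection_add:
  assumes "i \<noteq> j"
  shows "transvection i j s ** transvection i j t = transvection i j (s + t)"
  using assms by (auto simp: vec_eq_iff transvection_mult_left transvection_nth)

text \<open>This is where n \<ge> 3 enters: a third index makes every transvection a commutator. It
  yields the perfectness behind unimodularity, and it builds transvections that avoid an index k
  from those that meet it.\<close>

lemma transvection_commutator:
  assumes "i \<noteq> j" "i \<noteq> k" "k \<noteq> j"
  shows "transvection i k t ** (transvection k j 1 ** (transvection i k (-t) ** transvection k j (-1)))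
    = transvection i j t"
  using assms by (auto simp: vec_eq_iff transvection_mult_left transvection_nth)

lemma det_transvection:
  assumes "i \<noteq> j"
  shows "det (transvection i j t) = 1"
proof -
  have "transvection i j t = (\<chi> k. if k = i then row i (mat 1) + t *s row j (mat 1) else row k (mat 1))"
    using assms by (auto simp: vec_eq_iff transvection_nth row_def mat_def)
  then show ?thesis
    using det_row_operation[OF assms, of "mat 1 :: real^'a^'a" t] by simp
qed

lemma det_transvection_mult [simp]: "i \<noteq> j \<Longrightarrow> det (transvection i j t ** A) = det A"
  by (simp add: det_mul det_transvection)

section \<open>Bounded generation of the special linear group by transvections\<close>

fun transvection_words :: "nat \<Rightarrow> (real^'n^'n) set" where
  "transvection_words 0 = {mat 1}"
| "transvection_words (Suc m) = {transvection i j t ** A | i j t A. i \<noteq> j \<and> A \<in> transvection_words m}"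

lemma transvection_words_mult:
  "A \<in> transvection_words k \<Longrightarrow> B \<in> transvection_words l \<Longrightarrow> A ** B \<in> transvection_words (k + l)"
proof (induction k arbitrary: A)
  case (Suc k)
  then obtain i j t A' where "A = transvection i j t ** A'" "i \<noteq> j" "A' \<in> transvection_words k"
    by auto
  moreover from this have "A' ** B \<in> transvection_words (k + l)"
    using Suc by blast
  ultimately show ?case
    by (auto simp flip: matrix_mul_assoc)
qed auto

lemma transvection_in_words: "i \<noteq> j \<Longrightarrow> transvection i j t \<in> transvection_words 1"
  by simp (metis matrix_mul_rid)

lemma transvection_words_mono:
  assumes "i \<noteq> (j :: 'n)" "(A :: real^'n^'n) \<in> transvection_words k" "k \<le> l"
  shows "A \<in> transvection_words l"
  using assms(3,2)
proof (induction rule: dec_induct)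
  case (step l)
  then have "transvection i j 0 ** A \<in> transvection_words (1 + l)"
    by (intro transvection_words_mult transvection_in_words assms) auto
  then show ?case by simp
qed auto

lemma transvection_words_inverse:
  "A \<in> transvection_words k \<Longrightarrow> \<exists>B\<in>transvection_words k. A ** B = mat 1 \<and> B ** A = mat 1"
proof (induction k arbitrary: A)
  case (Suc k)
  then obtain i j t A' where A: "A = transvection i j t ** A'" "i \<noteq> j" "A' \<in> transvection_words k"
    by auto
  with Suc obtain B' where B': "B' \<in> transvection_words k" "A' ** B' = mat 1" "B' ** A' = mat 1"
    by blast
  let ?T = "transvection i j t" and ?S = "transvection i j (-t)"
  have TS: "?T ** ?S = mat 1" "?S ** ?T = mat 1"
    using A(2) by (simp_all add: transvection_add)
  have "B' ** ?S \<in> transvection_words (k + 1)"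
    by (intro transvection_words_mult transvection_in_words A B')
  moreover have "A ** (B' ** ?S) = ?T ** (A' ** B') ** ?S" "(B' ** ?S) ** A = B' ** (?S ** ?T) ** A'"
    by (simp_all add: A matrix_mul_assoc)
  ultimately show ?case
    using B' TS by (intro bexI[of _ "B' ** ?S"]) auto
qed auto

lemma column_matrix_in_words:
  fixes u :: "'n::finite \<Rightarrow> real"
  assumes "finite R" "p \<notin> R"
  shows "(\<chi> a b. (if a = b then 1 else 0) + (if b = p \<and> a \<in> R then u a else 0)) \<in> transvection_words (card R)"
  using assms
proof (induction R)
  case empty
  then show ?case by (auto simp: mat_def vec_eq_iff)
next
  case (insert r R)
  let ?C = "\<lambda>R. (\<chi> a b. (if a = b then 1 else 0) + (if b = p \<and> a \<in> R then u a else 0))"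
  have "?C (insert r R) = transvection r p (u r) ** ?C R"
    using insert by (auto simp: vec_eq_iff transvection_mult_left)
  moreover have "transvection r p (u r) ** ?C R \<in> transvection_words (1 + card R)"
    using insert by (intro transvection_words_mult transvection_in_words) auto
  ultimately show ?case using insert by simp
qed

lemma row_matrix_in_words:
  fixes u :: "'n::finite \<Rightarrow> real"
  assumes "finite R" "p \<notin> R"
  shows "(\<chi> a b. (if a = b then 1 else 0) + (if a = p \<and> b \<in> R then u b else 0)) \<in> transvection_words (card R)"
  using assms
proof (induction R)
  case empty
  then show ?case by (auto simp: mat_def vec_eq_iff)
next
  case (insert r R)
  let ?C = "\<lambda>R. (\<chi> a b. (if a = b then 1 else 0) + (if a = p \<and> b \<in> R then u b else 0))"
  have "?C (insert r R) = ?C R ** transvection p r (u r)"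
    using insert by (auto simp: vec_eq_iff transvection_mult_right)
  moreover have "?C R ** transvection p r (u r) \<in> transvection_words (card R + 1)"
    using insert by (intro transvection_words_mult transvection_in_words) auto
  ultimately show ?case using insert by simp
qed

text \<open>The state of a Gaussian elimination that stays inside the group: rows cannot be
  rescaled, and the remaining work lies in the block indexed by \<open>- S\<close>.\<close>

definition cleared :: "'n set \<Rightarrow> real^'n^'n \<Rightarrow> bool" where
  "cleared S A \<longleftrightarrow> (\<forall>a b. a \<in> S \<or> b \<in> S \<longrightarrow> A $ a $ b = (if a = b then 1 else 0))"

text \<open>Rescaling being forbidden, the pivot 1 is made by adding a multiple of another row with
  a nonzero entry in column p. If there is no such row, the pivot entry itself is nonzero and one
  extra transvection first copies it into row q; hence length 2.\<close>

lemma cleared_pivot: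
  fixes A :: "real^'n^'n"
  assumes "cleared S A" "det A \<noteq> 0" "p \<notin> S" "q \<notin> S" "p \<noteq> q"
  shows "\<exists>L\<in>transvection_words 2. cleared S (L ** A) \<and> (L ** A) $ p $ p = 1"
proof -
  have main: "\<exists>t. cleared S (transvection p r t ** A) \<and> (transvection p r t ** A) $ p $ p = 1"
    if "r \<noteq> p" "r \<notin> S" "A $ r $ p \<noteq> 0" "cleared S A" for r and A :: "real^'n^'n"
    using that assms(3)
    by (intro exI[of _ "(1 - A $ p $ p) / A $ r $ p"]) (auto simp: cleared_def transvection_mult_left)
  show ?thesis
  proof (cases "\<exists>r. r \<noteq> p \<and> A $ r $ p \<noteq> 0")
    case True
    then obtain r where r: "r \<noteq> p" "A $ r $ p \<noteq> 0" by blast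
    then have "r \<notin> S" using assms by (auto simp: cleared_def)
    then obtain t where "cleared S (transvection p r t ** A) \<and> (transvection p r t ** A) $ p $ p = 1"
      using main[OF r(1) _ r(2) assms(1)] by auto
    moreover have "transvection p r t \<in> transvection_words 2"
      by (rule transvection_words_mono[of p r _ 1, OF _ transvection_in_words]) (use r in auto)
    ultimately show ?thesis by (rule bexI)
  next
    case False
    have "A $ p $ p \<noteq> 0"
    proof
      assume "A $ p $ p = 0"
      with False have "column p A = 0" by (auto simp: column_def vec_eq_iff)
      then show False using det_zero_column(2)[of p A] assms by simp
    qed
    let ?A = "transvection q p 1 ** A"
    have "cleared S ?A" "?A $ q $ p \<noteq> 0"
      using assms False \<open>A $ p $ p \<noteq> 0\<close> by (auto simp: cleared_def transvection_mult_left)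
    then obtain t where "cleared S (transvection p q t ** ?A) \<and> (transvection p q t ** ?A) $ p $ p = 1"
      using main[of q ?A] assms by metis
    moreover have "transvection p q t ** transvection q p 1 \<in> transvection_words (1 + 1)"
      using assms by (intro transvection_words_mult transvection_in_words) auto
    ultimately show ?thesis
      by (intro bexI[of _ "transvection p q t ** transvection q p 1"]) (auto simp: matrix_mul_assoc numeral_2_eq_2)
  qed
qed

lemma cleared_insert:
  fixes A :: "real^'n^'n"
  assumes "cleared S A" "A $ p $ p = 1" "p \<notin> S" and q: "q \<noteq> p"
  shows "\<exists>L\<in>transvection_words CARD('n). \<exists>R\<in>transvection_words CARD('n). cleared (insert p S) (L ** A ** R)"
proof -
  \<comment> \<open>\<open>L\<close> clears column p by row operations and \<open>R\<close> clears
    row p by column operations; each is a product of transvections sharing one column or one row, so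
    at most \<open>CARD('n)\<close> of them occur.\<close>
  define L :: "real^'n^'n" where
    "L = (\<chi> a b. (if a = b then 1 else 0) + (if b = p \<and> a \<in> -{p} then - A $ a $ p else 0))"
  define R :: "real^'n^'n" where
    "R = (\<chi> a b. (if a = b then 1 else 0) + (if a = p \<and> b \<in> -{p} then - A $ p $ b else 0))"
  have L: "L \<in> transvection_words CARD('n)"
    unfolding L_def R_def by (rule transvection_words_mono[OF q column_matrix_in_words]) (auto intro: card_mono)
  have R: "R \<in> transvection_words CARD('n)"
    unfolding L_def R_def by (rule transvection_words_mono[OF q row_matrix_in_words]) (auto intro: card_mono)
  have LA: "(L ** B) $ a $ b = B $ a $ b + (if a \<noteq> p then - A $ a $ p * B $ p $ b else 0)" for B :: "real^'n^'n" and a b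
    by (simp add: L_def R_def matrix_matrix_mult_def distrib_right sum.distrib if_distrib[of "\<lambda>x. x * _"] cong: if_cong)
  have BR: "(B ** R) $ a $ b = B $ a $ b + (if b \<noteq> p then - A $ p $ b * B $ a $ p else 0)" for B :: "real^'n^'n" and a b
    by (simp add: L_def R_def matrix_matrix_mult_def distrib_left sum.distrib if_distrib[of "\<lambda>x. _ * x"] mult.commute cong: if_cong)
  have "cleared (insert p S) (L ** A ** R)"
    using assms by (auto simp: cleared_def LA BR)
  then show ?thesis using L R by blast
qed

text \<open>Each index costs 2 transvections for the pivot and \<open>CARD('n)\<close> each for its
  column and its row. The last index is free: the determinant forces the remaining entry to be
  1.\<close>

lemma SL_words_cleared:
  fixes A :: "real^'n^'n"
  assumes "cleared S A" "det A = 1" "CARD('n) \<ge> 2"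
  shows "A \<in> transvection_words ((2 * CARD('n) + 2) * card (- S))"
  using assms(1,2)
proof (induction "card (- S)" arbitrary: S A)
  case 0
  then have "S = UNIV" by auto
  with 0 have "A = mat 1" by (auto simp: cleared_def mat_def vec_eq_iff)
  with 0 show ?case by simp
next
  case (Suc m)
  let ?n = "CARD('n)"
  obtain p where p: "p \<notin> S" using Suc.hyps(2) by (cases "S = UNIV") auto
  show ?case
  proof (cases "\<exists>q. q \<notin> S \<and> q \<noteq> p")
    case False
    then have S: "- S = {p}" using p by auto
    have "det A = (\<Prod>i\<in>UNIV. A $ i $ i)"
    proof (rule det_diagonal)
      fix i j :: 'n assume "i \<noteq> j"
      then have "i \<in> S \<or> j \<in> S" using S by (metis ComplI singletonD)
      then show "A $ i $ j = 0" using Suc.prems(1) \<open>i \<noteq> j\<close> by (auto simp: cleared_def)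
    qed
    also have "\<dots> = A $ p $ p * (\<Prod>i\<in>UNIV - {p}. A $ i $ i)"
      by (rule prod.remove) auto
    also have "(\<Prod>i\<in>UNIV - {p}. A $ i $ i) = 1"
      using Suc.prems S by (intro prod.neutral) (auto simp: cleared_def)
    finally have "A $ p $ p = 1" using Suc.prems by simp
    moreover have "A $ a $ b = (if a = b then 1 else 0)" if "a \<noteq> p \<or> b \<noteq> p" for a b
      using Suc.prems(1) that S by (auto simp: cleared_def)
    ultimately have "A = mat 1"
      unfolding mat_def vec_eq_iff vec_lambda_beta by metis
    moreover obtain q where "q \<noteq> p"
      using assms(3) by (metis card_2_iff' ex_card UNIV_I)
    ultimately show ?thesis
      using transvection_words_mono[of q p "mat 1" 0] by simp
  next
    case True
    then obtain q where q: "q \<notin> S" "q \<noteq> p" by blast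
    obtain L1 where L1: "L1 \<in> transvection_words 2" "cleared S (L1 ** A)" "(L1 ** A) $ p $ p = 1"
      using cleared_pivot[of S A p q] Suc.prems p q by auto
    obtain L2 R where L2: "L2 \<in> transvection_words ?n" "R \<in> transvection_words ?n"
      "cleared (insert p S) (L2 ** (L1 ** A) ** R)"
      using cleared_insert[OF L1(2,3) p q(2)] by auto
    have detW: "det B = 1" if "B \<in> transvection_words k" for B :: "real^'n^'n" and k
      using that by (induction k arbitrary: B) auto
    let ?B = "L2 ** (L1 ** A) ** R"
    have "- insert p S = - S - {p}" by auto
    then have m: "m = card (- insert p S)" using Suc.hyps(2) p by simp
    have "det ?B = 1"
      using detW L1(1) L2(1,2) Suc.prems by (simp add: det_mul)
    then have B: "?B \<in> transvection_words ((2 * ?n + 2) * m)"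
      using Suc.hyps(1)[OF m L2(3)] m by simp
    obtain L1' L2' R' where inv: "L1' \<in> transvection_words 2" "L2' \<in> transvection_words ?n"
      "R' \<in> transvection_words ?n" "L1' ** L1 = mat 1" "L2' ** L2 = mat 1" "R ** R' = mat 1"
      using transvection_words_inverse L1(1) L2(1,2) by metis
    have "L1' ** (L2' ** (?B ** R')) = L1' ** (L2' ** L2) ** L1 ** A ** (R ** R')"
      by (simp add: matrix_mul_assoc)
    also have "\<dots> = A" using inv by simp
    finally have "A = L1' ** (L2' ** (?B ** R'))" ..
    moreover have "L1' ** (L2' ** (?B ** R')) \<in> transvection_words (2 + (?n + ((2 * ?n + 2) * m + ?n)))"
      by (intro transvection_words_mult inv B)
    moreover have "2 + (?n + ((2 * ?n + 2) * m + ?n)) = (2 * ?n + 2) * card (- S)"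
      using Suc.hyps(2) by (simp add: algebra_simps flip: Suc.hyps(2))
    ultimately show ?thesis by metis
  qed
qed

text \<open>A length independent of the matrix is essential, because each letter of a word will
  contribute a fixed error.\<close>

lemma SL_bounded_generation:
  fixes A :: "real^'n^'n"
  assumes "det A = 1" "CARD('n) \<ge> 2"
  shows "A \<in> transvection_words ((2 * CARD('n) + 2) * CARD('n))"
  using SL_words_cleared[of "{}" A] assms by (simp add: cleared_def)

section \<open>Invariance of Lebesgue measure\<close>

text \<open>Uniqueness of Haar measure by Fubini: in the double integral of the two indicators,
  translate the second variable by the first, then the first by the second, and reflect. The result
  is the same product with the two measures exchanged.\<close>

lemma translation_invariant_proportional:
  fixes \<mu> :: "'a::euclidean_space measure"
  assumes [measurable_cong]: "sets \<mu> = sets borel" and "sigma_finite_measure \<mu>"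
    and inv: "\<And>c. distr \<mu> borel (\<lambda>x. c + x) = \<mu>"
    and [measurable]: "A \<in> sets borel" "B \<in> sets borel"
  shows "emeasure \<mu> A * emeasure lborel B = emeasure \<mu> B * emeasure lborel A"
proof -
  interpret \<mu>: sigma_finite_measure \<mu> by fact
  interpret P: pair_sigma_finite \<mu> "lborel :: 'a measure" ..
  have neg: "distr lborel borel (\<lambda>y. c - y) = (lborel :: 'a measure)" for c :: 'a
  proof -
    have "lborel = density (distr lborel borel (\<lambda>x. c + (-1) *\<^sub>R x :: 'a)) (\<lambda>_. \<Prod>j\<in>(Basis::'a set). \<bar>-1::real\<bar>)"
      using lborel_affine_euclidean[of "\<lambda>_. -1" c] by (simp add: euclidean_representation sum_negf scaleR_minus_left)
    then show ?thesis by (simp add: density_1)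
  qed
  have "emeasure \<mu> A * emeasure lborel B = (\<integral>\<^sup>+x. \<integral>\<^sup>+y. indicator A x * indicator B y \<partial>lborel \<partial>\<mu>)"
    by (simp add: nn_integral_cmult nn_integral_multc)
  also have "\<dots> = (\<integral>\<^sup>+x. \<integral>\<^sup>+y. indicator A x * indicator B (x + y) \<partial>lborel \<partial>\<mu>)"
  proof (rule nn_integral_cong)
    fix x
    have "(\<integral>\<^sup>+y. indicator A x * indicator B y \<partial>lborel)
      = (\<integral>\<^sup>+y. indicator A x * indicator B y \<partial>distr lborel borel ((+) x))"
      by (simp add: lborel_distr_plus)
    also have "\<dots> = (\<integral>\<^sup>+y. indicator A x * indicator B (x + y) \<partial>lborel)"
      by (subst nn_integral_distr) auto
    finally show "(\<integral>\<^sup>+y. indicator A x * indicator B y \<partial>lborel) = \<dots>" .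
  qed
  also have "\<dots> = (\<integral>\<^sup>+y. \<integral>\<^sup>+x. indicator A x * indicator B (x + y) \<partial>\<mu> \<partial>lborel)"
    by (rule P.Fubini'[symmetric]) measurable
  also have "\<dots> = (\<integral>\<^sup>+y. \<integral>\<^sup>+x. indicator A (x - y) * indicator B x \<partial>\<mu> \<partial>lborel)"
  proof (rule nn_integral_cong)
    fix y :: 'a
    have "(\<integral>\<^sup>+x. indicator A x * indicator B (x + y) \<partial>\<mu>)
      = (\<integral>\<^sup>+x. indicator A x * indicator B (x + y) \<partial>distr \<mu> borel (\<lambda>x. (-y) + x))"
      by (simp only: inv)
    also have "\<dots> = (\<integral>\<^sup>+x. indicator A (x - y) * indicator B x \<partial>\<mu>)"
      by (subst nn_integral_distr) auto
    finally show "(\<integral>\<^sup>+x. indicator A x * indicator B (x + y) \<partial>\<mu>) = \<dots>" .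
  qed
  also have "\<dots> = (\<integral>\<^sup>+x. \<integral>\<^sup>+y. indicator A (x - y) * indicator B x \<partial>lborel \<partial>\<mu>)"
    by (rule P.Fubini') measurable
  also have "\<dots> = (\<integral>\<^sup>+x. emeasure lborel A * indicator B x \<partial>\<mu>)"
  proof (rule nn_integral_cong)
    fix x
    have "(\<integral>\<^sup>+y. indicator A (x - y) * indicator B x \<partial>lborel)
      = (\<integral>\<^sup>+y. indicator A y * indicator B x \<partial>distr lborel borel (\<lambda>y. x - y))"
      by (subst nn_integral_distr) auto
    then show "(\<integral>\<^sup>+y. indicator A (x - y) * indicator B x \<partial>lborel) = emeasure lborel A * indicator B x"
      by (simp add: neg nn_integral_multc)
  qed
  also have "\<dots> = emeasure \<mu> B * emeasure lborel A"
    by (simp add: nn_integral_cmult) (simp add: mult.commute)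
  finally show ?thesis .
qed

text \<open>For a linear bijection this is the reciprocal of the absolute determinant. Defining it
  through the measure makes multiplicativity immediate, and that property alone yields the
  invariance under \<open>SL\<close>.\<close>

definition linear_scaling :: "('a::euclidean_space \<Rightarrow> 'a) \<Rightarrow> ennreal" where
  "linear_scaling f = emeasure lborel (f -` cbox 0 One)"

lemma
  fixes f :: "'a::euclidean_space \<Rightarrow> 'a"
  assumes f: "linear f" "bij f"
  shows linear_scaling_finite: "linear_scaling f < \<infinity>"
    and emeasure_linear_vimage: "A \<in> sets borel \<Longrightarrow> emeasure lborel (f -` A) = linear_scaling f * emeasure lborel A"
proof -
  obtain g where g: "linear g" "g \<circ> f = id" "f \<circ> g = id"
    using linear_injective_isomorphism[of f] f by (metis bij_is_inj eq_id_iff comp_def)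
  have cont: "continuous_on UNIV f" "continuous_on UNIV g"
    using f g by (simp_all add: linear_continuous_on linear_conv_bounded_linear)
  then have [measurable]: "f \<in> borel_measurable borel" "g \<in> borel_measurable borel"
    by (simp_all add: borel_measurable_continuous_onI)
  have vim: "f -` S = g ` S" for S
    using g by (auto simp: fun_eq_iff image_iff) (metis)+
  let ?\<mu> = "distr lborel borel f"
  have em: "emeasure ?\<mu> S = emeasure lborel (f -` S)" if "S \<in> sets borel" for S
    using that by (simp add: emeasure_distr)
  have cpt: "compact (f -` S)" if "compact S" for S
    unfolding vim using cont(2) that by (auto intro: compact_continuous_image continuous_on_subset)
  have sf: "sigma_finite_measure ?\<mu>"
  proof
    let ?A = "range (\<lambda>n::nat. cball (0::'a) (real n))"
    have "\<Union>?A = space ?\<mu>"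
      by (auto simp: dist_norm) (meson real_arch_simple)
    moreover have "emeasure ?\<mu> a \<noteq> \<infinity>" if "a \<in> ?A" for a
      using that cpt[of a] em[of a] emeasure_compact_finite[of "f -` a"] by (auto simp: less_top)
    ultimately show "\<exists>A. countable A \<and> A \<subseteq> sets ?\<mu> \<and> \<Union> A = space ?\<mu> \<and> (\<forall>a\<in>A. emeasure ?\<mu> a \<noteq> \<infinity>)"
      by (intro exI[of _ ?A]) auto
  qed
  have inv: "distr ?\<mu> borel (\<lambda>x. c + x) = ?\<mu>" for c
  proof -
    have "distr ?\<mu> borel (\<lambda>x. c + x) = distr lborel borel (\<lambda>x. c + f x)"
      by (simp add: distr_distr comp_def)
    also have "(\<lambda>x. c + f x) = (\<lambda>x. f (g c + x))"
      using g f by (auto simp: linear_add fun_eq_iff)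
    also have "distr lborel borel \<dots> = distr (distr lborel borel ((+) (g c))) borel f"
      by (subst distr_distr) (auto simp: comp_def)
    finally show ?thesis by (simp add: lborel_distr_plus)
  qed
  have unit: "emeasure lborel (cbox 0 (One::'a)) = 1"
    by (simp add: emeasure_lborel_cbox_eq)
  show "emeasure lborel (f -` A) = linear_scaling f * emeasure lborel A" if [measurable]: "A \<in> sets borel" for A
    using translation_invariant_proportional[OF _ sf inv, of A "cbox 0 One"]
    by (simp add: unit em linear_scaling_def)
  show "linear_scaling f < \<infinity>"
    unfolding linear_scaling_def by (intro emeasure_compact_finite cpt) auto
qed

lemma linear_measurable:
  fixes f :: "'a::euclidean_space \<Rightarrow> 'b::euclidean_space"
  shows "linear f \<Longrightarrow> f \<in> borel_measurable borel"
  by (intro borel_measurable_continuous_onI) (simp add: linear_continuous_on linear_conv_bounded_linear)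

lemma linear_scaling_comp:
  fixes f g :: "'a::euclidean_space \<Rightarrow> 'a"
  assumes f: "linear f" "bij f" and g: "linear g" "bij g"
  shows "linear_scaling (f \<circ> g) = linear_scaling f * linear_scaling g"
proof -
  have "f \<in> borel_measurable borel"
    using f by (intro borel_measurable_continuous_onI) (simp add: linear_continuous_on linear_conv_bounded_linear)
  then have [measurable]: "f -` cbox 0 One \<in> sets borel"
    using measurable_sets[of f borel borel "cbox 0 One"] by auto
  have "linear_scaling (f \<circ> g) = emeasure lborel (g -` (f -` cbox 0 One))"
    by (simp add: linear_scaling_def vimage_comp)
  also have "\<dots> = linear_scaling g * linear_scaling f"
    by (subst emeasure_linear_vimage[OF g]) (auto simp: linear_scaling_def)
  finally show ?thesis by (simp add: mult.commute)
qed

section \<open>Multiplication by a matrix of determinant one preserves Lebesgue measure\<close>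

lemma continuous_on_matrix_mult [continuous_intros]:
  fixes f g :: "'a::topological_space \<Rightarrow> real^'n^'n"
  assumes "continuous_on S f" "continuous_on S g"
  shows "continuous_on S (\<lambda>x. f x ** g x)"
  unfolding matrix_matrix_mult_def using assms by (intro continuous_intros)

lemma borel_measurable_matrix_mult [measurable]:
  fixes f g :: "'a \<Rightarrow> real^'n^'n"
  assumes "f \<in> borel_measurable M" "g \<in> borel_measurable M"
  shows "(\<lambda>x. f x ** g x) \<in> borel_measurable M"
  by (rule borel_measurable_continuous_Pair[OF assms]) (intro continuous_intros)

lemma continuous_on_det [continuous_intros]:
  fixes f :: "'a::topological_space \<Rightarrow> real^'n^'n"
  assumes "continuous_on S f"
  shows "continuous_on S (\<lambda>x. det (f x))"
  unfolding det_def using assms by (intro continuous_intros)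

lemma borel_measurable_det [measurable]: "det \<in> borel_measurable (borel :: (real^'n^'n) measure)"
  by (intro borel_measurable_continuous_onI continuous_intros)

lemma linear_matrix_mult_left: "linear (\<lambda>X. A ** X :: real^'n^'n)"
  by (intro linearI) (auto simp: matrix_add_ldistrib matrix_scalar_ac scalar_matrix_assoc vec_eq_iff
      matrix_matrix_mult_def sum_distrib_left algebra_simps sum.distrib)

lemma linear_matrix_mult_right: "linear (\<lambda>X. X ** A :: real^'n^'n)"
  by (intro linearI) (auto simp: vec_eq_iff
      matrix_matrix_mult_def sum_distrib_left algebra_simps sum.distrib)

lemma bij_matrix_mult:
  fixes A :: "real^'n^'n"
  assumes "det A \<noteq> 0"
  shows "bij (\<lambda>X :: real^'n^'n. A ** X)" and "bij (\<lambda>X :: real^'n^'n. X ** A)"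
proof -
  have "A ** matrix_inv A = mat 1" "matrix_inv A ** A = mat 1"
    using assms someI_ex[of "\<lambda>B. A ** B = mat 1 \<and> B ** A = mat 1"]
    by (auto simp: invertible_det_nz[symmetric] invertible_def matrix_inv_def)
  then show "bij (\<lambda>X :: real^'n^'n. A ** X)" "bij (\<lambda>X :: real^'n^'n. X ** A)"
    by (intro o_bij[of "\<lambda>X. matrix_inv A ** X"] o_bij[of "\<lambda>X. X ** matrix_inv A"];
      auto simp: fun_eq_iff matrix_mul_assoc[symmetric]; simp add: matrix_mul_assoc)+
qed

lemma linear_scaling_matrix_mult:
  fixes A B :: "real^'n^'n"
  assumes "det A \<noteq> 0" "det B \<noteq> 0"
  shows "linear_scaling (\<lambda>X :: real^'n^'n. (A ** B) ** X) = linear_scaling (\<lambda>X :: real^'n^'n. A ** X) * linear_scaling (\<lambda>X :: real^'n^'n. B ** X)"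
    and "linear_scaling (\<lambda>X :: real^'n^'n. X ** (A ** B)) = linear_scaling (\<lambda>X :: real^'n^'n. X ** A) * linear_scaling (\<lambda>X :: real^'n^'n. X ** B)"
proof -
  have "(\<lambda>X :: real^'n^'n. (A ** B) ** X) = (\<lambda>X :: real^'n^'n. A ** X) \<circ> (\<lambda>X :: real^'n^'n. B ** X)"
    by (simp add: fun_eq_iff comp_def matrix_mul_assoc)
  then show "linear_scaling (\<lambda>X :: real^'n^'n. (A ** B) ** X) = linear_scaling (\<lambda>X :: real^'n^'n. A ** X) * linear_scaling (\<lambda>X :: real^'n^'n. B ** X)"
    using linear_scaling_comp[OF linear_matrix_mult_left[of A] bij_matrix_mult(1) linear_matrix_mult_left[of B]
        bij_matrix_mult(1)] assms by (simp add: comp_def flip: matrix_mul_assoc)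
  have "(\<lambda>X :: real^'n^'n. X ** (A ** B)) = (\<lambda>X :: real^'n^'n. X ** B) \<circ> (\<lambda>X :: real^'n^'n. X ** A)"
    by (simp add: fun_eq_iff comp_def matrix_mul_assoc)
  then show "linear_scaling (\<lambda>X :: real^'n^'n. X ** (A ** B)) = linear_scaling (\<lambda>X :: real^'n^'n. X ** A) * linear_scaling (\<lambda>X :: real^'n^'n. X ** B)"
    using linear_scaling_comp[OF linear_matrix_mult_right[of B] bij_matrix_mult(2) linear_matrix_mult_right[of A]
        bij_matrix_mult(2)] assms by (simp add: mult.commute comp_def matrix_mul_assoc)
qed

text \<open>A multiplicative function with values in a commutative monoid is trivial on commutators,
  every transvection is one, and transvections generate. Applied to the scalings of left and of
  right multiplication it gives both invariances without computing a Jacobian.\<close>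

lemma perfect_character_trivial:
  fixes J :: "real^'n^'n \<Rightarrow> ennreal"
  assumes "CARD('n) \<ge> 3" and J1: "J (mat 1) = 1"
    and J: "\<And>A B. det A \<noteq> 0 \<Longrightarrow> det B \<noteq> 0 \<Longrightarrow> J (A ** B) = J A * J B"
    and "det A = 1"
  shows "J A = 1"
proof -
  have tr: "J (transvection i j t) = 1" if "i \<noteq> j" for i j :: 'n and t
  proof -
    have "card {i, j} < CARD('n)" using assms(1) that by simp
    then obtain k where k: "k \<notin> {i, j}"
      by (metis UNIV_eq_I less_irrefl)
    have inv: "J (transvection a b s) * J (transvection a b (-s)) = 1" if "a \<noteq> b" for a b :: 'n and s
      using that J[of "transvection a b s" "transvection a b (-s)"]
      by (simp add: transvection_add det_transvection J1)
    have "J (transvection i j t) = J (transvection i k t) * (J (transvection k j 1) *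
      (J (transvection i k (-t)) * J (transvection k j (-1))))"
      using k that by (subst transvection_commutator[of i j k t, symmetric]) (auto simp: det_transvection J det_mul)
    also have "\<dots> = (J (transvection i k t) * J (transvection i k (-t))) *
      (J (transvection k j 1) * J (transvection k j (-1)))"
      by (simp add: ac_simps)
    also have "\<dots> = 1" using inv k by auto
    finally show ?thesis .
  qed
  have det_words: "det B = 1" if "B \<in> transvection_words k" for B :: "real^'n^'n" and k
    using that by (induction k arbitrary: B) auto
  have "J B = 1" if "B \<in> transvection_words k" for B k
    using that
  proof (induction k arbitrary: B)
    case (Suc k)
    then show ?case using det_words by (auto simp: J tr det_transvection)
  qed (simp add: J1)
  then show ?thesis using SL_bounded_generation[of A] assms by auto
qed

lemma linear_scaling_id: "linear_scaling (\<lambda>x. x) = 1"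
  by (simp add: linear_scaling_def emeasure_lborel_cbox_eq vimage_def)

lemma lborel_SL_invariant:
  fixes A :: "real^'n^'n"
  assumes n: "CARD('n) \<ge> 3" and A: "det A = 1"
  shows lborel_SL_left: "distr lborel borel (\<lambda>X :: real^'n^'n. A ** X) = (lborel :: (real^'n^'n) measure)"
    and lborel_SL_right: "distr lborel borel (\<lambda>X :: real^'n^'n. X ** A) = (lborel :: (real^'n^'n) measure)"
proof -
  have 1: "linear_scaling (\<lambda>X :: real^'n^'n. A ** X) = 1" "linear_scaling (\<lambda>X :: real^'n^'n. X ** A) = 1"
    by (rule perfect_character_trivial[OF n _ _ A, where J = "\<lambda>A. linear_scaling (\<lambda>X :: real^'n^'n. A ** X)"];
        simp add: linear_scaling_id linear_scaling_matrix_mult)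
      (rule perfect_character_trivial[OF n _ _ A, where J = "\<lambda>A. linear_scaling (\<lambda>X :: real^'n^'n. X ** A)"];
        simp add: linear_scaling_id linear_scaling_matrix_mult)
  show "distr lborel borel (\<lambda>X :: real^'n^'n. A ** X) = (lborel :: (real^'n^'n) measure)"
    using 1 A emeasure_linear_vimage[OF linear_matrix_mult_left bij_matrix_mult(1), of A]
    by (intro measure_eqI) (auto simp: emeasure_distr linear_measurable[OF linear_matrix_mult_left])
  show "distr lborel borel (\<lambda>X :: real^'n^'n. X ** A) = (lborel :: (real^'n^'n) measure)"
    using 1 A emeasure_linear_vimage[OF linear_matrix_mult_right bij_matrix_mult(2), of A]
    by (intro measure_eqI) (auto simp: emeasure_distr)
qed

lemma AE_linear_bij:
  fixes f :: "'a::euclidean_space \<Rightarrow> 'a"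
  assumes f: "linear f" "bij f" and ae: "AE x in lborel. P x"
  shows "AE x in lborel. P (f x)"
proof -
  have [measurable]: "f \<in> borel_measurable borel"
    using f by (intro borel_measurable_continuous_onI) (simp add: linear_continuous_on linear_conv_bounded_linear)
  obtain N where N: "{x. \<not> P x} \<subseteq> N" "N \<in> sets borel" "emeasure lborel N = 0"
    using ae by (auto elim!: AE_E)
  show ?thesis
  proof (rule AE_I)
    show "{x \<in> space lborel. \<not> P (f x)} \<subseteq> f -` N" using N by auto
    show "f -` N \<in> sets lborel" using measurable_sets[of f borel borel N] N by auto
    show "emeasure lborel (f -` N) = 0"
      using emeasure_linear_vimage[OF f] N by simp
  qed
qed

lemma AE_matrix_mult:
  fixes A :: "real^'n^'n"
  assumes "det A \<noteq> 0" "AE x in lborel. P x"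
  shows AE_matrix_mult_left: "AE x in lborel. P (A ** x)"
    and AE_matrix_mult_right: "AE x in lborel. P (x ** A)"
  by (rule AE_linear_bij[OF linear_matrix_mult_left bij_matrix_mult(1)[OF assms(1)] assms(2)])
    (rule AE_linear_bij[OF linear_matrix_mult_right bij_matrix_mult(2)[OF assms(1)] assms(2)])

section \<open>The fundamental domain of a lattice\<close>

text \<open>On this open set the cone measure is plain Lebesgue measure. Sets and functions that
  ignore positive scalars amount to sets and functions on \<open>SL\<close>, so
  \<open>lborel\<close> serves as Haar measure throughout.\<close>

definition GLpos :: "(real^'n^'n) set" where
  "GLpos = {a. det a > 0}"

lemma matrix_inv_cancel:
  fixes A :: "real^'n^'n"
  assumes "det A \<noteq> 0"
  shows "A ** matrix_inv A = mat 1" "matrix_inv A ** A = mat 1"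
  using assms someI_ex[of "\<lambda>B. A ** B = mat 1 \<and> B ** A = mat 1"]
  by (auto simp: invertible_det_nz[symmetric] invertible_def matrix_inv_def)

lemma matrix_inv_unique':
  fixes A B :: "real^'n^'n"
  assumes "A ** B = mat 1"
  shows "matrix_inv A = B"
proof -
  have "det A * det B = 1" using assms by (metis det_I det_mul)
  then have "det A \<noteq> 0" by auto
  then have "matrix_inv A ** (A ** B) = B"
    by (simp add: matrix_mul_assoc matrix_inv_cancel)
  then show ?thesis by (simp add: assms)
qed

text \<open>Cramer's rule expresses each entry as a quotient of determinants.\<close>

lemma continuous_on_matrix_inv: "continuous_on {A :: real^'n^'n. det A \<noteq> 0} matrix_inv"
proof -
  have eq: "matrix_inv A = (\<chi> k j. det (\<chi> i l. if l = k then axis j 1 $ i else A $ i $ l) / det A)"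
    if "det A \<noteq> 0" for A :: "real^'n^'n"
  proof -
    have "column j (matrix_inv A) = (\<chi> k. det (\<chi> i l. if l = k then axis j 1 $ i else A $ i $ l) / det A)" for j
    proof (rule cramer[OF that, THEN iffD1])
      have "A *v column j (matrix_inv A) = column j (A ** matrix_inv A)"
        by (simp add: vec_eq_iff matrix_vector_mult_def column_def matrix_matrix_mult_def)
      then show "A *v column j (matrix_inv A) = axis j 1"
        using that by (simp add: matrix_inv_cancel column_def mat_def axis_def vec_eq_iff)
    qed
    then show ?thesis
      by (auto simp: vec_eq_iff column_def)
  qed
  have "continuous_on {A :: real^'n^'n. det A \<noteq> 0}
      (\<lambda>A. \<chi> k j. det (\<chi> i l. if l = k then axis j 1 $ i else A $ i $ l) / det A)"
  proof (intro continuous_intros continuous_on_divide)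
    fix k j i l :: 'n
    show "continuous_on {A :: real^'n^'n. det A \<noteq> 0} (\<lambda>A. if l = k then axis j 1 $ i else A $ i $ l)"
      by (cases "l = k") (auto intro!: continuous_intros)
  qed auto
  then show ?thesis
    by (rule continuous_on_cong[THEN iffD1, rotated 2]) (auto simp: eq)
qed

lemma det_scaleR_matrix: "det (c *\<^sub>R A) = c ^ CARD('n) * det (A :: real^'n^'n)"
proof -
  have "c *\<^sub>R A = (c *\<^sub>R mat 1) ** A"
    by (simp add: vec_eq_iff matrix_matrix_mult_def mat_def if_distrib[of "\<lambda>x. x * _"]
        if_distrib[of "\<lambda>x. c * x"] cong: if_cong)
  moreover have "det (c *\<^sub>R mat 1 :: real^'n^'n) = c ^ CARD('n)"
    by (subst det_diagonal) (auto simp: mat_def)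
  ultimately show ?thesis by (simp add: det_mul)
qed

lemma scaleR_matrix_mult: "(c *\<^sub>R A) ** B = c *\<^sub>R (A ** B :: real^'n^'n)" "A ** (c *\<^sub>R B) = c *\<^sub>R (A ** B :: real^'n^'n)"
  by (simp_all add: vec_eq_iff matrix_matrix_mult_def sum_distrib_left ac_simps)

definition normalized :: "real^'n^'n \<Rightarrow> real^'n^'n" where
  "normalized a = inverse (root CARD('n) (det a)) *\<^sub>R a"

lemma det_normalized: "a \<in> GLpos \<Longrightarrow> det (normalized a) = 1"
  by (simp add: normalized_def det_scaleR_matrix GLpos_def power_inverse)

lemma normalized_scaleR: "c > 0 \<Longrightarrow> normalized (c *\<^sub>R a) = normalized (a :: real^'n^'n)"
  by (simp add: normalized_def det_scaleR_matrix real_root_mult real_root_power_cancel)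

lemma normalized_mult: "det g = 1 \<Longrightarrow> normalized (a ** g) = normalized a ** g"
  "det g = 1 \<Longrightarrow> normalized (g ** a) = g ** normalized a"
  by (simp_all add: normalized_def det_mul scaleR_matrix_mult)

lemma continuous_on_normalized: "continuous_on GLpos normalized"
  unfolding normalized_def by (intro continuous_intros) (auto simp: GLpos_def)

lemma open_GLpos: "open (GLpos :: (real^'n^'n) set)"
  unfolding GLpos_def by (intro open_Collect_less continuous_intros)

lemma GLpos_mult: "a \<in> GLpos \<Longrightarrow> det g = 1 \<Longrightarrow> a ** g \<in> GLpos" "a \<in> GLpos \<Longrightarrow> det g = 1 \<Longrightarrow> g ** a \<in> GLpos"
  by (auto simp: GLpos_def det_mul)

lemma GLpos_scaleR: "a \<in> GLpos \<Longrightarrow> c > 0 \<Longrightarrow> c *\<^sub>R a \<in> GLpos"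
  by (auto simp: GLpos_def det_scaleR_matrix)

section \<open>Proper discontinuity and a Borel section of the quotient\<close>

locale SL_lattice =
  fixes \<Gamma> :: "(real^'n^'n) set"
  assumes card_n: "CARD('n) \<ge> 3" and lattice: "lattice_SL \<Gamma>"
begin

lemma
  shows one_in: "mat 1 \<in> \<Gamma>" and mult_in: "x \<in> \<Gamma> \<Longrightarrow> y \<in> \<Gamma> \<Longrightarrow> x ** y \<in> \<Gamma>"
    and inv_in: "x \<in> \<Gamma> \<Longrightarrow> matrix_inv x \<in> \<Gamma>" and det_in: "x \<in> \<Gamma> \<Longrightarrow> det x = 1"
  using lattice by (auto simp: lattice_SL_def subgroup_SL_def SL_def)

lemma
  assumes "x \<in> \<Gamma>"
  shows inv_right: "x ** matrix_inv x = mat 1" and inv_left: "matrix_inv x ** x = mat 1"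
    and inv_inv: "matrix_inv (matrix_inv x) = x"
    and inv_left': "x ** (matrix_inv x ** y) = y"
    and inv_cancel_right: "(y ** x) ** matrix_inv x = y" and inv_cancel_right': "(y ** matrix_inv x) ** x = y"
proof -
  show 1: "x ** matrix_inv x = mat 1" and 2: "matrix_inv x ** x = mat 1"
    using matrix_inv_cancel[of x] det_in[OF assms] by auto
  show "matrix_inv (matrix_inv x) = x" by (rule matrix_inv_unique') (fact 2)
  show "x ** (matrix_inv x ** y) = y"
    by (simp add: matrix_mul_assoc 1)
  show "(y ** x) ** matrix_inv x = y" "(y ** matrix_inv x) ** x = y"
    by (simp_all add: 1 2 flip: matrix_mul_assoc)
qed

lemma uniformly_discrete: "\<exists>e>0. \<forall>\<gamma>\<in>\<Gamma>. dist \<gamma> (mat 1) < e \<longrightarrow> \<gamma> = mat 1"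
  using lattice one_in unfolding lattice_SL_def discrete_set_def by auto

text \<open>The map that sends (a, b) to the inverse of a times b is continuous at (x, x). On a
  product neighbourhood its values stay so close to the identity that the only lattice element among
  them is the identity.\<close>

lemma separating_neighbourhood:
  assumes "det x = 1"
  shows "\<exists>U. open U \<and> x \<in> U \<and> (\<forall>a\<in>U. \<forall>\<gamma>\<in>\<Gamma>. a ** \<gamma> \<in> U \<longrightarrow> \<gamma> = mat 1)"
proof -
  obtain e where e: "e > 0" "\<And>\<gamma>. \<gamma> \<in> \<Gamma> \<Longrightarrow> dist \<gamma> (mat 1) < e \<Longrightarrow> \<gamma> = mat 1"
    using uniformly_discrete by blast
  let ?S = "{A :: real^'n^'n. det A \<noteq> 0} \<times> (UNIV :: (real^'n^'n) set)"
  let ?h = "\<lambda>p. matrix_inv (fst p) ** snd p :: real^'n^'n"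
  have "open {A :: real^'n^'n. det A \<noteq> 0}"
    by (intro open_Collect_neq continuous_intros)
  then have S: "open ?S" by (intro open_Times) auto
  have "continuous_on ?S (\<lambda>p. matrix_inv (fst p))"
    by (rule continuous_on_compose2[OF continuous_on_matrix_inv]) (auto intro!: continuous_intros)
  then have "continuous_on ?S ?h"
    by (intro continuous_intros)
  then have "open (?h -` ball (mat 1) e \<inter> ?S)"
    using S by (simp add: continuous_on_open_vimage)
  moreover have "(x, x) \<in> ?h -` ball (mat 1) e \<inter> ?S"
    using assms e by (simp add: matrix_inv_cancel)
  ultimately obtain A B where AB: "open A" "open B" "(x, x) \<in> A \<times> B" "A \<times> B \<subseteq> ?h -` ball (mat 1) e \<inter> ?S"
    by (rule open_prod_elim)
  have "\<gamma> = mat 1" if "a \<in> A \<inter> B" "a ** \<gamma> \<in> A \<inter> B" "\<gamma> \<in> \<Gamma>" for a \<gamma>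
  proof -
    have "(a, a ** \<gamma>) \<in> A \<times> B" using that by auto
    then have "dist (matrix_inv a ** (a ** \<gamma>)) (mat 1) < e" "det a \<noteq> 0"
      using AB(4) by (auto simp: dist_commute)
    then show ?thesis
      using e(2) that by (simp add: matrix_mul_assoc matrix_inv_cancel)
  qed
  then show ?thesis using AB by (intro exI[of _ "A \<inter> B"]) auto
qed

text \<open>Discreteness speaks only about points of the lattice. An accumulation point still has
  determinant 1, hence a separating neighbourhood, and such a neighbourhood holds at most one
  lattice element.\<close>

lemma finite_Int_compact:
  assumes "compact K"
  shows "finite (\<Gamma> \<inter> K)"
proof (rule ccontr)
  assume "infinite (\<Gamma> \<inter> K)"
  then obtain x where x: "x islimpt (\<Gamma> \<inter> K)"
    using assms by (metis Heine_Borel_imp_Bolzano_Weierstrass inf_le2)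
  have "closed {A :: real^'n^'n. det A = 1}"
    by (intro closed_Collect_eq continuous_intros)
  moreover have "x islimpt {A. det A = 1}"
    using x by (rule islimpt_subset) (auto simp: det_in)
  ultimately have "det x = 1" by (auto simp: closed_limpt)
  then obtain U where U: "open U" "x \<in> U" "\<And>a \<gamma>. a \<in> U \<Longrightarrow> \<gamma> \<in> \<Gamma> \<Longrightarrow> a ** \<gamma> \<in> U \<Longrightarrow> \<gamma> = mat 1"
    using separating_neighbourhood[OF \<open>det x = 1\<close>] by blast
  have "infinite (U \<inter> (\<Gamma> \<inter> K))"
    using x U by (simp add: islimpt_eq_acc_point)
  then have "U \<inter> (\<Gamma> \<inter> K) \<noteq> {}" by (rule infinite_imp_nonempty)
  then obtain a where a: "a \<in> U" "a \<in> \<Gamma>" by blast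
  have "infinite (U \<inter> (\<Gamma> \<inter> K) - {a})"
    using \<open>infinite (U \<inter> (\<Gamma> \<inter> K))\<close> by simp
  then have "U \<inter> (\<Gamma> \<inter> K) - {a} \<noteq> {}" by (rule infinite_imp_nonempty)
  then obtain b where "b \<in> U" "b \<in> \<Gamma>" "b \<noteq> a" by blast
  then have "matrix_inv a ** b = mat 1"
    using a U(3)[of a "matrix_inv a ** b"] by (simp add: inv_left' mult_in inv_in)
  then have "a ** (matrix_inv a ** b) = a" by simp
  then show False using \<open>b \<noteq> a\<close> a by (simp add: inv_left')
qed

lemma countable_lattice: "countable \<Gamma>"
proof -
  have "\<Gamma> = (\<Union>k::nat. \<Gamma> \<inter> cball 0 (real k))"
  proof (intro set_eqI iffI)
    fix x assume x: "x \<in> \<Gamma>"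
    obtain k :: nat where "norm x \<le> real k" using real_arch_simple by blast
    then show "x \<in> (\<Union>k::nat. \<Gamma> \<inter> cball 0 (real k))" using x by auto
  qed auto
  moreover have "countable (\<Union>k::nat. \<Gamma> \<inter> cball 0 (real k))"
    by (rule countable_UN) (auto simp: finite_Int_compact countable_finite)
  ultimately show ?thesis by simp
qed

text \<open>Countably many separating sets cover \<open>SL\<close>. The selected element moves a
  matrix into the first of these sets that its lattice orbit meets; separation makes it unique, and
  testing membership after normalisation makes it blind to scalars. Its fibres are countable Boolean
  combinations of open sets.\<close>

lemma ex_sigma:
  "\<exists>s. (\<forall>a. s a \<in> \<Gamma>) \<and>
    (\<forall>a\<in>GLpos. \<forall>\<gamma>\<in>\<Gamma>. s (a ** \<gamma>) = matrix_inv \<gamma> ** s a) \<and>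
    (\<forall>a\<in>GLpos. \<forall>c>0. s (c *\<^sub>R a) = s a) \<and> s \<in> borel_measurable borel"
proof -
  obtain \<B> :: "(real^'n^'n) set set" where \<B>: "countable \<B>" "topological_basis \<B>"
    using ex_countable_basis by blast
  define \<G> where "\<G> = {B\<in>\<B>. \<forall>a\<in>B. \<forall>\<gamma>\<in>\<Gamma>. a ** \<gamma> \<in> B \<longrightarrow> \<gamma> = mat 1}"
  have cover: "\<exists>B\<in>\<G>. x \<in> B" if x: "det x = 1" for x
  proof -
    obtain U where U: "open U" "x \<in> U" "\<forall>a\<in>U. \<forall>\<gamma>\<in>\<Gamma>. a ** \<gamma> \<in> U \<longrightarrow> \<gamma> = mat 1"
      using separating_neighbourhood[OF x] by blast
    then obtain B where "B \<in> \<B>" "x \<in> B" "B \<subseteq> U"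
      using topological_basisE[OF \<B>(2)] by blast
    with U(3) show ?thesis unfolding \<G>_def by blast
  qed
  have G: "countable \<G>" "\<G> \<noteq> {}"
    using \<B>(1) cover[of "mat 1"] by (auto simp: \<G>_def)
  define W where "W k = {a\<in>GLpos. normalized a \<in> from_nat_into \<G> k}" for k
  have inG: "from_nat_into \<G> k \<in> \<G>" for k using G by (simp add: from_nat_into)
  have openW: "open (W k)" for k
  proof -
    have "open (from_nat_into \<G> k)"
      using inG[of k] \<B>(2) by (auto simp: \<G>_def intro: topological_basis_open)
    then have "open (normalized -` from_nat_into \<G> k \<inter> GLpos)"
      using continuous_on_normalized open_GLpos continuous_on_open_vimage[of GLpos normalized] by blast
    then show ?thesis by (simp add: W_def vimage_def Int_def conj_commute)
  qed
  have W_scale: "c *\<^sub>R a \<in> W k \<longleftrightarrow> a \<in> W k" if "c > 0" for c a k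
    using that by (auto simp: W_def normalized_scaleR GLpos_def det_scaleR_matrix zero_less_mult_iff)
  have W_sep: "\<gamma> = \<gamma>'" if "a ** \<gamma> \<in> W k" "a ** \<gamma>' \<in> W k" "\<gamma> \<in> \<Gamma>" "\<gamma>' \<in> \<Gamma>" for a \<gamma> \<gamma>' k
  proof -
    let ?b = "normalized a ** \<gamma>"
    have "?b \<in> from_nat_into \<G> k" "?b ** (matrix_inv \<gamma> ** \<gamma>') \<in> from_nat_into \<G> k"
      using that by (simp_all add: W_def normalized_mult det_in inv_left' flip: matrix_mul_assoc)
    then have "matrix_inv \<gamma> ** \<gamma>' = mat 1"
      using inG[of k] that by (auto simp: \<G>_def mult_in inv_in)
    then have "\<gamma> ** (matrix_inv \<gamma> ** \<gamma>') = \<gamma>" by simp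
    then show ?thesis using that by (simp add: inv_left')
  qed
  have W_GL: "W k \<subseteq> GLpos" for k by (auto simp: W_def)
  define Q where "Q k a \<longleftrightarrow> (\<exists>\<gamma>\<in>\<Gamma>. a ** \<gamma> \<in> W k)" for k a
  have exQ: "\<exists>k. Q k a" if a: "a \<in> GLpos" for a
  proof -
    obtain B where "B \<in> \<G>" "normalized a \<in> B" using cover[OF det_normalized[OF a]] by blast
    then obtain k where "a \<in> W k"
      using from_nat_into_surj[OF G(1)] a by (auto simp: W_def)
    then show ?thesis using one_in unfolding Q_def by (metis matrix_mul_rid)
  qed
  have Q_mult: "Q k (a ** \<gamma>) \<longleftrightarrow> Q k a" if "\<gamma> \<in> \<Gamma>" for k a \<gamma>
  proof
    assume "Q k (a ** \<gamma>)"
    then show "Q k a" unfolding Q_def using that by (metis matrix_mul_assoc mult_in)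
  next
    assume "Q k a"
    then obtain \<delta> where "\<delta> \<in> \<Gamma>" "a ** \<delta> \<in> W k" unfolding Q_def by blast
    then have "(a ** \<gamma>) ** (matrix_inv \<gamma> ** \<delta>) \<in> W k"
      using that by (simp add: inv_left' flip: matrix_mul_assoc)
    then show "Q k (a ** \<gamma>)" unfolding Q_def using that \<open>\<delta> \<in> \<Gamma>\<close> mult_in inv_in by blast
  qed
  define \<kappa> where "\<kappa> a = (LEAST k. Q k a)" for a
  have \<kappa>: "Q (\<kappa> a) a" if "a \<in> GLpos" for a
    unfolding \<kappa>_def using exQ[OF that] by (metis LeastI)
  define s where "s a = (if a \<in> GLpos then THE \<gamma>. \<gamma> \<in> \<Gamma> \<and> a ** \<gamma> \<in> W (\<kappa> a) else mat 1)" for a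
  have s_unique: "s a = \<gamma>" if "a \<in> GLpos" "\<gamma> \<in> \<Gamma>" "a ** \<gamma> \<in> W (\<kappa> a)" for a \<gamma>
    unfolding s_def using that W_sep by (simp, intro the_equality) blast+
  have s: "s a \<in> \<Gamma>" "a ** s a \<in> W (\<kappa> a)" if "a \<in> GLpos" for a
    using \<kappa>[OF that] s_unique[OF that] unfolding Q_def by metis+
  have "s (a ** \<gamma>) = matrix_inv \<gamma> ** s a" if "a \<in> GLpos" "\<gamma> \<in> \<Gamma>" for a \<gamma>
  proof (rule s_unique)
    have "\<kappa> (a ** \<gamma>) = \<kappa> a" unfolding \<kappa>_def using Q_mult that by simp
    then show "(a ** \<gamma>) ** (matrix_inv \<gamma> ** s a) \<in> W (\<kappa> (a ** \<gamma>))"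
      using s that by (simp add: inv_left' flip: matrix_mul_assoc)
  qed (use that s in \<open>auto simp: GLpos_mult det_in mult_in inv_in\<close>)
  moreover have "s (c *\<^sub>R a) = s a" if "a \<in> GLpos" "c > 0" for a c
  proof (rule s_unique)
    have "Q k (c *\<^sub>R a) = Q k a" for k
      unfolding Q_def using W_scale that by (simp add: scaleR_matrix_mult)
    then have "\<kappa> (c *\<^sub>R a) = \<kappa> a" unfolding \<kappa>_def by simp
    then show "(c *\<^sub>R a) ** s a \<in> W (\<kappa> (c *\<^sub>R a))"
      using s that by (simp add: scaleR_matrix_mult W_scale)
  qed (use that s in \<open>auto simp: GLpos_scaleR\<close>)
  moreover have "s \<in> borel_measurable borel"
  proof -
    have mW: "(\<lambda>a :: real^'n^'n. a ** \<gamma>) -` W k \<in> sets borel" for k \<gamma>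
      by (intro borel_open open_vimage openW) (intro continuous_intros)
    have mQ: "{a. Q k a} \<in> sets borel" for k
    proof -
      have "{a. Q k a} = (\<Union>\<gamma>\<in>\<Gamma>. (\<lambda>a. a ** \<gamma>) -` W k)" by (auto simp: Q_def)
      then show ?thesis using mW countable_lattice by auto
    qed
    have GL: "GLpos \<in> sets borel" by (rule borel_open[OF open_GLpos])
    have fib: "{a\<in>GLpos. s a = \<gamma>} \<in> sets borel" if "\<gamma> \<in> \<Gamma>" for \<gamma>
    proof -
      have "{a\<in>GLpos. s a = \<gamma>} = (\<Union>k. GLpos \<inter> (\<lambda>a. a ** \<gamma>) -` W k \<inter> {a. Q k a} - (\<Union>j<k. {a. Q j a}))"
        (is "_ = ?R")
      proof (intro set_eqI iffI)
        fix a assume "a \<in> {a\<in>GLpos. s a = \<gamma>}"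
        then have "a \<in> GLpos" "a ** \<gamma> \<in> W (\<kappa> a)" "Q (\<kappa> a) a" "\<forall>j<\<kappa> a. \<not> Q j a"
          using s \<kappa> not_less_Least unfolding \<kappa>_def by blast+
        then show "a \<in> ?R" by auto
      next
        fix a assume "a \<in> ?R"
        then obtain k where k: "a \<in> GLpos" "a ** \<gamma> \<in> W k" "Q k a" "\<forall>j<k. \<not> Q j a" by auto
        then have "\<kappa> a = k" unfolding \<kappa>_def by (intro Least_equality) (auto simp: not_less[symmetric])
        then show "a \<in> {a\<in>GLpos. s a = \<gamma>}" using k s_unique that by auto
      qed
      moreover have "?R \<in> sets borel"
        by (intro sets.countable_UN image_subsetI sets.Diff sets.Int sets.finite_UN) (use mW mQ GL in auto)
      ultimately show ?thesis by simp
    qed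
    show ?thesis
    proof (rule measurableI)
      fix S :: "(real^'n^'n) set"
      have "s -` S = (\<Union>\<gamma>\<in>\<Gamma>\<inter>S. {a\<in>GLpos. s a = \<gamma>}) \<union> (if mat 1 \<in> S then - GLpos else {})"
      proof (rule set_eqI)
        fix x
        have "x \<notin> GLpos \<Longrightarrow> s x = mat 1" by (simp add: s_def)
        then show "x \<in> s -` S \<longleftrightarrow> x \<in> (\<Union>\<gamma>\<in>\<Gamma>\<inter>S. {a\<in>GLpos. s a = \<gamma>}) \<union> (if mat 1 \<in> S then - GLpos else {})"
          using s(1)[of x] by (cases "x \<in> GLpos") auto
      qed
      moreover have "\<dots> \<in> sets borel"
        using fib GL countable_lattice by (auto intro!: sets.Un sets.countable_UN' countable_Int1 simp: Compl_eq_Diff_UNIV)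
      ultimately show "s -` S \<inter> space borel \<in> sets borel" by simp
    qed auto
  qed
  moreover have "s a \<in> \<Gamma>" for a using s one_in by (cases "a \<in> GLpos") (auto simp: s_def)
  ultimately show ?thesis by blast
qed

text \<open>A Borel selection of the lattice element that moves a matrix into the fundamental domain.\<close>

definition \<sigma> :: "real^'n^'n \<Rightarrow> real^'n^'n" where
  "\<sigma> = (SOME s. (\<forall>a. s a \<in> \<Gamma>) \<and>
    (\<forall>a\<in>GLpos. \<forall>\<gamma>\<in>\<Gamma>. s (a ** \<gamma>) = matrix_inv \<gamma> ** s a) \<and>
    (\<forall>a\<in>GLpos. \<forall>c>0. s (c *\<^sub>R a) = s a) \<and> s \<in> borel_measurable borel)"

lemma
  shows \<sigma>_in: "\<sigma> a \<in> \<Gamma>"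
    and \<sigma>_mult: "a \<in> GLpos \<Longrightarrow> \<gamma> \<in> \<Gamma> \<Longrightarrow> \<sigma> (a ** \<gamma>) = matrix_inv \<gamma> ** \<sigma> a"
    and \<sigma>_scaleR: "a \<in> GLpos \<Longrightarrow> c > 0 \<Longrightarrow> \<sigma> (c *\<^sub>R a) = \<sigma> a"
    and \<sigma>_measurable [measurable]: "\<sigma> \<in> borel_measurable borel"
  using someI_ex[OF ex_sigma] unfolding \<sigma>_def[symmetric] by auto

section \<open>Unfolding over the fundamental domain and the measure on the quotient\<close>

definition Dom :: "(real^'n^'n) set" where
  "Dom = {a\<in>GLpos. \<sigma> a = mat 1 \<and> det a \<le> 1}"

definition Cone :: "(real^'n^'n) set" where
  "Cone = {a\<in>GLpos. det a \<le> 1}"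

lemma GLpos_measurable [measurable]: "GLpos \<in> sets borel"
  by (rule borel_open[OF open_GLpos])

lemma Cone_measurable [measurable]: "Cone \<in> sets borel"
  unfolding Cone_def GLpos_def by measurable

lemma Dom_measurable [measurable]: "Dom \<in> sets borel"
  unfolding Dom_def GLpos_def by measurable

lemma Dom_eq: "a \<in> Dom \<longleftrightarrow> a \<in> Cone \<and> \<sigma> a = mat 1"
  by (auto simp: Dom_def Cone_def)

lemma Cone_mult: "det g = 1 \<Longrightarrow> a ** g \<in> Cone \<longleftrightarrow> a \<in> Cone" "det g = 1 \<Longrightarrow> g ** a \<in> Cone \<longleftrightarrow> a \<in> Cone"
  by (auto simp: Cone_def GLpos_def det_mul)

lemma Cone_GLpos: "a \<in> Cone \<Longrightarrow> a \<in> GLpos"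
  by (simp add: Cone_def)

lemma nn_integral_right:
  fixes f :: "real^'n^'n \<Rightarrow> ennreal"
  assumes [measurable]: "f \<in> borel_measurable borel" and "\<gamma> \<in> \<Gamma>"
  shows "(\<integral>\<^sup>+a. f (a ** \<gamma>) \<partial>lborel) = (\<integral>\<^sup>+a. f a \<partial>lborel)"
proof -
  have "(\<integral>\<^sup>+a. f a \<partial>lborel) = (\<integral>\<^sup>+a. f a \<partial>distr lborel borel (\<lambda>a. a ** \<gamma>))"
    by (simp add: lborel_SL_right[OF card_n det_in[OF assms(2)]])
  also have "\<dots> = (\<integral>\<^sup>+a. f (a ** \<gamma>) \<partial>lborel)"
    by (rule nn_integral_distr) auto
  finally show ?thesis ..
qed

lemma nn_integral_left:
  fixes f :: "real^'n^'n \<Rightarrow> ennreal"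
  assumes [measurable]: "f \<in> borel_measurable borel" and "det g = 1"
  shows "(\<integral>\<^sup>+a. f (g ** a) \<partial>lborel) = (\<integral>\<^sup>+a. f (a :: real^'n^'n) \<partial>lborel)"
proof -
  have "(\<integral>\<^sup>+a. f a \<partial>lborel) = (\<integral>\<^sup>+a. f a \<partial>distr lborel borel (\<lambda>a. g ** a))"
    by (simp add: lborel_SL_left[OF card_n assms(2)])
  also have "\<dots> = (\<integral>\<^sup>+a. f (g ** a) \<partial>lborel)"
    by (rule nn_integral_distr) auto
  finally show ?thesis ..
qed

text \<open>Weil's unfolding: the part of the cone where \<open>\<sigma>\<close> equals
  \<open>matrix_inv \<gamma>\<close> is the right translate of \<open>Dom\<close> by \<gamma>, and
  these parts are disjoint and exhaust the cone.\<close>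

lemma nn_integral_unfold:
  fixes f :: "real^'n^'n \<Rightarrow> ennreal"
  assumes [measurable]: "f \<in> borel_measurable borel"
  shows "(\<integral>\<^sup>+a. f a * indicator Cone a \<partial>lborel)
    = (\<integral>\<^sup>+a. (\<integral>\<^sup>+\<gamma>. f (a ** \<gamma>) \<partial>count_space \<Gamma>) * indicator Dom a \<partial>lborel)"
proof -
  have one: "(\<integral>\<^sup>+\<gamma>. indicator {matrix_inv (\<sigma> a)} \<gamma> \<partial>count_space \<Gamma>) = 1" for a
    by (subst nn_integral_indicator) (auto simp: \<sigma>_in inv_in)
  have "(\<integral>\<^sup>+a. f a * indicator Cone a \<partial>lborel)
    = (\<integral>\<^sup>+a. (\<integral>\<^sup>+\<gamma>. f a * indicator Cone a * indicator {matrix_inv (\<sigma> a)} \<gamma> \<partial>count_space \<Gamma>) \<partial>lborel)"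
    by (subst nn_integral_cmult) (auto simp: one)
  also have "\<dots> = (\<integral>\<^sup>+a. (\<integral>\<^sup>+\<gamma>. f a * indicator Cone a * indicator {a. \<sigma> a = matrix_inv \<gamma>} a \<partial>count_space \<Gamma>) \<partial>lborel)"
    by (intro nn_integral_cong) (auto split: split_indicator simp: inv_inv \<sigma>_in)
  also have "\<dots> = (\<integral>\<^sup>+\<gamma>. (\<integral>\<^sup>+a. f a * indicator Cone a * indicator {a. \<sigma> a = matrix_inv \<gamma>} a \<partial>lborel) \<partial>count_space \<Gamma>)"
    by (rule nn_integral_count_space_nn_integral[OF countable_lattice]) measurable
  also have "\<dots> = (\<integral>\<^sup>+\<gamma>. (\<integral>\<^sup>+a. f (a ** \<gamma>) * indicator Dom a \<partial>lborel) \<partial>count_space \<Gamma>)"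
  proof (rule nn_integral_cong)
    fix \<gamma> assume "\<gamma> \<in> space (count_space \<Gamma>)"
    then have g: "\<gamma> \<in> \<Gamma>" by simp
    have "(\<integral>\<^sup>+a. f a * indicator Cone a * indicator {a. \<sigma> a = matrix_inv \<gamma>} a \<partial>lborel)
      = (\<integral>\<^sup>+a. f (a ** \<gamma>) * indicator Cone (a ** \<gamma>) * indicator {a. \<sigma> a = matrix_inv \<gamma>} (a ** \<gamma>) \<partial>lborel)"
      by (rule nn_integral_right[symmetric]) (use g in auto)
    also have "\<dots> = (\<integral>\<^sup>+a. f (a ** \<gamma>) * indicator Dom a \<partial>lborel)"
    proof (rule nn_integral_cong)
      fix a
      have "\<sigma> (a ** \<gamma>) = matrix_inv \<gamma> \<longleftrightarrow> \<sigma> a = mat 1" if "a \<in> Cone"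
        using g that by (metis Cone_GLpos \<sigma>_mult inv_left' matrix_mul_rid inv_in)
      then show "f (a ** \<gamma>) * indicator Cone (a ** \<gamma>) * indicator {a. \<sigma> a = matrix_inv \<gamma>} (a ** \<gamma>)
        = f (a ** \<gamma>) * indicator Dom a"
        using g by (auto simp: Cone_mult det_in Dom_eq split: split_indicator)
    qed
    finally show "(\<integral>\<^sup>+a. f a * indicator Cone a * indicator {a. \<sigma> a = matrix_inv \<gamma>} a \<partial>lborel)
      = (\<integral>\<^sup>+a. f (a ** \<gamma>) * indicator Dom a \<partial>lborel)" .
  qed
  also have "\<dots> = (\<integral>\<^sup>+a. (\<integral>\<^sup>+\<gamma>. f (a ** \<gamma>) * indicator Dom a \<partial>count_space \<Gamma>) \<partial>lborel)"
    by (rule nn_integral_count_space_nn_integral[OF countable_lattice, symmetric]) measurable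
  also have "\<dots> = (\<integral>\<^sup>+a. (\<integral>\<^sup>+\<gamma>. f (a ** \<gamma>) \<partial>count_space \<Gamma>) * indicator Dom a \<partial>lborel)"
    by (intro nn_integral_cong nn_integral_multc) auto
  finally show ?thesis .
qed

text \<open>Every point of \<open>Dom\<close> has a lattice translate in the cone over F, so
  unfolding the indicator of that cone gives at least the measure of \<open>Dom\<close>.\<close>

lemma Dom_finite: "emeasure lborel Dom < \<infinity>"
proof -
  obtain F where F: "F \<subseteq> SL" "SL_cone F \<in> sets borel" "emeasure lborel (SL_cone F) < \<infinity>"
    "\<And>g. g \<in> SL \<Longrightarrow> \<exists>f\<in>F. \<exists>\<gamma>\<in>\<Gamma>. g = f ** \<gamma>"
    using lattice unfolding lattice_SL_def finite_covolume_def by auto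
  note [measurable] = F(2)
  have sub: "SL_cone F \<subseteq> Cone"
    using F(1) by (auto simp: SL_cone_def Cone_def SL_def GLpos_def det_scaleR_matrix power_le_one)
  have "emeasure lborel Dom = (\<integral>\<^sup>+a. 1 * indicator Dom a \<partial>lborel)" by simp
  also have "\<dots> \<le> (\<integral>\<^sup>+a. (\<integral>\<^sup>+\<gamma>. indicator (SL_cone F) (a ** \<gamma>) \<partial>count_space \<Gamma>) * indicator Dom a \<partial>lborel)"
  proof (rule nn_integral_mono)
    fix a
    show "1 * indicator Dom a \<le> (\<integral>\<^sup>+\<gamma>. indicator (SL_cone F) (a ** \<gamma>) \<partial>count_space \<Gamma>) * indicator Dom a"
    proof (cases "a \<in> Dom")
      case True
      then have a: "a \<in> GLpos" "det a \<le> 1" by (auto simp: Dom_def)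
      then have "normalized a \<in> SL" by (simp add: SL_def det_normalized)
      then obtain f \<gamma> where f: "f \<in> F" "\<gamma> \<in> \<Gamma>" "normalized a = f ** \<gamma>" using F(4) by blast
      let ?c = "root CARD('n) (det a)"
      have c: "0 < ?c" "?c \<le> 1" using a by (auto simp: GLpos_def)
      then have "a = ?c *\<^sub>R normalized a" by (simp add: normalized_def)
      then have "a ** matrix_inv \<gamma> = ?c *\<^sub>R f"
        using f by (simp add: scaleR_matrix_mult) (metis inv_cancel_right scaleR_matrix_mult(1))
      then have "a ** matrix_inv \<gamma> \<in> SL_cone F"
        unfolding SL_cone_def using f(1) c by blast
      then have "(\<integral>\<^sup>+\<delta>. indicator {matrix_inv \<gamma>} \<delta> \<partial>count_space \<Gamma>)
        \<le> (\<integral>\<^sup>+\<gamma>. indicator (SL_cone F) (a ** \<gamma>) \<partial>count_space \<Gamma>)"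
        by (intro nn_integral_mono) (auto split: split_indicator)
      moreover have "(\<integral>\<^sup>+\<delta>. indicator {matrix_inv \<gamma>} \<delta> \<partial>count_space \<Gamma>) = 1"
        using f by (subst nn_integral_indicator) (auto simp: inv_in)
      ultimately show ?thesis using True by simp
    qed simp
  qed
  also have "\<dots> = (\<integral>\<^sup>+a. indicator (SL_cone F) a * indicator Cone a \<partial>lborel)"
    by (rule nn_integral_unfold[symmetric]) measurable
  also have "\<dots> = emeasure lborel (SL_cone F)"
    using sub F(2) by (subst nn_integral_indicator[symmetric])
      (auto intro!: nn_integral_cong simp del: nn_integral_indicator split: split_indicator)
  finally show ?thesis using F(3) by simp
qed

text \<open>Unfolding the constant 1 would otherwise make the whole cone null, although it contains
  a nonempty open set.\<close>

lemma Dom_pos: "emeasure lborel Dom > 0"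
proof (rule ccontr)
  assume "\<not> ?thesis"
  then have D: "AE a in lborel. a \<notin> Dom"
    by (intro AE_not_in) (auto simp: null_sets_def)
  have "emeasure lborel Cone = (\<integral>\<^sup>+a. 1 * indicator Cone a \<partial>lborel)" by simp
  also have "\<dots> = (\<integral>\<^sup>+a. (\<integral>\<^sup>+\<gamma>. 1 \<partial>count_space \<Gamma>) * indicator Dom a \<partial>lborel)"
    by (rule nn_integral_unfold) auto
  also have "\<dots> = (\<integral>\<^sup>+a. 0 \<partial>(lborel :: (real^'n^'n) measure))"
    using D by (intro nn_integral_cong_AE, eventually_elim) auto
  finally have null: "emeasure lborel Cone = 0" by simp
  let ?U = "{a :: real^'n^'n. 0 < det a \<and> det a < 1}"
  have "open ?U" by (intro open_Collect_conj open_Collect_less continuous_intros)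
  moreover have "(1/2) *\<^sub>R mat 1 \<in> ?U" by (simp add: det_scaleR_matrix power_one_over)
  ultimately have "\<not> negligible ?U" using open_not_negligible by blast
  moreover have "emeasure lborel ?U \<le> emeasure lborel Cone"
    by (intro emeasure_mono) (auto simp: Cone_def GLpos_def)
  then have "?U \<in> null_sets lborel" using null \<open>open ?U\<close> by (auto simp: null_sets_def)
  then have "negligible ?U" by (simp add: negligible_iff_null_sets null_sets_completionI)
  ultimately show False by blast
qed

text \<open>A model of the invariant probability measure on the quotient by the lattice.\<close>

definition M :: "(real^'n^'n) measure" where
  "M = uniform_measure lborel Dom"

lemma sets_M [measurable_cong, simp]: "sets M = sets borel" and space_M [simp]: "space M = UNIV"
  by (simp_all add: M_def)

lemma prob_M: "prob_space M"
  unfolding M_def using Dom_finite Dom_pos by (intro prob_space_uniform_measure) (auto simp: less_top)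

lemma AE_M_Dom: "AE a in M. a \<in> Dom"
  unfolding M_def using Dom_finite Dom_pos by (intro AE_uniform_measureI) auto

lemma AE_M: "AE a in lborel. P a \<Longrightarrow> AE a in M. P a"
  unfolding M_def by (intro AE_uniform_measureI) auto

text \<open>Reduction to the fundamental domain: \<open>\<lambda>a. q (g ** a)\<close> models the
  left action of g on the quotient, and \<open>\<sigma> (g ** a)\<close> is its cocycle.\<close>

definition q :: "real^'n^'n \<Rightarrow> real^'n^'n" where
  "q a = a ** \<sigma> a"

lemma q_measurable [measurable]: "q \<in> borel_measurable borel"
  unfolding q_def by measurable

lemma q_Dom: "a \<in> Dom \<Longrightarrow> q a = a"
  by (simp add: Dom_def q_def)

lemma \<sigma>_\<sigma>: "a \<in> GLpos \<Longrightarrow> \<sigma> (q a) = mat 1"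
  by (simp add: q_def \<sigma>_mult \<sigma>_in inv_left)

lemma q_mult: "a \<in> GLpos \<Longrightarrow> \<gamma> \<in> \<Gamma> \<Longrightarrow> q (a ** \<gamma>) = q a"
  by (simp add: q_def \<sigma>_mult inv_left' \<sigma>_in flip: matrix_mul_assoc)

lemma Dom_Cone: "a \<in> Dom \<Longrightarrow> a \<in> Cone" by (simp add: Dom_eq)

text \<open>A left translate of \<open>Dom\<close> is again a fundamental domain for the right
  action of the lattice, and a right invariant function has the same integral over all of
  these.\<close>

lemma nn_integral_Dom_invariant:
  fixes h :: "real^'n^'n \<Rightarrow> ennreal"
  assumes [measurable]: "h \<in> borel_measurable borel" and g: "det g = 1"
    and inv: "\<And>a \<gamma>. a \<in> GLpos \<Longrightarrow> \<gamma> \<in> \<Gamma> \<Longrightarrow> h (a ** \<gamma>) = (h a :: ennreal)"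
  shows "(\<integral>\<^sup>+a. h (g ** a) * indicator Dom a \<partial>lborel) = (\<integral>\<^sup>+a. h a * indicator Dom a \<partial>lborel)"
proof -
  define k where "k = matrix_inv g"
  have k: "k ** g = mat 1" "g ** k = mat 1" using g by (simp_all add: k_def matrix_inv_cancel)
  then have dk: "det k = 1" using g by (metis det_I det_mul mult.left_neutral mult.commute)
  have "(\<integral>\<^sup>+a. h (g ** a) * indicator Dom a \<partial>lborel)
    = (\<integral>\<^sup>+a. (\<lambda>b. h b * indicator Dom (k ** b)) (g ** a) \<partial>lborel)"
    by (simp add: matrix_mul_assoc k)
  also have "\<dots> = (\<integral>\<^sup>+b. h b * indicator Dom (k ** b) \<partial>lborel)"
    by (rule nn_integral_left) (auto simp: g)
  also have "\<dots> = (\<integral>\<^sup>+b. (h b * indicator Dom (k ** b)) * indicator Cone b \<partial>lborel)"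
  proof (intro nn_integral_cong)
    fix b
    have "k ** b \<in> Dom \<Longrightarrow> b \<in> Cone" using dk Dom_Cone Cone_mult(2) by blast
    then show "h b * indicator Dom (k ** b) = (h b * indicator Dom (k ** b)) * indicator Cone b"
      by (auto split: split_indicator)
  qed
  also have "\<dots> = (\<integral>\<^sup>+a. (\<integral>\<^sup>+\<gamma>. h (a ** \<gamma>) * indicator Dom (k ** (a ** \<gamma>)) \<partial>count_space \<Gamma>) * indicator Dom a \<partial>lborel)"
    by (rule nn_integral_unfold) measurable
  also have "\<dots> = (\<integral>\<^sup>+a. h a * indicator Dom a \<partial>lborel)"
  proof (rule nn_integral_cong)
    fix a
    show "(\<integral>\<^sup>+\<gamma>. h (a ** \<gamma>) * indicator Dom (k ** (a ** \<gamma>)) \<partial>count_space \<Gamma>) * indicator Dom a = h a * indicator Dom a"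
    proof (cases "a \<in> Dom")
      case True
      then have a: "a \<in> GLpos" "a \<in> Cone" by (auto simp: Dom_eq Cone_GLpos)
      have "(\<integral>\<^sup>+\<gamma>. h (a ** \<gamma>) * indicator Dom (k ** (a ** \<gamma>)) \<partial>count_space \<Gamma>)
        = (\<integral>\<^sup>+\<gamma>. h a * indicator {\<sigma> (k ** a)} \<gamma> \<partial>count_space \<Gamma>)"
      proof (rule nn_integral_cong)
        fix \<gamma> assume "\<gamma> \<in> space (count_space \<Gamma>)"
        then have \<gamma>: "\<gamma> \<in> \<Gamma>" by simp
        have ka: "k ** a \<in> Cone" using a dk Cone_mult by blast
        have "k ** (a ** \<gamma>) \<in> Dom \<longleftrightarrow> matrix_inv \<gamma> ** \<sigma> (k ** a) = mat 1"
          using ka \<gamma> by (simp add: Dom_eq Cone_mult det_in \<sigma>_mult Cone_GLpos matrix_mul_assoc)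
        also have "\<dots> \<longleftrightarrow> \<gamma> = \<sigma> (k ** a)"
          using \<gamma> \<sigma>_in by (metis inv_left inv_left' matrix_mul_rid)
        finally show "h (a ** \<gamma>) * indicator Dom (k ** (a ** \<gamma>)) = h a * indicator {\<sigma> (k ** a)} \<gamma>"
          using inv a \<gamma> by (auto split: split_indicator)
      qed
      also have "\<dots> = h a"
        by (subst nn_integral_cmult) (auto simp: \<sigma>_in)
      finally show ?thesis by simp
    qed simp
  qed
  finally show ?thesis .
qed

lemma emeasure_M: "S \<in> sets borel \<Longrightarrow> emeasure M S = (\<integral>\<^sup>+a. indicator S a * indicator Dom a \<partial>lborel) / emeasure lborel Dom"
  unfolding M_def
  by (subst emeasure_uniform_measure)
    (auto simp: nn_integral_indicator[symmetric] simp del: nn_integral_indicator intro!: arg_cong2[where f="(/)"] nn_integral_cong split: split_indicator)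

lemma distr_M_translate:
  assumes g: "det g = 1"
  shows "distr M M (\<lambda>a. q (g ** a)) = M"
proof (rule measure_eqI)
  fix S assume "S \<in> sets (distr M M (\<lambda>a. q (g ** a)))"
  then have [measurable]: "S \<in> sets borel" by simp
  have [measurable]: "(\<lambda>a. q (g ** a)) \<in> borel_measurable borel" by measurable
  have "(\<lambda>a. q (g ** a)) -` S \<in> sets borel"
    using measurable_sets[of "\<lambda>a. q (g ** a)" borel borel S] by simp
  then have "emeasure (distr M M (\<lambda>a. q (g ** a))) S
    = (\<integral>\<^sup>+a. indicator S (q (g ** a)) * indicator Dom a \<partial>lborel) / emeasure lborel Dom"
    by (simp add: emeasure_distr emeasure_M indicator_vimage)
  also have "(\<integral>\<^sup>+a. indicator S (q (g ** a)) * indicator Dom a \<partial>lborel)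
    = (\<integral>\<^sup>+a. indicator S (q a) * indicator Dom a \<partial>lborel)"
    by (rule nn_integral_Dom_invariant[OF _ g]) (auto simp: q_mult)
  also have "\<dots> = (\<integral>\<^sup>+a. indicator S a * indicator Dom a \<partial>lborel)"
    by (intro nn_integral_cong) (auto simp: q_Dom split: split_indicator)
  finally show "emeasure (distr M M (\<lambda>a. q (g ** a))) S = emeasure M S"
    by (simp add: emeasure_M)
qed simp

lemma AE_lborel_of_AE_M:
  assumes P: "AE a in M. P a" and inv: "\<And>a \<gamma>. a \<in> Cone \<Longrightarrow> \<gamma> \<in> \<Gamma> \<Longrightarrow> P (a ** \<gamma>) = P a"
    and [measurable]: "Measurable.pred borel P"
  shows "AE a in lborel. a \<in> Cone \<longrightarrow> P a"
proof -
  have "AE a in lborel. a \<in> Dom \<longrightarrow> P a"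
    using P unfolding M_def by (subst (asm) AE_uniform_measure) (use Dom_finite Dom_pos in auto)
  moreover have "(\<integral>\<^sup>+a. indicator {a. \<not> P a} a * indicator Cone a \<partial>lborel)
    = (\<integral>\<^sup>+a. (\<integral>\<^sup>+\<gamma>. indicator {a. \<not> P a} (a ** \<gamma>) \<partial>count_space \<Gamma>) * indicator Dom a \<partial>lborel)"
    by (rule nn_integral_unfold) measurable
  moreover have "\<dots> = (\<integral>\<^sup>+a. (\<integral>\<^sup>+\<gamma>. indicator {a. \<not> P a} a \<partial>count_space \<Gamma>) * indicator Dom a \<partial>lborel)"
  proof (rule nn_integral_cong)
    fix a
    show "(\<integral>\<^sup>+\<gamma>. indicator {a. \<not> P a} (a ** \<gamma>) \<partial>count_space \<Gamma>) * indicator Dom a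
      = (\<integral>\<^sup>+\<gamma>. indicator {a. \<not> P a} a \<partial>count_space \<Gamma>) * indicator Dom a"
    proof (cases "a \<in> Dom")
      case True
      then have "(\<integral>\<^sup>+\<gamma>. indicator {a. \<not> P a} (a ** \<gamma>) \<partial>count_space \<Gamma>) = (\<integral>\<^sup>+\<gamma>. indicator {a. \<not> P a} a \<partial>count_space \<Gamma>)"
        by (intro nn_integral_cong) (simp add: inv Dom_Cone indicator_def)
      then show ?thesis by simp
    qed simp
  qed
  moreover have "\<dots> = (\<integral>\<^sup>+a. 0 \<partial>(lborel :: (real^'n^'n) measure))"
    using \<open>AE a in lborel. a \<in> Dom \<longrightarrow> P a\<close> by (intro nn_integral_cong_AE, eventually_elim) (auto split: split_indicator)
  ultimately have "(\<integral>\<^sup>+a. indicator {a. \<not> P a} a * indicator Cone a \<partial>lborel) = 0" by simp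
  then have "AE a in lborel. indicator {a. \<not> P a} a * indicator Cone a = (0 :: ennreal)"
    by (subst (asm) nn_integral_0_iff_AE) measurable
  then show ?thesis by eventually_elim (auto split: split_indicator_asm)
qed

text \<open>If a and its image \<open>q (g ** a)\<close> both lie in a compact K, then
  \<open>\<sigma> (g ** a)\<close> is the product of the inverse of a, the inverse of g and that
  image. It thus lies in a compact set, which meets the lattice in a finite one. The action
  preserves \<open>M\<close>, so each of the two conditions fails with probability at most
  e/2.\<close>

lemma tight:
  assumes C: "compact C" "\<And>g. g \<in> C \<Longrightarrow> det g = 1" and e: "e > 0"
  shows "\<exists>\<Phi>. finite \<Phi> \<and> \<Phi> \<subseteq> \<Gamma> \<and> (\<forall>g\<in>C. measure M {a. \<sigma> (g ** a) \<notin> \<Phi>} \<le> e)"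
proof -
  interpret prob_space M by (rule prob_M)
  have "emeasure M Dom = 1" using AE_M_Dom by (subst emeasure_eq_1_AE) auto
  have "emeasure M Dom = (SUP K\<in>{K. K \<subseteq> Dom \<and> compact K}. emeasure M K)"
    by (rule inner_regular) auto
  moreover have "ennreal (1 - e / 2) < 1" using e by (simp add: ennreal_less_one_iff)
  ultimately obtain K where K': "compact K" "K \<subseteq> Dom" "ennreal (1 - e / 2) < emeasure M K"
    using \<open>emeasure M Dom = 1\<close> by (metis (no_types, lifting) less_SUP_iff mem_Collect_eq)
  then have K: "compact K" "K \<subseteq> Dom" "measure M K > 1 - e / 2"
    by (auto simp: emeasure_eq_measure ennreal_less_iff dest: ennreal_less_iff[THEN iffD1, rotated])
      (metis ennreal_leI linorder_not_less)
  have mK[measurable]: "K \<in> sets borel" using K by (simp add: compact_imp_closed borel_closed)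
  let ?f = "\<lambda>p. matrix_inv (fst p) ** (matrix_inv (fst (snd p)) ** snd (snd p)) :: real^'n^'n"
  have nz: "det a \<noteq> 0" if "a \<in> K" for a using that K by (auto simp: Dom_def GLpos_def)
  have "continuous_on (K \<times> C \<times> K) ?f"
    using nz C(2)
    by (intro continuous_intros continuous_on_compose2[OF continuous_on_matrix_inv]) auto
  then have "compact (?f ` (K \<times> C \<times> K))"
    using K C by (intro compact_continuous_image compact_Times) auto
  then have fin: "finite (\<Gamma> \<inter> ?f ` (K \<times> C \<times> K))" by (rule finite_Int_compact)
  have "measure M {a. \<sigma> (g ** a) \<notin> \<Gamma> \<inter> ?f ` (K \<times> C \<times> K)} \<le> e" if g: "g \<in> C" for g
  proof -
    let ?T = "\<lambda>a. q (g ** a)"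
    have mT[measurable]: "?T \<in> measurable M M" by measurable
    have "measure M (?T -` K) = measure (distr M M ?T) K"
      by (subst measure_distr) auto
    also have "\<dots> = measure M K" using C(2) g by (simp add: distr_M_translate)
    finally have mTK: "measure M (?T -` K) = measure M K" .
    have s[measurable]: "?T -` K \<in> sets M" using measurable_sets[OF mT, of K] by simp
    have "{a. \<sigma> (g ** a) \<notin> \<Gamma> \<inter> ?f ` (K \<times> C \<times> K)} \<subseteq> (UNIV - K) \<union> (UNIV - ?T -` K)"
    proof (rule subsetI, rule ccontr)
      fix a assume a: "a \<in> {a. \<sigma> (g ** a) \<notin> \<Gamma> \<inter> ?f ` (K \<times> C \<times> K)}" "a \<notin> (UNIV - K) \<union> (UNIV - ?T -` K)"
      then have "a \<in> K" "?T a \<in> K" by auto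
      moreover have "?f (a, g, ?T a) = \<sigma> (g ** a)"
      proof -
        have "?f (a, g, ?T a) = matrix_inv a ** ((matrix_inv g ** g) ** (a ** \<sigma> (g ** a)))"
          by (simp add: q_def matrix_mul_assoc)
        also have "\<dots> = (matrix_inv a ** a) ** \<sigma> (g ** a)"
          using C(2)[OF g] by (simp add: matrix_inv_cancel matrix_mul_assoc)
        finally show ?thesis using nz[OF \<open>a \<in> K\<close>] by (simp add: matrix_inv_cancel)
      qed
      ultimately have "\<sigma> (g ** a) \<in> ?f ` (K \<times> C \<times> K)"
        using g by (metis (no_types, lifting) image_eqI mem_Sigma_iff)
      then show False using a \<sigma>_in by blast
    qed
    then have "measure M {a. \<sigma> (g ** a) \<notin> \<Gamma> \<inter> ?f ` (K \<times> C \<times> K)} \<le> measure M ((UNIV - K) \<union> (UNIV - ?T -` K))"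
      using s by (intro finite_measure_mono sets.Un sets.Diff) auto
    also have "\<dots> \<le> measure M (UNIV - K) + measure M (UNIV - ?T -` K)"
      using s by (intro measure_Un_le sets.Diff) auto
    also have "\<dots> = (1 - measure M K) + (1 - measure M K)"
      using prob_compl[of K] prob_compl[OF s] mTK by simp
    finally show ?thesis using K(3) by simp
  qed
  then show ?thesis using fin by (intro exI[of _ "\<Gamma> \<inter> ?f ` (K \<times> C \<times> K)"]) auto
qed

end

section \<open>Even trigonometric polynomials in two variables\<close>

definition phase :: "int \<times> int \<Rightarrow> real \<times> real \<Rightarrow> real" where
  "phase z \<theta> = real_of_int (fst z) * fst \<theta> + real_of_int (snd z) * snd \<theta>"

lemma phase_add: "phase (z + y) \<theta> = phase z \<theta> + phase y \<theta>"
  and phase_diff: "phase (z - y) \<theta> = phase z \<theta> - phase y \<theta>"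
  and phase_0 [simp]: "phase 0 \<theta> = 0"
  by (simp_all add: phase_def algebra_simps)

text \<open>A formal even trigonometric polynomial. The same list is read as a function on the torus
  and as an operator on functions on the integer lattice, both by recursion on the list; repeated
  frequencies are allowed.\<close>

type_synonym trig_list = "(real \<times> (int \<times> int)) list"

definition trig_eval :: "trig_list \<Rightarrow> real \<times> real \<Rightarrow> real" where
  "trig_eval xs \<theta> = (\<Sum>(c, z)\<leftarrow>xs. c * cos (phase z \<theta>))"

text \<open>The convolution operator on functions on the integer lattice whose Fourier multiplier is \<open>trig_eval xs\<close>.\<close>

definition trig_op :: "trig_list \<Rightarrow> (int \<times> int \<Rightarrow> 'v::real_vector) \<Rightarrow> int \<times> int \<Rightarrow> 'v" where
  "trig_op xs g w = (\<Sum>(c, z)\<leftarrow>xs. (c / 2) *\<^sub>R (g (w + z) + g (w - z)))"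

text \<open>The formula cos a cos b = (cos (a + b) + cos (a - b)) / 2 explains the two entries;
  under the other reading the product is composition, see \<open>trig_op_mult\<close>.\<close>

definition trig_mult :: "trig_list \<Rightarrow> trig_list \<Rightarrow> trig_list" where
  "trig_mult xs ys = concat (map (\<lambda>(c, z). concat (map (\<lambda>(d, y). [(c * d / 2, z + y), (c * d / 2, z - y)]) ys)) xs)"

definition trig_scale :: "real \<Rightarrow> trig_list \<Rightarrow> trig_list" where
  "trig_scale k xs = map (\<lambda>(c, z). (k * c, z)) xs"

lemma trig_simps [simp]:
  "trig_eval [] \<theta> = 0" "trig_eval ((c, z) # xs) \<theta> = c * cos (phase z \<theta>) + trig_eval xs \<theta>"
  "trig_eval (xs @ ys) \<theta> = trig_eval xs \<theta> + trig_eval ys \<theta>"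
  "trig_op [] g w = 0" "trig_op ((c, z) # xs) g w = (c / 2) *\<^sub>R (g (w + z) + g (w - z)) + trig_op xs g w"
  "trig_op (xs @ ys) g w = trig_op xs g w + trig_op ys g w"
  "trig_mult [] ys = []"
  "trig_mult ((c, z) # xs) ys = concat (map (\<lambda>(d, y). [(c * d / 2, z + y), (c * d / 2, z - y)]) ys) @ trig_mult xs ys"
  by (simp_all add: trig_eval_def trig_op_def trig_mult_def)

lemma trig_eval_scale [simp]: "trig_eval (trig_scale k xs) \<theta> = k * trig_eval xs \<theta>"
  by (induction xs) (auto simp: trig_scale_def algebra_simps)

lemma trig_op_scale [simp]: "trig_op (trig_scale k xs) g w = k *\<^sub>R trig_op xs g w"
  by (induction xs) (auto simp: trig_scale_def algebra_simps)

lemma trig_eval_mult [simp]: "trig_eval (trig_mult xs ys) \<theta> = trig_eval xs \<theta> * trig_eval ys \<theta>"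
proof (induction xs)
  case (Cons p xs)
  obtain c z where p: "p = (c, z)" by (cases p)
  have "trig_eval (concat (map (\<lambda>(d, y). [(c * d / 2, z + y), (c * d / 2, z - y)]) ys)) \<theta>
    = c * cos (phase z \<theta>) * trig_eval ys \<theta>"
    by (induction ys) (auto simp: algebra_simps phase_add phase_diff cos_add cos_diff)
  then show ?case using Cons by (simp add: p algebra_simps)
qed simp

lemma trig_op_mult: "trig_op (trig_mult xs ys) g w = trig_op xs (trig_op ys g) w"
proof (induction xs)
  case (Cons p xs)
  obtain c z where p: "p = (c, z)" by (cases p)
  have "trig_op (concat (map (\<lambda>(d, y). [(c * d / 2, z + y), (c * d / 2, z - y)]) ys)) g w
    = (c / 2) *\<^sub>R (trig_op ys g (w + z) + trig_op ys g (w - z))"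
  proof (induction ys)
    case (Cons r ys)
    obtain d y where r: "r = (d, y)" by (cases r)
    have "w + (z + y) = w + z + y" "w + (z - y) = w + z - y" "w - (z + y) = w - z - y" "w - (z - y) = w - z + y"
      by simp_all
    moreover have "(c * d / 4) = c / 2 * (d / 2)" by simp
    ultimately show ?case using Cons by (simp add: r algebra_simps)
  qed simp
  then show ?case using Cons by (simp add: p)
qed simp

lemma trig_op_diff: "trig_op xs (\<lambda>u. f u - g u) w = trig_op xs f w - trig_op xs g w"
  by (induction xs) (auto simp: algebra_simps)

lemma trig_op_linear:
  assumes "linear L" shows "trig_op xs (\<lambda>u. L (g u)) w = L (trig_op xs g w)"
  by (induction xs) (auto simp: linear_add[OF assms] linear_scale[OF assms] linear_0[OF assms])

definition trig_norm :: "trig_list \<Rightarrow> real" where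
  "trig_norm xs = (\<Sum>(c, z)\<leftarrow>xs. \<bar>c\<bar>)"

lemma trig_norm_nonneg: "trig_norm xs \<ge> 0"
  by (induction xs) (auto simp: trig_norm_def)

lemma norm_trig_op_le:
  fixes g :: "int \<times> int \<Rightarrow> 'v::real_normed_vector"
  assumes "\<And>u. norm (g u) \<le> C"
  shows "norm (trig_op xs g w) \<le> trig_norm xs * C"
proof (induction xs)
  case (Cons p xs)
  obtain c z where p: "p = (c, z)" by (cases p)
  have "norm ((c / 2) *\<^sub>R (g (w + z) + g (w - z))) \<le> \<bar>c\<bar> / 2 * (C + C)"
    unfolding norm_scaleR using assms[of "w + z"] assms[of "w - z"]
    by (intro mult_mono norm_triangle_le add_mono) auto
  then have "norm ((c / 2) *\<^sub>R (g (w + z) + g (w - z)) + trig_op xs g w) \<le> \<bar>c\<bar> * C + trig_norm xs * C"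
    using Cons by (intro norm_triangle_le) auto
  then show ?case by (simp add: p trig_norm_def algebra_simps)
qed (simp add: trig_norm_def)

section \<open>Positivity and norm bounds for multipliers by exact sampling on the torus\<close>

lemma sum_roots_of_unity_1:
  assumes "\<bar>m\<bar> < int q"
  shows "(\<Sum>j<q. cis (2 * pi * real j * real_of_int m / real q)) = (if m = 0 then of_nat q else 0)"
proof (cases "m = 0")
  case False
  let ?x = "cis (2 * pi * real_of_int m / real q)"
  have q: "q > 0" using assms by auto
  have "?x \<noteq> 1"
  proof
    assume "?x = 1"
    then have "cos (2 * pi * real_of_int m / real q) = 1" by (metis cis.simps(1) one_complex.simps(1))
    then obtain k :: int where "2 * pi * real_of_int m / real q = real_of_int k * 2 * pi"
      by (auto simp: cos_one_2pi_int)
    then have "real_of_int m = real_of_int k * real q" using q by (simp add: field_simps)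
    then have "m = k * int q" by (metis of_int_eq_iff of_int_mult of_int_of_nat_eq)
    then show False using assms False by (cases "k = 0") (auto simp: abs_mult)
  qed
  moreover have "?x ^ q = 1"
  proof -
    have "?x ^ q = cis (2 * pi * real_of_int m)" using q by (subst Complex.DeMoivre) simp
    then show ?thesis by (simp add: cis_multiple_2pi)
  qed
  ultimately have "(\<Sum>j<q. ?x ^ j) = 0" by (simp add: geometric_sum)
  moreover have "?x ^ j = cis (2 * pi * real j * real_of_int m / real q)" for j
    by (simp add: Complex.DeMoivre algebra_simps)
  ultimately show ?thesis using False by simp
qed simp

definition torus_point :: "nat \<Rightarrow> nat \<times> nat \<Rightarrow> real \<times> real" where
  "torus_point q j = (2 * pi * real (fst j) / real q, 2 * pi * real (snd j) / real q)"

lemma sum_roots_of_unity: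
  assumes "\<bar>fst z\<bar> < int q" "\<bar>snd z\<bar> < int q"
  shows "(\<Sum>j\<in>{..<q}\<times>{..<q}. cos (phase z (torus_point q j))) = (if z = 0 then (real q)\<^sup>2 else 0)"
proof -
  have "(\<Sum>j\<in>{..<q}\<times>{..<q}. cis (phase z (torus_point q j)))
    = (\<Sum>j<q. cis (2 * pi * real j * real_of_int (fst z) / real q)) * (\<Sum>j<q. cis (2 * pi * real j * real_of_int (snd z) / real q))"
    by (simp add: sum_product sum.cartesian_product cis_mult phase_def torus_point_def case_prod_beta algebra_simps)
  also have "\<dots> = (if z = 0 then of_real ((real q)\<^sup>2) else 0)"
    using assms by (cases z) (auto simp: sum_roots_of_unity_1 power2_eq_square zero_prod_def)
  finally have "Re (\<Sum>j\<in>{..<q}\<times>{..<q}. cis (phase z (torus_point q j))) = (if z = 0 then (real q)\<^sup>2 else 0)"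
    by (auto split: if_splits)
  then show ?thesis by simp
qed

text \<open>A discrete Plancherel argument. \<open>C \<theta> \<bullet> C \<theta> + D \<theta>
  \<bullet> D \<theta>\<close> is the squared modulus of the Fourier transform of g; its product
  with the multiplier is nonnegative at every grid point, and the grid sum reproduces the quadratic
  form exactly.\<close>

lemma trig_op_nonneg:
  fixes g :: "int \<times> int \<Rightarrow> 'v::real_inner"
  assumes S: "finite S" "\<And>w. w \<notin> S \<Longrightarrow> g w = 0" and pos: "\<And>\<theta>. trig_eval xs \<theta> \<ge> 0"
  shows "(\<Sum>w\<in>S. g w \<bullet> trig_op xs g w) \<ge> 0"
proof -
  define T where "T = (\<lambda>(c, u, u'). c + u - u') ` ((insert 0 (snd ` set xs) \<union> uminus ` snd ` set xs) \<times> S \<times> S)"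
  have "finite T" unfolding T_def using S by auto
  \<comment> \<open>\<open>q\<close> exceeds both coordinates of every frequency in
    \<open>T\<close>, the frequencies that occur in the product, so the grid of q-th roots of unity
    causes no aliasing.\<close>
  define q where "q = nat (1 + (\<Sum>t\<in>T. \<bar>fst t\<bar> + \<bar>snd t\<bar>))"
  have sum0: "(\<Sum>t\<in>T. \<bar>fst t\<bar> + \<bar>snd t\<bar>) \<ge> 0" by (intro sum_nonneg) auto
  have qT: "\<bar>fst t\<bar> < int q \<and> \<bar>snd t\<bar> < int q" if "t \<in> T" for t
  proof -
    have "\<bar>fst t\<bar> + \<bar>snd t\<bar> \<le> (\<Sum>t\<in>T. \<bar>fst t\<bar> + \<bar>snd t\<bar>)"
      using \<open>finite T\<close> that by (intro member_le_sum) auto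
    then show ?thesis using sum0 unfolding q_def by auto
  qed
  have q: "q > 0" using sum0 by (auto simp: q_def)
  let ?J = "{..<q} \<times> {..<q}" and ?p = "torus_point q"
  define C where "C \<theta> = (\<Sum>u\<in>S. cos (phase u \<theta>) *\<^sub>R g u)" for \<theta>
  define D where "D \<theta> = (\<Sum>u\<in>S. sin (phase u \<theta>) *\<^sub>R g u)" for \<theta>
  have CD: "C \<theta> \<bullet> C \<theta> + D \<theta> \<bullet> D \<theta> = (\<Sum>u\<in>S. \<Sum>u'\<in>S. cos (phase (u - u') \<theta>) * (g u \<bullet> g u'))" for \<theta>
  proof -
    have "C \<theta> \<bullet> C \<theta> + D \<theta> \<bullet> D \<theta> = (\<Sum>u\<in>S. \<Sum>u'\<in>S. cos (phase u \<theta>) * cos (phase u' \<theta>) * (g u \<bullet> g u'))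
      + (\<Sum>u\<in>S. \<Sum>u'\<in>S. sin (phase u \<theta>) * sin (phase u' \<theta>) * (g u \<bullet> g u'))"
      unfolding C_def D_def inner_sum_left inner_sum_right
      by (intro arg_cong2[where f="(+)"] sum.cong refl) (auto simp: inner_commute)
    then show ?thesis
      by (simp add: phase_diff cos_diff sum.distrib[symmetric] distrib_right)
  qed
  have avg: "(\<Sum>j\<in>?J. cos (phase z (?p j)) * (C (?p j) \<bullet> C (?p j) + D (?p j) \<bullet> D (?p j)))
      = (real q)\<^sup>2 * (\<Sum>u\<in>S. g u \<bullet> ((1 / 2) *\<^sub>R (g (u + z) + g (u - z))))"
    if z: "z \<in> snd ` set xs" for z
  proof -
    have one: "(\<Sum>j\<in>?J. cos (phase z (?p j)) * cos (phase (u - u') (?p j)))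
      = (real q)\<^sup>2 / 2 * ((if u' = u + z then 1 else 0) + (if u' = u - z then 1 else 0))"
      if u: "u \<in> S" "u' \<in> S" for u u'
    proof -
      have T1: "z + u - u' \<in> T"
        unfolding T_def by (rule image_eqI[of _ _ "(z, u, u')"]) (use u z in auto)
      have T2: "- z + u - u' \<in> T"
        unfolding T_def by (rule image_eqI[of _ _ "(- z, u, u')"]) (use u z in auto)
      have "(\<Sum>j\<in>?J. cos (phase z (?p j)) * cos (phase (u - u') (?p j)))
        = (\<Sum>j\<in>?J. (cos (phase (z + u - u') (?p j)) + cos (phase (- z + u - u') (?p j))) / 2)"
        by (intro sum.cong refl) (simp add: phase_add phase_diff cos_add cos_diff sin_add sin_diff phase_def algebra_simps
            flip: cos_minus[of "phase (- z + _ - _) _"])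
      also have "\<dots> = ((\<Sum>j\<in>?J. cos (phase (z + u - u') (?p j))) + (\<Sum>j\<in>?J. cos (phase (- z + u - u') (?p j)))) / 2"
        by (simp add: sum.distrib sum_divide_distrib[symmetric])
      also have "\<dots> = ((if z + u - u' = 0 then (real q)\<^sup>2 else 0) + (if - z + u - u' = 0 then (real q)\<^sup>2 else 0)) / 2"
        using sum_roots_of_unity[of "z + u - u'" q] sum_roots_of_unity[of "- z + u - u'" q] qT[OF T1] qT[OF T2] by simp
      finally show ?thesis by (auto simp: algebra_simps)
    qed
    have "(\<Sum>j\<in>?J. cos (phase z (?p j)) * (C (?p j) \<bullet> C (?p j) + D (?p j) \<bullet> D (?p j)))
      = (\<Sum>u\<in>S. \<Sum>u'\<in>S. (\<Sum>j\<in>?J. cos (phase z (?p j)) * cos (phase (u - u') (?p j))) * (g u \<bullet> g u'))"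
      unfolding CD sum_distrib_left sum_distrib_right
      by (rule trans[OF sum.swap], intro sum.cong refl, rule trans[OF sum.swap]) (simp add: mult.assoc)
    also have "\<dots> = (\<Sum>u\<in>S. (real q)\<^sup>2 * (g u \<bullet> ((1 / 2) *\<^sub>R (g (u + z) + g (u - z)))))"
    proof (rule sum.cong[OF refl])
      fix u assume u: "u \<in> S"
      have "(\<Sum>u'\<in>S. (\<Sum>j\<in>?J. cos (phase z (?p j)) * cos (phase (u - u') (?p j))) * (g u \<bullet> g u'))
        = (\<Sum>u'\<in>S. (real q)\<^sup>2 / 2 * (if u' = u + z then g u \<bullet> g u' else 0) + (real q)\<^sup>2 / 2 * (if u' = u - z then g u \<bullet> g u' else 0))"
        by (intro sum.cong refl) (auto simp: one u algebra_simps)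
      also have "\<dots> = (real q)\<^sup>2 / 2 * (g u \<bullet> g (u + z)) + (real q)\<^sup>2 / 2 * (g u \<bullet> g (u - z))"
      proof -
        have "(\<Sum>u'\<in>S. if u' = v then g u \<bullet> g u' else 0) = g u \<bullet> g v" for v
          using S by (cases "v \<in> S") (auto simp: sum.delta)
        then show ?thesis by (simp only: sum.distrib sum_distrib_left[symmetric])
      qed
      finally show "(\<Sum>u'\<in>S. (\<Sum>j\<in>?J. cos (phase z (?p j)) * cos (phase (u - u') (?p j))) * (g u \<bullet> g u'))
        = (real q)\<^sup>2 * (g u \<bullet> ((1 / 2) *\<^sub>R (g (u + z) + g (u - z))))"
        by (simp add: inner_add_right algebra_simps)
    qed
    finally show ?thesis by (simp add: sum_distrib_left)
  qed
  have "(\<Sum>j\<in>?J. trig_eval ys (?p j) * (C (?p j) \<bullet> C (?p j) + D (?p j) \<bullet> D (?p j)))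
      = (real q)\<^sup>2 * (\<Sum>w\<in>S. g w \<bullet> trig_op ys g w)" if "set ys \<subseteq> set xs" for ys
    using that
  proof (induction ys)
    case (Cons p ys)
    obtain c z where p: "p = (c, z)" by (cases p)
    then have z: "z \<in> snd ` set xs" using Cons.prems by force
    have "(\<Sum>j\<in>?J. trig_eval (p # ys) (?p j) * (C (?p j) \<bullet> C (?p j) + D (?p j) \<bullet> D (?p j)))
      = c * (\<Sum>j\<in>?J. cos (phase z (?p j)) * (C (?p j) \<bullet> C (?p j) + D (?p j) \<bullet> D (?p j)))
        + (\<Sum>j\<in>?J. trig_eval ys (?p j) * (C (?p j) \<bullet> C (?p j) + D (?p j) \<bullet> D (?p j)))"
      unfolding p sum_distrib_left sum.distrib[symmetric] by (intro sum.cong refl) (simp add: algebra_simps)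
    also have "\<dots> = (real q)\<^sup>2 * (c * (\<Sum>u\<in>S. g u \<bullet> ((1 / 2) *\<^sub>R (g (u + z) + g (u - z)))) + (\<Sum>w\<in>S. g w \<bullet> trig_op ys g w))"
    proof -
      have "(\<Sum>j\<in>?J. trig_eval ys (?p j) * (C (?p j) \<bullet> C (?p j) + D (?p j) \<bullet> D (?p j)))
        = (real q)\<^sup>2 * (\<Sum>w\<in>S. g w \<bullet> trig_op ys g w)" using Cons by auto
      then show ?thesis unfolding avg[OF z] by (simp only: distrib_left mult.left_commute)
    qed
    also have "c * (\<Sum>u\<in>S. g u \<bullet> ((1 / 2) *\<^sub>R (g (u + z) + g (u - z)))) + (\<Sum>w\<in>S. g w \<bullet> trig_op ys g w)
      = (\<Sum>w\<in>S. g w \<bullet> trig_op (p # ys) g w)"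
      unfolding p sum_distrib_left sum.distrib[symmetric] by (intro sum.cong refl) (simp add: inner_add_right algebra_simps)
    finally show ?case .
  qed simp
  then have "(real q)\<^sup>2 * (\<Sum>w\<in>S. g w \<bullet> trig_op xs g w)
    = (\<Sum>j\<in>?J. trig_eval xs (?p j) * (C (?p j) \<bullet> C (?p j) + D (?p j) \<bullet> D (?p j)))" by simp
  also have "\<dots> \<ge> 0" by (intro sum_nonneg mult_nonneg_nonneg pos add_nonneg_nonneg inner_ge_zero)
  finally show ?thesis using q by (simp add: zero_le_mult_iff)
qed

lemma sum_shift:
  fixes f :: "int \<times> int \<Rightarrow> 'v::comm_monoid_add"
  assumes "finite R" "\<And>w. w \<notin> R \<Longrightarrow> f w = 0" "\<And>w. w \<notin> R \<Longrightarrow> f (w + z) = 0"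
  shows "(\<Sum>w\<in>R. f (w + z)) = (\<Sum>w\<in>R. f w)"
proof -
  have "(\<Sum>w\<in>R. f (w + z)) = (\<Sum>v\<in>(\<lambda>w. w + z) ` R. f v)"
    by (subst sum.reindex) (auto simp: inj_on_def)
  also have "\<dots> = (\<Sum>v\<in>(\<lambda>w. w + z) ` R \<union> R. f v)"
  proof (rule sum.mono_neutral_left)
    show "\<forall>i\<in>(\<lambda>w. w + z) ` R \<union> R - (\<lambda>w. w + z) ` R. f i = 0"
    proof
      fix i assume "i \<in> (\<lambda>w. w + z) ` R \<union> R - (\<lambda>w. w + z) ` R"
      then have "i - z \<notin> R" by (metis DiffD2 diff_add_cancel image_eqI)
      then show "f i = 0" using assms(3)[of "i - z"] by simp
    qed
  qed (use assms in auto)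
  also have "\<dots> = (\<Sum>w\<in>R. f w)"
    by (rule sum.mono_neutral_right) (use assms in auto)
  finally show ?thesis .
qed

text \<open>Positivity is applied to the multiplier
  \<open>m\<^sup>2 - (trig_eval xs \<theta>)\<^sup>2\<close>. Because \<open>trig_op\<close> is
  symmetric, its quadratic form is the difference of the two squared norms.\<close>

lemma trig_op_norm_bound:
  fixes g :: "int \<times> int \<Rightarrow> 'v::real_inner"
  assumes S: "finite S" "\<And>w. w \<notin> S \<Longrightarrow> g w = 0" and S': "finite S'"
    and bound: "\<And>\<theta>. \<bar>trig_eval xs \<theta>\<bar> \<le> m"
  shows "(\<Sum>w\<in>S'. (norm (trig_op xs g w))\<^sup>2) \<le> m\<^sup>2 * (\<Sum>w\<in>S. (norm (g w))\<^sup>2)"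
proof -
  define h where "h = trig_op xs g"
  \<comment> \<open>A finite window outside which both g and its image vanish, so that sums over it
    may be reindexed by shifts.\<close>
  define R where "R = S \<union> S' \<union> (\<Union>z\<in>snd ` set xs. (\<lambda>w. w - z) ` S \<union> (\<lambda>w. w + z) ` S)"
  have R: "finite R" unfolding R_def using S S' by auto
  have g0: "g w = 0" if "w \<notin> R" for w using that S by (auto simp: R_def)
  have h0': "trig_op ys g w = 0" if "w \<notin> R" "set ys \<subseteq> set xs" for w ys
    using that(2)
  proof (induction ys)
    case (Cons p ys)
    obtain c z where p: "p = (c, z)" by (cases p)
    then have z: "z \<in> snd ` set xs" using Cons.prems by force
    have "w + z \<notin> S" using that(1) z by (auto simp: R_def image_iff) (metis add_diff_cancel_right' prod.collapse snd_conv)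
    moreover have "w - z \<notin> S" using that(1) z by (auto simp: R_def image_iff) (metis diff_add_cancel prod.collapse snd_conv)
    ultimately show ?case using Cons S by (simp add: p)
  qed simp
  have h0: "h w = 0" if "w \<notin> R" for w using h0'[OF that, of xs] by (simp add: h_def)
  have adj: "(\<Sum>w\<in>R. g w \<bullet> trig_op ys h w) = (\<Sum>w\<in>R. trig_op ys g w \<bullet> h w)" for ys
  proof (induction ys)
    case (Cons p ys)
    obtain c z where p: "p = (c, z)" by (cases p)
    have 1: "(\<Sum>w\<in>R. g w \<bullet> h (w + z)) = (\<Sum>w\<in>R. g (w - z) \<bullet> h w)"
      using sum_shift[OF R, of "\<lambda>w. g (w - z) \<bullet> h w" z] g0 h0 by simp
    have 2: "(\<Sum>w\<in>R. g w \<bullet> h (w - z)) = (\<Sum>w\<in>R. g (w + z) \<bullet> h w)"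
      using sum_shift[OF R, of "\<lambda>w. g w \<bullet> h (w - z)" z] g0 h0 by simp
    have "(\<Sum>w\<in>R. g w \<bullet> trig_op (p # ys) h w)
      = c / 2 * ((\<Sum>w\<in>R. g w \<bullet> h (w + z)) + (\<Sum>w\<in>R. g w \<bullet> h (w - z))) + (\<Sum>w\<in>R. g w \<bullet> trig_op ys h w)"
      by (simp add: p inner_add_right sum.distrib sum_distrib_left algebra_simps)
    also have "\<dots> = (\<Sum>w\<in>R. trig_op (p # ys) g w \<bullet> h w)"
      unfolding 1 2 Cons by (simp add: p inner_add_left sum.distrib sum_distrib_left algebra_simps)
    finally show ?case .
  qed simp
  have "0 \<le> (\<Sum>w\<in>R. g w \<bullet> trig_op ((m\<^sup>2, 0) # trig_scale (-1) (trig_mult xs xs)) g w)"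
  proof (rule trig_op_nonneg[OF R g0])
    fix \<theta>
    have "(trig_eval xs \<theta>)\<^sup>2 \<le> m\<^sup>2" using bound[of \<theta>] by (simp add: abs_le_square_iff[symmetric])
    then show "0 \<le> trig_eval ((m\<^sup>2, 0) # trig_scale (-1) (trig_mult xs xs)) \<theta>"
      by (simp add: power2_eq_square)
  qed
  also have "\<dots> = m\<^sup>2 * (\<Sum>w\<in>R. g w \<bullet> g w) - (\<Sum>w\<in>R. g w \<bullet> trig_op xs h w)"
    by (simp add: trig_op_mult h_def inner_diff_right inner_add_right sum_subtractf sum.distrib sum_distrib_left scaleR_2[symmetric])
  also have "(\<Sum>w\<in>R. g w \<bullet> trig_op xs h w) = (\<Sum>w\<in>R. h w \<bullet> h w)"
    unfolding adj by (simp add: h_def)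
  also have "(\<Sum>w\<in>R. g w \<bullet> g w) = (\<Sum>w\<in>S. g w \<bullet> g w)"
    by (rule sum.mono_neutral_right) (use R S in \<open>auto simp: R_def\<close>)
  finally have "(\<Sum>w\<in>R. h w \<bullet> h w) \<le> m\<^sup>2 * (\<Sum>w\<in>S. g w \<bullet> g w)" by simp
  moreover have "(\<Sum>w\<in>S'. h w \<bullet> h w) \<le> (\<Sum>w\<in>R. h w \<bullet> h w)"
    by (rule sum_mono2[OF R]) (auto simp: R_def)
  ultimately show ?thesis by (simp add: h_def power2_norm_eq_inner)
qed

subsection \<open>The Lyapunov function\<close>

text \<open>Up to the regularisation \<open>\<tau>\<close> this is half the sine of twice the angle of \<open>(sin x, sin y)\<close>, a bounded
  function whose total variation along the four unit shears is positive away from the origin. It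
  witnesses that no mean on the punctured torus is invariant under \<open>SL\<^sub>2(\<int>)\<close>.\<close>

definition lyapunov :: "real \<Rightarrow> real \<times> real \<Rightarrow> real" where
  "lyapunov \<tau> \<theta> = sin (fst \<theta>) * sin (snd \<theta>) / ((sin (fst \<theta>))\<^sup>2 + (sin (snd \<theta>))\<^sup>2 + \<tau>)"

lemma lyapunov_bound:
  assumes "\<tau> > 0" shows "\<bar>lyapunov \<tau> \<theta>\<bar> \<le> 1 / 2"
proof -
  let ?x = "sin (fst \<theta>)" and ?y = "sin (snd \<theta>)"
  have "2 * \<bar>?x * ?y\<bar> \<le> ?x\<^sup>2 + ?y\<^sup>2"
    using sum_squares_bound[of "\<bar>?x\<bar>" "\<bar>?y\<bar>"] by (simp add: abs_mult)
  moreover have "?x\<^sup>2 + ?y\<^sup>2 + \<tau> > 0" using assms by (simp add: add_nonneg_pos)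
  ultimately show ?thesis
    using assms by (simp add: lyapunov_def abs_mult abs_divide divide_le_eq)
qed

text \<open>X and Y are the squared sines of the two angles, c and d their cosines, and
  \<open>DD\<close> and \<open>EE\<close> the products of the denominators that arise when the shear
  differences are put over common denominators. The first summand can be negative only for X > 2Y +
  \<tau>; then it loses at most a quarter of X / (X + \<tau>), while the second summand is twice
  what is required.\<close>

lemma lyapunov_algebra_le:
  fixes X Y :: real
  assumes "0 \<le> Y" "Y \<le> X" "X \<le> 1 / 10" "\<tau> > 0" "95 / 100 \<le> c" "c \<le> 1" "95 / 100 \<le> d" "d \<le> 1"
  defines "DD \<equiv> (X - Y)\<^sup>2 + (Y + \<tau>) * (2 * X + 2 * Y - 4 * X * Y) + (Y + \<tau>)\<^sup>2"
  defines "EE \<equiv> (X - Y)\<^sup>2 + (X + \<tau>) * (2 * X + 2 * Y - 4 * X * Y) + (X + \<tau>)\<^sup>2"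
  shows "3 / 10 * (X / (X + \<tau>)) \<le> 2 * Y * c * (2 * Y - X + \<tau>) / DD + 2 * X * d * (2 * X - Y + \<tau>) / EE"
proof -
  have XY: "0 \<le> X * Y" "X * Y \<le> Y / 10" "X * Y \<le> X / 10" "X * X \<le> X/10"
    using assms mult_right_mono[of X "1/10" Y] mult_left_mono[of Y "1/10" X] mult_left_mono[of X "1/10" X] by auto
  have X0: "0 \<le> X" "0 < X + \<tau>" using assms by auto
  have s0: "0 \<le> 2 * X + 2 * Y - 4 * X * Y" using XY assms by auto
  have DD0: "DD > 0" unfolding DD_def using s0 assms by (intro add_nonneg_pos add_nonneg_nonneg mult_nonneg_nonneg) auto
  have EE0: "EE > 0" unfolding EE_def using s0 assms by (intro add_nonneg_pos add_nonneg_nonneg mult_nonneg_nonneg) auto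
  have EEle: "EE \<le> 4 * X\<^sup>2 + Y\<^sup>2 + \<tau> * (4 * X + 2 * Y) + \<tau>\<^sup>2"
  proof -
    have "(X + \<tau>) * (2 * X + 2 * Y - 4 * X * Y) \<le> (X + \<tau>) * (2 * X + 2 * Y)"
      using XY X0 by (intro mult_left_mono) auto
    then show ?thesis unfolding EE_def by (simp add: power2_eq_square algebra_simps)
  qed
  have sq: "Y\<^sup>2 \<le> X\<^sup>2" "0 \<le> Y\<^sup>2" "Y * \<tau> \<le> X * \<tau>" "0 \<le> X * \<tau>" "0 \<le> \<tau>\<^sup>2" "0 \<le> X\<^sup>2"  "0 \<le> Y * \<tau>"
    using assms by (auto simp: power_mono)
  have term2: "r * (X / (X + \<tau>)) \<le> 2 * X * d * (2 * X - Y + \<tau>) / EE"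
    if r: "r * (4 * X\<^sup>2 + Y\<^sup>2 + \<tau> * (4 * X + 2 * Y) + \<tau>\<^sup>2) \<le> 2 * (95 / 100) * ((2 * X - Y + \<tau>) * (X + \<tau>))" "r \<ge> 0" for r
  proof -
    have p: "0 \<le> (2 * X - Y + \<tau>) * (X + \<tau>)" using assms by (intro mult_nonneg_nonneg) auto
    have "r * EE \<le> r * (4 * X\<^sup>2 + Y\<^sup>2 + \<tau> * (4 * X + 2 * Y) + \<tau>\<^sup>2)" using EEle that by (intro mult_left_mono) auto
    also have "\<dots> \<le> 2 * (95 / 100) * ((2 * X - Y + \<tau>) * (X + \<tau>))" by (rule that(1))
    also have "\<dots> \<le> 2 * d * ((2 * X - Y + \<tau>) * (X + \<tau>))"
      using p assms by (intro mult_right_mono) auto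
    finally have "X * (r * EE) \<le> X * (2 * d * ((2 * X - Y + \<tau>) * (X + \<tau>)))" using X0 by (intro mult_left_mono) auto
    then show ?thesis using EE0 X0 by (simp add: divide_simps) (simp add: algebra_simps)
  qed
  show ?thesis
  proof (cases "X \<le> 2 * Y + \<tau>")
    case True
    have "3 / 10 * (4 * X\<^sup>2 + Y\<^sup>2 + \<tau> * (4 * X + 2 * Y) + \<tau>\<^sup>2) \<le> 2 * (95 / 100) * ((X + \<tau>) * (X + \<tau>))"
    proof -
      have "2 * (95 / 100) * ((X + \<tau>) * (X + \<tau>)) - 3 / 10 * (4 * X\<^sup>2 + Y\<^sup>2 + \<tau> * (4 * X + 2 * Y) + \<tau>\<^sup>2)
        = 7 / 10 * X\<^sup>2 - 3 / 10 * Y\<^sup>2 + 26 / 10 * (X * \<tau>) - 6 / 10 * (Y * \<tau>) + 16 / 10 * \<tau>\<^sup>2"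
        by (simp add: power2_eq_square field_simps)
      then show ?thesis using sq by linarith
    qed
    also have "\<dots> \<le> 2 * (95 / 100) * ((2 * X - Y + \<tau>) * (X + \<tau>))"
      using assms by (intro mult_left_mono mult_right_mono) auto
    finally have "3 / 10 * (X / (X + \<tau>)) \<le> 2 * X * d * (2 * X - Y + \<tau>) / EE"
      by (intro term2) auto
    moreover have "0 \<le> 2 * Y * c * (2 * Y - X + \<tau>) / DD"
      using True DD0 assms by (intro divide_nonneg_nonneg mult_nonneg_nonneg) auto
    ultimately show ?thesis by linarith
  next
    case False
    then have Y: "2 * Y \<le> X" using assms by auto
    then have Y2: "4 * Y\<^sup>2 \<le> X\<^sup>2" using assms power_mono[of "2 * Y" X 2] by (simp add: power_mult_distrib)
    have "6 / 10 * (4 * X\<^sup>2 + Y\<^sup>2 + \<tau> * (4 * X + 2 * Y) + \<tau>\<^sup>2) \<le> 2 * (95 / 100) * ((3 / 2 * X + \<tau>) * (X + \<tau>))"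
    proof -
      have "2 * (95 / 100) * ((3 / 2 * X + \<tau>) * (X + \<tau>)) - 6 / 10 * (4 * X\<^sup>2 + Y\<^sup>2 + \<tau> * (4 * X + 2 * Y) + \<tau>\<^sup>2)
        = 45 / 100 * X\<^sup>2 - 6 / 10 * Y\<^sup>2 + 235 / 100 * (X * \<tau>) - 12 / 10 * (Y * \<tau>) + 13 / 10 * \<tau>\<^sup>2"
        by (simp add: power2_eq_square field_simps)
      then show ?thesis using sq Y2 by linarith
    qed
    also have "\<dots> \<le> 2 * (95 / 100) * ((2 * X - Y + \<tau>) * (X + \<tau>))"
      using assms Y by (intro mult_left_mono mult_right_mono) auto
    finally have t2: "6 / 10 * (X / (X + \<tau>)) \<le> 2 * X * d * (2 * X - Y + \<tau>) / EE"
      by (intro term2) auto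
    have DDge: "(X + \<tau>)\<^sup>2 \<le> DD"
    proof -
      have "(Y + \<tau>) * (2 * X + 2 * Y - 4 / 10 * Y) \<le> (Y + \<tau>) * (2 * X + 2 * Y - 4 * X * Y)"
        using XY assms by (intro mult_left_mono) auto
      moreover have "(X - Y)\<^sup>2 + (Y + \<tau>) * (2 * X + 2 * Y - 4 / 10 * Y) + (Y + \<tau>)\<^sup>2 - (X + \<tau>)\<^sup>2
        = 36 / 10 * Y\<^sup>2 + 36 / 10 * (Y * \<tau>)"
        by (simp add: power2_eq_square field_simps)
      ultimately show ?thesis unfolding DD_def using sq by linarith
    qed
    \<comment> \<open>The product of 2Y and X - 2Y, whose sum is X, is at most a quarter of the
      square of X.\<close>
    have "2 * Y * c * (X - 2 * Y - \<tau>) \<le> 2 * Y * 1 * (X - 2 * Y)"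
      using assms False by (intro mult_mono) auto
    also have "\<dots> \<le> X\<^sup>2 / 4"
      using zero_le_power2[of "X - 4 * Y"] by (simp add: power2_eq_square algebra_simps)
    finally have n: "2 * Y * c * (X - 2 * Y - \<tau>) \<le> X\<^sup>2 / 4" .
    have "2 * Y * c * (X - 2 * Y - \<tau>) / DD \<le> (X\<^sup>2 / 4) / (X + \<tau>)\<^sup>2"
      using n DDge X0 by (intro frac_le) auto
    also have "\<dots> = 1 / 4 * (X / (X + \<tau>)) * (X / (X + \<tau>))" by (simp add: power2_eq_square)
    also have "\<dots> \<le> 1 / 4 * (X / (X + \<tau>)) * 1"
      using X0 assms by (intro mult_left_mono) auto
    finally have "2 * Y * c * (X - 2 * Y - \<tau>) / DD \<le> 1 / 4 * (X / (X + \<tau>))" by simp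
    moreover have "2 * Y * c * (2 * Y - X + \<tau>) / DD = - (2 * Y * c * (X - 2 * Y - \<tau>) / DD)"
    proof -
      have "2 * Y * c * (2 * Y - X + \<tau>) = - (2 * Y * c * (X - 2 * Y - \<tau>))" by (simp add: algebra_simps)
      then show ?thesis by (simp only: minus_divide_left)
    qed
    moreover have "0 \<le> X / (X + \<tau>)" using X0 by auto
    moreover have "3 / 10 * x \<le> b + e" if "a \<le> 1 / 4 * x" "b = - a" "0 \<le> x" "6 / 10 * x \<le> e" for a b e x :: real
      using that by linarith
    ultimately show ?thesis using t2 by blast
  qed
qed

lemma abs_sin_mult_le: "\<bar>sin (real k * t)\<bar> \<le> real k * \<bar>sin t\<bar>"
proof (induction k)
  case (Suc k)
  have "\<bar>sin (real (Suc k) * t)\<bar> = \<bar>sin (real k * t) * cos t + cos (real k * t) * sin t\<bar>"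
    by (simp add: algebra_simps sin_add)
  also have "\<dots> \<le> \<bar>sin (real k * t)\<bar> * 1 + 1 * \<bar>sin t\<bar>"
    by (intro order_trans[OF abs_triangle_ineq] add_mono) (auto simp: abs_mult intro!: mult_left_le mult_left_le_one_le)
  finally show ?case using Suc by (simp add: algebra_simps)
qed simp

lemma one_minus_cos_mult_le: "1 - cos (real k * t) \<le> (real k)\<^sup>2 * (1 - cos t)"
proof -
  have *: "1 - cos x = 2 * (sin (x / 2))\<^sup>2" for x :: real
    using cos_double_sin[of "x / 2"] by simp
  have "(sin (real k * (t / 2)))\<^sup>2 \<le> (real k * \<bar>sin (t / 2)\<bar>)\<^sup>2"
    using power_mono[OF abs_sin_mult_le[of k "t / 2"], of 2] by simp
  then show ?thesis unfolding * by (simp add: power_mult_distrib)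
qed

text \<open>With X the squared sine of u: if both cosines are at least 95/100, the gain along the
  shears is at least 3/10 of X / (X + \<tau>), and for \<tau> the inverse square of m the left side
  is at most 3 times that quotient; hence the factor 10. Otherwise 2 - cos u - cos v \<ge> 5/100,
  and 440 * 5/100 = 22 covers the left side, at most 2, together with a loss of at most 20.\<close>

lemma lyapunov_inequality:
  assumes m: "m \<ge> (1::nat)" and \<tau>: "\<tau> = 1 / (real m)\<^sup>2"
  shows "1 - cos (real m * u) \<le> 10 * (lyapunov \<tau> (u + v, v) - lyapunov \<tau> (u - v, v) + lyapunov \<tau> (u, v + u) - lyapunov \<tau> (u, v - u))
    + 440 * (2 - cos u - cos v)"
proof -
  have \<tau>0: "\<tau> > 0" using m \<tau> by simp
  let ?G = "lyapunov \<tau> (u + v, v) - lyapunov \<tau> (u - v, v) + lyapunov \<tau> (u, v + u) - lyapunov \<tau> (u, v - u)"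
  define G where "G = ?G"
  show ?thesis
  proof (cases "cos u \<ge> 95 / 100 \<and> cos v \<ge> 95 / 100")
    case False
    have "?G \<ge> -2"
      using lyapunov_bound[OF \<tau>0, of "(u + v, v)"] lyapunov_bound[OF \<tau>0, of "(u - v, v)"]
        lyapunov_bound[OF \<tau>0, of "(u, v + u)"] lyapunov_bound[OF \<tau>0, of "(u, v - u)"] by linarith
    moreover have "2 - cos u - cos v \<ge> 5 / 100" using False cos_le_one[of u] cos_le_one[of v] by linarith
    moreover have "1 - cos (real m * u) \<le> 2" using cos_ge_minus_one[of "real m * u"] by linarith
    ultimately have "10 * G \<ge> -20" "440 * (2 - cos u - cos v) \<ge> 22" "1 - cos (real m * u) \<le> 2"
      unfolding G_def[symmetric] by simp_all
    then show ?thesis unfolding G_def[symmetric] by linarith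
  next
    case True
    define x y p q c d where "x = sin u" "y = sin v" "p = sin (u + v)" "q = sin (u - v)" "c = cos u" "d = cos v"
    note defs = this
    define X Y where "X = x\<^sup>2" "Y = y\<^sup>2"
    note XY_def = this
    have X1: "X = 1 - c\<^sup>2" "Y = 1 - d\<^sup>2" using sin_squared_eq by (simp_all add: XY_def defs)
    have c: "95 / 100 \<le> c" "c \<le> 1" "95 / 100 \<le> d" "d \<le> 1" using True by (auto simp: defs)
    then have "(95 / 100)\<^sup>2 \<le> c\<^sup>2" "(95 / 100)\<^sup>2 \<le> d\<^sup>2" by (intro power_mono; simp)+
    then have X10: "0 \<le> X" "X \<le> 1 / 10" "0 \<le> Y" "Y \<le> 1 / 10"
      unfolding X1(1) X1(2) using c by (auto simp: power2_eq_square power_le_one mult_le_one)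
    have pq: "p - q = 2 * y * c" "p + q = 2 * x * d" "p * q = X - Y"
    proof -
      have pe: "p = x * d + c * y" "q = x * d - c * y" by (simp_all add: defs sin_add sin_diff)
      have "(x * d + c * y) * (x * d - c * y) = X * d\<^sup>2 - c\<^sup>2 * Y"
        by (simp add: XY_def power2_eq_square algebra_simps)
      then have "p * q = X * d\<^sup>2 - c\<^sup>2 * Y" by (simp only: pe)
      then have "p * q = X * (1 - Y) - (1 - X) * Y" using X1 by (simp add: algebra_simps)
      then show "p * q = X - Y" by (simp add: algebra_simps)
      show "p - q = 2 * y * c" "p + q = 2 * x * d" unfolding pe by simp_all
    qed
    have pq2: "p\<^sup>2 + q\<^sup>2 = 2 * X + 2 * Y - 4 * X * Y"
    proof -
      have "p\<^sup>2 + q\<^sup>2 = ((p - q)\<^sup>2 + (p + q)\<^sup>2) / 2" by (simp add: power2_eq_square algebra_simps)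
      also have "\<dots> = 2 * Y * c\<^sup>2 + 2 * X * d\<^sup>2" unfolding pq by (simp add: XY_def power2_eq_square)
      also have "\<dots> = 2 * Y * (1 - X) + 2 * X * (1 - Y)" using X1 by simp
      finally show ?thesis by (simp add: algebra_simps)
    qed
    have pos: "p\<^sup>2 + Y + \<tau> > 0" "q\<^sup>2 + Y + \<tau> > 0" "X + p\<^sup>2 + \<tau> > 0" "X + q\<^sup>2 + \<tau> > 0"
      using \<tau>0 X10 by (simp_all add: add_nonneg_pos)
    have sinm: "sin (v - u) = - q" using sin_minus[of "u - v"] by (simp add: defs)
    have "?G = (p * y / (p\<^sup>2 + Y + \<tau>) - q * y / (q\<^sup>2 + Y + \<tau>)) + (x * p / (X + p\<^sup>2 + \<tau>) + x * q / (X + q\<^sup>2 + \<tau>))"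
      by (simp add: lyapunov_def sinm) (simp add: defs XY_def add.commute)
    also have "p * y / (p\<^sup>2 + Y + \<tau>) - q * y / (q\<^sup>2 + Y + \<tau>)
      = y * (p - q) * (Y + \<tau> - p * q) / ((p\<^sup>2 + Y + \<tau>) * (q\<^sup>2 + Y + \<tau>))"
      using pos by (simp add: diff_frac_eq) (simp add: power2_eq_square algebra_simps)
    also have "x * p / (X + p\<^sup>2 + \<tau>) + x * q / (X + q\<^sup>2 + \<tau>)
      = x * (p + q) * (X + \<tau> + p * q) / ((X + p\<^sup>2 + \<tau>) * (X + q\<^sup>2 + \<tau>))"
      using pos by (simp add: add_frac_eq) (simp add: power2_eq_square algebra_simps)
    also have "(p\<^sup>2 + Y + \<tau>) * (q\<^sup>2 + Y + \<tau>) = (p * q)\<^sup>2 + (Y + \<tau>) * (p\<^sup>2 + q\<^sup>2) + (Y + \<tau>)\<^sup>2"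
      by (simp add: power2_eq_square algebra_simps)
    also have "(X + p\<^sup>2 + \<tau>) * (X + q\<^sup>2 + \<tau>) = (p * q)\<^sup>2 + (X + \<tau>) * (p\<^sup>2 + q\<^sup>2) + (X + \<tau>)\<^sup>2"
      by (simp add: power2_eq_square algebra_simps)
    finally have G: "?G = 2 * Y * c * (2 * Y - X + \<tau>) / ((X - Y)\<^sup>2 + (Y + \<tau>) * (2 * X + 2 * Y - 4 * X * Y) + (Y + \<tau>)\<^sup>2)
       + 2 * X * d * (2 * X - Y + \<tau>) / ((X - Y)\<^sup>2 + (X + \<tau>) * (2 * X + 2 * Y - 4 * X * Y) + (X + \<tau>)\<^sup>2)"
      unfolding pq pq2 by (simp add: XY_def power2_eq_square algebra_simps)
    have "3 / 10 * (X / (X + \<tau>)) \<le> ?G"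
    proof (cases "Y \<le> X")
      case True
      then show ?thesis unfolding G using X10 \<tau>0 c by (intro lyapunov_algebra_le) auto
    next
      case False
      \<comment> \<open>X / (X + \<tau>) increases with X, and exchanging the two angles leads back
        to the case already treated.\<close>
      have "3 / 10 * (X / (X + \<tau>)) \<le> 3 / 10 * (Y / (Y + \<tau>))"
        using False X10 \<tau>0 by (simp add: divide_simps) (simp add: algebra_simps)
      also have "\<dots> \<le> ?G"
        using lyapunov_algebra_le[of X Y \<tau> d c] False X10 \<tau>0 c unfolding G
        by (simp add: power2_commute[of X Y] algebra_simps)
      finally show ?thesis .
    qed
    moreover have "1 - cos (real m * u) \<le> 3 * (X / (X + \<tau>))"
    proof -
      let ?t = "(real m)\<^sup>2 * X"
      have "1 - cos u \<le> X"
        using c unfolding X1 power2_eq_square by (simp add: defs algebra_simps mult_left_le)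
      then have "(real m)\<^sup>2 * (1 - cos u) \<le> ?t" by (intro mult_left_mono) auto
      then have 1: "1 - cos (real m * u) \<le> ?t" using one_minus_cos_mult_le[of m u] by linarith
      have 2: "1 - cos (real m * u) \<le> 2" using cos_ge_minus_one[of "real m * u"] by linarith
      have t0: "?t \<ge> 0" using X10 by simp
      \<comment> \<open>Both bounds 1 and 2 are used: the smaller of t and 2 is at most 3t / (t + 1)
        for every t \<ge> 0.\<close>
      have "1 - cos (real m * u) \<le> 3 * (?t / (?t + 1))"
      proof (cases "?t \<le> 2")
        case True
        have "?t * (?t + 1) \<le> ?t * 3" using True t0 by (intro mult_left_mono) auto
        then have "?t \<le> 3 * (?t / (?t + 1))" using t0 by (simp add: pos_le_divide_eq)
        then show ?thesis using 1 by linarith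
      next
        case False
        have "2 \<le> 3 * (t / (t + 1))" if "t \<ge> 2" for t :: real
          using that by (simp add: field_simps)
        then have "2 \<le> 3 * (?t / (?t + 1))" using False by auto
        then show ?thesis using 2 by linarith
      qed
      also have "?t / (?t + 1) = X / (X + \<tau>)"
        using m by (simp add: \<tau> field_simps)
      finally show ?thesis .
    qed
    moreover have "0 \<le> 2 - cos u - cos v" using cos_le_one[of u] cos_le_one[of v] by linarith
    moreover have "s \<le> 10 * g + 440 * e" if "3 / 10 * x \<le> g" "s \<le> 3 * x" "0 \<le> e" for s g e x :: real
      using that by linarith
    ultimately show ?thesis unfolding G_def[symmetric] by blast
  qed
qed

section \<open>Uniform approximation of the Lyapunov function by trigonometric polynomials\<close>

definition trig_poly :: "(real \<times> real \<Rightarrow> real) \<Rightarrow> bool" where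
  "trig_poly f \<longleftrightarrow> (\<exists>xs. \<forall>\<theta>. trig_eval xs \<theta> = f \<theta>)"

lemma trig_poly_const: "trig_poly (\<lambda>_. c)"
  unfolding trig_poly_def by (rule exI[of _ "[(c, 0)]"]) simp

lemma trig_poly_cos: "trig_poly (\<lambda>\<theta>. cos (phase z \<theta>))"
  unfolding trig_poly_def by (rule exI[of _ "[(1, z)]"]) simp

lemma trig_poly_add: "trig_poly f \<Longrightarrow> trig_poly g \<Longrightarrow> trig_poly (\<lambda>\<theta>. f \<theta> + g \<theta>)"
  unfolding trig_poly_def by (metis trig_simps(3))

lemma trig_poly_mult: "trig_poly f \<Longrightarrow> trig_poly g \<Longrightarrow> trig_poly (\<lambda>\<theta>. f \<theta> * g \<theta>)"
  unfolding trig_poly_def by (metis trig_eval_mult)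

lemma trig_poly_cmult: "trig_poly f \<Longrightarrow> trig_poly (\<lambda>\<theta>. c * f \<theta>)"
  by (rule trig_poly_mult[OF trig_poly_const])

lemma trig_poly_power: "trig_poly f \<Longrightarrow> trig_poly (\<lambda>\<theta>. f \<theta> ^ k)"
  by (induction k) (auto intro: trig_poly_mult trig_poly_const)

lemma trig_poly_sum: "(\<And>k. k < K \<Longrightarrow> trig_poly (f k)) \<Longrightarrow> trig_poly (\<lambda>\<theta>. \<Sum>k<K::nat. f k \<theta>)"
  by (induction K) (auto intro: trig_poly_add trig_poly_const)

text \<open>The denominator t + \<tau> equals c (1 - r) with c = 2 + \<tau>. Since t ranges over
  [0, 2], r ranges over [0, 2/c] with 2/c < 1, and the geometric series for the reciprocal converges
  uniformly.\<close>

lemma lyapunov_approx: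
  assumes \<tau>: "\<tau> > 0" and \<kappa>: "\<kappa> > 0"
  shows "\<exists>xs. \<forall>\<theta>. \<bar>trig_eval xs \<theta> - lyapunov \<tau> \<theta>\<bar> \<le> \<kappa>"
proof -
  define t where "t \<theta> = (sin (fst \<theta>))\<^sup>2 + (sin (snd \<theta>))\<^sup>2" for \<theta> :: "real \<times> real"
  define N where "N \<theta> = sin (fst \<theta>) * sin (snd \<theta>)" for \<theta> :: "real \<times> real"
  define c where "c = 2 + \<tau>"
  have c: "c > 2" using \<tau> by (simp add: c_def)
  have tN: "t = (\<lambda>\<theta>. 1 + ((-1/2) * cos (phase (2, 0) \<theta>) + (-1/2) * cos (phase (0, 2) \<theta>)))"
    "N = (\<lambda>\<theta>. (1/2) * cos (phase (1, -1) \<theta>) + (-1/2) * cos (phase (1, 1) \<theta>))"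
    by (simp_all add: t_def N_def fun_eq_iff phase_def cos_diff cos_add cos_double_sin diff_divide_distrib add_divide_distrib)
      
  have "trig_poly t" "trig_poly N"
    unfolding tN by (intro trig_poly_add trig_poly_cmult trig_poly_cos trig_poly_const)+
  define r where "r \<theta> = (2 - t \<theta>) / c" for \<theta>
  have "r = (\<lambda>\<theta>. 2 / c + (-1/c) * t \<theta>)" by (simp add: r_def fun_eq_iff diff_divide_distrib)
  moreover have "trig_poly (\<lambda>\<theta>. 2 / c + (-1/c) * t \<theta>)"
    by (intro trig_poly_add trig_poly_cmult trig_poly_const \<open>trig_poly t\<close>)
  ultimately have r: "trig_poly r" by metis
  have t02: "0 \<le> t \<theta>" "t \<theta> \<le> 2" for \<theta>
    using abs_sin_le_one[of "fst \<theta>"] abs_sin_le_one[of "snd \<theta>"] unfolding abs_square_le_1[symmetric] t_def by auto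
  have r01: "0 \<le> r \<theta>" "r \<theta> \<le> 2 / c" for \<theta> using t02[of \<theta>] c by (auto simp: r_def divide_right_mono)
  have "2 / c < 1" "0 \<le> 2 / c" using c by auto
  then have "(\<lambda>K. (2 / c) ^ K) \<longlonglongrightarrow> 0" by (intro LIMSEQ_power_zero) auto
  then have "eventually (\<lambda>K. (2 / c) ^ K < \<kappa> * \<tau>) sequentially"
    using \<kappa> \<tau> by (intro order_tendstoD) auto
  then obtain K where K: "(2 / c) ^ K < \<kappa> * \<tau>" by (auto simp: eventually_sequentially)
  have "trig_poly (\<lambda>\<theta>. N \<theta> * ((1 / c) * (\<Sum>k<K. r \<theta> ^ k)))"
    by (intro trig_poly_mult[OF \<open>trig_poly N\<close>] trig_poly_cmult trig_poly_sum trig_poly_power r)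
  then obtain xs where xs: "\<And>\<theta>. trig_eval xs \<theta> = N \<theta> * ((1 / c) * (\<Sum>k<K. r \<theta> ^ k))"
    unfolding trig_poly_def by blast
  have "\<bar>trig_eval xs \<theta> - lyapunov \<tau> \<theta>\<bar> \<le> \<kappa>" for \<theta>
  proof -
    have r1: "r \<theta> \<noteq> 1" using r01[of \<theta>] \<open>2 / c < 1\<close> by auto
    have e: "c * (1 - r \<theta>) = t \<theta> + \<tau>" using c by (simp add: r_def c_def field_simps)
    have tp: "t \<theta> + \<tau> > 0" using t02[of \<theta>] \<tau> by auto
    have "(1 / c) * (\<Sum>k<K. r \<theta> ^ k) = (1 - r \<theta> ^ K) / (c * (1 - r \<theta>))"
      using r1 by (simp add: sum_gp_strict)
    then have "trig_eval xs \<theta> - lyapunov \<tau> \<theta> = - N \<theta> * r \<theta> ^ K / (t \<theta> + \<tau>)"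
      unfolding xs e lyapunov_def t_def[symmetric] N_def[symmetric] by (simp add: diff_divide_distrib right_diff_distrib)
    then have "\<bar>trig_eval xs \<theta> - lyapunov \<tau> \<theta>\<bar> = \<bar>N \<theta>\<bar> * r \<theta> ^ K / (t \<theta> + \<tau>)"
      using tp r01[of \<theta>] by (simp add: abs_mult abs_divide)
    also have "\<dots> \<le> 1 * (2 / c) ^ K / \<tau>"
      using r01[of \<theta>] t02[of \<theta>] \<tau> c
      by (intro frac_le mult_mono power_mono) (auto simp: N_def abs_mult mult_le_one)
    also have "\<dots> \<le> \<kappa>" using K \<tau> by (simp add: divide_le_eq)
    finally show ?thesis .
  qed
  then show ?thesis by blast
qed

subsection \<open>Foelner averages of matrix coefficients\<close>

definition boundary :: "(int \<times> int) set \<Rightarrow> int \<times> int \<Rightarrow> nat" where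
  "boundary B z = card {w\<in>B. w + z \<notin> B}"

text \<open>Coefficients are ignored on purpose: this bounds the proportion of points of
  \<open>B\<close> that some frequency of the list, with either sign, moves out of \<open>B\<close>;
  see \<open>card_not_interior\<close>.\<close>

definition boundary_ratio :: "(int \<times> int) set \<Rightarrow> trig_list \<Rightarrow> real" where
  "boundary_ratio B xs = (\<Sum>(c, z)\<leftarrow>xs. real (boundary B z + boundary B (- z))) / card B"

definition folner :: "(nat \<Rightarrow> (int \<times> int) set) \<Rightarrow> bool" where
  "folner B \<longleftrightarrow> (\<forall>n. finite (B n) \<and> B n \<noteq> {}) \<and> (\<forall>z. (\<lambda>n. real (boundary (B n) z) / card (B n)) \<longlonglongrightarrow> 0)"

lemma folner_boundary_ratio:
  assumes "folner B"
  shows "(\<lambda>n. boundary_ratio (B n) xs) \<longlonglongrightarrow> 0"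
proof (induction xs)
  case (Cons p xs)
  obtain c z where p: "p = (c, z)" by (cases p)
  have "(\<lambda>n. (real (boundary (B n) z) / card (B n) + real (boundary (B n) (- z)) / card (B n)) + boundary_ratio (B n) xs) \<longlonglongrightarrow> 0 + 0 + 0"
    using assms Cons unfolding folner_def by (intro tendsto_add) blast+
  then show ?case by (simp add: p boundary_ratio_def add_divide_distrib)
qed (simp add: boundary_ratio_def)

definition interior_pts :: "(int \<times> int) set \<Rightarrow> trig_list \<Rightarrow> (int \<times> int) set" where
  "interior_pts B xs = {w\<in>B. \<forall>z\<in>snd ` set xs. w + z \<in> B \<and> w - z \<in> B}"

lemma card_not_interior:
  assumes "finite B" "B \<noteq> {}"
  shows "real (card (B - interior_pts B xs)) \<le> boundary_ratio B xs * card B"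
proof -
  have "card (B - interior_pts B xs) \<le> (\<Sum>(c, z)\<leftarrow>xs. boundary B z + boundary B (- z))"
  proof (induction xs)
    case (Cons p xs)
    obtain c z where p: "p = (c, z)" by (cases p)
    have "B - interior_pts B (p # xs) \<subseteq> (B - interior_pts B xs) \<union> ({w\<in>B. w + z \<notin> B} \<union> {w\<in>B. w + - z \<notin> B})"
      by (auto simp: interior_pts_def p)
    then have "card (B - interior_pts B (p # xs)) \<le> card ((B - interior_pts B xs) \<union> ({w\<in>B. w + z \<notin> B} \<union> {w\<in>B. w + - z \<notin> B}))"
      using assms by (intro card_mono) auto
    also have "\<dots> \<le> card (B - interior_pts B xs) + (boundary B z + boundary B (- z))"
      unfolding boundary_def by (intro order_trans[OF card_Un_le] add_mono order_refl card_Un_le)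
    finally show ?case using Cons by (simp add: p)
  qed (simp add: interior_pts_def)
  then have "real (card (B - interior_pts B xs)) \<le> real (\<Sum>(c, z)\<leftarrow>xs. boundary B z + boundary B (- z))"
    by linarith
  also have "\<dots> = (\<Sum>(c, z)\<leftarrow>xs. real (boundary B z + boundary B (- z)))"
    by (induction xs) auto
  also have "\<dots> = boundary_ratio B xs * card B"
    using assms by (simp add: boundary_ratio_def)
  finally show ?thesis .
qed

lemma trig_op_interior:
  assumes "w \<in> interior_pts B xs"
  shows "trig_op xs (\<lambda>u. if u \<in> B then g u else 0) w = trig_op xs g w"
proof -
  have "trig_op ys (\<lambda>u. if u \<in> B then g u else 0) w = trig_op ys g w" if "set ys \<subseteq> set xs" for ys
    using that
  proof (induction ys)
    case (Cons p ys)
    then have "w + snd p \<in> B" "w - snd p \<in> B" using assms by (auto simp: interior_pts_def)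
    then show ?case using Cons by (cases p) simp
  qed simp
  then show ?thesis by blast
qed

lemma sum_interior_error:
  fixes f :: "int \<times> int \<Rightarrow> real"
  assumes "finite B" "B \<noteq> {}" "\<And>w. w \<in> interior_pts B xs \<Longrightarrow> f w = h w" "\<And>w. w \<in> B \<Longrightarrow> f w \<le> h w + C" "C \<ge> 0"
  shows "(\<Sum>w\<in>B. f w) \<le> (\<Sum>w\<in>B. h w) + C * (boundary_ratio B xs * card B)"
proof -
  have "(\<Sum>w\<in>B. f w - h w) = (\<Sum>w\<in>B - interior_pts B xs. f w - h w)"
    using assms by (intro sum.mono_neutral_right) (auto simp: interior_pts_def)
  also have "\<dots> \<le> (\<Sum>w\<in>B - interior_pts B xs. C)"
    using assms(4) by (intro sum_mono) (simp add: algebra_simps)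
  also have "\<dots> = C * card (B - interior_pts B xs)" by simp
  also have "\<dots> \<le> C * (boundary_ratio B xs * card B)"
    using card_not_interior[OF assms(1,2)] assms(5) by (intro mult_left_mono)
  finally show ?thesis by (simp add: sum_subtractf)
qed

text \<open>Cutting g off outside \<open>B\<close> gives finite support, where the operator bound
  applies; only points outside \<open>interior_pts\<close> notice the cut.\<close>

lemma trig_op_folner_norm:
  fixes g :: "int \<times> int \<Rightarrow> 'v::real_inner"
  assumes B: "finite B" "B \<noteq> {}" and g: "\<And>u. norm (g u) \<le> C" and bound: "\<And>\<theta>. \<bar>trig_eval xs \<theta>\<bar> \<le> 1"
  shows "(\<Sum>w\<in>B. (norm (trig_op xs g w))\<^sup>2)
    \<le> (\<Sum>w\<in>B. (norm (g w))\<^sup>2) + (trig_norm xs * C)\<^sup>2 * (boundary_ratio B xs * card B)"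
proof -
  let ?g = "\<lambda>u. if u \<in> B then g u else 0"
  have C: "C \<ge> 0" using g[of 0] norm_ge_zero[of "g 0"] by linarith
  have "(\<Sum>w\<in>B. (norm (trig_op xs g w))\<^sup>2)
    \<le> (\<Sum>w\<in>B. (norm (trig_op xs ?g w))\<^sup>2) + (trig_norm xs * C)\<^sup>2 * (boundary_ratio B xs * card B)"
  proof (rule sum_interior_error[OF B])
    fix w
    have "(norm (trig_op xs g w))\<^sup>2 \<le> (trig_norm xs * C)\<^sup>2"
      using norm_trig_op_le[of g, OF g] by (intro power_mono) auto
    then show "(norm (trig_op xs g w))\<^sup>2 \<le> (norm (trig_op xs ?g w))\<^sup>2 + (trig_norm xs * C)\<^sup>2"
      using zero_le_power2[of "norm (trig_op xs ?g w)"] by linarith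
  qed (auto simp: trig_op_interior)
  also have "(\<Sum>w\<in>B. (norm (trig_op xs ?g w))\<^sup>2) \<le> 1\<^sup>2 * (\<Sum>w\<in>B. (norm (?g w))\<^sup>2)"
    using B bound by (intro trig_op_norm_bound) auto
  finally show ?thesis by simp
qed

lemma trig_op_folner_nonneg:
  fixes g :: "int \<times> int \<Rightarrow> 'v::real_inner"
  assumes B: "finite B" "B \<noteq> {}" and g: "\<And>u. norm (g u) \<le> 1" and pos: "\<And>\<theta>. trig_eval xs \<theta> \<ge> 0"
  shows "(\<Sum>w\<in>B. trig_op xs g w \<bullet> g w) \<ge> - (2 * trig_norm xs * (boundary_ratio B xs * card B))"
proof -
  let ?g = "\<lambda>u. if u \<in> B then g u else 0"
  have n0: "trig_norm xs \<ge> 0" by (rule trig_norm_nonneg)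
  have "0 \<le> (\<Sum>w\<in>B. ?g w \<bullet> trig_op xs ?g w)"
    using B pos by (intro trig_op_nonneg) auto
  also have "\<dots> = (\<Sum>w\<in>B. trig_op xs ?g w \<bullet> g w)" by (intro sum.cong) (auto simp: inner_commute)
  also have "\<dots> \<le> (\<Sum>w\<in>B. trig_op xs g w \<bullet> g w) + 2 * trig_norm xs * (boundary_ratio B xs * card B)"
  proof (rule sum_interior_error[OF B])
    fix w
    have *: "\<bar>trig_op xs f w \<bullet> g w\<bar> \<le> trig_norm xs * 1 * 1" if "\<And>u. norm (f u) \<le> 1" for f :: "int \<times> int \<Rightarrow> 'v"
      using norm_trig_op_le[of f, OF that] g[of w] n0
      by (intro order_trans[OF Cauchy_Schwarz_ineq2] mult_mono) auto
    have "norm (?g u) \<le> 1" for u using g[of u] by simp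
    then show "trig_op xs ?g w \<bullet> g w \<le> trig_op xs g w \<bullet> g w + 2 * trig_norm xs"
      using *[of ?g] *[of g] g by (auto simp: abs_le_iff)
  qed (auto simp: trig_op_interior n0)
  finally show ?thesis by simp
qed

context prob_space
begin

definition field :: "(int \<times> int \<Rightarrow> 'a \<Rightarrow> 'v::euclidean_space) \<Rightarrow> bool" where
  "field \<xi> \<longleftrightarrow> (\<forall>u. \<xi> u \<in> borel_measurable M) \<and> (\<forall>u a. norm (\<xi> u a) \<le> 1)"

text \<open>For an orthogonal representation of \<open>\<int>\<^sup>2\<close> and an orbit \<open>\<xi>\<close> this would be the integral of \<open>trig_eval xs\<close>
  against the spectral measure; the mean over \<open>B\<close> makes it almost positive when \<open>\<xi>\<close> is only nearly an orbit.\<close>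

definition Lam :: "(int \<times> int) set \<Rightarrow> trig_list \<Rightarrow> (int \<times> int \<Rightarrow> 'a \<Rightarrow> 'v::euclidean_space) \<Rightarrow> real" where
  "Lam B xs \<xi> = (\<Sum>w\<in>B. \<integral>a. trig_op xs (\<lambda>u. \<xi> u a) w \<bullet> \<xi> w a \<partial>M) / card B"

lemma
  assumes "field \<xi>"
  shows field_measurable: "\<xi> u \<in> borel_measurable M" and field_norm: "norm (\<xi> u a) \<le> 1"
  using assms unfolding field_def by blast+

lemma trig_op_measurable [measurable (raw)]:
  fixes \<xi> :: "int \<times> int \<Rightarrow> 'a \<Rightarrow> 'v::euclidean_space"
  assumes "\<And>u. \<xi> u \<in> borel_measurable M"
  shows "(\<lambda>a. trig_op xs (\<lambda>u. \<xi> u a) w) \<in> borel_measurable M"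
proof (induction xs)
  case (Cons p xs)
  note [measurable] = Cons assms
  show ?case by (cases p) simp
qed simp

lemma integrable_bounded:
  fixes f :: "'a \<Rightarrow> real"
  assumes "f \<in> borel_measurable M" "\<And>a. \<bar>f a\<bar> \<le> C"
  shows "integrable M f"
  using assms by (intro integrable_const_bound[of _ C]) auto

lemma integral_bounded:
  fixes f :: "'a \<Rightarrow> real"
  assumes "f \<in> borel_measurable M" "\<And>a. \<bar>f a\<bar> \<le> C"
  shows "\<bar>\<integral>a. f a \<partial>M\<bar> \<le> C"
proof -
  have "\<bar>\<integral>a. f a \<partial>M\<bar> \<le> (\<integral>a. \<bar>f a\<bar> \<partial>M)" by (rule integral_abs_bound)
  also have "\<dots> \<le> (\<integral>a. C \<partial>M)"
    using integrable_bounded[OF assms] assms by (intro integral_mono) auto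
  finally show ?thesis by (simp add: prob_space)
qed

lemma field_inner_bound:
  assumes "field \<xi>" "field \<eta>"
  shows "\<bar>trig_op xs (\<lambda>u. \<xi> u a) w \<bullet> \<eta> v a\<bar> \<le> trig_norm xs"
proof -
  have "norm (trig_op xs (\<lambda>u. \<xi> u a) w) \<le> trig_norm xs * 1"
    using assms(1) by (intro norm_trig_op_le field_norm)
  then have "\<bar>trig_op xs (\<lambda>u. \<xi> u a) w \<bullet> \<eta> v a\<bar> \<le> trig_norm xs * 1 * 1"
    using trig_norm_nonneg[of xs] by (intro order_trans[OF Cauchy_Schwarz_ineq2] mult_mono field_norm assms) auto
  then show ?thesis by simp
qed

lemma integrable_field:
  assumes "field \<xi>" "field \<eta>"
  shows "integrable M (\<lambda>a. trig_op xs (\<lambda>u. \<xi> u a) w \<bullet> \<eta> v a)"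
proof (rule integrable_bounded[where C = "trig_norm xs"])
  have [measurable]: "\<xi> u \<in> borel_measurable M" "\<eta> u \<in> borel_measurable M" for u using assms by (simp_all add: field_measurable)
  show "(\<lambda>a. trig_op xs (\<lambda>u. \<xi> u a) w \<bullet> \<eta> v a) \<in> borel_measurable M" by measurable
qed (use field_inner_bound[OF assms] in auto)

lemma Lam_append: "field \<xi> \<Longrightarrow> Lam B (xs @ ys) \<xi> = Lam B xs \<xi> + Lam B ys \<xi>"
  unfolding Lam_def
  by (simp add: inner_add_left integrable_field sum.distrib add_divide_distrib)

lemma Lam_scale: "Lam B (trig_scale k xs) \<xi> = k * Lam B xs \<xi>"
  unfolding Lam_def by (simp add: sum_distrib_left[symmetric])

lemma Lam_nonneg:
  assumes B: "finite B" "B \<noteq> {}" and \<xi>: "field \<xi>" and pos: "\<And>\<theta>. trig_eval xs \<theta> \<ge> 0"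
  shows "Lam B xs \<xi> \<ge> - (2 * trig_norm xs * boundary_ratio B xs)"
proof -
  have "- (2 * trig_norm xs * (boundary_ratio B xs * card B)) \<le> (\<integral>a. (\<Sum>w\<in>B. trig_op xs (\<lambda>u. \<xi> u a) w \<bullet> \<xi> w a) \<partial>M)"
  proof -
    have "(\<integral>a. - (2 * trig_norm xs * (boundary_ratio B xs * card B)) \<partial>M) \<le> (\<integral>a. (\<Sum>w\<in>B. trig_op xs (\<lambda>u. \<xi> u a) w \<bullet> \<xi> w a) \<partial>M)"
      by (intro integral_mono trig_op_folner_nonneg Bochner_Integration.integrable_sum integrable_field \<xi> pos B field_norm) simp
    then show ?thesis by (simp add: prob_space)
  qed
  also have "\<dots> = Lam B xs \<xi> * card B"
    using B \<xi> by (simp add: Lam_def Bochner_Integration.integral_sum integrable_field)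
  finally have "- (2 * trig_norm xs * boundary_ratio B xs) * card B \<le> Lam B xs \<xi> * card B" by (simp add: mult.assoc)
  moreover have "real (card B) > 0" using B by (simp add: card_gt_0_iff)
  ultimately show ?thesis by (rule mult_right_le_imp_le)
qed

text \<open>Each half of the bilinear difference is estimated by Young's inequality with weight e.
  The operator is contractive only after summation over \<open>B\<close>, up to a boundary term that
  vanishes along a Foelner sequence. The lasting loss is therefore 2e however large
  \<open>trig_norm xs\<close> is, which matters because the approximating polynomials have
  uncontrolled coefficients.\<close>

lemma Lam_perturb:
  assumes B: "finite B" "B \<noteq> {}" and \<xi>: "field \<xi>" and \<eta>: "field \<eta>" and bound: "\<And>\<theta>. \<bar>trig_eval xs \<theta>\<bar> \<le> 1"
    and e: "e > 0" and close: "\<And>w. (\<integral>a. (norm (\<xi> w a - \<eta> w a))\<^sup>2 \<partial>M) \<le> e\<^sup>2"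
  shows "\<bar>Lam B xs \<xi> - Lam B xs \<eta>\<bar> \<le> 2 * e + (trig_norm xs)\<^sup>2 * boundary_ratio B xs * (2 / e + e / 2)"
proof -
  let ?n = "real (card B)" and ?b = "(trig_norm xs)\<^sup>2 * boundary_ratio B xs"
  let ?T = "\<lambda>\<xi> w a. trig_op xs (\<lambda>u. \<xi> u a) w"
  define d where "d u a = \<xi> u a - \<eta> u a" for u a
  have n: "?n > 0" using B by (simp add: card_gt_0_iff)
  have m[measurable]: "\<xi> u \<in> borel_measurable M" "\<eta> u \<in> borel_measurable M" for u
    using \<xi> \<eta> by (simp_all add: field_measurable)
  have [measurable]: "d u \<in> borel_measurable M" for u unfolding d_def by measurable
  have nb: "norm (\<xi> u a) \<le> 1" "norm (\<eta> u a) \<le> 1" for u a using \<xi> \<eta> by (simp_all add: field_norm)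
  have db: "norm (d u a) \<le> 2" for u a
    unfolding d_def using norm_triangle_ineq4[of "\<xi> u a" "\<eta> u a"] nb[of u a] by linarith
  have dT: "norm (?T d w a) \<le> trig_norm xs * 2" "norm (?T \<eta> w a) \<le> trig_norm xs * 1" for w a
    by (intro norm_trig_op_le db nb)+
  have sq_int: "integrable M (\<lambda>a. (norm (f a))\<^sup>2)" if "f \<in> borel_measurable M" "\<And>a. norm (f a) \<le> C" for f :: "'a \<Rightarrow> 'b" and C
    using that by (intro integrable_bounded[where C="C\<^sup>2"]) (auto intro!: power_mono)
  have i1: "integrable M (\<lambda>a. (norm (?T d w a))\<^sup>2)" "integrable M (\<lambda>a. (norm (?T \<eta> w a))\<^sup>2)"
    "integrable M (\<lambda>a. (norm (d w a))\<^sup>2)" "integrable M (\<lambda>a. (norm (\<xi> w a))\<^sup>2)" "integrable M (\<lambda>a. (norm (\<eta> w a))\<^sup>2)" for w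
    by (rule sq_int[OF _ dT(1)] sq_int[OF _ dT(2)] sq_int[OF _ db] sq_int[OF _ nb(1)] sq_int[OF _ nb(2)]; measurable)+
  have Td: "(\<Sum>w\<in>B. \<integral>a. (norm (?T d w a))\<^sup>2 \<partial>M) \<le> ?n * (e\<^sup>2 + 4 * ?b)"
  proof -
    have "(\<Sum>w\<in>B. \<integral>a. (norm (?T d w a))\<^sup>2 \<partial>M) = (\<integral>a. (\<Sum>w\<in>B. (norm (?T d w a))\<^sup>2) \<partial>M)"
      by (rule Bochner_Integration.integral_sum[symmetric]) (rule i1)
    also have "\<dots> \<le> (\<integral>a. (\<Sum>w\<in>B. (norm (d w a))\<^sup>2) + (trig_norm xs * 2)\<^sup>2 * (boundary_ratio B xs * card B) \<partial>M)"
      by (intro integral_mono trig_op_folner_norm[OF B db bound] Bochner_Integration.integrable_add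
          Bochner_Integration.integrable_sum i1) auto
    also have "\<dots> = (\<Sum>w\<in>B. \<integral>a. (norm (d w a))\<^sup>2 \<partial>M) + (trig_norm xs * 2)\<^sup>2 * (boundary_ratio B xs * card B)"
      by (subst Bochner_Integration.integral_add) (auto simp: prob_space Bochner_Integration.integral_sum i1)
    also have "\<dots> \<le> (\<Sum>w\<in>B. e\<^sup>2) + (trig_norm xs * 2)\<^sup>2 * (boundary_ratio B xs * card B)"
      using close by (intro add_right_mono sum_mono) (auto simp: d_def)
    finally show ?thesis by (simp add: power_mult_distrib algebra_simps)
  qed
  have Teta: "(\<Sum>w\<in>B. \<integral>a. (norm (?T \<eta> w a))\<^sup>2 \<partial>M) \<le> ?n * (1 + ?b)"
  proof -
    have "(\<Sum>w\<in>B. \<integral>a. (norm (?T \<eta> w a))\<^sup>2 \<partial>M) = (\<integral>a. (\<Sum>w\<in>B. (norm (?T \<eta> w a))\<^sup>2) \<partial>M)"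
      by (rule Bochner_Integration.integral_sum[symmetric]) (rule i1)
    also have "\<dots> \<le> (\<integral>a. (\<Sum>w\<in>B. (norm (\<eta> w a))\<^sup>2) + (trig_norm xs * 1)\<^sup>2 * (boundary_ratio B xs * card B) \<partial>M)"
      by (intro integral_mono trig_op_folner_norm[OF B nb(2) bound] Bochner_Integration.integrable_add
          Bochner_Integration.integrable_sum i1) auto
    also have "\<dots> = (\<Sum>w\<in>B. \<integral>a. (norm (\<eta> w a))\<^sup>2 \<partial>M) + (trig_norm xs * 1)\<^sup>2 * (boundary_ratio B xs * card B)"
      by (subst Bochner_Integration.integral_add) (auto simp: prob_space Bochner_Integration.integral_sum i1)
    also have "\<dots> \<le> (\<Sum>w\<in>B. 1) + (trig_norm xs * 1)\<^sup>2 * (boundary_ratio B xs * card B)"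
    proof (intro add_right_mono sum_mono)
      fix w
      have "(\<integral>a. (norm (\<eta> w a))\<^sup>2 \<partial>M) \<le> (\<integral>a. 1 \<partial>M)"
        using nb by (intro integral_mono i1) (auto simp: power_le_one)
      then show "(\<integral>a. (norm (\<eta> w a))\<^sup>2 \<partial>M) \<le> 1" by (simp add: prob_space)
    qed
    finally show ?thesis by (simp add: algebra_simps)
  qed
  have young: "\<bar>x \<bullet> y\<bar> \<le> (norm x)\<^sup>2 / (2 * t) + t / 2 * (norm y)\<^sup>2" if "t > 0" for x y :: 'b and t
  proof -
    have "0 \<le> (norm x - t * norm y)\<^sup>2" by simp
    then have "2 * t * (norm x * norm y) \<le> (norm x)\<^sup>2 + t\<^sup>2 * (norm y)\<^sup>2"
      by (simp add: power2_eq_square algebra_simps)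
    then have "norm x * norm y \<le> ((norm x)\<^sup>2 + t\<^sup>2 * (norm y)\<^sup>2) / (2 * t)"
      using that by (simp add: pos_le_divide_eq mult.commute)
    also have "\<dots> = (norm x)\<^sup>2 / (2 * t) + t / 2 * (norm y)\<^sup>2"
      using that by (simp add: add_divide_distrib power2_eq_square)
    finally show ?thesis using Cauchy_Schwarz_ineq2[of x y] by linarith
  qed
  have pt: "\<bar>?T \<xi> w a \<bullet> \<xi> w a - ?T \<eta> w a \<bullet> \<eta> w a\<bar>
    \<le> ((norm (?T d w a))\<^sup>2 / (2 * e) + e / 2 * (norm (\<xi> w a))\<^sup>2) + (e / 2 * (norm (?T \<eta> w a))\<^sup>2 + (norm (d w a))\<^sup>2 / (2 * e))" for w a
  proof -
    have "?T \<xi> w a \<bullet> \<xi> w a - ?T \<eta> w a \<bullet> \<eta> w a = ?T d w a \<bullet> \<xi> w a + d w a \<bullet> ?T \<eta> w a"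
      by (simp add: d_def trig_op_diff inner_diff_left inner_diff_right inner_commute)
    then show ?thesis
      using young[OF e, of "?T d w a" "\<xi> w a"] young[OF e, of "d w a" "?T \<eta> w a"] by linarith
  qed
  let ?R = "\<lambda>w a. ((norm (?T d w a))\<^sup>2 / (2 * e) + e / 2 * (norm (\<xi> w a))\<^sup>2) + (e / 2 * (norm (?T \<eta> w a))\<^sup>2 + (norm (d w a))\<^sup>2 / (2 * e))"
  have "\<bar>(\<Sum>w\<in>B. \<integral>a. ?T \<xi> w a \<bullet> \<xi> w a \<partial>M) - (\<Sum>w\<in>B. \<integral>a. ?T \<eta> w a \<bullet> \<eta> w a \<partial>M)\<bar>
    = \<bar>\<Sum>w\<in>B. \<integral>a. (?T \<xi> w a \<bullet> \<xi> w a - ?T \<eta> w a \<bullet> \<eta> w a) \<partial>M\<bar>"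
    by (simp add: sum_subtractf integrable_field \<xi> \<eta>)
  also have "\<dots> \<le> (\<Sum>w\<in>B. \<integral>a. ?R w a \<partial>M)"
  proof (intro order_trans[OF sum_abs] sum_mono)
    fix w
    have "\<bar>\<integral>a. (?T \<xi> w a \<bullet> \<xi> w a - ?T \<eta> w a \<bullet> \<eta> w a) \<partial>M\<bar> \<le> (\<integral>a. \<bar>?T \<xi> w a \<bullet> \<xi> w a - ?T \<eta> w a \<bullet> \<eta> w a\<bar> \<partial>M)"
      by (rule integral_abs_bound)
    also have "\<dots> \<le> (\<integral>a. ?R w a \<partial>M)"
      by (intro integral_mono pt integrable_abs Bochner_Integration.integrable_diff integrable_field \<xi> \<eta>
          Bochner_Integration.integrable_add integrable_mult_right integrable_divide i1)
    finally show "\<bar>\<integral>a. (?T \<xi> w a \<bullet> \<xi> w a - ?T \<eta> w a \<bullet> \<eta> w a) \<partial>M\<bar> \<le> (\<integral>a. ?R w a \<partial>M)" .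
  qed
  also have "\<dots> = (\<Sum>w\<in>B. \<integral>a. (norm (?T d w a))\<^sup>2 \<partial>M) / (2 * e) + e / 2 * (\<Sum>w\<in>B. \<integral>a. (norm (\<xi> w a))\<^sup>2 \<partial>M)
      + (e / 2 * (\<Sum>w\<in>B. \<integral>a. (norm (?T \<eta> w a))\<^sup>2 \<partial>M) + (\<Sum>w\<in>B. \<integral>a. (norm (d w a))\<^sup>2 \<partial>M) / (2 * e))"
    by (simp add: i1 sum.distrib sum_distrib_left sum_divide_distrib)
  also have "\<dots> \<le> (?n * (e\<^sup>2 + 4 * ?b)) / (2 * e) + e / 2 * (?n * 1) + (e / 2 * (?n * (1 + ?b)) + (?n * e\<^sup>2) / (2 * e))"
  proof (intro add_mono divide_right_mono mult_left_mono Td Teta)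
    have "(\<integral>a. (norm (\<xi> w a))\<^sup>2 \<partial>M) \<le> 1" for w
    proof -
      have "(\<integral>a. (norm (\<xi> w a))\<^sup>2 \<partial>M) \<le> (\<integral>a. 1 \<partial>M)"
        using nb by (intro integral_mono i1) (auto simp: power_le_one)
      then show ?thesis by (simp add: prob_space)
    qed
    then show "(\<Sum>w\<in>B. \<integral>a. (norm (\<xi> w a))\<^sup>2 \<partial>M) \<le> ?n * 1"
      using sum_mono[of B "\<lambda>w. \<integral>a. (norm (\<xi> w a))\<^sup>2 \<partial>M" "\<lambda>_. 1"] by simp
    show "(\<Sum>w\<in>B. \<integral>a. (norm (d w a))\<^sup>2 \<partial>M) \<le> ?n * e\<^sup>2"
      using sum_mono[of B "\<lambda>w. \<integral>a. (norm (d w a))\<^sup>2 \<partial>M" "\<lambda>_. e\<^sup>2"] close by (simp add: d_def)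
  qed (use e in auto)
  also have "\<dots> = ?n * (2 * e + ?b * (2 / e + e / 2))"
    using e by (simp add: field_simps power2_eq_square)
  finally have "\<bar>(\<Sum>w\<in>B. \<integral>a. ?T \<xi> w a \<bullet> \<xi> w a \<partial>M) - (\<Sum>w\<in>B. \<integral>a. ?T \<eta> w a \<bullet> \<eta> w a \<partial>M)\<bar> / ?n \<le> 2 * e + ?b * (2 / e + e / 2)"
    using n by (simp add: pos_divide_le_eq mult.commute)
  then show ?thesis
    using n unfolding Lam_def diff_divide_distrib[symmetric] abs_divide by simp
qed

text \<open>Translation operators of the induced representation: a measure preserving map followed by a cocycle of isometries.\<close>

definition twist :: "('a \<Rightarrow> 'v \<Rightarrow> 'v::euclidean_space) \<Rightarrow> ('a \<Rightarrow> 'a) \<Rightarrow> bool" where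
  "twist R \<tau> \<longleftrightarrow> \<tau> \<in> measurable M M \<and> distr M M \<tau> = M \<and> (\<forall>a. linear (R a) \<and> (\<forall>x. norm (R a x) = norm x))
    \<and> (\<forall>F\<in>borel_measurable M. (\<lambda>a. R a (F (\<tau> a))) \<in> borel_measurable M)"

lemma field_twist: "twist R \<tau> \<Longrightarrow> field \<xi> \<Longrightarrow> field (\<lambda>u a. R a (\<xi> u (\<tau> a)))"
  unfolding field_def twist_def by auto

lemma twist_inner: "twist R \<tau> \<Longrightarrow> R a x \<bullet> R a y = x \<bullet> y"
  unfolding twist_def using orthogonal_transformation[of "R a"] orthogonal_transformation_def[of "R a"] by blast

lemma integral_twist:
  fixes h :: "'a \<Rightarrow> real"
  assumes "twist R \<tau>" "h \<in> borel_measurable M"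
  shows "(\<integral>a. h (\<tau> a) \<partial>M) = (\<integral>a. h a \<partial>M)"
  using assms integral_distr[of \<tau> M M h] by (simp add: twist_def)

lemma Lam_twist:
  assumes tw: "twist R \<tau>" and \<xi>: "field \<xi>"
  shows "Lam B xs (\<lambda>u a. R a (\<xi> u (\<tau> a))) = Lam B xs \<xi>"
proof -
  have [measurable]: "\<xi> u \<in> borel_measurable M" for u using \<xi> by (rule field_measurable)
  have "(\<integral>a. trig_op xs (\<lambda>u. R a (\<xi> u (\<tau> a))) w \<bullet> R a (\<xi> w (\<tau> a)) \<partial>M) = (\<integral>a. trig_op xs (\<lambda>u. \<xi> u a) w \<bullet> \<xi> w a \<partial>M)" for w
  proof -
    have "trig_op xs (\<lambda>u. R a (\<xi> u (\<tau> a))) w \<bullet> R a (\<xi> w (\<tau> a)) = trig_op xs (\<lambda>u. \<xi> u (\<tau> a)) w \<bullet> \<xi> w (\<tau> a)" for a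
    proof -
      have "linear (R a)" using tw by (simp add: twist_def)
      then show ?thesis using trig_op_linear[of "R a" xs "\<lambda>u. \<xi> u (\<tau> a)" w] by (simp add: twist_inner[OF tw])
    qed
    then show ?thesis
      using integral_twist[OF tw, of "\<lambda>a. trig_op xs (\<lambda>u. \<xi> u a) w \<bullet> \<xi> w a"] by simp
  qed
  then show ?thesis by (simp add: Lam_def)
qed

lemma trig_op_shift: "trig_op xs (\<lambda>u. g (u + y)) w = trig_op xs g (w + y)"
proof (induction xs)
  case (Cons p xs)
  obtain c z where p: "p = (c, z)" by (cases p)
  have "w + z + y = w + y + z" "w - z + y = w + y - z" by simp_all
  then show ?case using Cons by (simp only: p trig_simps)
qed simp

lemma sum_translate_diff:
  fixes J :: "int \<times> int \<Rightarrow> real"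
  assumes B: "finite B" and J: "\<And>u. \<bar>J u\<bar> \<le> C"
  shows "\<bar>(\<Sum>y\<in>B. J (w + y)) - (\<Sum>y\<in>B. J y)\<bar> \<le> C * (boundary B w + boundary B (- w))"
proof -
  let ?S = "(\<lambda>y. y + w) ` B"
  have "(\<Sum>y\<in>B. J (w + y)) = (\<Sum>v\<in>?S. J v)"
    by (subst sum.reindex) (auto simp: inj_on_def add.commute)
  moreover have "(\<Sum>v\<in>?S. J v) = (\<Sum>v\<in>?S - B. J v) + (\<Sum>v\<in>?S \<inter> B. J v)"
    using B by (subst sum.union_disjoint[symmetric]) (auto intro!: sum.cong)
  moreover have "(\<Sum>v\<in>B. J v) = (\<Sum>v\<in>B - ?S. J v) + (\<Sum>v\<in>?S \<inter> B. J v)"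
    using B by (subst sum.union_disjoint[symmetric]) (auto intro!: sum.cong)
  moreover have "\<bar>\<Sum>v\<in>?S - B. J v\<bar> \<le> C * boundary B w"
  proof -
    have "?S - B = (\<lambda>y. y + w) ` {y\<in>B. y + w \<notin> B}" by auto
    then have "card (?S - B) = boundary B w"
      unfolding boundary_def by (simp add: card_image inj_on_def)
    moreover have "\<bar>\<Sum>v\<in>?S - B. J v\<bar> \<le> (\<Sum>v\<in>?S - B. C)"
      by (intro order_trans[OF sum_abs] sum_mono J)
    ultimately show ?thesis by (simp add: mult.commute)
  qed
  moreover have "\<bar>\<Sum>v\<in>B - ?S. J v\<bar> \<le> C * boundary B (- w)"
  proof -
    have "B - ?S = {y\<in>B. y + - w \<notin> B}"
      by (auto simp: image_iff) (metis diff_add_cancel)+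
    then have "card (B - ?S) = boundary B (- w)" unfolding boundary_def by simp
    moreover have "\<bar>\<Sum>v\<in>B - ?S. J v\<bar> \<le> (\<Sum>v\<in>B - ?S. C)"
      by (intro order_trans[OF sum_abs] sum_mono J)
    ultimately show ?thesis by (simp add: mult.commute)
  qed
  ultimately show ?thesis by (simp add: distrib_left)
qed

text \<open>Shifting by y is a twisted translation up to \<delta>, so \<open>Lam\<close> hardly
  changes when \<open>B0\<close> is replaced by \<open>B0\<close> + y, whatever y is. Averaging over
  y in a large Foelner set makes the limit independent of \<open>B0\<close>.\<close>

lemma Lam_mean_independent:
  assumes \<xi>: "field \<xi>" and \<delta>: "\<delta> > 0" and tw: "\<And>y. twist (R y) (\<tau> y)"
    and close: "\<And>y u. AE a in M. norm (R y a (\<xi> u (\<tau> y a)) - \<xi> (u + y) a) \<le> \<delta>"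
    and bound: "\<And>\<theta>. \<bar>trig_eval xs \<theta>\<bar> \<le> 1"
    and B0: "finite B0" "B0 \<noteq> {}" and B: "folner B" and \<kappa>: "\<kappa> > 0"
  shows "eventually (\<lambda>n. \<bar>Lam B0 xs \<xi> - Lam (B n) xs \<xi>\<bar>
    \<le> 2 * \<delta> + (trig_norm xs)\<^sup>2 * boundary_ratio B0 xs * (2 / \<delta> + \<delta> / 2) + \<kappa>) sequentially"
proof -
  define J where "J u = (\<integral>a. trig_op xs (\<lambda>v. \<xi> v a) u \<bullet> \<xi> u a \<partial>M)" for u
  define S where "S = 2 * \<delta> + (trig_norm xs)\<^sup>2 * boundary_ratio B0 xs * (2 / \<delta> + \<delta> / 2)"
  have J: "\<bar>J u\<bar> \<le> trig_norm xs" for u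
    unfolding J_def using integrable_field[OF \<xi> \<xi>, of xs u u] field_inner_bound[OF \<xi> \<xi>]
    by (intro integral_bounded borel_measurable_integrable) auto
  have LamJ: "Lam B xs \<xi> = (\<Sum>w\<in>B. J w) / card B" for B by (simp add: Lam_def J_def)
  have one: "\<bar>Lam B0 xs \<xi> - (\<Sum>w\<in>B0. J (w + y)) / card B0\<bar> \<le> S" for y
  proof -
    have \<eta>: "field (\<lambda>u. \<xi> (u + y))" using \<xi> unfolding field_def by blast
    have "Lam B0 xs (\<lambda>u. \<xi> (u + y)) = (\<Sum>w\<in>B0. J (w + y)) / card B0"
      by (simp add: Lam_def J_def trig_op_shift[of xs "\<lambda>u. \<xi> u _"])
    moreover have "\<bar>Lam B0 xs (\<lambda>u a. R y a (\<xi> u (\<tau> y a))) - Lam B0 xs (\<lambda>u. \<xi> (u + y))\<bar> \<le> S"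
      unfolding S_def
    proof (rule Lam_perturb[OF B0 field_twist[OF tw \<xi>] \<eta> bound \<delta>])
      fix w
      have f: "field (\<lambda>u a. R y a (\<xi> u (\<tau> y a)))" by (rule field_twist[OF tw \<xi>])
      have [measurable]: "(\<lambda>a. R y a (\<xi> w (\<tau> y a))) \<in> borel_measurable M" "\<xi> (w + y) \<in> borel_measurable M"
        using field_measurable[OF f] field_measurable[OF \<xi>] by auto
      have b: "norm (R y a (\<xi> w (\<tau> y a)) - \<xi> (w + y) a) \<le> 2" for a
        using norm_triangle_ineq4[of "R y a (\<xi> w (\<tau> y a))" "\<xi> (w + y) a"] field_norm[OF f, where u = w and a = a] field_norm[OF \<xi>, where u = "w + y" and a = a] by linarith
      have "integrable M (\<lambda>a. (norm (R y a (\<xi> w (\<tau> y a)) - \<xi> (w + y) a))\<^sup>2)"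
        using power_mono[OF b norm_ge_zero, where n = 2] by (intro integrable_bounded[where C = "2\<^sup>2"]) auto
      then have "(\<integral>a. (norm (R y a (\<xi> w (\<tau> y a)) - \<xi> (w + y) a))\<^sup>2 \<partial>M) \<le> (\<integral>a. \<delta>\<^sup>2 \<partial>M)"
        using close[of y w] by (intro integral_mono_AE) (auto elim!: eventually_mono intro!: power_mono)
      then show "(\<integral>a. (norm (R y a (\<xi> w (\<tau> y a)) - \<xi> (w + y) a))\<^sup>2 \<partial>M) \<le> \<delta>\<^sup>2"
        by (simp add: prob_space)
    qed
    ultimately show ?thesis by (simp add: Lam_twist[OF tw \<xi>])
  qed
  let ?c = "real (card B0)"
  have n0: "?c > 0" using B0 by (simp add: card_gt_0_iff)
  define E where "E n = (\<Sum>w\<in>B0. trig_norm xs * (real (boundary (B n) w) / card (B n) + real (boundary (B n) (- w)) / card (B n))) / ?c" for n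
  have "E \<longlonglongrightarrow> (\<Sum>w\<in>B0. trig_norm xs * (0 + 0)) / ?c"
    unfolding E_def using B n0 unfolding folner_def
    by (intro tendsto_divide tendsto_sum tendsto_mult tendsto_add tendsto_const) (blast | simp)+
  then have "E \<longlonglongrightarrow> 0" by simp
  then have "eventually (\<lambda>n. E n < \<kappa>) sequentially" using \<kappa> by (rule order_tendstoD)
  then show ?thesis
  proof eventually_elim
    case (elim n)
    have Bn: "finite (B n)" "B n \<noteq> {}" using B by (auto simp: folner_def)
    let ?n = "real (card (B n))"
    have n: "?n > 0" using Bn by (simp add: card_gt_0_iff)
    have "\<bar>Lam B0 xs \<xi> - (\<Sum>y\<in>B n. (\<Sum>w\<in>B0. J (w + y)) / ?c) / ?n\<bar>
      = \<bar>\<Sum>y\<in>B n. (Lam B0 xs \<xi> - (\<Sum>w\<in>B0. J (w + y)) / ?c)\<bar> / ?n"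
    proof -
      have "\<bar>l - t / k\<bar> = \<bar>k * l - t\<bar> / k" if "k > 0" for l t k :: real
      proof -
        have "l - t / k = (k * l - t) / k" using that by (simp add: diff_divide_distrib)
        then show ?thesis using that by simp
      qed
      then show ?thesis using n by (simp add: sum_subtractf)
    qed
    also have "\<dots> \<le> (\<Sum>y\<in>B n. S) / ?n"
      using one by (intro divide_right_mono order_trans[OF sum_abs] sum_mono) auto
    also have "\<dots> = S" using n by simp
    finally have 1: "\<bar>Lam B0 xs \<xi> - (\<Sum>y\<in>B n. (\<Sum>w\<in>B0. J (w + y)) / ?c) / ?n\<bar> \<le> S" .
    \<comment> \<open>After exchanging the sums, each inner sum runs over a translate of
      \<open>B n\<close> by a point of the fixed set \<open>B0\<close>, which differs from
      \<open>B n\<close> only near its boundary.\<close>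
    have sw: "(\<Sum>y\<in>B n. (\<Sum>w\<in>B0. J (w + y)) / ?c) / ?n = (\<Sum>w\<in>B0. (\<Sum>y\<in>B n. J (w + y)) / ?n) / ?c"
      unfolding sum_divide_distrib by (subst sum.swap) (simp add: mult.commute)
    have "(\<Sum>w\<in>B0. (\<Sum>y\<in>B n. J (w + y)) / ?n) / ?c - Lam (B n) xs \<xi>
      = (\<Sum>w\<in>B0. ((\<Sum>y\<in>B n. J (w + y)) - (\<Sum>y\<in>B n. J y)) / ?n) / ?c"
      using n0 by (simp add: LamJ sum_subtractf diff_divide_distrib)
    also have "\<bar>\<dots>\<bar> \<le> (\<Sum>w\<in>B0. trig_norm xs * (boundary (B n) w + boundary (B n) (- w)) / ?n) / ?c"
      unfolding abs_divide abs_of_nat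
      by (intro divide_right_mono order_trans[OF sum_abs] sum_mono)
        (unfold abs_divide abs_of_nat, intro divide_right_mono sum_translate_diff[OF Bn(1) J], simp_all)
    also have "\<dots> = E n" unfolding E_def by (simp add: add_divide_distrib distrib_left)
    finally have "\<bar>(\<Sum>w\<in>B0. (\<Sum>y\<in>B n. J (w + y)) / ?n) / ?c - Lam (B n) xs \<xi>\<bar> \<le> E n" .
    then show ?case using 1 elim unfolding sw S_def[symmetric] by linarith
  qed
qed

text \<open>Both means are compared with \<open>Lam (B1 m)\<close> for one common, much larger m;
  each comparison costs 2\<delta>.\<close>

lemma Lam_two_folner:
  assumes \<xi>: "field \<xi>" and \<delta>: "\<delta> > 0" and tw: "\<And>y. twist (R y) (\<tau> y)"
    and close: "\<And>y u. AE a in M. norm (R y a (\<xi> u (\<tau> y a)) - \<xi> (u + y) a) \<le> \<delta>"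
    and bound: "\<And>\<theta>. \<bar>trig_eval xs \<theta>\<bar> \<le> 1"
    and B1: "folner B1" and B2: "folner B2" and \<kappa>: "\<kappa> > 0"
  shows "eventually (\<lambda>n. \<bar>Lam (B1 n) xs \<xi> - Lam (B2 n) xs \<xi>\<bar> \<le> 4 * \<delta> + \<kappa>) sequentially"
proof -
  have small: "eventually (\<lambda>n. (trig_norm xs)\<^sup>2 * boundary_ratio (B n) xs * (2 / \<delta> + \<delta> / 2) < \<kappa> / 4) sequentially"
    if "folner B" for B
  proof -
    have "(\<lambda>n. (trig_norm xs)\<^sup>2 * boundary_ratio (B n) xs * (2 / \<delta> + \<delta> / 2)) \<longlonglongrightarrow> (trig_norm xs)\<^sup>2 * 0 * (2 / \<delta> + \<delta> / 2)"
      by (intro tendsto_intros folner_boundary_ratio that)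
    then show ?thesis using \<kappa> by (intro order_tendstoD) auto
  qed
  show ?thesis
    using small[OF B1] small[OF B2]
  proof eventually_elim
    case (elim n)
    have f: "finite (B1 n)" "B1 n \<noteq> {}" "finite (B2 n)" "B2 n \<noteq> {}" using B1 B2 by (auto simp: folner_def)
    have "eventually (\<lambda>m. \<bar>Lam (B1 n) xs \<xi> - Lam (B1 m) xs \<xi>\<bar> \<le> 2 * \<delta> + (trig_norm xs)\<^sup>2 * boundary_ratio (B1 n) xs * (2 / \<delta> + \<delta> / 2) + \<kappa> / 4) sequentially"
      "eventually (\<lambda>m. \<bar>Lam (B2 n) xs \<xi> - Lam (B1 m) xs \<xi>\<bar> \<le> 2 * \<delta> + (trig_norm xs)\<^sup>2 * boundary_ratio (B2 n) xs * (2 / \<delta> + \<delta> / 2) + \<kappa> / 4) sequentially"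
      using \<kappa> by (intro Lam_mean_independent[OF \<xi> \<delta> tw close bound _ _ B1] f; simp)+
    then have "eventually (\<lambda>m. \<bar>Lam (B1 n) xs \<xi> - Lam (B2 n) xs \<xi>\<bar> \<le> 4 * \<delta> + \<kappa>) sequentially"
      by eventually_elim (use elim in linarith)
    then show ?case by simp
  qed
qed

end

section \<open>Boxes, unit shears, and the behaviour of means under them\<close>

definition zbox :: "nat \<Rightarrow> (int \<times> int) set" where
  "zbox n = {0..int n} \<times> {0..int n}"

lemma folner_zbox: "folner zbox"
  unfolding folner_def
proof (intro conjI allI)
  fix z :: "int \<times> int"
  have card1: "card {x\<in>{0..int n}. x + k \<notin> {0..int n}} \<le> nat \<bar>k\<bar>" for n k
  proof (cases "k \<ge> 0")
    case True
    then have "{x\<in>{0..int n}. x + k \<notin> {0..int n}} \<subseteq> {int n - k<..int n}" by auto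
    then have "card {x\<in>{0..int n}. x + k \<notin> {0..int n}} \<le> card {int n - k<..int n}" by (intro card_mono) auto
    then show ?thesis using True by simp
  next
    case False
    then have "{x\<in>{0..int n}. x + k \<notin> {0..int n}} \<subseteq> {0..<-k}" by auto
    then have "card {x\<in>{0..int n}. x + k \<notin> {0..int n}} \<le> card {0..<-k}" by (intro card_mono) auto
    then show ?thesis using False by simp
  qed
  have cardb: "card (zbox n) = (n + 1) * (n + 1)" for n
    by (simp add: zbox_def card_cartesian_product nat_add_distrib)
  have bd: "boundary (zbox n) z \<le> (nat \<bar>fst z\<bar> + nat \<bar>snd z\<bar>) * (n + 1)" for n
  proof -
    have fin: "finite {x\<in>{0..int n}. x + k \<notin> {0..int n}}" for k
      by (rule finite_subset[of _ "{0..int n}"]) auto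
    have "{w\<in>zbox n. w + z \<notin> zbox n} \<subseteq> {x\<in>{0..int n}. x + fst z \<notin> {0..int n}} \<times> {0..int n}
      \<union> {0..int n} \<times> {x\<in>{0..int n}. x + snd z \<notin> {0..int n}}"
      by (auto simp: zbox_def plus_prod_def)
    then have "boundary (zbox n) z \<le> card ({x\<in>{0..int n}. x + fst z \<notin> {0..int n}} \<times> {0..int n}
      \<union> {0..int n} \<times> {x\<in>{0..int n}. x + snd z \<notin> {0..int n}})"
      unfolding boundary_def by (intro card_mono finite_UnI finite_cartesian_product fin) auto
    also have "\<dots> \<le> card {x\<in>{0..int n}. x + fst z \<notin> {0..int n}} * (n + 1) + (n + 1) * card {x\<in>{0..int n}. x + snd z \<notin> {0..int n}}"
      by (intro order_trans[OF card_Un_le]) (simp add: card_cartesian_product nat_add_distrib)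
    also have "\<dots> \<le> nat \<bar>fst z\<bar> * (n + 1) + (n + 1) * nat \<bar>snd z\<bar>"
      by (intro add_mono mult_mono card1) auto
    finally show ?thesis by (simp add: algebra_simps)
  qed
  let ?k = "nat \<bar>fst z\<bar> + nat \<bar>snd z\<bar>"
  show "(\<lambda>n. real (boundary (zbox n) z) / real (card (zbox n))) \<longlonglongrightarrow> 0"
  proof (rule real_tendsto_sandwich[of "\<lambda>_. 0" _ _ "\<lambda>n. real ?k * inverse (real (Suc n))"])
    have "(\<lambda>n. real ?k * inverse (real (Suc n))) \<longlonglongrightarrow> real ?k * 0"
      by (intro tendsto_intros LIMSEQ_inverse_real_of_nat)
    then show "(\<lambda>n. real ?k * inverse (real (Suc n))) \<longlonglongrightarrow> 0" by simp
    have "real (boundary (zbox n) z) / real (card (zbox n)) \<le> real ?k * inverse (real (Suc n))" for n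
    proof -
      have "real (boundary (zbox n) z) / real (card (zbox n)) \<le> real (?k * (n + 1)) / real ((n + 1) * (n + 1))"
        unfolding cardb using bd[of n] by (intro divide_right_mono) linarith+
      also have "\<dots> = real ?k * inverse (real (Suc n))"
      proof -
        have "real (k * (n + 1)) / real ((n + 1) * (n + 1)) = real k * inverse (real (Suc n))" for k
        proof -
          have "y * x / (x * x) = y * inverse x" if "x > 0" for x y :: real
            using that by (simp add: divide_simps)
          from this[of "real (n + 1)" "real k"] show ?thesis by (simp only: of_nat_mult) simp
        qed
        then show ?thesis .
      qed
      finally show ?thesis .
    qed
    then show "eventually (\<lambda>n. real (boundary (zbox n) z) / real (card (zbox n)) \<le> real ?k * inverse (real (Suc n))) sequentially"
      by simp
  qed auto
qed (auto simp: zbox_def)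

lemma folner_image:
  assumes B: "folner B" and s: "bij s" "\<And>x y. s (x + y) = s x + s y"
  shows "folner (\<lambda>n. s ` B n)"
  unfolding folner_def
proof (intro conjI allI)
  fix z
  obtain z' where z: "z = s z'" using s(1) by (metis bij_pointE)
  have inj: "inj s" using s(1) by (rule bij_is_inj)
  have "{w\<in>s ` B n. w + z \<notin> s ` B n} = s ` {v\<in>B n. v + z' \<notin> B n}" for n
  proof -
    have "s v + z \<in> s ` B n \<longleftrightarrow> v + z' \<in> B n" for v
      by (simp add: z s(2)[symmetric] inj_image_mem_iff[OF inj])
    then show ?thesis by blast
  qed
  then have "boundary (s ` B n) z = boundary (B n) z'" for n
    unfolding boundary_def by (simp add: card_image[OF inj_on_subset[OF inj]])
  moreover have "card (s ` B n) = card (B n)" for n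
    by (simp add: card_image[OF inj_on_subset[OF inj]])
  ultimately show "(\<lambda>n. real (boundary (s ` B n) z) / real (card (s ` B n))) \<longlonglongrightarrow> 0"
    using B unfolding folner_def by (simp del: split_paired_All)
qed (use B in \<open>auto simp: folner_def\<close>)

definition trig_map :: "(int \<times> int \<Rightarrow> int \<times> int) \<Rightarrow> trig_list \<Rightarrow> trig_list" where
  "trig_map s xs = map (\<lambda>(c, z). (c, s z)) xs"

lemma trig_op_map:
  assumes "\<And>x y. s (x + y) = s x + (s y :: int \<times> int)"
  shows "trig_op xs (\<lambda>u. g (s u)) w = trig_op (trig_map s xs) g (s w)"
proof -
  have "s 0 = 0" using assms[of 0 0] by simp
  then have "s (- y) = - s y" for y using assms[of y "- y"] by (simp add: eq_neg_iff_add_eq_0 add.commute)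
  then have "s (x - y) = s x - s y" for x y using assms[of x "- y"] by simp
  note d = this
  show ?thesis
  proof (induction xs)
    case (Cons p xs)
    obtain c z where p: "p = (c, z)" by (cases p)
    show ?case using Cons by (simp add: p trig_map_def d assms)
  qed (simp add: trig_map_def)
qed

definition shear1 :: "int \<Rightarrow> int \<times> int \<Rightarrow> int \<times> int" where
  "shear1 k z = (fst z + k * snd z, snd z)"

definition shear2 :: "int \<Rightarrow> int \<times> int \<Rightarrow> int \<times> int" where
  "shear2 k z = (fst z, snd z + k * fst z)"

lemma shear_add: "shear1 k (x + y) = shear1 k x + shear1 k y" "shear2 k (x + y) = shear2 k x + shear2 k y"
  by (simp_all add: shear1_def shear2_def algebra_simps)

lemma shear_bij: "bij (shear1 k)" "bij (shear2 k)"
  by (rule o_bij[of "shear1 (- k)"]; simp add: shear1_def fun_eq_iff)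
    (rule o_bij[of "shear2 (- k)"]; simp add: shear2_def fun_eq_iff)

text \<open>A shear of the frequencies is the transposed shear of the angles, so the two kinds are
  interchanged.\<close>

lemma trig_eval_shear:
  "trig_eval (trig_map (shear1 k) xs) (u, v) = trig_eval xs (u, v + k * u)"
  "trig_eval (trig_map (shear2 k) xs) (u, v) = trig_eval xs (u + k * v, v)"
  by (induction xs) (auto simp: trig_map_def shear1_def shear2_def phase_def algebra_simps)

context prob_space
begin

text \<open>Twisting leaves \<open>Lam\<close> unchanged and carries the field to its reindexing by
  s up to e in mean square, at a cost of 2e. Reindexing turns the box into its image under s and the
  list into \<open>trig_map s xs\<close>; returning to the box compares two Foelner sequences and
  costs 4\<delta>.\<close>

lemma Lam_shear_invariant:
  assumes \<xi>: "field \<xi>" and \<delta>: "\<delta> > 0" and tw: "\<And>y. twist (R y) (\<tau> y)"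
    and close: "\<And>y u. AE a in M. norm (R y a (\<xi> u (\<tau> y a)) - \<xi> (u + y) a) \<le> \<delta>"
    and bound: "\<And>\<theta>. \<bar>trig_eval xs \<theta>\<bar> \<le> 1" "\<And>\<theta>. \<bar>trig_eval (trig_map s xs) \<theta>\<bar> \<le> 1"
    and s: "bij s" "\<And>x y. s (x + y) = s x + s y"
    and tws: "twist Rs \<tau>s" and e: "e > 0"
    and closes: "\<And>w. (\<integral>a. (norm (Rs a (\<xi> w (\<tau>s a)) - \<xi> (s w) a))\<^sup>2 \<partial>M) \<le> e\<^sup>2" and \<kappa>: "\<kappa> > 0"
  shows "eventually (\<lambda>n. \<bar>Lam (zbox n) xs \<xi> - Lam (zbox n) (trig_map s xs) \<xi>\<bar> \<le> 2 * e + 4 * \<delta> + \<kappa>) sequentially"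
proof -
  have inj: "inj s" using s(1) by (rule bij_is_inj)
  have "(\<lambda>n. (trig_norm xs)\<^sup>2 * boundary_ratio (zbox n) xs * (2 / e + e / 2)) \<longlonglongrightarrow> (trig_norm xs)\<^sup>2 * 0 * (2 / e + e / 2)"
    by (intro tendsto_intros folner_boundary_ratio folner_zbox)
  then have "eventually (\<lambda>n. (trig_norm xs)\<^sup>2 * boundary_ratio (zbox n) xs * (2 / e + e / 2) < \<kappa> / 2) sequentially"
    using \<kappa> by (intro order_tendstoD) auto
  moreover have "eventually (\<lambda>n. \<bar>Lam (s ` zbox n) (trig_map s xs) \<xi> - Lam (zbox n) (trig_map s xs) \<xi>\<bar> \<le> 4 * \<delta> + \<kappa> / 2) sequentially"
    using \<kappa> by (intro Lam_two_folner[OF \<xi> \<delta> tw close bound(2)] folner_image folner_zbox s) auto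
  ultimately show ?thesis
  proof eventually_elim
    case (elim n)
    have b: "finite (zbox n)" "zbox n \<noteq> {}" by (auto simp: zbox_def)
    have \<eta>: "field (\<lambda>u. \<xi> (s u))" using \<xi> unfolding field_def by blast
    have "\<bar>Lam (zbox n) xs (\<lambda>u a. Rs a (\<xi> u (\<tau>s a))) - Lam (zbox n) xs (\<lambda>u. \<xi> (s u))\<bar>
      \<le> 2 * e + (trig_norm xs)\<^sup>2 * boundary_ratio (zbox n) xs * (2 / e + e / 2)"
      by (rule Lam_perturb[OF b field_twist[OF tws \<xi>] \<eta> bound(1) e closes])
    moreover have "Lam (zbox n) xs (\<lambda>u. \<xi> (s u)) = Lam (s ` zbox n) (trig_map s xs) \<xi>"
      unfolding Lam_def
      by (subst sum.reindex[OF inj_on_subset[OF inj]])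
        (auto simp: card_image[OF inj_on_subset[OF inj]] trig_op_map[OF s(2), of _ "\<lambda>u. \<xi> u _"])
    ultimately show ?case using elim unfolding Lam_twist[OF tws \<xi>] by linarith
  qed
qed

text \<open>Moving the base point of an inner product from w to 0 is a single twisted translation,
  which alters each of the two unit vectors by at most \<delta>. The average over w therefore stays
  within 2\<delta> of the coefficient at 0.\<close>

lemma Lam_single:
  assumes \<xi>: "field \<xi>" and unit: "\<And>u a. norm (\<xi> u a) = 1" and \<delta>: "\<delta> > 0" and tw: "\<And>y. twist (R y) (\<tau> y)"
    and close: "\<And>y u. AE a in M. norm (R y a (\<xi> u (\<tau> y a)) - \<xi> (u + y) a) \<le> \<delta>" and B: "finite B" "B \<noteq> {}"
  shows "\<bar>Lam B [(1, z)] \<xi> - (\<integral>a. \<xi> z a \<bullet> \<xi> 0 a \<partial>M)\<bar> \<le> 2 * \<delta>"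
proof -
  let ?K = "\<integral>a. \<xi> z a \<bullet> \<xi> 0 a \<partial>M"
  have [measurable]: "\<xi> u \<in> borel_measurable M" for u using \<xi> by (rule field_measurable)
  have int: "integrable M (\<lambda>a. \<xi> u a \<bullet> \<xi> v a)" for u v
    using Cauchy_Schwarz_ineq2[of "\<xi> u _" "\<xi> v _"] by (intro integrable_bounded[where C = 1]) (auto simp: unit)
  have near: "\<bar>(\<integral>a. \<xi> (w + z) a \<bullet> \<xi> w a \<partial>M) - ?K\<bar> \<le> 2 * \<delta>" for w
  proof -
    have f: "field (\<lambda>u a. R w a (\<xi> u (\<tau> w a)))" by (rule field_twist[OF tw \<xi>])
    have [measurable]: "(\<lambda>a. R w a (\<xi> u (\<tau> w a))) \<in> borel_measurable M" for u
      using field_measurable[OF f] by auto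
    have unit': "norm (R w a (\<xi> u (\<tau> w a))) = 1" for u a
      using tw[of w] unit by (simp add: twist_def)
    have "?K = (\<integral>a. \<xi> z (\<tau> w a) \<bullet> \<xi> 0 (\<tau> w a) \<partial>M)"
      by (rule integral_twist[OF tw[of w], symmetric]) measurable
    also have "\<dots> = (\<integral>a. R w a (\<xi> z (\<tau> w a)) \<bullet> R w a (\<xi> 0 (\<tau> w a)) \<partial>M)"
      by (simp add: twist_inner[OF tw])
    finally have K: "?K = \<dots>" .
    have int2: "integrable M (\<lambda>a. R w a (\<xi> z (\<tau> w a)) \<bullet> R w a (\<xi> 0 (\<tau> w a)))"
    proof (rule integrable_bounded[where C = 1])
      show "\<bar>R w a (\<xi> z (\<tau> w a)) \<bullet> R w a (\<xi> 0 (\<tau> w a))\<bar> \<le> 1" for a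
        using Cauchy_Schwarz_ineq2[of "R w a (\<xi> z (\<tau> w a))" "R w a (\<xi> 0 (\<tau> w a))"] by (simp add: unit')
    qed measurable
    have "\<bar>(\<integral>a. \<xi> (w + z) a \<bullet> \<xi> w a \<partial>M) - ?K\<bar>
      = \<bar>\<integral>a. (\<xi> (w + z) a \<bullet> \<xi> w a - R w a (\<xi> z (\<tau> w a)) \<bullet> R w a (\<xi> 0 (\<tau> w a))) \<partial>M\<bar>"
      unfolding K by (simp add: int int2)
    also have "\<dots> \<le> (\<integral>a. \<bar>\<xi> (w + z) a \<bullet> \<xi> w a - R w a (\<xi> z (\<tau> w a)) \<bullet> R w a (\<xi> 0 (\<tau> w a))\<bar> \<partial>M)"
      by (rule integral_abs_bound)
    also have "\<dots> \<le> (\<integral>a. 2 * \<delta> \<partial>M)"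
    proof (rule integral_mono_AE)
      show "AE a in M. \<bar>\<xi> (w + z) a \<bullet> \<xi> w a - R w a (\<xi> z (\<tau> w a)) \<bullet> R w a (\<xi> 0 (\<tau> w a))\<bar> \<le> 2 * \<delta>"
        using close[of w z] close[of w 0]
      proof eventually_elim
        case (elim a)
        let ?x = "\<xi> (w + z) a" and ?y = "\<xi> w a" and ?x' = "R w a (\<xi> z (\<tau> w a))" and ?y' = "R w a (\<xi> 0 (\<tau> w a))"
        have "?x \<bullet> ?y - ?x' \<bullet> ?y' = (?x - ?x') \<bullet> ?y + ?x' \<bullet> (?y - ?y')"
          by (simp add: inner_diff_left inner_diff_right)
        moreover have "\<bar>(?x - ?x') \<bullet> ?y\<bar> \<le> \<delta> * 1"
          using elim(1) unit \<delta> by (intro order_trans[OF Cauchy_Schwarz_ineq2] mult_mono) (auto simp: norm_minus_commute add.commute)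
        moreover have "\<bar>?x' \<bullet> (?y - ?y')\<bar> \<le> 1 * \<delta>"
          using elim(2) unit' \<delta> by (intro order_trans[OF Cauchy_Schwarz_ineq2] mult_mono) (auto simp: norm_minus_commute)
        ultimately show ?case by linarith
      qed
    qed (use int int2 in auto)
    finally show ?thesis by (simp add: prob_space)
  qed
  have trm: "\<bar>(\<integral>a. trig_op [(1, z)] (\<lambda>u. \<xi> u a) w \<bullet> \<xi> w a \<partial>M) - ?K\<bar> \<le> 2 * \<delta>" for w
  proof -
    have "(\<integral>a. trig_op [(1, z)] (\<lambda>u. \<xi> u a) w \<bullet> \<xi> w a \<partial>M)
      = (1/2) * ((\<integral>a. \<xi> (w + z) a \<bullet> \<xi> w a \<partial>M) + (\<integral>a. \<xi> ((w - z) + z) a \<bullet> \<xi> (w - z) a \<partial>M))"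
      using int by (simp add: inner_add_left inner_commute[of "\<xi> (w - z) _"])
    moreover have "\<bar>x - k\<bar> \<le> d" if "x = 1 / 2 * (y + y')" "\<bar>y - k\<bar> \<le> d" "\<bar>y' - k\<bar> \<le> d" for x y y' k d :: real
      using that unfolding abs_le_iff by (simp add: field_simps)
    ultimately show ?thesis using near[of w] near[of "w - z"] by blast
  qed
  have n: "real (card B) > 0" using B by (simp add: card_gt_0_iff)
  have "Lam B [(1, z)] \<xi> - ?K = (\<Sum>w\<in>B. ((\<integral>a. trig_op [(1, z)] (\<lambda>u. \<xi> u a) w \<bullet> \<xi> w a \<partial>M) - ?K)) / card B"
    using n unfolding Lam_def by (simp add: sum_subtractf diff_divide_distrib)
  also have "\<bar>\<dots>\<bar> \<le> (\<Sum>w\<in>B. 2 * \<delta>) / card B"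
    unfolding abs_divide abs_of_nat using trm by (intro divide_right_mono order_trans[OF sum_abs] sum_mono) auto
  also have "\<dots> = 2 * \<delta>" using n by simp
  finally show ?thesis .
qed

text \<open>The Lyapunov inequality is integrated against the almost positive mean
  \<open>Lam\<close>: the shear differences nearly cancel, and the cosines become matrix
  coefficients. The gain is that the bound does not depend on m, so knowledge of the two generators
  controls every multiple.\<close>

theorem almost_invariance_along_translations:
  assumes \<xi>: "field \<xi>" and unit: "\<And>u a. norm (\<xi> u a) = 1" and \<delta>: "\<delta> > 0" and tw: "\<And>y. twist (R y) (\<tau> y)"
    and close: "\<And>y u. AE a in M. norm (R y a (\<xi> u (\<tau> y a)) - \<xi> (u + y) a) \<le> \<delta>"
    and e: "e > 0"
    and shears: "\<And>s. s \<in> {shear1 1, shear1 (-1), shear2 1, shear2 (-1)} \<Longrightarrow>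
      \<exists>Rs \<tau>s. twist Rs \<tau>s \<and> (\<forall>w. (\<integral>a. (norm (Rs a (\<xi> w (\<tau>s a)) - \<xi> (s w) a))\<^sup>2 \<partial>M) \<le> e\<^sup>2)"
    and m: "m \<ge> (1::nat)"
  defines "K \<equiv> \<lambda>z. \<integral>a. \<xi> z a \<bullet> \<xi> 0 a \<partial>M"
  shows "1 - K (int m, 0) \<le> 80 * e + 2000 * \<delta> + 440 * ((1 - K (1, 0)) + (1 - K (0, 1)))"
proof (rule field_le_epsilon)
  fix \<epsilon> :: real assume \<epsilon>: "\<epsilon> > 0"
  define \<kappa> where "\<kappa> = min (\<epsilon> / 100) (1 / 2)"
  have \<kappa>: "\<kappa> > 0" "\<kappa> \<le> 1 / 2" "100 * \<kappa> \<le> \<epsilon>" using \<epsilon> by (auto simp: \<kappa>_def)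
  define t where "t = 1 / (real m)\<^sup>2"
  have t: "t > 0" using m by (simp add: t_def)
  obtain xs where xs: "\<And>\<theta>. \<bar>trig_eval xs \<theta> - lyapunov t \<theta>\<bar> \<le> \<kappa>"
    using lyapunov_approx[OF t \<kappa>(1)] by blast
  have bound: "\<bar>trig_eval xs \<theta>\<bar> \<le> 1" for \<theta>
    using xs[of \<theta>] lyapunov_bound[OF t, of \<theta>] \<kappa>(2) by linarith
  have ev: "eventually (\<lambda>n. \<bar>Lam (zbox n) xs \<xi> - Lam (zbox n) (trig_map s xs) \<xi>\<bar> \<le> 2 * e + 4 * \<delta> + \<kappa>) sequentially"
    if s: "s \<in> {shear1 1, shear1 (-1), shear2 1, shear2 (-1)}" for s
  proof -
    obtain Rs \<tau>s where rs: "twist Rs \<tau>s" "\<And>w. (\<integral>a. (norm (Rs a (\<xi> w (\<tau>s a)) - \<xi> (s w) a))\<^sup>2 \<partial>M) \<le> e\<^sup>2"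
      using shears[OF s] by blast
    have "bij s" "\<And>x y. s (x + y) = s x + s y" using s shear_bij shear_add by auto
    moreover have "\<bar>trig_eval (trig_map s xs) \<theta>\<bar> \<le> 1" for \<theta>
      using s bound by (cases \<theta>) (auto simp: trig_eval_shear)
    ultimately show ?thesis
      by (intro Lam_shear_invariant[OF \<xi> \<delta> tw close bound _ _ _ rs(1) e rs(2) \<kappa>(1)])
  qed
  \<comment> \<open>Right side minus left side of the Lyapunov inequality. The constant is 879 = 2 *
    440 - 1, and \<open>40 * \<kappa>\<close> pays for replacing the Lyapunov function by
    \<open>xs\<close> in four places with weight 10.\<close>
  define P where "P = trig_scale 10 (trig_map (shear2 1) xs) @ trig_scale (-10) (trig_map (shear2 (-1)) xs)
    @ trig_scale 10 (trig_map (shear1 1) xs) @ trig_scale (-10) (trig_map (shear1 (-1)) xs)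
    @ trig_scale (879 + 40 * \<kappa>) [(1, 0)] @ trig_scale (-440) [(1, (1, 0))] @ trig_scale (-440) [(1, (0, 1))] @ [(1, (int m, 0))]"
  have Ppos: "trig_eval P \<theta> \<ge> 0" for \<theta>
  proof -
    obtain u v where \<theta>: "\<theta> = (u, v)" by (cases \<theta>)
    have "trig_eval P \<theta> = 10 * (trig_eval xs (u + v, v) - trig_eval xs (u - v, v) + trig_eval xs (u, v + u) - trig_eval xs (u, v - u))
      + 440 * (2 - cos u - cos v) + 40 * \<kappa> - (1 - cos (real m * u))"
      by (simp add: P_def \<theta> trig_eval_shear phase_def algebra_simps)
    then show ?thesis
      using lyapunov_inequality[OF m t_def, of u v] xs[of "(u + v, v)"] xs[of "(u - v, v)"] xs[of "(u, v + u)"] xs[of "(u, v - u)"]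
      unfolding abs_le_iff right_diff_distrib distrib_left by linarith
  qed
  have "(\<lambda>n. 2 * trig_norm P * boundary_ratio (zbox n) P) \<longlonglongrightarrow> 2 * trig_norm P * 0"
    by (intro tendsto_intros folner_boundary_ratio folner_zbox)
  then have "eventually (\<lambda>n. 2 * trig_norm P * boundary_ratio (zbox n) P < \<kappa>) sequentially"
    using \<kappa> by (intro order_tendstoD) auto
  moreover have "eventually (\<lambda>n. \<bar>Lam (zbox n) xs \<xi> - Lam (zbox n) (trig_map (shear1 1) xs) \<xi>\<bar> \<le> 2 * e + 4 * \<delta> + \<kappa>) sequentially"
    "eventually (\<lambda>n. \<bar>Lam (zbox n) xs \<xi> - Lam (zbox n) (trig_map (shear1 (-1)) xs) \<xi>\<bar> \<le> 2 * e + 4 * \<delta> + \<kappa>) sequentially"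
    "eventually (\<lambda>n. \<bar>Lam (zbox n) xs \<xi> - Lam (zbox n) (trig_map (shear2 1) xs) \<xi>\<bar> \<le> 2 * e + 4 * \<delta> + \<kappa>) sequentially"
    "eventually (\<lambda>n. \<bar>Lam (zbox n) xs \<xi> - Lam (zbox n) (trig_map (shear2 (-1)) xs) \<xi>\<bar> \<le> 2 * e + 4 * \<delta> + \<kappa>) sequentially"
    by (intro ev; simp)+
  ultimately have "eventually (\<lambda>n. 1 - K (int m, 0) \<le> 80 * e + 2000 * \<delta> + 440 * ((1 - K (1, 0)) + (1 - K (0, 1))) + \<epsilon>) sequentially"
  proof eventually_elim
    case (elim n)
    let ?L = "\<lambda>xs. Lam (zbox n) xs \<xi>"
    have b: "finite (zbox n)" "zbox n \<noteq> {}" by (auto simp: zbox_def)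
    have "?L P \<ge> - \<kappa>"
      using Lam_nonneg[OF b \<xi> Ppos] elim(1) by linarith
    moreover have "?L P = 10 * ?L (trig_map (shear2 1) xs) - 10 * ?L (trig_map (shear2 (-1)) xs)
      + 10 * ?L (trig_map (shear1 1) xs) - 10 * ?L (trig_map (shear1 (-1)) xs)
      + (879 + 40 * \<kappa>) * ?L [(1, 0)] - 440 * ?L [(1, (1, 0))] - 440 * ?L [(1, (0, 1))] + ?L [(1, (int m, 0))]"
      unfolding P_def Lam_append[OF \<xi>] Lam_scale by simp
    moreover have "?L [(1, 0)] = 1"
    proof -
      have "trig_op [(1, 0)] (\<lambda>u. \<xi> u a) w \<bullet> \<xi> w a = 1" for w a
        using unit[of w a] by (simp add: scaleR_2[symmetric] power2_norm_eq_inner[symmetric])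
      then show ?thesis using b by (simp add: Lam_def prob_space card_gt_0_iff)
    qed
    moreover note single = Lam_single[OF \<xi> unit \<delta> tw close b, folded K_def]
    note single[of "(1, 0)"] single[of "(0, 1)"] single[of "(int m, 0)"]
    \<comment> \<open>The two pairs of shears cost 80e + 160\<delta> + 40\<kappa>, the three
      coefficients 1762\<delta>, and positivity together with the constant 41\<kappa>. So
      1922\<delta> and 81\<kappa> occur, within 2000\<delta> and \<epsilon>.\<close>
    ultimately show ?case using elim(2-5) \<kappa> \<delta>
      unfolding abs_le_iff distrib_left right_diff_distrib by (simp add: K_def)
  qed
  then show "1 - K (int m, 0) \<le> 80 * e + 2000 * \<delta> + 440 * ((1 - K (1, 0)) + (1 - K (0, 1))) + \<epsilon>" by simp
qed

end

section \<open>Near representations and the relative property (T) estimate\<close>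

text \<open>A scaled copy of the rank two integer lattice in column k, normalised by the
  transvections with indices i and j, which act on it as shears.\<close>

definition translation :: "'n \<Rightarrow> 'n \<Rightarrow> 'n \<Rightarrow> real \<Rightarrow> int \<times> int \<Rightarrow> real^'n^'n" where
  "translation i j k t z = transvection i k (t * of_int (fst z)) ** transvection j k (t * of_int (snd z))"

lemma translation_add:
  assumes "i \<noteq> j" "i \<noteq> k" "j \<noteq> k"
  shows "translation i j k t (z + y) = translation i j k t z ** translation i j k t y"
  using assms by (auto simp: translation_def vec_eq_iff transvection_mult_left transvection_nth algebra_simps
      simp flip: matrix_mul_assoc)

lemma translation_shear:
  assumes "i \<noteq> j" "i \<noteq> k" "j \<noteq> k"
  shows "translation i j k t z ** transvection i j (- of_int c) = transvection i j (- of_int c) ** translation i j k t (shear1 c z)"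
    and "translation i j k t z ** transvection j i (- of_int c) = transvection j i (- of_int c) ** translation i j k t (shear2 c z)"
  using assms by (auto simp: translation_def vec_eq_iff transvection_mult_left transvection_nth shear1_def shear2_def algebra_simps
      simp flip: matrix_mul_assoc)

lemma det_translation: "i \<noteq> k \<Longrightarrow> j \<noteq> k \<Longrightarrow> det (translation i j k t z) = 1"
  by (simp add: translation_def det_transvection det_mul)

text \<open>The operators are orthogonal on a real space; complex matrices with the Frobenius norm
  will be such a space. The distinguished unit vector \<open>v\<close> is included because the
  induced field is built from it.\<close>

locale near_rep = SL_lattice \<Gamma> for \<Gamma> :: "(real^'n^'n) set" +
  fixes \<pi> :: "real^'n^'n \<Rightarrow> 'v::euclidean_space \<Rightarrow> 'v" and \<delta> :: real and v :: 'v
  assumes \<pi>_linear: "\<gamma> \<in> \<Gamma> \<Longrightarrow> linear (\<pi> \<gamma>)"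
    and \<pi>_norm: "\<gamma> \<in> \<Gamma> \<Longrightarrow> norm (\<pi> \<gamma> x) = norm x"
    and \<pi>_near: "\<gamma> \<in> \<Gamma> \<Longrightarrow> \<gamma>' \<in> \<Gamma> \<Longrightarrow> norm (\<pi> (\<gamma> ** \<gamma>') x - \<pi> \<gamma> (\<pi> \<gamma>' x)) \<le> \<delta> * norm x"
    and \<pi>_one: "\<pi> (mat 1) x = x"
    and v_norm: "norm v = 1" and \<delta>_pos: "\<delta> > 0"
begin

sublocale prob_space M by (rule prob_M)

lemma prob_UNIV: "measure M UNIV = 1"
  using prob_space by simp

text \<open>For an exact representation this is the vector of the induced representation that is
  constantly \<open>v\<close> on the fundamental domain.\<close>

definition \<zeta> :: "real^'n^'n \<Rightarrow> 'v" where
  "\<zeta> a = \<pi> (\<sigma> a) v"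

lemma norm_\<zeta> [simp]: "norm (\<zeta> a) = 1"
  by (simp add: \<zeta>_def \<pi>_norm \<sigma>_in v_norm)

lemma \<zeta>_Dom: "a \<in> Dom \<Longrightarrow> \<zeta> a = v"
  by (simp add: \<zeta>_def Dom_eq \<pi>_one)

lemma \<zeta>_scaleR: "a \<in> GLpos \<Longrightarrow> c > 0 \<Longrightarrow> \<zeta> (c *\<^sub>R a) = \<zeta> a"
  by (simp add: \<zeta>_def \<sigma>_scaleR)

lemma \<zeta>_mult: "a \<in> GLpos \<Longrightarrow> \<gamma> \<in> \<Gamma> \<Longrightarrow> norm (\<zeta> (a ** \<gamma>) - \<pi> (matrix_inv \<gamma>) (\<zeta> a)) \<le> \<delta>"
  using \<pi>_near[of "matrix_inv \<gamma>" "\<sigma> a" v] by (simp add: \<zeta>_def \<sigma>_mult inv_in \<sigma>_in v_norm)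

lemma \<sigma>_count_space: "\<sigma> \<in> measurable borel (count_space \<Gamma>)"
proof -
  have "\<sigma> -` {\<gamma>} \<in> sets borel" for \<gamma>
    using measurable_sets[OF \<sigma>_measurable, of "{\<gamma>}"] by simp
  then show ?thesis
    using countable_lattice by (subst measurable_count_space_eq_countable) (auto simp: \<sigma>_in)
qed

text \<open>\<open>\<sigma>\<close> has countably many values, so measurability can be tested with
  the lattice element frozen; nothing is known about how \<open>\<pi>\<close> depends on it.\<close>

lemma compose_\<sigma>_measurable:
  assumes "\<And>\<gamma>. \<gamma> \<in> \<Gamma> \<Longrightarrow> f \<gamma> \<in> borel_measurable borel" "h \<in> borel_measurable borel"
  shows "(\<lambda>a. f (\<sigma> (h a)) a) \<in> borel_measurable borel"
  by (rule measurable_compose_countable'[where I = \<Gamma>, OF _ measurable_compose[OF assms(2) \<sigma>_count_space] countable_lattice])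
    (rule assms(1))

lemma \<zeta>_measurable [measurable]: "\<zeta> \<in> borel_measurable borel"
  unfolding \<zeta>_def using compose_\<sigma>_measurable[of "\<lambda>\<gamma> a. \<pi> \<gamma> v" "\<lambda>a. a"] by simp

lemma twist_translate:
  assumes k: "det k = 1"
  shows "twist (\<lambda>a. \<pi> (\<sigma> (k ** a))) (\<lambda>a. q (k ** a))"
  unfolding twist_def
proof (intro conjI ballI allI)
  show "(\<lambda>a. q (k ** a)) \<in> measurable M M" by measurable
  show "distr M M (\<lambda>a. q (k ** a)) = M" by (rule distr_M_translate[OF k])
  fix F :: "real^'n^'n \<Rightarrow> 'v" assume "F \<in> borel_measurable M"
  then have [measurable]: "F \<in> borel_measurable borel" by simp
  have "(\<lambda>a. \<pi> \<gamma> (F (q (k ** a)))) \<in> borel_measurable borel" if "\<gamma> \<in> \<Gamma>" for \<gamma>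
    by (rule measurable_compose[OF _ linear_measurable[OF \<pi>_linear[OF that]]]) measurable
  then show "(\<lambda>a. \<pi> (\<sigma> (k ** a)) (F (q (k ** a)))) \<in> borel_measurable M"
    using compose_\<sigma>_measurable[of "\<lambda>\<gamma> a. \<pi> \<gamma> (F (q (k ** a)))" "\<lambda>a. k ** a"] by simp
qed (auto simp: \<pi>_linear \<pi>_norm \<sigma>_in)

text \<open>The matrices \<open>k ** a\<close> and \<open>q (k ** a)\<close> differ by one lattice
  element, so near equivariance is used once and the cost is \<delta>, uniformly in g and k.\<close>

lemma twist_close:
  assumes "det g = 1" "det k = 1" "a \<in> GLpos"
  shows "norm (\<pi> (\<sigma> (k ** a)) (\<zeta> (g ** q (k ** a))) - \<zeta> (g ** (k ** a))) \<le> \<delta>"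
proof -
  let ?s = "\<sigma> (k ** a)"
  have ka: "k ** a \<in> GLpos" using assms by (simp add: GLpos_mult)
  have qk: "q (k ** a) \<in> GLpos" using ka by (simp add: q_def GLpos_mult det_in \<sigma>_in)
  have "g ** (k ** a) = (g ** q (k ** a)) ** matrix_inv ?s"
    by (simp add: q_def inv_right \<sigma>_in flip: matrix_mul_assoc)
  then show ?thesis
    using \<zeta>_mult[of "g ** q (k ** a)" "matrix_inv ?s"] assms qk
    by (simp add: GLpos_mult inv_in \<sigma>_in inv_inv norm_minus_commute)
qed

section \<open>Mean square displacement of the induced field under transvections\<close>

definition sqdist :: "real^'n^'n \<Rightarrow> real" where
  "sqdist g = (\<integral>a. (norm (\<zeta> (g ** a) - \<zeta> a))\<^sup>2 \<partial>M)"

lemma norm_\<zeta>_diff: "norm (\<zeta> a - \<zeta> b) \<le> 2"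
  using norm_triangle_ineq4[of "\<zeta> a" "\<zeta> b"] by simp

lemma sqdist_integrable: "integrable M (\<lambda>a. (norm (\<zeta> (g ** a) - \<zeta> a))\<^sup>2)"
  using power_mono[OF norm_\<zeta>_diff norm_ge_zero, where n = 2]
  by (intro integrable_bounded[where C = "2\<^sup>2"]) auto

text \<open>On \<open>Dom\<close> the displacement is that of \<open>v\<close> under
  \<open>\<pi> (\<sigma> (g ** a))\<close>. Off a set of measure \<eta> only elements of the finite
  set \<Phi> occur there, and on that set the squared displacement is at most 4.\<close>

lemma sqdist_tight:
  assumes \<Phi>: "\<And>\<gamma>. \<gamma> \<in> \<Phi> \<Longrightarrow> norm (\<pi> \<gamma> v - v) \<le> \<eta>" and \<eta>: "0 \<le> \<eta>" "\<eta> \<le> 1" and "\<Phi> \<subseteq> \<Gamma>" "finite \<Phi>"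
    and m: "measure M {a. \<sigma> (g ** a) \<notin> \<Phi>} \<le> \<eta>"
  shows "sqdist g \<le> 5 * \<eta>"
proof -
  have "{a. \<sigma> (g ** a) = \<gamma>} \<in> sets borel" for \<gamma>
    using measurable_sets[of "\<lambda>a. \<sigma> (g ** a)" borel borel "{\<gamma>}"] by (simp add: vimage_def)
  then have "UNIV - (\<Union>\<gamma>\<in>\<Phi>. {a. \<sigma> (g ** a) = \<gamma>}) \<in> sets borel"
    using \<open>finite \<Phi>\<close> by (intro sets.Diff sets.finite_UN) auto
  moreover have "UNIV - (\<Union>\<gamma>\<in>\<Phi>. {a. \<sigma> (g ** a) = \<gamma>}) = {a. \<sigma> (g ** a) \<notin> \<Phi>}" by auto
  ultimately have [measurable]: "{a. \<sigma> (g ** a) \<notin> \<Phi>} \<in> sets borel" by simp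
  have ii: "integrable M (indicator {a. \<sigma> (g ** a) \<notin> \<Phi>} :: _ \<Rightarrow> real)"
    by (rule integrable_bounded[where C = 1]) (simp_all add: indicator_def)
  have "sqdist g \<le> (\<integral>a. \<eta> + 4 * indicator {a. \<sigma> (g ** a) \<notin> \<Phi>} a \<partial>M)"
    unfolding sqdist_def
  proof (rule integral_mono_AE[OF sqdist_integrable])
    show "integrable M (\<lambda>a. \<eta> + 4 * indicator {a. \<sigma> (g ** a) \<notin> \<Phi>} a)"
      by (intro Bochner_Integration.integrable_add integrable_mult_right ii) simp
    show "AE a in M. (norm (\<zeta> (g ** a) - \<zeta> a))\<^sup>2 \<le> \<eta> + 4 * indicator {a. \<sigma> (g ** a) \<notin> \<Phi>} a"
      using AE_M_Dom
    proof eventually_elim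
      case (elim a)
      show ?case
      proof (cases "\<sigma> (g ** a) \<in> \<Phi>")
        case True
        then have "norm (\<zeta> (g ** a) - \<zeta> a) \<le> \<eta>" using \<Phi> elim by (simp add: \<zeta>_Dom \<zeta>_def[of "g ** a"])
        then have "(norm (\<zeta> (g ** a) - \<zeta> a))\<^sup>2 \<le> \<eta>\<^sup>2" by (intro power_mono) auto
        also have "\<eta>\<^sup>2 \<le> \<eta> * 1" unfolding power2_eq_square using \<eta> by (intro mult_left_mono) auto
        finally show ?thesis using True by simp
      next
        case False
        have "(norm (\<zeta> (g ** a) - \<zeta> a))\<^sup>2 \<le> 2\<^sup>2" by (intro power_mono norm_\<zeta>_diff) auto
        then show ?thesis using False \<eta> by simp
      qed
    qed
  qed
  also have "\<dots> = \<eta> + 4 * measure M {a. \<sigma> (g ** a) \<notin> \<Phi>}"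
    using ii by (subst Bochner_Integration.integral_add) (simp_all add: prob_UNIV)
  finally show ?thesis using m by linarith
qed

text \<open>The matrix coefficient of the field is 1 minus half of \<open>sqdist\<close>, so the
  constants of \<open>almost_invariance_along_translations\<close> for e and \<delta> are doubled,
  while 440 stays.\<close>

lemma sqdist_translation:
  fixes t :: real
  assumes ijk: "i \<noteq> j" "i \<noteq> k" "j \<noteq> k" and m: "m \<ge> (1::nat)" and e: "e > 0"
    and c: "\<And>x y s. x \<noteq> y \<Longrightarrow> s \<in> {1, -1} \<Longrightarrow> 18 * \<delta>\<^sup>2 + 2 * sqdist (transvection x y s) \<le> e\<^sup>2"
  shows "sqdist (transvection i k (t * m)) \<le> 160 * e + 4000 * \<delta> + 440 * (sqdist (transvection i k t) + sqdist (transvection j k t))"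
proof -
  let ?N = "translation i j k t"
  define \<xi> where "\<xi> z a = \<zeta> (?N z ** a)" for z a
  have dN: "det (?N z) = 1" for z using ijk by (simp add: det_translation)
  have \<xi>: "field \<xi>" unfolding field_def \<xi>_def by (simp, measurable)
  have unit: "norm (\<xi> u a) = 1" for u a by (simp add: \<xi>_def)
  have K: "(\<integral>a. \<xi> z a \<bullet> \<xi> 0 a \<partial>M) = 1 - sqdist (?N z) / 2" for z
  proof -
    have N0: "?N 0 = mat 1" by (simp add: translation_def)
    have "\<xi> z a \<bullet> \<xi> 0 a = 1 - (norm (\<zeta> (?N z ** a) - \<zeta> a))\<^sup>2 / 2" for a
      unfolding \<xi>_def N0 using dot_norm_neg[of "\<zeta> (?N z ** a)" "\<zeta> a"] by simp
    then show ?thesis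
      unfolding sqdist_def using sqdist_integrable[of "?N z"] by (simp add: prob_UNIV)
  qed
  have tw: "twist (\<lambda>a. \<pi> (\<sigma> (?N y ** a))) (\<lambda>a. q (?N y ** a))" for y by (rule twist_translate[OF dN])
  have close: "AE a in M. norm (\<pi> (\<sigma> (?N y ** a)) (\<xi> u (q (?N y ** a))) - \<xi> (u + y) a) \<le> \<delta>" for y u
    using AE_M_Dom
  proof eventually_elim
    case (elim a)
    then show ?case
      using twist_close[OF dN[of u] dN[of y], of a] ijk
      by (simp add: \<xi>_def Dom_def translation_add matrix_mul_assoc)
  qed
  have shear: "\<exists>Rs \<tau>s. twist Rs \<tau>s \<and> (\<forall>w. (\<integral>a. (norm (Rs a (\<xi> w (\<tau>s a)) - \<xi> (f w) a))\<^sup>2 \<partial>M) \<le> e\<^sup>2)"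
    if f: "\<And>w. ?N w ** s = s ** ?N (f w)" and s: "det s = 1" "18 * \<delta>\<^sup>2 + 2 * sqdist s \<le> e\<^sup>2" for f s
  proof -
    have tws: "twist (\<lambda>a. \<pi> (\<sigma> (s ** a))) (\<lambda>a. q (s ** a))" by (rule twist_translate[OF s(1)])
    have "(\<integral>a. (norm (\<pi> (\<sigma> (s ** a)) (\<xi> w (q (s ** a))) - \<xi> (f w) a))\<^sup>2 \<partial>M) \<le> e\<^sup>2" for w
    proof -
    let ?w = "f w"
    let ?h = "\<lambda>b. norm (\<zeta> (s ** b) - \<zeta> b)"
    \<comment> \<open>Three near equivariances separate the two vectors from the displacement by s
      at a moved base point; squaring 3\<delta> + h gives at most 18 and 2 times the squares. The
      move of the base point preserves \<open>M\<close>, so the mean is bounded uniformly in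
      w.\<close>
    have pt: "AE a in M. (norm (\<pi> (\<sigma> (s ** a)) (\<xi> w (q (s ** a))) - \<xi> ?w a))\<^sup>2 \<le> 18 * \<delta>\<^sup>2 + 2 * (?h (q (?N ?w ** a)))\<^sup>2"
      using AE_M_Dom
    proof eventually_elim
      case (elim a)
      then have a: "a \<in> GLpos" by (simp add: Dom_def)
      let ?U = "\<pi> (\<sigma> (?N ?w ** a))" and ?b = "q (?N ?w ** a)"
      have 1: "norm (\<pi> (\<sigma> (s ** a)) (\<xi> w (q (s ** a))) - \<zeta> (?N w ** (s ** a))) \<le> \<delta>"
        unfolding \<xi>_def by (rule twist_close[OF dN s(1) a])
      have 2: "norm (?U (\<zeta> (s ** ?b)) - \<zeta> (s ** (?N ?w ** a))) \<le> \<delta>"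
        by (rule twist_close[OF s(1) dN a])
      have 3: "norm (?U (\<zeta> ?b) - \<zeta> (?N ?w ** a)) \<le> \<delta>"
        using twist_close[of "mat 1" "?N ?w" a] dN a by simp
      have 4: "norm (?U (\<zeta> (s ** ?b)) - ?U (\<zeta> ?b)) = ?h ?b"
        using \<pi>_norm[OF \<sigma>_in] linear_diff[OF \<pi>_linear[OF \<sigma>_in]] by metis
      have "?N w ** (s ** a) = s ** (?N ?w ** a)" by (simp add: matrix_mul_assoc f)
      with 1 have one: "norm (\<pi> (\<sigma> (s ** a)) (\<xi> w (q (s ** a))) - \<zeta> (s ** (?N ?w ** a))) \<le> \<delta>" by simp
      have tri: "norm (x - y) \<le> d + d + h + d"
        if "norm (x - z) \<le> d" "norm (u - z) \<le> d" "norm (u - u') = h" "norm (u' - y) \<le> d" for x y z u u' :: 'v and d h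
      proof -
        have "norm (x - y) \<le> norm (x - z) + norm (u - z) + norm (u - u') + norm (u' - y)" by norm
        then show ?thesis using that by linarith
      qed
      have "norm (\<pi> (\<sigma> (s ** a)) (\<xi> w (q (s ** a))) - \<zeta> (?N ?w ** a)) \<le> \<delta> + \<delta> + ?h ?b + \<delta>"
        by (rule tri[OF one 2 4 3])
      then have "norm (\<pi> (\<sigma> (s ** a)) (\<xi> w (q (s ** a))) - \<xi> ?w a) \<le> 3 * \<delta> + ?h ?b"
        by (simp add: \<xi>_def)
      then have "(norm (\<pi> (\<sigma> (s ** a)) (\<xi> w (q (s ** a))) - \<xi> ?w a))\<^sup>2 \<le> (3 * \<delta> + ?h ?b)\<^sup>2"
        by (intro power_mono) auto
      also have "\<dots> \<le> 18 * \<delta>\<^sup>2 + 2 * (?h ?b)\<^sup>2"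
        using zero_le_power2[of "3 * \<delta> - ?h ?b"] by (simp add: power2_eq_square algebra_simps)
      finally show ?case .
    qed
    have [measurable]: "\<xi> u \<in> borel_measurable M" for u by (rule field_measurable[OF \<xi>])
    have fs: "field (\<lambda>u a. \<pi> (\<sigma> (s ** a)) (\<xi> u (q (s ** a))))" by (rule field_twist[OF tws \<xi>])
    have [measurable]: "(\<lambda>a. \<pi> (\<sigma> (s ** a)) (\<xi> w (q (s ** a)))) \<in> borel_measurable M" using field_measurable[OF fs] .
    have b2: "norm (\<pi> (\<sigma> (s ** a)) (\<xi> w (q (s ** a))) - \<xi> ?w a) \<le> 2" for a
      using norm_triangle_ineq4[of "\<pi> (\<sigma> (s ** a)) (\<xi> w (q (s ** a)))" "\<xi> ?w a"] field_norm[OF fs, where u = w and a = a] field_norm[OF \<xi>, where u = ?w and a = a]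
      by linarith
    have "integrable M (\<lambda>a. (norm (\<pi> (\<sigma> (s ** a)) (\<xi> w (q (s ** a))) - \<xi> ?w a))\<^sup>2)"
      using power_mono[OF b2 norm_ge_zero, where n = 2] by (intro integrable_bounded[where C = "2\<^sup>2"]) auto
    moreover have ih: "integrable M (\<lambda>a. (?h (q (?N ?w ** a)))\<^sup>2)"
      using power_mono[OF norm_\<zeta>_diff norm_ge_zero, where n = 2] by (intro integrable_bounded[where C = "2\<^sup>2"]) auto
    ultimately have "(\<integral>a. (norm (\<pi> (\<sigma> (s ** a)) (\<xi> w (q (s ** a))) - \<xi> ?w a))\<^sup>2 \<partial>M)
      \<le> (\<integral>a. 18 * \<delta>\<^sup>2 + 2 * (?h (q (?N ?w ** a)))\<^sup>2 \<partial>M)"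
      using pt by (intro integral_mono_AE) auto
    also have "\<dots> = 18 * \<delta>\<^sup>2 + 2 * (\<integral>a. (?h (q (?N ?w ** a)))\<^sup>2 \<partial>M)"
      using ih by (simp add: prob_UNIV)
    also have "(\<integral>a. (?h (q (?N ?w ** a)))\<^sup>2 \<partial>M) = sqdist s"
      unfolding sqdist_def by (rule integral_twist[OF tw]) measurable
    finally show "(\<integral>a. (norm (\<pi> (\<sigma> (s ** a)) (\<xi> w (q (s ** a))) - \<xi> ?w a))\<^sup>2 \<partial>M) \<le> e\<^sup>2" using s(2) by linarith
    qed
    then show ?thesis using tws by blast
  qed
  have shears: "\<exists>Rs \<tau>s. twist Rs \<tau>s \<and> (\<forall>w. (\<integral>a. (norm (Rs a (\<xi> w (\<tau>s a)) - \<xi> (f w) a))\<^sup>2 \<partial>M) \<le> e\<^sup>2)"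
    if fs: "f \<in> {shear1 1, shear1 (-1), shear2 1, shear2 (-1)}" for f
  proof -
    have "\<exists>s. (\<forall>w. ?N w ** s = s ** ?N (f w)) \<and> det s = 1 \<and> 18 * \<delta>\<^sup>2 + 2 * sqdist s \<le> e\<^sup>2"
    proof -
      consider r where "f = shear1 r" "r \<in> {1, -1}" | r where "f = shear2 r" "r \<in> {1, -1}" using fs by blast
      then show ?thesis
      proof cases
        case 1
        then show ?thesis
          using translation_shear(1)[OF ijk, of t _ r] c[of i j "- of_int r"] ijk
          by (intro exI[of _ "transvection i j (- of_int r)"]) (auto simp: det_transvection)
      next
        case 2
        then show ?thesis
          using translation_shear(2)[OF ijk, of t _ r] c[of j i "- of_int r"] ijk
          by (intro exI[of _ "transvection j i (- of_int r)"]) (auto simp: det_transvection)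
      qed
    qed
    then show ?thesis using shear by blast
  qed
  have "1 - (\<integral>a. \<xi> (int m, 0) a \<bullet> \<xi> 0 a \<partial>M)
    \<le> 80 * e + 2000 * \<delta> + 440 * ((1 - (\<integral>a. \<xi> (1, 0) a \<bullet> \<xi> 0 a \<partial>M)) + (1 - (\<integral>a. \<xi> (0, 1) a \<bullet> \<xi> 0 a \<partial>M)))"
    by (rule almost_invariance_along_translations[OF \<xi> unit \<delta>_pos tw close e shears m])
  moreover have "?N (int m, 0) = transvection i k (t * m)" "?N (1, 0) = transvection i k t" "?N (0, 1) = transvection j k t"
    by (simp_all add: translation_def)
  ultimately show ?thesis unfolding K by (simp add: field_simps)
qed

end

context SL_lattice
begin

text \<open>An arbitrary parameter t is a positive integer m times one in [-2, 2]. Tightness handles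
  the compact range, and the estimate along translations does not depend on m.\<close>

theorem sqdist_transvection_small:
  assumes \<epsilon>: "\<epsilon> > 0"
  shows "\<exists>\<Phi> \<eta>. finite \<Phi> \<and> \<Phi> \<subseteq> \<Gamma> \<and> \<eta> > 0 \<and>
    (\<forall>(\<pi> :: real^'n^'n \<Rightarrow> 'v::euclidean_space \<Rightarrow> 'v) \<delta> v. near_rep \<Gamma> \<pi> \<delta> v \<and> \<delta> \<le> \<eta> \<and> (\<forall>\<gamma>\<in>\<Phi>. norm (\<pi> \<gamma> v - v) \<le> \<eta>) \<longrightarrow>
      (\<forall>i j t. i \<noteq> j \<longrightarrow> near_rep.sqdist \<Gamma> \<pi> v (transvection i j t) \<le> \<epsilon>))"
proof -
  \<comment> \<open>The terms 160e and 8400\<eta> each receive a third of \<epsilon>, with 8400 =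
    4000 + 440 * (5 + 5). The bound on 28\<eta> comes from 18 + 2 * 5 in the shear condition, where
    the square of \<delta> is at most \<eta>.\<close>
  define e where "e = min 1 (\<epsilon> / 480)"
  define \<eta> where "\<eta> = min (e\<^sup>2 / 28) (min (\<epsilon> / 25200) 1)"
  have e: "0 < e" "160 * e \<le> \<epsilon> / 3" "e \<le> 1" using \<epsilon> by (auto simp: e_def)
  have \<eta>: "0 < \<eta>" "28 * \<eta> \<le> e\<^sup>2" "\<eta> \<le> 1" "8400 * \<eta> \<le> \<epsilon> / 3" using \<epsilon> e by (auto simp: \<eta>_def)
  define C where "C = (\<Union>p\<in>{p. fst p \<noteq> snd p}. (\<lambda>t. transvection (fst p) (snd p) t) ` {-2..2::real} :: (real^'n^'n) set)"
  have cont: "continuous_on S (\<lambda>t. transvection i j t)" for i j :: 'n and S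
    unfolding transvection_def
  proof (intro continuous_intros)
    fix a b :: 'n
    show "continuous_on S (\<lambda>t. if a = i \<and> b = j then t else 0)" by (cases "a = i \<and> b = j") (auto intro: continuous_intros)
  qed
  have "compact C"
    unfolding C_def by (intro compact_UN compact_continuous_image cont) (auto simp: finite_subset[OF subset_UNIV])
  moreover have "det g = 1" if "g \<in> C" for g using that by (auto simp: C_def det_transvection)
  ultimately obtain \<Phi> where \<Phi>: "finite \<Phi>" "\<Phi> \<subseteq> \<Gamma>" "\<And>g. g \<in> C \<Longrightarrow> measure M {a. \<sigma> (g ** a) \<notin> \<Phi>} \<le> \<eta>"
    using tight[of C \<eta>] \<eta>(1) by metis
  have "near_rep.sqdist \<Gamma> \<pi> v (transvection i j t) \<le> \<epsilon>"
    if nr: "near_rep \<Gamma> \<pi> \<delta> v" and \<delta>: "\<delta> \<le> \<eta>" and inv: "\<And>\<gamma>. \<gamma> \<in> \<Phi> \<Longrightarrow> norm (\<pi> \<gamma> v - v) \<le> \<eta>" and ij: "i \<noteq> j"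
    for \<pi> :: "real^'n^'n \<Rightarrow> 'v \<Rightarrow> 'v" and \<delta> v i j t
  proof -
    interpret near_rep \<Gamma> \<pi> \<delta> v by (rule nr)
    have small: "sqdist (transvection x y s) \<le> 5 * \<eta>" if "x \<noteq> y" "\<bar>s\<bar> \<le> 2" for x y s
    proof (rule sqdist_tight[OF inv])
      have "transvection x y s \<in> C" unfolding C_def by (rule UN_I[of "(x, y)"]) (use that in \<open>auto simp: abs_le_iff\<close>)
      then show "measure M {a. \<sigma> (transvection x y s ** a) \<notin> \<Phi>} \<le> \<eta>" by (rule \<Phi>(3))
    qed (use \<eta> \<Phi> in auto)
    have "card {i, j} < CARD('n)" using card_n ij by simp
    then obtain l where l: "l \<notin> {i, j}" by (metis UNIV_eq_I less_irrefl)
    obtain m0 :: nat where m0: "\<bar>t\<bar> \<le> real m0" using real_arch_simple by blast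
    define m where "m = Suc m0"
    have m: "m \<ge> 1" "\<bar>t\<bar> \<le> 2 * real m" using m0 by (simp_all add: m_def)
    have tm: "\<bar>t / m\<bar> \<le> 2" "t / m * m = t" using m by (auto simp: field_simps)
    have "\<delta>\<^sup>2 \<le> \<eta> * 1"
      unfolding power2_eq_square using \<delta> \<delta>_pos \<eta> by (intro mult_mono) auto
    then have c: "18 * \<delta>\<^sup>2 + 2 * sqdist (transvection x y s) \<le> e\<^sup>2" if "x \<noteq> y" "s \<in> {1, -1}" for x y s
      using small[of x y s] that \<eta>(2) by auto
    have "sqdist (transvection i j (t / m * m)) \<le> 160 * e + 4000 * \<delta> + 440 * (sqdist (transvection i j (t / m)) + sqdist (transvection l j (t / m)))"
      using l ij by (intro sqdist_translation m e c) auto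
    also have "\<dots> \<le> 160 * e + 4000 * \<eta> + 440 * (5 * \<eta> + 5 * \<eta>)"
      using l ij tm \<delta> by (intro add_mono mult_left_mono small) auto
    also have "\<dots> \<le> \<epsilon>"
    proof -
      have "160 * e + 4000 * \<eta> + 440 * (5 * \<eta> + 5 * \<eta>) = 160 * e + 8400 * \<eta>" by simp
      also have "\<dots> \<le> \<epsilon> / 3 + \<epsilon> / 3" by (intro add_mono e \<eta>)
      also have "\<dots> \<le> \<epsilon>" using \<epsilon> by simp
      finally show ?thesis .
    qed
    finally show ?thesis using tm by simp
  qed
  then show ?thesis using \<Phi> \<eta>(1) by (intro exI[of _ \<Phi>] exI[of _ \<eta>]) blast
qed

end

section \<open>Ergodicity of diagonal elements\<close>

text \<open>It commutes with the transvections that avoid the index k, while conjugation by its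
  powers contracts or expands those that meet k.\<close>

definition dilation :: "'n \<Rightarrow> real \<Rightarrow> real^'n^'n" where
  "dilation k c = (\<chi> a b. if a = b then (if a = k then inverse (c ^ (CARD('n) - 1)) else c) else 0)"

lemma dilation_mult_left:
  "(dilation k c ** A) $ a $ b = (if a = k then inverse (c ^ (CARD('n) - 1)) else c) * (A :: real^'n^'n) $ a $ b"
  by (simp add: dilation_def matrix_matrix_mult_def if_distrib[of "\<lambda>x. x * _"] cong: if_cong)

lemma dilation_mult_right:
  "((A :: real^'n^'n) ** dilation k c) $ a $ b = (if b = k then inverse (c ^ (CARD('n) - 1)) else c) * A $ a $ b"
  by (simp add: dilation_def matrix_matrix_mult_def if_distrib[of "\<lambda>x. _ * x"] mult.commute cong: if_cong)

lemma dilation_mult: "dilation k c ** dilation k d = dilation k (c * d)"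
  by (simp add: vec_eq_iff dilation_mult_left) (simp add: dilation_def power_mult_distrib)

lemma dilation_commute: "dilation k c ** dilation l d = dilation l d ** dilation k c"
  by (simp add: vec_eq_iff dilation_mult_left dilation_mult_right) (simp add: dilation_def)

lemma dilation_1 [simp]: "dilation k 1 = mat 1"
  by (simp add: dilation_def mat_def vec_eq_iff)

lemma det_dilation:
  assumes "c \<noteq> 0" shows "det (dilation k c :: real^'n^'n) = 1"
proof -
  have "det (dilation k c :: real^'n^'n) = (\<Prod>i\<in>UNIV. if i = k then inverse (c ^ (CARD('n) - 1)) else c)"
    by (subst det_diagonal) (auto simp: dilation_def)
  also have "\<dots> = inverse (c ^ (CARD('n) - 1)) * (\<Prod>i\<in>UNIV - {k}. if i = k then inverse (c ^ (CARD('n) - 1)) else c)"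
    by (subst prod.remove[of _ k]) auto
  also have "(\<Prod>i\<in>UNIV - {k}. if i = k then inverse (c ^ (CARD('n) - 1)) else c) = (\<Prod>i\<in>UNIV - {k}. c)"
    by (intro prod.cong) auto
  also have "\<dots> = c ^ (CARD('n) - 1)" by simp
  finally show ?thesis using assms by simp
qed

lemma dilation_transvection_commute:
  assumes "i \<noteq> k" "j \<noteq> k"
  shows "dilation k c ** transvection i j t = transvection i j t ** dilation k c"
  using assms by (auto simp: vec_eq_iff dilation_mult_left transvection_mult_left) (auto simp: dilation_def transvection_nth algebra_simps)

text \<open>Opposite signs of the exponent are used in the two parts, so that for c > 1 column and
  row transvections are both contracted.\<close>

lemma dilation_conj:
  fixes i k :: "'n::finite" and c :: real
  assumes "i \<noteq> k" "c \<noteq> 0"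
  shows "dilation k (inverse c) ** (transvection i k t ** dilation k c) = transvection i k (t / c ^ CARD('n))"
    and "dilation k c ** (transvection k i t ** dilation k (inverse c)) = transvection k i (t / c ^ CARD('n))"
proof -
  define p where "p = c ^ (CARD('n) - 1)"
  have cn: "c ^ CARD('n) = c * p"
    unfolding p_def by (metis One_nat_def Suc_pred power_Suc zero_less_card_finite)
  have p: "p \<noteq> 0" "inverse c ^ (CARD('n) - 1) = inverse p" using assms by (simp_all add: p_def power_inverse)
  have "(dilation k (inverse c) ** (transvection i k t ** dilation k c)) $ a $ b = transvection i k (t / c ^ CARD('n)) $ a $ b" for a b
    unfolding dilation_mult_left dilation_mult_right p(2) p_def[symmetric] cn transvection_nth
    using assms p(1) by (cases "a = b"; cases "a = i"; cases "b = k") (auto simp: divide_inverse)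
  then show "dilation k (inverse c) ** (transvection i k t ** dilation k c) = transvection i k (t / c ^ CARD('n))"
    by (simp add: vec_eq_iff)
  have "(dilation k c ** (transvection k i t ** dilation k (inverse c))) $ a $ b = transvection k i (t / c ^ CARD('n)) $ a $ b" for a b
    unfolding dilation_mult_left dilation_mult_right p(2) p_def[symmetric] cn transvection_nth
    using assms p(1) by (cases "a = b"; cases "a = k"; cases "b = i") (auto simp: divide_inverse)
  then show "dilation k c ** (transvection k i t ** dilation k (inverse c)) = transvection k i (t / c ^ CARD('n))"
    by (simp add: vec_eq_iff)
qed

lemma norm_axis_eq: "norm (axis i x) = norm (x :: 'a::real_normed_vector)"
proof -
  have "(norm (axis i x $ j))\<^sup>2 = (if j = i then (norm x)\<^sup>2 else 0)" for j by (simp add: axis_def)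
  then show ?thesis by (simp add: norm_vec_def L2_set_def)
qed

lemma norm_transvection_diff: "norm (transvection i k t ** a - a) \<le> \<bar>t\<bar> * norm (a :: real^'n^'n)"
proof -
  have "transvection i k t ** a - a = axis i (t *\<^sub>R (a $ k))"
    by (auto simp: vec_eq_iff transvection_mult_left axis_def)
  also have "norm \<dots> = \<bar>t\<bar> * norm (a $ k)" by (simp add: norm_axis_eq)
  also have "\<dots> \<le> \<bar>t\<bar> * norm a" by (intro mult_left_mono Finite_Cartesian_Product.norm_nth_le) simp
  finally show ?thesis .
qed

context SL_lattice
begin

lemma emeasure_left:
  assumes "det g = 1" "S \<in> sets borel"
  shows "emeasure lborel {a. g ** a \<in> S} = emeasure lborel (S :: (real^'n^'n) set)"
proof -
  have "emeasure lborel S = emeasure (distr lborel borel (\<lambda>a. g ** a)) S"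
    by (simp add: lborel_SL_left[OF card_n assms(1)])
  also have "\<dots> = emeasure lborel {a. g ** a \<in> S}"
    using assms(2) by (subst emeasure_distr) (auto simp: vimage_def)
  finally show ?thesis ..
qed

lemma measurable_left:
  fixes S :: "(real^'n^'n) set" and g :: "real^'n^'n"
  shows "S \<in> sets borel \<Longrightarrow> {a. g ** a \<in> S} \<in> sets borel"
  using measurable_sets[of "\<lambda>a. g ** a" borel borel S] by (simp add: vimage_def)

text \<open>Choose a compact C inside S and an open U around S with small differences. A small
  transvection keeps C inside U, so a point that leaves S started in S - C or landed in U - S; the
  second event is measured by invariance.\<close>

lemma transvection_almost_preserves:
  fixes S :: "(real^'n^'n) set"
  assumes S: "S \<in> sets borel" "bounded S" and ik: "i \<noteq> k" and e: "e > 0"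
  shows "\<exists>d>0. \<forall>t. \<bar>t\<bar> < d \<longrightarrow> emeasure lborel {a\<in>S. transvection i k t ** a \<notin> S} \<le> ennreal e"
proof -
  have SL: "S \<in> sets lebesgue" using S by simp
  obtain C where C: "closed C" "C \<subseteq> S" "emeasure lebesgue (S - C) < ennreal (e / 2)"
    using sets_lebesgue_inner_closed[OF SL, of "e / 2"] e by (metis half_gt_zero)
  obtain U where U: "open U" "S \<subseteq> U" "emeasure lebesgue (U - S) < ennreal (e / 2)"
    using sets_lebesgue_outer_open[OF SL, of "e / 2"] e by (metis half_gt_zero)
  have cC: "compact C" using C S by (meson bounded_subset compact_eq_bounded_closed)
  obtain r where r: "r > 0" "(\<Union>x\<in>C. ball x r) \<subseteq> U"
    using compact_subset_open_imp_ball_epsilon_subset[OF cC U(1)] C(2) U(2) by blast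
  obtain R where R: "R > 0" "\<And>a. a \<in> S \<Longrightarrow> norm a \<le> R" using S(2) by (meson bounded_pos)
  have mb: "C \<in> sets borel" "U \<in> sets borel" using C U by auto
  have e1: "emeasure lborel (S - C) \<le> ennreal (e / 2)" "emeasure lborel (U - S) \<le> ennreal (e / 2)"
    using C(3) U(3) S mb by (auto simp: less_imp_le)
  have "emeasure lborel {a\<in>S. transvection i k t ** a \<notin> S} \<le> ennreal e" if t: "\<bar>t\<bar> < r / R" for t
  proof -
    let ?T = "transvection i k t"
    have "{a\<in>S. ?T ** a \<notin> S} \<subseteq> (S - C) \<union> {a. ?T ** a \<in> U - S}"
    proof
      fix a assume a: "a \<in> {a\<in>S. ?T ** a \<notin> S}"
      show "a \<in> (S - C) \<union> {a. ?T ** a \<in> U - S}"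
      proof (cases "a \<in> C")
        case True
        have "norm (?T ** a - a) \<le> \<bar>t\<bar> * norm a" by (rule norm_transvection_diff)
        also have "\<dots> \<le> \<bar>t\<bar> * R" using R a by (intro mult_left_mono) auto
        also have "\<dots> < r" using t R by (simp add: pos_less_divide_eq)
        finally have "?T ** a \<in> ball a r" by (simp add: dist_norm norm_minus_commute)
        then have "?T ** a \<in> (\<Union>x\<in>C. ball x r)" using True by blast
        then show ?thesis using r(2) a by blast
      qed (use a in auto)
    qed
    then have "emeasure lborel {a\<in>S. ?T ** a \<notin> S} \<le> emeasure lborel ((S - C) \<union> {a. ?T ** a \<in> U - S})"
      using S mb measurable_left[of "U - S" ?T] by (intro emeasure_mono) auto
    also have "\<dots> \<le> emeasure lborel (S - C) + emeasure lborel {a. ?T ** a \<in> U - S}"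
      using S mb measurable_left[of "U - S" ?T] by (intro emeasure_subadditive) auto
    also have "emeasure lborel {a. ?T ** a \<in> U - S} = emeasure lborel (U - S)"
      using S mb by (intro emeasure_left det_transvection ik) auto
    also have "emeasure lborel (S - C) + emeasure lborel (U - S) \<le> ennreal (e / 2) + ennreal (e / 2)"
      by (intro add_mono e1)
    also have "\<dots> = ennreal e" using e by (simp flip: ennreal_plus)
    finally show ?thesis .
  qed
  then show ?thesis using r R by (intro exI[of _ "r / R"]) auto
qed

lemma inner_compact:
  assumes "e > 0"
  shows "\<exists>K. compact K \<and> K \<subseteq> Dom \<and> measure M (- K) \<le> e"
proof -
  interpret prob_space M by (rule prob_M)
  have "emeasure M Dom = 1" using AE_M_Dom by (subst emeasure_eq_1_AE) auto
  moreover have "emeasure M Dom = (SUP K\<in>{K. K \<subseteq> Dom \<and> compact K}. emeasure M K)"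
    by (rule inner_regular) auto
  moreover have "ennreal (1 - e) < 1" using assms by (simp add: ennreal_less_one_iff)
  ultimately obtain K where K: "compact K" "K \<subseteq> Dom" "ennreal (1 - e) < emeasure M K"
    by (metis (no_types, lifting) less_SUP_iff mem_Collect_eq)
  have "1 - e \<le> measure M K"
    using K(3) by (metis emeasure_eq_measure ennreal_leI linorder_le_cases linorder_not_less)
  moreover have "K \<in> sets M" using K by (simp add: compact_imp_closed borel_closed)
  then have "measure M (- K) = 1 - measure M K"
    using prob_compl[of K] by (simp add: Compl_eq_Diff_UNIV)
  ultimately show ?thesis using K by auto
qed

lemma measure_M_le:
  assumes "S \<in> sets borel" "emeasure lborel S \<le> ennreal e" "e \<ge> 0"
  shows "measure M S \<le> e / measure lborel Dom"
proof -
  have m: "measure lborel Dom > 0" "emeasure lborel Dom = ennreal (measure lborel Dom)"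
    using Dom_finite Dom_pos by (simp_all add: measure_def enn2real_positive_iff)
  have "measure M S = measure lborel (Dom \<inter> S) / measure lborel Dom"
    unfolding M_def by (rule measure_uniform_measure) (use Dom_finite Dom_pos assms in auto)
  also have "measure lborel (Dom \<inter> S) \<le> e"
  proof -
    have "emeasure lborel (Dom \<inter> S) \<le> emeasure lborel S" using assms by (intro emeasure_mono) auto
    then have "emeasure lborel (Dom \<inter> S) \<le> ennreal e" using assms by (meson order_trans)
    then show ?thesis using assms(3) by (simp add: measure_def enn2real_leI)
  qed
  finally show ?thesis using m by (simp add: divide_right_mono)
qed

text \<open>\<open>M\<close> sees only determinants up to 1. Multiplying by the inverse of a large
  integer brings any matrix of positive determinant there, and countably many scalars
  suffice.\<close>

lemma AE_GLpos_of_AE_M: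
  assumes P: "AE a in M. P a" and inv: "\<And>a \<gamma>. a \<in> GLpos \<Longrightarrow> \<gamma> \<in> \<Gamma> \<Longrightarrow> P (a ** \<gamma>) = P a"
    and scale: "\<And>a c. a \<in> GLpos \<Longrightarrow> c > 0 \<Longrightarrow> P (c *\<^sub>R a) = P a"
    and meas: "Measurable.pred borel P"
  shows "AE a in lborel. a \<in> GLpos \<longrightarrow> P a"
proof -
  have 1: "AE a in lborel. a \<in> Cone \<longrightarrow> P a"
    by (rule AE_lborel_of_AE_M[OF P _ meas]) (auto simp: inv Cone_GLpos)
  have "AE a in lborel. \<forall>m. inverse (real (Suc m)) *\<^sub>R a \<in> Cone \<longrightarrow> P (inverse (real (Suc m)) *\<^sub>R a)"
    unfolding AE_all_countable
  proof
    fix m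
    have "bij (\<lambda>a :: real^'n^'n. inverse (real (Suc m)) *\<^sub>R a)"
      by (rule o_bij[of "\<lambda>a. real (Suc m) *\<^sub>R a"]) (auto simp: fun_eq_iff)
    then show "AE a in lborel. inverse (real (Suc m)) *\<^sub>R a \<in> Cone \<longrightarrow> P (inverse (real (Suc m)) *\<^sub>R a)"
      by (intro AE_linear_bij[OF _ _ 1]) (auto intro: linear_scale_self linear_compose_scale_right linear_ident)
  qed
  then show ?thesis
  proof eventually_elim
    case (elim a)
    show ?case
    proof
      assume a: "a \<in> GLpos"
      obtain m :: nat where m: "det a \<le> real m" using real_arch_simple by blast
      let ?c = "inverse (real (Suc m))"
      have "?c ^ CARD('n) \<le> ?c ^ 1" by (rule power_decreasing) (auto simp: inverse_le_1_iff Suc_leI)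
      then have "?c ^ CARD('n) * det a \<le> ?c * real (Suc m)"
        using m a by (intro mult_mono) (auto simp: GLpos_def)
      then have "?c *\<^sub>R a \<in> Cone"
        using a by (simp add: Cone_def GLpos_scaleR det_scaleR_matrix)
      then show "P a" using elim scale[OF a, of ?c] by auto
    qed
  qed
qed

text \<open>The exceptional null set may depend on g. Treating g as a variable matrix and exchanging
  quantifiers by Fubini fixes a instead, and then \<open>g ** a\<close> runs over almost all
  matrices.\<close>

lemma AE_constant:
  assumes meas: "{p :: (real^'n^'n) \<times> (real^'n^'n). R (fst p) (snd p)} \<in> sets (borel \<Otimes>\<^sub>M borel)"
    and inv: "\<And>g. det g = 1 \<Longrightarrow> AE a in lborel. a \<in> GLpos \<longrightarrow> R (g ** a) a"
    and scale: "\<And>x y c. x \<in> GLpos \<Longrightarrow> c > 0 \<Longrightarrow> R (c *\<^sub>R x) y = R x y"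
  shows "AE a in lborel. a \<in> GLpos \<longrightarrow> (AE b in lborel. b \<in> GLpos \<longrightarrow> R b a)"
proof -
  have R[measurable]: "Measurable.pred (borel \<Otimes>\<^sub>M borel) (\<lambda>p. R (fst p) (snd p :: real^'n^'n))"
    using meas by (simp add: pred_def space_pair_measure)
  let ?Q = "\<lambda>g a. g \<in> GLpos \<longrightarrow> a \<in> GLpos \<longrightarrow> R (g ** a) a"
  have "AE g in lborel. AE a in lborel. ?Q g a"
  proof (rule AE_I2)
    fix g :: "real^'n^'n"
    show "AE a in lborel. ?Q g a"
    proof (cases "g \<in> GLpos")
      case True
      have c: "root CARD('n) (det g) > 0" using True by (simp add: GLpos_def)
      have g: "g = root CARD('n) (det g) *\<^sub>R normalized g" using c by (simp add: normalized_def)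
      have "AE a in lborel. a \<in> GLpos \<longrightarrow> R (normalized g ** a) a" using True by (intro inv det_normalized)
      then show ?thesis
      proof eventually_elim
        case (elim a)
        have "R (g ** a) a = R (normalized g ** a) a" if "a \<in> GLpos"
          by (subst g) (use that c True in \<open>simp add: scaleR_matrix_mult scale GLpos_mult det_normalized\<close>)
        then show ?case using elim by simp
      qed
    qed simp
  qed
  moreover have "{x \<in> space (lborel \<Otimes>\<^sub>M lborel). ?Q (fst x) (snd x)} \<in> sets (lborel \<Otimes>\<^sub>M lborel)"
  proof -
    have m1: "(\<lambda>x :: (real^'n^'n) \<times> (real^'n^'n). (fst x ** snd x, snd x)) \<in> measurable (borel \<Otimes>\<^sub>M borel) (borel \<Otimes>\<^sub>M borel)"
      by measurable
    have "Measurable.pred (borel \<Otimes>\<^sub>M borel) (\<lambda>x. R (fst x ** snd x) (snd x :: real^'n^'n))"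
      using measurable_compose[OF m1 R] by simp
    then have "Measurable.pred (borel \<Otimes>\<^sub>M borel) (\<lambda>x. ?Q (fst x) (snd x))" by measurable
    then show ?thesis by (simp add: pred_def space_pair_measure cong: sets_pair_measure_cong)
  qed
  ultimately have "AE a in lborel. AE g in lborel. ?Q g a"
    by (subst (asm) lborel_pair.AE_commute) auto
  then show ?thesis
  proof eventually_elim
    case (elim a)
    show ?case
    proof
      assume a: "a \<in> GLpos"
      then have d: "det a \<noteq> 0" by (simp add: GLpos_def)
      have "det (matrix_inv a) * det a = 1" using matrix_inv_cancel[OF d] by (metis det_I det_mul)
      then have "det (matrix_inv a) > 0"
        using a zero_less_mult_pos2[of "det (matrix_inv a)" "det a"] by (simp add: GLpos_def)
      then have da: "det (matrix_inv a) > 0" "det (matrix_inv a) \<noteq> 0" by simp_all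
      have "AE b in lborel. ?Q (b ** matrix_inv a) a"
        by (rule AE_matrix_mult_right[OF da(2) elim])
      then show "AE b in lborel. b \<in> GLpos \<longrightarrow> R b a"
      proof eventually_elim
        case (elim b)
        have "(b ** matrix_inv a) ** a = b" using matrix_inv_cancel[OF d] by (simp flip: matrix_mul_assoc)
        moreover have "b \<in> GLpos \<Longrightarrow> b ** matrix_inv a \<in> GLpos" using da by (simp add: GLpos_def det_mul)
        ultimately show ?case using elim a by auto
      qed
    qed
  qed
qed

lemma AE_GLpos_ex: "AE a in lborel. a \<in> (GLpos :: (real^'n^'n) set) \<longrightarrow> P a \<Longrightarrow> \<exists>a\<in>GLpos. P a"
proof (rule ccontr)
  assume ae: "AE a in lborel. a \<in> (GLpos :: (real^'n^'n) set) \<longrightarrow> P a" and no: "\<not> (\<exists>a\<in>GLpos. P a)"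
  interpret prob_space M by (rule prob_M)
  have "AE a in M. a \<in> GLpos \<longrightarrow> P a" by (rule AE_M[OF ae])
  then have "AE a in M. False"
    using AE_M_Dom by eventually_elim (use no in \<open>auto simp: Dom_def\<close>)
  then show False using prob_space by simp
qed

text \<open>The Mautner phenomenon in measure form. \<open>m g\<close> tells how much g moves E; it
  is subadditive, vanishes on powers of the dilation, hence is unaffected by conjugation with them,
  and is small for small transvections. Transvections meeting k are conjugate to arbitrarily small
  ones, the others are commutators of these, and all of \<open>SL\<close> follows.\<close>

theorem dilation_ergodic:
  assumes E[measurable]: "E \<in> sets borel" and inv: "\<And>a \<gamma>. a \<in> GLpos \<Longrightarrow> \<gamma> \<in> \<Gamma> \<Longrightarrow> a ** \<gamma> \<in> E \<longleftrightarrow> a \<in> E"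
    and scale: "\<And>a c. a \<in> GLpos \<Longrightarrow> c > 0 \<Longrightarrow> c *\<^sub>R a \<in> E \<longleftrightarrow> a \<in> E"
    and dil: "\<And>a. a \<in> GLpos \<Longrightarrow> dilation k 2 ** a \<in> E \<longleftrightarrow> a \<in> E"
  shows "(AE a in lborel. a \<in> GLpos \<longrightarrow> a \<in> E) \<or> (AE a in lborel. a \<in> GLpos \<longrightarrow> a \<notin> E)"
proof -
  interpret prob_space M by (rule prob_M)
  define N where "N g = {a \<in> GLpos. (g ** a \<in> E) \<noteq> (a \<in> E)}" for g
  have mN[measurable]: "N g \<in> sets borel" for g
    unfolding N_def using measurable_left[OF E, of g] by measurable
  define m where "m g = measure M (N g)" for g
  have Ninv: "a ** \<gamma> \<in> N g \<longleftrightarrow> a \<in> N g" if "a \<in> GLpos" "\<gamma> \<in> \<Gamma>" "det g = 1" for a \<gamma> g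
    using that inv[of "g ** a" \<gamma>] inv[of a \<gamma>] by (auto simp: N_def GLpos_mult det_in matrix_mul_assoc)
  have pull: "measure M {a. h ** a \<in> N g} = m g" if "det g = 1" "det h = 1" for g h
  proof -
    have mq: "(\<lambda>a. q (h ** a)) \<in> measurable M M" by measurable
    have sN: "N g \<in> sets M" by simp
    have "m g = measure (distr M M (\<lambda>a. q (h ** a))) (N g)"
      by (simp add: m_def distr_M_translate[OF that(2)])
    also have "\<dots> = measure M {a. q (h ** a) \<in> N g}"
      by (subst measure_distr[OF mq sN]) (simp add: vimage_def)
    also have "\<dots> = measure M {a. h ** a \<in> N g}"
    proof (rule measure_eq_AE)
      show "AE a in M. (a \<in> {a. q (h ** a) \<in> N g}) = (a \<in> {a. h ** a \<in> N g})"
        using AE_M_Dom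
      proof eventually_elim
        case (elim a)
        then have "h ** a \<in> GLpos" using that by (simp add: Dom_def GLpos_mult)
        then show ?case using Ninv[of "h ** a" "\<sigma> (h ** a)" g] that by (simp add: q_def \<sigma>_in)
      qed
      show "{a. q (h ** a) \<in> N g} \<in> sets M" using measurable_sets[OF mq sN] by (simp add: vimage_def)
      show "{a. h ** a \<in> N g} \<in> sets M" using measurable_left[OF mN] by simp
    qed
    finally show ?thesis ..
  qed
  have sub: "m (g ** h) \<le> m g + m h" if "det g = 1" "det h = 1" for g h
  proof -
    have "N (g ** h) \<subseteq> {a. h ** a \<in> N g} \<union> N h"
      using that by (auto simp: N_def GLpos_mult matrix_mul_assoc)
    then have "m (g ** h) \<le> measure M ({a. h ** a \<in> N g} \<union> N h)"
      unfolding m_def using measurable_left[OF mN] by (intro finite_measure_mono) auto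
    also have "\<dots> \<le> measure M {a. h ** a \<in> N g} + m h"
      unfolding m_def using measurable_left[OF mN] by (intro measure_Un_le) auto
    finally show ?thesis using pull[OF that] by simp
  qed
  have m0: "m g \<ge> 0" for g by (simp add: m_def)
  have dilE: "dilation k (2 ^ j) ** a \<in> E \<longleftrightarrow> a \<in> E" if "a \<in> GLpos" for j a
    using that
  proof (induction j arbitrary: a)
    case (Suc j)
    have "dilation k (2 ^ Suc j) ** a = dilation k 2 ** (dilation k (2 ^ j) ** a)"
      by (simp add: matrix_mul_assoc dilation_mult)
    then show ?case using Suc dil[of "dilation k (2 ^ j) ** a"] by (simp add: GLpos_mult det_dilation)
  qed simp
  have mdil: "m (dilation k (2 ^ j)) = 0" "m (dilation k (inverse (2 ^ j))) = 0" for j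
  proof -
    have "N (dilation k (2 ^ j)) = {}" using dilE by (auto simp: N_def)
    then show "m (dilation k (2 ^ j)) = 0" by (simp add: m_def)
    have "(dilation k (inverse (2 ^ j)) ** a \<in> E) = (a \<in> E)" if "a \<in> GLpos" for a
    proof -
      have "dilation k (2 ^ j) ** (dilation k (inverse (2 ^ j)) ** a) = a"
        by (simp add: matrix_mul_assoc dilation_mult)
      then show ?thesis using dilE[of "dilation k (inverse (2 ^ j)) ** a" j] that by (simp add: GLpos_mult det_dilation)
    qed
    then have "N (dilation k (inverse (2 ^ j))) = {}" by (auto simp: N_def)
    then show "m (dilation k (inverse (2 ^ j))) = 0" by (simp add: m_def)
  qed
  have conj: "m g \<le> m (x ** (g ** y))" if "det g = 1" "det x = 1" "det y = 1" "m x = 0" "m y = 0" "y ** x = mat 1" for g x y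
  proof -
    have "g = y ** ((x ** (g ** y)) ** x)"
    proof -
      have "y ** ((x ** (g ** y)) ** x) = (y ** x) ** g ** (y ** x)" by (simp add: matrix_mul_assoc)
      then show ?thesis using that by simp
    qed
    then have "m g \<le> m y + (m (x ** (g ** y)) + m x)"
      using sub[of y "(x ** (g ** y)) ** x"] sub[of "x ** (g ** y)" x] that by (simp add: det_mul)
    then show ?thesis using that by simp
  qed
  have small: "\<exists>d>0. \<forall>t. \<bar>t\<bar> < d \<longrightarrow> m (transvection i l t) \<le> \<epsilon>" if il: "i \<noteq> l" and \<epsilon>: "\<epsilon> > 0" for i l \<epsilon>
  proof -
    let ?D = "measure lborel Dom"
    have D: "?D > 0" using Dom_finite Dom_pos by (simp add: measure_def enn2real_positive_iff)
    obtain K where K: "compact K" "K \<subseteq> Dom" "measure M (- K) \<le> \<epsilon> / 3"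
      using inner_compact[of "\<epsilon> / 3"] \<epsilon> by auto
    obtain r where r: "r > 0" "\<And>a. a \<in> K \<Longrightarrow> norm a \<le> r"
      using compact_imp_bounded[OF K(1)] by (meson bounded_pos)
    \<comment> \<open>The regularity argument requires a bounded set. For |t| < 1 a point of K and
      its image have norm at most 2r, so inside this ball E may be replaced by S.\<close>
    define S where "S = E \<inter> ball 0 (2 * r + 1)"
    have S[measurable]: "S \<in> sets borel" and bS: "bounded S" unfolding S_def by (auto intro: bounded_Int)
    obtain d where d: "d > 0" "\<And>t. \<bar>t\<bar> < d \<Longrightarrow> emeasure lborel {a\<in>S. transvection i l t ** a \<notin> S} \<le> ennreal (\<epsilon> / 3 * ?D)"
      using transvection_almost_preserves[OF S bS il, of "\<epsilon> / 3 * ?D"] \<epsilon> D by auto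
    have "m (transvection i l t) \<le> \<epsilon>" if t: "\<bar>t\<bar> < min d 1" for t
    proof -
      let ?T = "transvection i l t" and ?T' = "transvection i l (- t)"
      have TT: "?T' ** (?T ** a) = a" for a :: "real^'n^'n"
        using il by (simp add: matrix_mul_assoc transvection_add)
      define S1 where "S1 = {a\<in>S. ?T ** a \<notin> S}"
      define S2 where "S2 = {a\<in>S. ?T' ** a \<notin> S}"
      have mS[measurable]: "S1 \<in> sets borel" "S2 \<in> sets borel"
        unfolding S1_def S2_def using measurable_left[OF S, of ?T] measurable_left[OF S, of ?T']
        by (auto simp: Collect_conj_eq Collect_neg_eq)
      have N: "N ?T \<subseteq> - K \<union> (S1 \<union> {a. ?T ** a \<in> S2})"
      proof
        fix a assume a: "a \<in> N ?T"
        show "a \<in> - K \<union> (S1 \<union> {a. ?T ** a \<in> S2})"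
        proof (cases "a \<in> K")
          case True
          have "norm (?T ** a) \<le> norm (?T ** a - a) + norm a" using norm_triangle_ineq[of "?T ** a - a" a] by simp
          also have "\<dots> \<le> \<bar>t\<bar> * norm a + norm a" using norm_transvection_diff[of i l t a] by simp
          also have "\<dots> \<le> 1 * r + r" using t r True by (intro add_mono mult_mono) auto
          finally have "?T ** a \<in> ball 0 (2 * r + 1)" "a \<in> ball 0 (2 * r + 1)" using r True by (auto intro: le_less_trans[of _ r])
          then show ?thesis using a by (auto simp: N_def S1_def S2_def S_def TT)
        qed simp
      qed
      have mT: "{a. ?T ** a \<in> S2} \<in> sets borel" by (rule measurable_left) simp
      have mK: "K \<in> sets borel" using K by (simp add: compact_imp_closed borel_closed)
      have "emeasure lborel S1 \<le> ennreal (\<epsilon> / 3 * ?D)" unfolding S1_def using t by (intro d(2)) auto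
      then have 1: "measure M S1 \<le> \<epsilon> / 3" using measure_M_le[of S1 "\<epsilon> / 3 * ?D"] D \<epsilon> by simp
      have "emeasure lborel S2 \<le> ennreal (\<epsilon> / 3 * ?D)" unfolding S2_def using t by (intro d(2)) auto
      then have "emeasure lborel {a. ?T ** a \<in> S2} \<le> ennreal (\<epsilon> / 3 * ?D)"
        using emeasure_left[OF det_transvection[OF il] mS(2)] by simp
      then have 2: "measure M {a. ?T ** a \<in> S2} \<le> \<epsilon> / 3" using measure_M_le[OF mT, of "\<epsilon> / 3 * ?D"] D \<epsilon> by simp
      have "m ?T \<le> measure M (- K \<union> (S1 \<union> {a. ?T ** a \<in> S2}))"
        unfolding m_def using N mT mK by (intro finite_measure_mono) (auto simp: Compl_eq_Diff_UNIV)
      also have "\<dots> \<le> measure M (- K) + measure M (S1 \<union> {a. ?T ** a \<in> S2})"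
        using mT mK by (intro measure_Un_le) (auto simp: Compl_eq_Diff_UNIV)
      also have "measure M (S1 \<union> {a. ?T ** a \<in> S2}) \<le> measure M S1 + measure M {a. ?T ** a \<in> S2}"
        using mT by (intro measure_Un_le) auto
      finally show ?thesis using K(3) 1 2 by linarith
    qed
    then show ?thesis using d(1) by (intro exI[of _ "min d 1"]) auto
  qed
  have contract: "\<exists>j. \<bar>t / (2 ^ j) ^ CARD('n)\<bar> < d" if "d > 0" for t d :: real
  proof -
    have "(\<lambda>j. \<bar>t\<bar> * (1 / 2) ^ j) \<longlonglongrightarrow> \<bar>t\<bar> * 0" by (intro tendsto_intros LIMSEQ_power_zero) auto
    then have "eventually (\<lambda>j. \<bar>t\<bar> * (1 / 2) ^ j < d) sequentially" using that by (intro order_tendstoD) auto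
    then obtain j where j: "\<bar>t\<bar> * (1 / 2) ^ j < d" by (auto simp: eventually_sequentially)
    have "(2::real) ^ j \<le> (2 ^ j) ^ CARD('n)" by (rule self_le_power) auto
    then have "\<bar>t\<bar> / (2 ^ j) ^ CARD('n) \<le> \<bar>t\<bar> / 2 ^ j" by (intro divide_left_mono) auto
    then show ?thesis using j by (intro exI[of _ j]) (auto simp: power_one_over abs_divide)
  qed
  have root: "m (transvection i k t) = 0" "m (transvection k i t) = 0" if ik: "i \<noteq> k" for i t
  proof -
    have "m (transvection i k t) \<le> 0 + \<epsilon>" if \<epsilon>: "\<epsilon> > 0" for \<epsilon>
    proof -
      obtain d where d: "d > 0" "\<And>t. \<bar>t\<bar> < d \<Longrightarrow> m (transvection i k t) \<le> \<epsilon>" using small[OF ik \<epsilon>] by blast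
      obtain j where j: "\<bar>t / (2 ^ j) ^ CARD('n)\<bar> < d" using contract[OF d(1)] by blast
      have "m (transvection i k t) \<le> m (dilation k (inverse (2 ^ j)) ** (transvection i k t ** dilation k (2 ^ j)))"
        by (rule conj) (auto simp: det_transvection[OF ik] det_dilation mdil dilation_mult)
      also have "\<dots> \<le> \<epsilon>"
        using d(2)[OF j] dilation_conj(1)[OF ik, of "2 ^ j" t] by simp
      finally show ?thesis by simp
    qed
    then show "m (transvection i k t) = 0" using m0 field_le_epsilon by (metis order_antisym)
    have "m (transvection k i t) \<le> 0 + \<epsilon>" if \<epsilon>: "\<epsilon> > 0" for \<epsilon>
    proof -
      obtain d where d: "d > 0" "\<And>t. \<bar>t\<bar> < d \<Longrightarrow> m (transvection k i t) \<le> \<epsilon>" using small[OF ik[symmetric] \<epsilon>] by blast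
      obtain j where j: "\<bar>t / (2 ^ j) ^ CARD('n)\<bar> < d" using contract[OF d(1)] by blast
      have "m (transvection k i t) \<le> m (dilation k (2 ^ j) ** (transvection k i t ** dilation k (inverse (2 ^ j))))"
        by (rule conj) (auto simp: det_transvection[OF ik[symmetric]] det_dilation mdil dilation_mult)
      also have "\<dots> \<le> \<epsilon>"
        using d(2)[OF j] dilation_conj(2)[OF ik, of "2 ^ j" t] by simp
      finally show ?thesis by simp
    qed
    then show "m (transvection k i t) = 0" using m0 field_le_epsilon by (metis order_antisym)
  qed
  have tr: "m (transvection i j t) = 0" if "i \<noteq> j" for i j t
  proof (cases "i = k \<or> j = k")
    case True then show ?thesis using root that by auto
  next
    case False
    then have "m (transvection i j t) \<le> m (transvection i k t) + (m (transvection k j 1) + (m (transvection i k (-t)) + m (transvection k j (-1))))"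
      using that
      by (subst transvection_commutator[of i j k t, symmetric])
        (auto intro!: order_trans[OF sub] add_mono order_refl simp: det_mul det_transvection)
    then show ?thesis using root False m0[of "transvection i j t"] by auto
  qed
  have words: "m g = 0 \<and> det g = 1" if "g \<in> transvection_words l" for g l
    using that
  proof (induction l arbitrary: g)
    case 0
    then show ?case by (simp add: m_def N_def)
  next
    case (Suc l)
    then obtain i j t h where g: "g = transvection i j t ** h" "i \<noteq> j" "h \<in> transvection_words l" by auto
    with Suc have "m h = 0" "det h = 1" by auto
    then show ?case using sub[of "transvection i j t" h] g tr[OF g(2)] m0[of g] by (auto simp: det_transvection)
  qed
  have SL: "AE a in lborel. a \<in> GLpos \<longrightarrow> (g ** a \<in> E) = (a \<in> E)" if g: "det g = 1" for g
  proof -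
    have "m g = 0" using words SL_bounded_generation[OF g] card_n by auto
    then have "AE a in M. a \<notin> N g" unfolding m_def by (intro AE_not_in) (simp add: null_setsI emeasure_eq_measure)
    then have "AE a in lborel. a \<in> GLpos \<longrightarrow> a \<notin> N g"
    proof (rule AE_GLpos_of_AE_M)
      show "a ** \<gamma> \<notin> N g \<longleftrightarrow> a \<notin> N g" if "a \<in> GLpos" "\<gamma> \<in> \<Gamma>" for a \<gamma> using Ninv that g by blast
      show "c *\<^sub>R a \<notin> N g \<longleftrightarrow> a \<notin> N g" if "a \<in> GLpos" "c > 0" for a c
        using that g scale[of "g ** a" c] scale[of a c] by (auto simp: N_def GLpos_scaleR scaleR_matrix_mult GLpos_mult)
    qed measurable
    then show ?thesis by eventually_elim (auto simp: N_def)
  qed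
  have "AE a in lborel. a \<in> GLpos \<longrightarrow> (AE b in lborel. b \<in> GLpos \<longrightarrow> (b \<in> E) = (a \<in> E))"
  proof (rule AE_constant[where R = "\<lambda>b a. (b \<in> E) = (a \<in> E)"])
    have "Measurable.pred (borel \<Otimes>\<^sub>M borel) (\<lambda>p. (fst p \<in> E) = (snd p \<in> E))" by measurable
    then show "{p. (fst p \<in> E) = (snd p \<in> E)} \<in> sets (borel \<Otimes>\<^sub>M borel)" by (simp add: pred_def space_pair_measure)
    show "AE a in lborel. a \<in> GLpos \<longrightarrow> (g ** a \<in> E) = (a \<in> E)" if "det g = 1" for g by (rule SL[OF that])
    show "((c *\<^sub>R b \<in> E) = (a \<in> E)) \<longleftrightarrow> ((b \<in> E) = (a \<in> E))" if "b \<in> GLpos" "c > 0" for b a c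
      using scale[OF that] by blast
  qed
  from AE_GLpos_ex[OF this] obtain a where "AE b in lborel. b \<in> GLpos \<longrightarrow> (b \<in> E) = (a \<in> E)" ..
  then show ?thesis by (cases "a \<in> E") auto
qed

end

section \<open>Ergodic upper bounds\<close>

context SL_lattice
begin

text \<open>A superlevel set is not invariant, but its saturation E under powers of the dilation and
  the lattice is. If E were conull, then \<psi> \<ge> b - 2c almost everywhere, since one lattice
  element and one power lose c each, contrary to the mean. That c bounds every power at once is what
  keeps the loss at 2c.\<close>

lemma ergodic_upper_bound:
  fixes \<psi> :: "real^'n^'n \<Rightarrow> real"
  assumes \<psi>[measurable]: "\<psi> \<in> borel_measurable borel" and bd: "\<And>a. \<bar>\<psi> a\<bar> \<le> C"
    and scale: "\<And>a c. a \<in> GLpos \<Longrightarrow> c > 0 \<Longrightarrow> \<psi> (c *\<^sub>R a) = \<psi> a"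
    and inv: "\<And>\<gamma>. \<gamma> \<in> \<Gamma> \<Longrightarrow> AE a in lborel. a \<in> GLpos \<longrightarrow> \<psi> (a ** \<gamma>) \<le> \<psi> a + c"
    and dil: "\<And>j::int. AE a in lborel. a \<in> GLpos \<longrightarrow> \<psi> (dilation k (2 powi j) ** a) \<le> \<psi> a + c"
    and int: "(\<integral>a. \<psi> a \<partial>M) \<le> \<kappa>"
  shows "AE a in lborel. a \<in> GLpos \<longrightarrow> \<psi> a \<le> \<kappa> + 2 * c"
proof -
  interpret prob_space M by (rule prob_M)
  let ?d = "\<lambda>j::int. dilation k (2 powi j) :: real^'n^'n"
  have dd: "?d i ** ?d j = ?d (i + j)" for i j by (simp add: dilation_mult power_int_add)
  have det_d: "det (?d j) = 1" for j by (simp add: det_dilation)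
  have step: "AE a in lborel. a \<in> GLpos \<longrightarrow> \<psi> a \<le> b" if b: "b > \<kappa> + 2 * c" for b
  proof -
    define E where "E = {a \<in> GLpos. \<exists>j. \<exists>\<gamma>\<in>\<Gamma>. \<psi> (?d j ** a ** \<gamma>) > b}"
    have EI: "a \<in> E \<longleftrightarrow> (\<exists>j. \<exists>\<gamma>\<in>\<Gamma>. \<psi> (?d j ** a ** \<gamma>) > b)" if "a \<in> GLpos" for a
      using that by (simp add: E_def)
    have E_eq: "E = GLpos \<inter> (\<Union>j. \<Union>\<gamma>\<in>\<Gamma>. {a. \<psi> (?d j ** a ** \<gamma>) > b})"
      by (auto simp: E_def)
    have E: "E \<in> sets borel"
    proof -
      have "{a. \<psi> (?d j ** a ** \<gamma>) > b} \<in> sets borel" for j and \<gamma> :: "real^'n^'n" by measurable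
      then show ?thesis unfolding E_eq
        by (intro sets.Int GLpos_measurable sets.countable_UN'' countable_lattice) auto
    qed
    have 1: "a ** \<gamma> \<in> E \<longleftrightarrow> a \<in> E" if a: "a \<in> GLpos" "\<gamma> \<in> \<Gamma>" for a \<gamma>
    proof -
      have *: "?d j ** (a ** \<gamma>) ** \<gamma>' = ?d j ** a ** (\<gamma> ** \<gamma>')" for j and \<gamma>' :: "real^'n^'n" by (simp add: matrix_mul_assoc)
      have **: "?d j ** a ** \<gamma>' = ?d j ** (a ** \<gamma>) ** (matrix_inv \<gamma> ** \<gamma>')" for j and \<gamma>' :: "real^'n^'n"
        using inv_left'[OF a(2), of \<gamma>'] by (simp add: matrix_mul_assoc[symmetric])
      have ag: "a ** \<gamma> \<in> GLpos" using a by (simp add: GLpos_mult det_in)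
      show ?thesis
        unfolding EI[OF a(1)] EI[OF ag]
      proof
        assume "\<exists>j. \<exists>\<gamma>'\<in>\<Gamma>. b < \<psi> (?d j ** (a ** \<gamma>) ** \<gamma>')"
        then show "\<exists>j. \<exists>\<gamma>'\<in>\<Gamma>. b < \<psi> (?d j ** a ** \<gamma>')" unfolding * using mult_in[OF a(2)] by blast
      next
        assume "\<exists>j. \<exists>\<gamma>'\<in>\<Gamma>. b < \<psi> (?d j ** a ** \<gamma>')"
        then obtain j \<gamma>' where "\<gamma>' \<in> \<Gamma>" "b < \<psi> (?d j ** (a ** \<gamma>) ** (matrix_inv \<gamma> ** \<gamma>'))" using ** by metis
        then show "\<exists>j. \<exists>\<gamma>'\<in>\<Gamma>. b < \<psi> (?d j ** (a ** \<gamma>) ** \<gamma>')" using mult_in[OF inv_in[OF a(2)]] by blast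
      qed
    qed
    have 2: "s *\<^sub>R a \<in> E \<longleftrightarrow> a \<in> E" if a: "a \<in> GLpos" "s > 0" for a s
    proof -
      have "\<psi> (?d j ** (s *\<^sub>R a) ** \<gamma>) = \<psi> (?d j ** a ** \<gamma>)" if "\<gamma> \<in> \<Gamma>" for j \<gamma>
        using scale[of "?d j ** a ** \<gamma>" s] a that by (simp add: scaleR_matrix_mult GLpos_mult det_d det_in)
      then show ?thesis using EI[OF a(1)] EI[OF GLpos_scaleR[OF a]] by auto
    qed
    have 3: "dilation k 2 ** a \<in> E \<longleftrightarrow> a \<in> E" if a: "a \<in> GLpos" for a
    proof -
      have da: "dilation k 2 ** a \<in> GLpos" using a by (simp add: GLpos_mult det_dilation)
      have "?d j ** (dilation k 2 ** a) ** \<gamma> = ?d (j + 1) ** a ** \<gamma>" for j and \<gamma> :: "real^'n^'n"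
        using dd[of j 1] by (simp add: matrix_mul_assoc)
      then have "dilation k 2 ** a \<in> E \<longleftrightarrow> (\<exists>j. \<exists>\<gamma>\<in>\<Gamma>. \<psi> (?d (j + 1) ** a ** \<gamma>) > b)"
        unfolding EI[OF da] by presburger
      also have "\<dots> \<longleftrightarrow> (\<exists>j. \<exists>\<gamma>\<in>\<Gamma>. \<psi> (?d j ** a ** \<gamma>) > b)"
      proof
        assume "\<exists>j. \<exists>\<gamma>\<in>\<Gamma>. \<psi> (?d j ** a ** \<gamma>) > b"
        then obtain j where "\<exists>\<gamma>\<in>\<Gamma>. \<psi> (?d ((j - 1) + 1) ** a ** \<gamma>) > b" by auto
        then show "\<exists>j. \<exists>\<gamma>\<in>\<Gamma>. \<psi> (?d (j + 1) ** a ** \<gamma>) > b" by blast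
      qed blast
      finally show ?thesis using EI[OF a] by simp
    qed
    have "\<not> (AE a in lborel. a \<in> GLpos \<longrightarrow> a \<in> E)"
    proof
      assume con: "AE a in lborel. a \<in> GLpos \<longrightarrow> a \<in> E"
      have i1: "AE a in lborel. \<forall>j. \<forall>\<gamma>\<in>\<Gamma>. ?d j ** a \<in> GLpos \<longrightarrow> \<psi> (?d j ** a ** \<gamma>) \<le> \<psi> (?d j ** a) + c"
        unfolding AE_all_countable AE_ball_countable[OF countable_lattice]
      proof (intro allI ballI)
        fix j \<gamma> assume "\<gamma> \<in> \<Gamma>"
        show "AE a in lborel. ?d j ** a \<in> GLpos \<longrightarrow> \<psi> (?d j ** a ** \<gamma>) \<le> \<psi> (?d j ** a) + c"
          using inv[OF \<open>\<gamma> \<in> \<Gamma>\<close>] det_d[of j]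
          by (intro AE_matrix_mult_left[where P = "\<lambda>a. a \<in> GLpos \<longrightarrow> \<psi> (a ** \<gamma>) \<le> \<psi> a + c"]) auto
      qed
      have i2: "AE a in lborel. \<forall>j. a \<in> GLpos \<longrightarrow> \<psi> (?d j ** a) \<le> \<psi> a + c"
        unfolding AE_all_countable using dil by blast
      have "AE a in lborel. a \<in> GLpos \<longrightarrow> b - 2 * c \<le> \<psi> a"
        using con i1 i2
      proof eventually_elim
        case (elim a)
        show ?case
        proof
          assume a: "a \<in> GLpos"
          then obtain j \<gamma> where g: "\<gamma> \<in> \<Gamma>" "\<psi> (?d j ** a ** \<gamma>) > b" using elim(1) EI by blast
          have "\<psi> (?d j ** a ** \<gamma>) \<le> \<psi> (?d j ** a) + c" using elim(2) g(1) GLpos_mult(2)[OF a det_d] by blast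
          moreover have "\<psi> (?d j ** a) \<le> \<psi> a + c" using elim(3) a by blast
          ultimately show "b - 2 * c \<le> \<psi> a" using g(2) by linarith
        qed
      qed
      from AE_M[OF this] AE_M_Dom have "AE a in M. b - 2 * c \<le> \<psi> a"
        by eventually_elim (simp add: Dom_def)
      then have "(\<integral>a. b - 2 * c \<partial>M) \<le> (\<integral>a. \<psi> a \<partial>M)"
        using bd by (intro integral_mono_AE integrable_bounded[of \<psi> C]) auto
      then show False using int b prob_space by simp
    qed
    then have "AE a in lborel. a \<in> GLpos \<longrightarrow> a \<notin> E"
      using dilation_ergodic[OF E 1 2 3] by blast
    then show ?thesis
    proof eventually_elim
      case (elim a)
      show ?case
      proof
        assume a: "a \<in> GLpos"
        then have "\<not> \<psi> (?d 0 ** a ** mat 1) > b" using elim EI one_in by blast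
        then show "\<psi> a \<le> b" by simp
      qed
    qed
  qed
  have "AE a in lborel. \<forall>n. a \<in> GLpos \<longrightarrow> \<psi> a \<le> \<kappa> + 2 * c + inverse (real (Suc n))"
    unfolding AE_all_countable by (intro allI step) auto
  then show ?thesis
  proof eventually_elim
    case (elim a)
    have "\<psi> a \<le> \<kappa> + 2 * c + e" if "a \<in> GLpos" "e > 0" for e
      using reals_Archimedean[OF that(2)] elim that(1) by (meson add_left_mono less_imp_le order_trans)
    then show ?case using field_le_epsilon by blast
  qed
qed

end

section \<open>Almost everywhere convergent means\<close>

text \<open>Midpoints are all that the parallelogram law needs, and every convex estimate extends to such means by induction.\<close>

inductive_set midpoint_means :: "(nat \<Rightarrow> 'a \<Rightarrow> 'v::real_vector) \<Rightarrow> nat \<Rightarrow> ('a \<Rightarrow> 'v) set"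
  for f m where
  base: "m \<le> n \<Longrightarrow> f n \<in> midpoint_means f m"
| mid: "g \<in> midpoint_means f m \<Longrightarrow> h \<in> midpoint_means f m \<Longrightarrow> (\<lambda>x. (1/2) *\<^sub>R (g x + h x)) \<in> midpoint_means f m"

lemma midpoint_means_mono: "m \<le> m' \<Longrightarrow> g \<in> midpoint_means f m' \<Longrightarrow> g \<in> midpoint_means f m"
  by (rotate_tac, induction rule: midpoint_means.induct) (auto intro: midpoint_means.intros)

lemma midpoint_means_le:
  assumes "g \<in> midpoint_means f m" and "\<And>n. m \<le> n \<Longrightarrow> p (f n) \<le> (C::real)"
    and "\<And>g h. g \<in> midpoint_means f m \<Longrightarrow> h \<in> midpoint_means f m \<Longrightarrow> p (\<lambda>x. (1/2) *\<^sub>R (g x + h x)) \<le> (1/2) * (p g + p h)"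
  shows "p g \<le> C"
  using assms(1)
proof induction
  case (mid g h)
  have "p (\<lambda>x. (1/2) *\<^sub>R (g x + h x)) \<le> (1/2) * (p g + p h)" using mid by (intro assms(3))
  also have "\<dots> \<le> (1/2) * (C + C)" using mid by (intro mult_left_mono add_mono) auto
  finally show ?case by simp
qed (rule assms(2))

lemma norm_midpoint_le: "norm ((1/2) *\<^sub>R (x + y) - (1/2) *\<^sub>R (x' + y')) \<le> (1/2) * (norm (x - x') + norm (y - y'))"
proof -
  have "(1/2) *\<^sub>R (x + y) - (1/2) *\<^sub>R (x' + y') = (1/2) *\<^sub>R ((x - x') + (y - y'))" by (simp add: algebra_simps)
  then show ?thesis using norm_triangle_ineq[of "x - x'" "y - y'"] by simp
qed

lemma parallelogram_midpoint:
  fixes x y :: "'v::real_inner"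
  shows "(norm (x - y))\<^sup>2 = 2 * (norm x)\<^sup>2 + 2 * (norm y)\<^sup>2 - 4 * (norm ((1/2) *\<^sub>R (x + y)))\<^sup>2"
  by (simp add: power_mult_distrib power2_norm_eq_inner algebra_simps inner_commute)

text \<open>This takes the place of a pointwise ergodic theorem. Nearly minimise the squared norm
  over each tail: the infima increase and are bounded, so the parallelogram law makes the minimisers
  Cauchy in L2, hence in L1, and a subsequence converges almost everywhere. Tail sets decrease, so
  the subsequence still lies in the right ones.\<close>

lemma midpoint_means_AE_convergent:
  fixes f :: "nat \<Rightarrow> 'a \<Rightarrow> 'v::euclidean_space"
  assumes "finite_measure N" and [measurable]: "\<And>n. f n \<in> borel_measurable N" and bd: "\<And>n x. norm (f n x) \<le> 1"
  shows "\<exists>G. (\<forall>m. G m \<in> midpoint_means f m) \<and> (AE x in N. convergent (\<lambda>m. G m x))"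
proof -
  interpret finite_measure N by fact
  let ?K = "midpoint_means f"
  have meas: "g \<in> borel_measurable N" if "g \<in> ?K m" for g m
    using that by induction auto
  have b1: "norm (g x) \<le> 1" if "g \<in> ?K m" for g m x
    using that
  proof (rule midpoint_means_le[where p = "\<lambda>g. norm (g x)"])
    show "norm ((1/2) *\<^sub>R (g x + h x)) \<le> (1/2) * (norm (g x) + norm (h x))" for g h
      using norm_midpoint_le[of "g x" "h x" 0 0] by simp
  qed (rule bd)
  define J where "J g = (\<integral>x. (norm (g x))\<^sup>2 \<partial>N)" for g :: "'a \<Rightarrow> 'v"
  have int: "integrable N (\<lambda>x. (norm (g x))\<^sup>2)" if "g \<in> ?K m" for g m
    using b1[OF that] meas[OF that] power_mono[of "norm (g _)" 1 2]
    by (intro integrable_const_bound[of _ 1]) (auto intro: power_le_one)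
  have J0: "0 \<le> J g" for g unfolding J_def by simp
  have J1: "J g \<le> measure N (space N)" if "g \<in> ?K m" for g m
  proof -
    have "J g \<le> (\<integral>x. 1 \<partial>N)" unfolding J_def
      using b1[OF that] int[OF that] by (intro integral_mono) (auto intro: power_le_one)
    then show ?thesis by simp
  qed
  define L where "L m = Inf (J ` ?K m)" for m
  have ne: "?K m \<noteq> {}" for m using midpoint_means.base[of m m f] by blast
  have bb: "bdd_below (J ` ?K m)" for m using J0 by (intro bdd_belowI[of _ 0]) auto
  have L_le: "L m \<le> J g" if "g \<in> ?K m" for m g unfolding L_def using that bb by (intro cInf_lower) auto
  have L_mono: "L m \<le> L m'" if "m \<le> m'" for m m'
    unfolding L_def using midpoint_means_mono[OF that] ne bb by (intro cInf_superset_mono) auto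
  have "L m \<le> measure N (space N)" for m
    using L_le[OF midpoint_means.base] J1[OF midpoint_means.base] order_refl by (meson order_trans)
  then have "convergent L"
    using L_mono by (metis convergentI incseq_convergent incseq_def)
  then have LC: "Cauchy L" by (rule convergent_Cauchy)
  have "\<exists>g. g \<in> ?K m \<and> J g < L m + inverse (Suc m)" for m
    using cInf_lessD[of "J ` ?K m" "L m + inverse (Suc m)"] ne unfolding L_def by auto
  then obtain g where g: "\<And>m. g m \<in> ?K m" "\<And>m. J (g m) < L m + inverse (Suc m)" by metis
  have [measurable]: "g m \<in> borel_measurable N" for m by (rule meas[OF g(1)])
  have gb: "norm (g m x) \<le> 1" for m x by (rule b1[OF g(1)])
  have gi: "integrable N (g m)" for m using gb by (intro integrable_const_bound[of _ 1]) auto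
  have di2: "integrable N (\<lambda>x. (norm (g i x - g j x))\<^sup>2)" for i j
  proof (rule integrable_const_bound[of _ 4])
    have "norm (g i x - g j x) \<le> 2" for x using norm_triangle_ineq4[of "g i x" "g j x"] gb[of i x] gb[of j x] by linarith
    then have "(norm (g i x - g j x))\<^sup>2 \<le> 2\<^sup>2" for x by (rule power_mono) simp
    then show "AE x in N. norm ((norm (g i x - g j x))\<^sup>2) \<le> 4" by simp
  qed measurable
  have sq: "(\<integral>x. (norm (g i x - g j x))\<^sup>2 \<partial>N) \<le> 2 * (L j - L i) + 4 * inverse (Suc i)" if ij: "i \<le> j" for i j
  proof -
    define h where "h = (\<lambda>x. (1/2) *\<^sub>R (g i x + g j x))"
    have h: "h \<in> ?K i" unfolding h_def by (intro midpoint_means.mid g midpoint_means_mono[OF ij])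
    have "(\<integral>x. (norm (g i x - g j x))\<^sup>2 \<partial>N) = 2 * J (g i) + 2 * J (g j) - 4 * J h"
      unfolding J_def parallelogram_midpoint[of "g i _" "g j _"]
      using int[OF g(1), of i] int[OF g(1), of j] int[OF h] by (simp add: h_def)
    moreover have "inverse (real (Suc j)) \<le> inverse (Suc i)" using ij by (intro le_imp_inverse_le) auto
    moreover have "I \<le> 2 * (Lj - Li) + 4 * ei"
      if "I = 2 * a + 2 * b - 4 * c" "ej \<le> ei" "a < Li + ei" "b < Lj + ej" "Li \<le> c" for I Lj Li ei ej a b c :: real
      using that by (smt (verit))
    ultimately show ?thesis using g(2)[of i] g(2)[of j] L_le[OF h] by blast
  qed
  let ?S = "measure N (space N)"
  have "\<exists>n0. \<forall>i\<ge>n0. \<forall>j\<ge>n0. (\<integral>x. norm (g i x - g j x) \<partial>N) < e" if e: "e > 0" for e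
  proof -
    define d where "d = e / 2 / (?S + 1)"
    have S: "0 \<le> ?S" by simp
    have d: "d > 0" using e S unfolding d_def by (intro divide_pos_pos add_nonneg_pos) auto
    obtain n1 where n1: "\<And>i j. i \<ge> n1 \<Longrightarrow> j \<ge> n1 \<Longrightarrow> norm (L i - L j) < e * d / 8"
      using LC e d unfolding Cauchy_iff by (metis divide_pos_pos mult_pos_pos zero_less_numeral)
    obtain n2 where n2: "inverse (real (Suc n2)) < e * d / 16"
      using reals_Archimedean[of "e * d / 16"] e d by auto
    have le: "(\<integral>x. norm (g i x - g j x) \<partial>N) < e" if "max n1 n2 \<le> i" "i \<le> j" for i j
    proof -
      have "inverse (real (Suc i)) \<le> inverse (Suc n2)" using that by (intro le_imp_inverse_le) auto
      moreover have "\<bar>L j - L i\<bar> < e * d / 8" using n1[of j i] that by simp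
      then have "L j - L i < e * d / 8" by linarith
      ultimately have "(\<integral>x. (norm (g i x - g j x))\<^sup>2 \<partial>N) < e * d / 2"
        using sq[OF that(2)] n2 by argo
      then have lt: "(\<integral>x. (norm (g i x - g j x))\<^sup>2 \<partial>N) / d < e / 2" using d by (simp add: pos_divide_less_eq mult.commute)
      \<comment> \<open>This trades L2 for L1 on a finite measure; d is chosen so that its own
        contribution is at most e/2.\<close>
      have pt: "r \<le> d + r\<^sup>2 / d" if "r \<ge> 0" for r :: real
      proof (cases "r \<le> d")
        case False
        then have "d * r \<le> r * r" using that d by (intro mult_right_mono) auto
        then show ?thesis using d by (simp add: field_simps power2_eq_square add_increasing)
      qed (use d in \<open>auto intro: add_increasing2\<close>)
      have "(\<integral>x. norm (g i x - g j x) \<partial>N) \<le> (\<integral>x. d + (norm (g i x - g j x))\<^sup>2 / d \<partial>N)"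
        using di2[of i j] gi by (intro integral_mono pt) auto
      also have "\<dots> = ?S * d + (\<integral>x. (norm (g i x - g j x))\<^sup>2 \<partial>N) / d"
        using di2[of i j] by simp
      also have "?S * d \<le> e / 2"
      proof -
        have "?S * d \<le> (?S + 1) * d" using d by simp
        also have "\<dots> = e / 2" unfolding d_def using S by (intro nonzero_mult_div_cancel_left[of "?S + 1" "e / 2", unfolded times_divide_eq_right[symmetric]]) linarith
        finally show ?thesis .
      qed
      finally show ?thesis using lt by linarith
    qed
    have "(\<integral>x. norm (g i x - g j x) \<partial>N) < e" if "max n1 n2 \<le> i" "max n1 n2 \<le> j" for i j
      using le[of i j] le[of j i] that by (cases "i \<le> j") (auto simp: norm_minus_commute)
    then show ?thesis by blast
  qed
  then obtain r where r: "strict_mono r" "AE x in N. Cauchy (\<lambda>i. g (r i) x)"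
    by (rule cauchy_L1_AE_cauchy_subseq[OF gi])
  have "(\<lambda>x. g (r m) x) \<in> ?K m" for m
    using midpoint_means_mono[OF strict_mono_imp_increasing[OF r(1)] g(1)[of "r m"]] .
  moreover have "AE x in N. convergent (\<lambda>m. g (r m) x)"
    using r(2) by eventually_elim (rule Cauchy_convergent)
  ultimately show ?thesis by (intro exI[of _ "\<lambda>m. g (r m)"]) auto
qed

section \<open>Averaging along a dilation\<close>

context near_rep
begin

definition dist1 :: "real^'n^'n \<Rightarrow> real" where
  "dist1 g = (\<integral>a. norm (\<zeta> (g ** a) - \<zeta> a) \<partial>M)"

lemma dist1_integrable: "integrable M (\<lambda>a. norm (\<zeta> (g ** a) - \<zeta> a))"
  using norm_\<zeta>_diff by (intro integrable_bounded[where C = 2]) auto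

lemma dist1_le_sqdist:
  assumes "sqdist g \<le> e\<^sup>2" "e > 0"
  shows "dist1 g \<le> e"
proof -
  have pt: "r \<le> e / 2 + r\<^sup>2 / (2 * e)" for r :: real
  proof -
    have "0 \<le> (r - e)\<^sup>2 / (2 * e)" using assms by simp
    also have "(r - e)\<^sup>2 / (2 * e) = e / 2 + r\<^sup>2 / (2 * e) - r"
      using assms by (simp add: field_simps power2_eq_square)
    finally show ?thesis by simp
  qed
  have "dist1 g \<le> (\<integral>a. e / 2 + (norm (\<zeta> (g ** a) - \<zeta> a))\<^sup>2 / (2 * e) \<partial>M)"
    unfolding dist1_def using sqdist_integrable[of g] dist1_integrable[of g] by (intro integral_mono pt) auto
  also have "\<dots> = e / 2 + sqdist g / (2 * e)"
    unfolding sqdist_def using sqdist_integrable[of g] by (simp add: prob_UNIV)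
  also have "\<dots> \<le> e / 2 + e\<^sup>2 / (2 * e)" using assms by (intro add_left_mono divide_right_mono) auto
  also have "\<dots> = e" using assms by (simp add: power2_eq_square)
  finally show ?thesis .
qed

text \<open>Near equivariance enters twice, for the field and for its translate by g, hence
  2\<delta>; the rest is the triangle inequality and invariance of \<open>M\<close>.\<close>

lemma dist1_mult:
  assumes "det g = 1" "det h = 1"
  shows "dist1 (g ** h) \<le> dist1 g + dist1 h + 2 * \<delta>"
proof -
  let ?f = "\<lambda>b. norm (\<zeta> (g ** b) - \<zeta> b)"
  have tri: "norm (x - y + z + w) \<le> norm x + norm y + norm z + norm w" for x y z w :: 'v
    using norm_triangle_ineq[of "x - y + z" w] norm_triangle_ineq[of "x - y" z] norm_triangle_ineq4[of x y] by linarith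
  have tw: "twist (\<lambda>a. \<pi> (\<sigma> (h ** a))) (\<lambda>a. q (h ** a))" by (rule twist_translate[OF assms(2)])
  have fi: "integrable M (\<lambda>a. ?f (q (h ** a)))"
    using norm_\<zeta>_diff by (intro integrable_bounded[where C = 2]) auto
  have "dist1 (g ** h) \<le> (\<integral>a. ?f (q (h ** a)) + norm (\<zeta> (h ** a) - \<zeta> a) + 2 * \<delta> \<partial>M)"
    unfolding dist1_def
  proof (rule integral_mono_AE[OF dist1_integrable])
    show "AE a in M. norm (\<zeta> (g ** h ** a) - \<zeta> a) \<le> ?f (q (h ** a)) + norm (\<zeta> (h ** a) - \<zeta> a) + 2 * \<delta>"
      using AE_M_Dom
    proof eventually_elim
      case (elim a)
      then have a: "a \<in> GLpos" by (simp add: Dom_def)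
      let ?U = "\<pi> (\<sigma> (h ** a))" and ?b = "q (h ** a)"
      have 1: "norm (?U (\<zeta> (g ** ?b)) - \<zeta> (g ** (h ** a))) \<le> \<delta>" by (rule twist_close[OF assms a])
      have 2: "norm (?U (\<zeta> ?b) - \<zeta> (h ** a)) \<le> \<delta>"
        using twist_close[of "mat 1" h a] assms(2) a by simp
      have 3: "norm (?U (\<zeta> (g ** ?b)) - ?U (\<zeta> ?b)) = ?f ?b"
        using \<pi>_norm[OF \<sigma>_in, of "h ** a" "\<zeta> (g ** ?b) - \<zeta> ?b"] \<pi>_linear[OF \<sigma>_in] by (simp add: linear_diff)
      have "\<zeta> (g ** (h ** a)) - \<zeta> a = (?U (\<zeta> (g ** ?b)) - ?U (\<zeta> ?b)) - (?U (\<zeta> (g ** ?b)) - \<zeta> (g ** (h ** a)))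
          + (?U (\<zeta> ?b) - \<zeta> (h ** a)) + (\<zeta> (h ** a) - \<zeta> a)" by simp
      then have "norm (\<zeta> (g ** (h ** a)) - \<zeta> a) \<le> norm (?U (\<zeta> (g ** ?b)) - ?U (\<zeta> ?b)) + norm (?U (\<zeta> (g ** ?b)) - \<zeta> (g ** (h ** a)))
          + norm (?U (\<zeta> ?b) - \<zeta> (h ** a)) + norm (\<zeta> (h ** a) - \<zeta> a)"
        using tri by metis
      then show ?case using 1 2 3 by (simp add: matrix_mul_assoc)
    qed
  qed (use fi dist1_integrable in auto)
  also have "\<dots> = (\<integral>a. ?f (q (h ** a)) \<partial>M) + dist1 h + 2 * \<delta>"
    unfolding dist1_def using fi dist1_integrable by (simp add: prob_UNIV)
  also have "(\<integral>a. ?f (q (h ** a)) \<partial>M) = dist1 g"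
    unfolding dist1_def by (rule integral_twist[OF tw, of ?f]) measurable
  finally show ?thesis .
qed

lemma dist1_words:
  assumes tr: "\<And>i j t. i \<noteq> j \<Longrightarrow> dist1 (transvection i j t) \<le> e" and "g \<in> transvection_words l"
  shows "det g = 1 \<and> dist1 g \<le> l * (e + 2 * \<delta>)"
  using assms(2)
proof (induction l arbitrary: g)
  case 0
  then show ?case by (simp add: dist1_def)
next
  case (Suc l)
  then obtain i j t h where g: "g = transvection i j t ** h" "i \<noteq> j" "h \<in> transvection_words l" by auto
  have h: "det h = 1" "dist1 h \<le> l * (e + 2 * \<delta>)" using Suc.IH[OF g(3)] by auto
  have "dist1 g \<le> dist1 (transvection i j t) + dist1 h + 2 * \<delta>"
    unfolding g(1) using g(2) h(1) by (intro dist1_mult det_transvection)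
  also have "\<dots> \<le> e + l * (e + 2 * \<delta>) + 2 * \<delta>" by (intro add_mono tr h order_refl g(2))
  also have "\<dots> = Suc l * (e + 2 * \<delta>)" by (simp add: algebra_simps)
  finally show ?case using g h by (simp add: det_mul det_transvection)
qed

definition orbit_mean :: "'n \<Rightarrow> nat \<Rightarrow> real^'n^'n \<Rightarrow> 'v" where
  "orbit_mean k n a = (1 / real (n + 1)) *\<^sub>R (\<Sum>j\<le>n. \<zeta> (dilation k (2 ^ j) ** a))"

lemma norm_mean_le:
  fixes f :: "nat \<Rightarrow> 'v"
  assumes "\<And>j. norm (f j) \<le> C"
  shows "norm ((1 / real (n + 1)) *\<^sub>R (\<Sum>j\<le>n. f j)) \<le> C"
proof -
  have "norm (\<Sum>j\<le>n. f j) \<le> (\<Sum>j\<le>n. C)" using assms by (intro sum_norm_le) auto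
  also have "\<dots> = real (n + 1) * C" by simp
  finally have "norm (\<Sum>j\<le>n. f j) / real (n + 1) \<le> C" by (simp add: divide_le_eq mult.commute del: of_nat_add)
  then show ?thesis by simp
qed

lemma orbit_mean_measurable [measurable]: "orbit_mean k n \<in> borel_measurable borel"
  unfolding orbit_mean_def by measurable

lemma norm_orbit_mean: "norm (orbit_mean k n a) \<le> 1"
  unfolding orbit_mean_def by (rule norm_mean_le) simp

lemma orbit_mean_scaleR: "a \<in> GLpos \<Longrightarrow> c > 0 \<Longrightarrow> orbit_mean k n (c *\<^sub>R a) = orbit_mean k n a"
  unfolding orbit_mean_def by (simp add: scaleR_matrix_mult \<zeta>_scaleR GLpos_mult det_dilation)

lemma orbit_mean_dilation: "norm (orbit_mean k n (dilation k 2 ** a) - orbit_mean k n a) \<le> 2 / real (n + 1)"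
proof -
  have "(\<Sum>j\<le>n. \<zeta> (dilation k (2 ^ j) ** (dilation k 2 ** a))) - (\<Sum>j\<le>n. \<zeta> (dilation k (2 ^ j) ** a))
      = (\<Sum>j\<le>n. \<zeta> (dilation k (2 ^ Suc j) ** a) - \<zeta> (dilation k (2 ^ j) ** a))"
    by (simp add: matrix_mul_assoc dilation_mult sum_subtractf mult.commute)
  also have "\<dots> = \<zeta> (dilation k (2 ^ Suc n) ** a) - \<zeta> (dilation k (2 ^ 0) ** a)"
    by (induction n) simp_all
  finally have "orbit_mean k n (dilation k 2 ** a) - orbit_mean k n a
      = (1 / real (n + 1)) *\<^sub>R (\<zeta> (dilation k (2 ^ Suc n) ** a) - \<zeta> (dilation k (2 ^ 0) ** a))"
    unfolding orbit_mean_def scaleR_diff_right[symmetric] by simp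
  then show ?thesis using norm_\<zeta>_diff by (simp add: divide_right_mono)
qed

lemma orbit_mean_mult:
  assumes "a \<in> GLpos" "\<gamma> \<in> \<Gamma>"
  shows "norm (orbit_mean k n (a ** \<gamma>) - \<pi> (matrix_inv \<gamma>) (orbit_mean k n a)) \<le> \<delta>"
proof -
  let ?d = "\<lambda>j. dilation k (2 ^ j) :: real^'n^'n"
  have lin: "linear (\<pi> (matrix_inv \<gamma>))" using assms by (intro \<pi>_linear inv_in)
  have "orbit_mean k n (a ** \<gamma>) - \<pi> (matrix_inv \<gamma>) (orbit_mean k n a)
      = (1 / real (n + 1)) *\<^sub>R (\<Sum>j\<le>n. \<zeta> (?d j ** a ** \<gamma>) - \<pi> (matrix_inv \<gamma>) (\<zeta> (?d j ** a)))"
    unfolding orbit_mean_def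
    by (simp add: linear_scale[OF lin] linear_sum[OF lin] sum_subtractf scaleR_diff_right matrix_mul_assoc)
  also have "norm \<dots> \<le> \<delta>"
    using assms by (intro norm_mean_le \<zeta>_mult) (simp_all add: GLpos_mult det_dilation)
  finally show ?thesis .
qed

text \<open>Arbitrarily high powers of the dilation occur in the mean, so the bound on
  \<open>dist1\<close> has to be uniform over the whole group. This is what bounded generation
  provides.\<close>

lemma orbit_mean_close:
  assumes "\<And>g. det g = 1 \<Longrightarrow> dist1 g \<le> e"
  shows "(\<integral>a. norm (orbit_mean k n a - \<zeta> a) \<partial>M) \<le> e"
proof -
  let ?d = "\<lambda>j. dilation k (2 ^ j) :: real^'n^'n"
  have ii: "integrable M (\<lambda>a. (1 / real (n + 1)) * (\<Sum>j\<le>n. norm (\<zeta> (?d j ** a) - \<zeta> a)))"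
    by (intro integrable_mult_right Bochner_Integration.integrable_sum dist1_integrable)
  have "(\<integral>a. norm (orbit_mean k n a - \<zeta> a) \<partial>M) \<le> (\<integral>a. (1 / real (n + 1)) * (\<Sum>j\<le>n. norm (\<zeta> (?d j ** a) - \<zeta> a)) \<partial>M)"
  proof (rule integral_mono[OF _ ii])
    have "norm (orbit_mean k n a - \<zeta> a) \<le> 2" for a
      using norm_triangle_ineq4[of "orbit_mean k n a" "\<zeta> a"] norm_orbit_mean[of k n a] norm_\<zeta>[of a] by linarith
    then show "integrable M (\<lambda>a. norm (orbit_mean k n a - \<zeta> a))"
      by (intro integrable_bounded[where C = 2]) auto
    show "norm (orbit_mean k n a - \<zeta> a) \<le> (1 / real (n + 1)) * (\<Sum>j\<le>n. norm (\<zeta> (?d j ** a) - \<zeta> a))" for a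
    proof -
      have "orbit_mean k n a - \<zeta> a = (1 / real (n + 1)) *\<^sub>R (\<Sum>j\<le>n. \<zeta> (?d j ** a) - \<zeta> a)"
        unfolding orbit_mean_def by (simp add: sum_subtractf scaleR_diff_right sum_constant_scaleR del: sum_constant)
      also have "norm \<dots> \<le> (1 / real (n + 1)) * (\<Sum>j\<le>n. norm (\<zeta> (?d j ** a) - \<zeta> a))"
        by (simp add: divide_right_mono norm_sum)
      finally show ?thesis .
    qed
  qed
  also have "\<dots> = (1 / real (n + 1)) * (\<Sum>j\<le>n. dist1 (?d j))"
    unfolding dist1_def using dist1_integrable by (simp add: Bochner_Integration.integral_sum)
  also have "\<dots> \<le> (1 / real (n + 1)) * (\<Sum>j\<le>n. e)"
    using assms by (intro mult_left_mono sum_mono) (auto simp: det_dilation)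
  also have "\<dots> = e" by simp
  finally show ?thesis .
qed

lemma midpoint_means_orbit:
  assumes g: "g \<in> midpoint_means (orbit_mean k) m"
  shows mm_measurable: "g \<in> borel_measurable borel"
    and mm_norm: "norm (g a) \<le> 1"
    and mm_scaleR: "a \<in> GLpos \<Longrightarrow> c > 0 \<Longrightarrow> g (c *\<^sub>R a) = g a"
    and mm_dilation: "norm (g (dilation k 2 ** a) - g a) \<le> 2 / real (m + 1)"
    and mm_mult: "a \<in> GLpos \<Longrightarrow> \<gamma> \<in> \<Gamma> \<Longrightarrow> norm (g (a ** \<gamma>) - \<pi> (matrix_inv \<gamma>) (g a)) \<le> \<delta>"
    and mm_close: "(\<And>g. det g = 1 \<Longrightarrow> dist1 g \<le> e) \<Longrightarrow> (\<integral>a. norm (g a - \<zeta> a) \<partial>M) \<le> e"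
proof -
  let ?K = "midpoint_means (orbit_mean k) m"
  have meas: "g \<in> borel_measurable borel" if "g \<in> ?K" for g
    using that by induction auto
  show "g \<in> borel_measurable borel" by (rule meas[OF g])
  have b1: "norm (g a) \<le> 1" if "g \<in> ?K" for g a
    using that
  proof (rule midpoint_means_le[where p = "\<lambda>g. norm (g a)"])
    show "norm ((1/2) *\<^sub>R (g a + h a)) \<le> (1/2) * (norm (g a) + norm (h a))" for g h
      using norm_midpoint_le[of "g a" "h a" 0 0] by simp
  qed (rule norm_orbit_mean)
  show "norm (g a) \<le> 1" by (rule b1[OF g])
  show "g (c *\<^sub>R a) = g a" if "a \<in> GLpos" "c > 0"
    using g by induction (auto simp: orbit_mean_scaleR[OF that])
  show "norm (g (dilation k 2 ** a) - g a) \<le> 2 / real (m + 1)"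
    using g
  proof (rule midpoint_means_le[where p = "\<lambda>g. norm (g (dilation k 2 ** a) - g a)"])
    show "norm (orbit_mean k n (dilation k 2 ** a) - orbit_mean k n a) \<le> 2 / real (m + 1)" if "m \<le> n" for n
      by (rule order_trans[OF orbit_mean_dilation]) (use that in \<open>auto intro!: divide_left_mono\<close>)
  qed (rule norm_midpoint_le)
  show "norm (g (a ** \<gamma>) - \<pi> (matrix_inv \<gamma>) (g a)) \<le> \<delta>" if a: "a \<in> GLpos" "\<gamma> \<in> \<Gamma>"
    using g
  proof (rule midpoint_means_le[where p = "\<lambda>g. norm (g (a ** \<gamma>) - \<pi> (matrix_inv \<gamma>) (g a))"])
    have lin: "linear (\<pi> (matrix_inv \<gamma>))" using a by (intro \<pi>_linear inv_in)
    show "norm ((1/2) *\<^sub>R (g (a ** \<gamma>) + h (a ** \<gamma>)) - \<pi> (matrix_inv \<gamma>) ((1/2) *\<^sub>R (g a + h a)))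
        \<le> (1/2) * (norm (g (a ** \<gamma>) - \<pi> (matrix_inv \<gamma>) (g a)) + norm (h (a ** \<gamma>) - \<pi> (matrix_inv \<gamma>) (h a)))" for g h
      unfolding linear_scale[OF lin] linear_add[OF lin] by (rule norm_midpoint_le)
  qed (rule orbit_mean_mult[OF a])
  show "(\<integral>a. norm (g a - \<zeta> a) \<partial>M) \<le> e" if "\<And>g. det g = 1 \<Longrightarrow> dist1 g \<le> e"
    using g
  proof (rule midpoint_means_le[where p = "\<lambda>g. \<integral>a. norm (g a - \<zeta> a) \<partial>M"])
    fix g h assume gh: "g \<in> ?K" "h \<in> ?K"
    have int: "integrable M (\<lambda>a. norm (g a - \<zeta> a))" if "g \<in> ?K" for g
    proof (rule integrable_bounded[where C = 2])
      show "\<bar>norm (g a - \<zeta> a)\<bar> \<le> 2" for a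
        using norm_triangle_ineq4[of "g a" "\<zeta> a"] b1[OF that, of a] norm_\<zeta>[of a] by simp
    qed (use meas[OF that] in measurable)
    have "(\<integral>a. norm ((1/2) *\<^sub>R (g a + h a) - \<zeta> a) \<partial>M) \<le> (\<integral>a. (1/2) * (norm (g a - \<zeta> a) + norm (h a - \<zeta> a)) \<partial>M)"
    proof (rule integral_mono[OF int[OF midpoint_means.mid[OF gh]]])
      show "norm ((1/2) *\<^sub>R (g a + h a) - \<zeta> a) \<le> (1/2) * (norm (g a - \<zeta> a) + norm (h a - \<zeta> a))" for a
        using norm_midpoint_le[of "g a" "h a" "\<zeta> a" "\<zeta> a"] by (simp flip: scaleR_2)
    qed (use int gh in auto)
    also have "\<dots> = (1/2) * ((\<integral>a. norm (g a - \<zeta> a) \<partial>M) + (\<integral>a. norm (h a - \<zeta> a) \<partial>M))"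
      using int[OF gh(1)] int[OF gh(2)] by simp
    finally show "(\<integral>a. norm ((1/2) *\<^sub>R (g a + h a) - \<zeta> a) \<partial>M) \<le> \<dots>" .
  qed (rule orbit_mean_close[OF that])
qed

text \<open>Convergence is wanted almost everywhere for Lebesgue measure, which is infinite; a
  positive integrable density gives an equivalent finite measure. Since \<open>G m\<close> involves
  only orbit means of index at least m, its defect of invariance is at most 2 / (m + 1), and the
  limit is exactly invariant almost everywhere.\<close>

lemma averaged_field_exists:
  "\<exists>Z. Z \<in> borel_measurable borel \<and> (\<forall>a. norm (Z a) \<le> 1) \<and> (\<forall>a\<in>GLpos. \<forall>c>0. Z (c *\<^sub>R a) = Z a)
    \<and> (AE a in lborel. Z (dilation k 2 ** a) = Z a)
    \<and> (\<forall>\<gamma>\<in>\<Gamma>. AE a in lborel. a \<in> GLpos \<longrightarrow> norm (Z (a ** \<gamma>) - \<pi> (matrix_inv \<gamma>) (Z a)) \<le> \<delta>)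
    \<and> (\<forall>e. (\<forall>g. det g = 1 \<longrightarrow> dist1 g \<le> e) \<longrightarrow> (\<integral>a. norm (Z a - \<zeta> a) \<partial>M) \<le> e)"
proof -
  obtain \<rho> :: "real^'n^'n \<Rightarrow> real" where \<rho>: "\<rho> \<in> borel_measurable lborel" "\<And>x. \<rho> x > 0" "\<And>x. \<rho> x \<le> 1" "integrable lborel \<rho>"
    by (rule sigma_finite_measure.obtain_positive_integrable_function[OF sigma_finite_lborel]) blast
  define N where "N = density lborel (\<lambda>x. ennreal (\<rho> x))"
  have [simp]: "sets N = sets borel" "space N = UNIV" by (simp_all add: N_def)
  have AE_N: "(AE x in N. P x) \<longleftrightarrow> (AE x in lborel. P x)" for P
    unfolding N_def using \<rho> by (subst AE_density) auto
  have "finite_measure N"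
  proof
    have "emeasure N (space N) = (\<integral>\<^sup>+x. ennreal (\<rho> x) \<partial>lborel)"
      unfolding N_def using \<rho> by (subst emeasure_density) auto
    also have "\<dots> < \<infinity>" using \<rho> by (simp add: nn_integral_eq_integral less_imp_le)
    finally show "emeasure N (space N) \<noteq> \<infinity>" by simp
  qed
  then obtain G where G: "\<And>m. G m \<in> midpoint_means (orbit_mean k) m" and conv: "AE a in lborel. convergent (\<lambda>m. G m a)"
    using midpoint_means_AE_convergent[of N "orbit_mean k"] norm_orbit_mean unfolding AE_N
    by (auto simp: measurable_cong_sets[of N borel borel borel])
  have [measurable]: "G m \<in> borel_measurable borel" for m by (rule mm_measurable[OF G])
  \<comment> \<open>The value 0 on the set of divergence keeps \<open>Z\<close> Borel, bounded by 1
    and blind to scalars everywhere.\<close>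
  define Z where "Z a = (if Cauchy (\<lambda>m. G m a) then lim (\<lambda>m. G m a) else 0)" for a
  have Zm[measurable]: "Z \<in> borel_measurable borel" unfolding Z_def by measurable
  have lim: "(\<lambda>m. G m a) \<longlonglongrightarrow> Z a" if "convergent (\<lambda>m. G m a)" for a
    using that convergent_LIMSEQ_iff convergent_Cauchy by (auto simp: Z_def)
  have Z1: "norm (Z a) \<le> 1" for a
  proof (cases "convergent (\<lambda>m. G m a)")
    case True
    then show ?thesis using tendsto_norm[OF lim[OF True]] mm_norm[OF G] by (intro LIMSEQ_le_const2) auto
  next
    case False then show ?thesis by (simp add: Z_def Cauchy_convergent_iff)
  qed
  have Zs: "Z (c *\<^sub>R a) = Z a" if "a \<in> GLpos" "c > 0" for a c
    unfolding Z_def mm_scaleR[OF G that] ..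
  have "AE a in lborel. convergent (\<lambda>m. G m (dilation k 2 ** a))"
    by (rule AE_matrix_mult_left[OF _ conv]) (simp add: det_dilation)
  with conv have Zd: "AE a in lborel. Z (dilation k 2 ** a) = Z a"
  proof eventually_elim
    case (elim a)
    have "(\<lambda>m. norm (G m (dilation k 2 ** a) - G m a)) \<longlonglongrightarrow> norm (Z (dilation k 2 ** a) - Z a)"
      by (intro tendsto_intros lim elim)
    moreover have "(\<lambda>m. 2 / real (m + 1)) \<longlonglongrightarrow> 0"
      using LIMSEQ_inverse_real_of_nat[THEN tendsto_mult_left, of 2] by (simp add: divide_inverse add.commute)
    ultimately have "norm (Z (dilation k 2 ** a) - Z a) \<le> 0"
      using mm_dilation[OF G] by (intro LIMSEQ_le) auto
    then show ?case by simp
  qed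
  have Zg: "AE a in lborel. a \<in> GLpos \<longrightarrow> norm (Z (a ** \<gamma>) - \<pi> (matrix_inv \<gamma>) (Z a)) \<le> \<delta>" if \<gamma>: "\<gamma> \<in> \<Gamma>" for \<gamma>
  proof -
    have bl: "bounded_linear (\<pi> (matrix_inv \<gamma>))" using \<gamma> by (simp add: \<pi>_linear inv_in flip: linear_conv_bounded_linear)
    have "AE a in lborel. convergent (\<lambda>m. G m (a ** \<gamma>))"
      by (rule AE_matrix_mult_right[OF _ conv]) (simp add: det_in[OF \<gamma>])
    with conv show ?thesis
    proof eventually_elim
      case (elim a)
      have "(\<lambda>m. norm (G m (a ** \<gamma>) - \<pi> (matrix_inv \<gamma>) (G m a))) \<longlonglongrightarrow> norm (Z (a ** \<gamma>) - \<pi> (matrix_inv \<gamma>) (Z a))"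
        by (intro tendsto_intros bounded_linear.tendsto[OF bl] lim elim)
      then show ?case using mm_mult[OF G _ \<gamma>] by (auto intro: LIMSEQ_le_const2)
    qed
  qed
  have Zc: "(\<integral>a. norm (Z a - \<zeta> a) \<partial>M) \<le> e" if e: "\<forall>g. det g = 1 \<longrightarrow> dist1 g \<le> e" for e
  proof -
    have "(\<lambda>m. \<integral>a. norm (G m a - \<zeta> a) \<partial>M) \<longlonglongrightarrow> (\<integral>a. norm (Z a - \<zeta> a) \<partial>M)"
    proof (rule integral_dominated_convergence[where w = "\<lambda>_. 2"])
      show "AE a in M. (\<lambda>m. norm (G m a - \<zeta> a)) \<longlonglongrightarrow> norm (Z a - \<zeta> a)"
        using AE_M[OF conv] by eventually_elim (intro tendsto_intros lim)
      show "AE a in M. norm (norm (G m a - \<zeta> a)) \<le> 2" for m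
      proof (rule AE_I2)
        fix a show "norm (norm (G m a - \<zeta> a)) \<le> 2"
          using norm_triangle_ineq4[of "G m a" "\<zeta> a"] mm_norm[OF G, of m a] norm_\<zeta>[of a] by simp
      qed
    qed simp_all
    then show ?thesis using mm_close[OF G, of e] e by (intro LIMSEQ_le_const2) auto
  qed
  show ?thesis using Zm Z1 Zs Zd Zg Zc by blast
qed

end

section \<open>Almost invariant vectors are uniformly almost invariant\<close>

text \<open>The distance between two fields that are almost equivariant for the same isometry is an
  almost invariant scalar function, which is the kind of function that
  \<open>ergodic_upper_bound\<close> accepts.\<close>

lemma norm_isometry_shift_le:
  fixes x y x' y' :: "'v::euclidean_space"
  assumes "linear U" "\<And>x. norm (U x) = norm x" "norm (x' - U x) \<le> d" "norm (y' - U y) \<le> d"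
  shows "norm (x' - y') \<le> norm (x - y) + 2 * d" "norm (x - y) \<le> norm (x' - y') + 2 * d"
proof -
  have U: "norm (U x - U y) = norm (x - y)"
    using assms(2)[of "x - y"] by (simp add: linear_diff[OF assms(1)])
  have "x' - y' = (x' - U x) - (y' - U y) + (U x - U y)" by simp
  then have "norm (x' - y') \<le> norm ((x' - U x) - (y' - U y)) + norm (U x - U y)" by (metis norm_triangle_ineq)
  then show "norm (x' - y') \<le> norm (x - y) + 2 * d"
    using U assms(3,4) norm_triangle_ineq4[of "x' - U x" "y' - U y"] by linarith
  have "U x - U y = (x' - y') - ((x' - U x) - (y' - U y))" by simp
  then have "norm (U x - U y) \<le> norm (x' - y') + norm ((x' - U x) - (y' - U y))" by (metis norm_triangle_ineq4)
  then show "norm (x - y) \<le> norm (x' - y') + 2 * d"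
    using U assms(3,4) norm_triangle_ineq4[of "x' - U x" "y' - U y"] by linarith
qed

context near_rep
begin

definition averaged_field :: "'n \<Rightarrow> (real^'n^'n \<Rightarrow> 'v) \<Rightarrow> bool" where
  "averaged_field k Z \<longleftrightarrow> Z \<in> borel_measurable borel \<and> (\<forall>a. norm (Z a) \<le> 1) \<and> (\<forall>a\<in>GLpos. \<forall>c>0. Z (c *\<^sub>R a) = Z a)
    \<and> (AE a in lborel. Z (dilation k 2 ** a) = Z a)
    \<and> (\<forall>\<gamma>\<in>\<Gamma>. AE a in lborel. a \<in> GLpos \<longrightarrow> norm (Z (a ** \<gamma>) - \<pi> (matrix_inv \<gamma>) (Z a)) \<le> \<delta>)
    \<and> (\<forall>e. (\<forall>g. det g = 1 \<longrightarrow> dist1 g \<le> e) \<longrightarrow> (\<integral>a. norm (Z a - \<zeta> a) \<partial>M) \<le> e)"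

lemma averaged_fieldD:
  assumes "averaged_field k Z"
  shows "Z \<in> borel_measurable borel" "norm (Z a) \<le> 1" "a \<in> GLpos \<Longrightarrow> c > 0 \<Longrightarrow> Z (c *\<^sub>R a) = Z a"
    "AE a in lborel. Z (dilation k 2 ** a) = Z a"
    "AE a in lborel. a \<in> GLpos \<longrightarrow> (\<forall>\<gamma>\<in>\<Gamma>. norm (Z (a ** \<gamma>) - \<pi> (matrix_inv \<gamma>) (Z a)) \<le> \<delta>)"
    "(\<And>g. det g = 1 \<Longrightarrow> dist1 g \<le> e) \<Longrightarrow> (\<integral>a. norm (Z a - \<zeta> a) \<partial>M) \<le> e"
proof -
  have "AE a in lborel. \<forall>\<gamma>\<in>\<Gamma>. a \<in> GLpos \<longrightarrow> norm (Z (a ** \<gamma>) - \<pi> (matrix_inv \<gamma>) (Z a)) \<le> \<delta>"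
    using assms unfolding averaged_field_def AE_ball_countable[OF countable_lattice] by blast
  then show "AE a in lborel. a \<in> GLpos \<longrightarrow> (\<forall>\<gamma>\<in>\<Gamma>. norm (Z (a ** \<gamma>) - \<pi> (matrix_inv \<gamma>) (Z a)) \<le> \<delta>)"
    by eventually_elim blast
qed (use assms in \<open>auto simp: averaged_field_def\<close>)

lemma averaged_field_norm_diff:
  assumes "averaged_field k Z" "averaged_field k' Z'"
  shows "norm (Z a - Z' b) \<le> 2"
  using norm_triangle_ineq4[of "Z a" "Z' b"] averaged_fieldD(2)[OF assms(1), of a] averaged_fieldD(2)[OF assms(2), of b]
  by linarith

lemma averaged_field_\<zeta>_integrable:
  assumes "averaged_field k Z"
  shows "integrable M (\<lambda>a. norm (Z a - \<zeta> a))"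
proof (rule integrable_bounded[where C = 2])
  show "\<bar>norm (Z a - \<zeta> a)\<bar> \<le> 2" for a
    using norm_triangle_ineq4[of "Z a" "\<zeta> a"] averaged_fieldD(2)[OF assms, of a] norm_\<zeta>[of a] by simp
qed (use averaged_fieldD(1)[OF assms] in measurable)

lemma averaged_field_dilation:
  assumes Z: "averaged_field k Z"
  shows "AE a in lborel. Z (dilation k (2 powi j) ** a) = Z a"
proof -
  have nat: "AE a in lborel. Z (dilation k (2 ^ n) ** a) = Z a" for n
  proof (induction n)
    case (Suc n)
    have "AE a in lborel. Z (dilation k 2 ** (dilation k (2 ^ n) ** a)) = Z (dilation k (2 ^ n) ** a)"
      by (rule AE_matrix_mult_left[OF _ averaged_fieldD(4)[OF Z]]) (simp add: det_dilation)
    with Suc show ?case by eventually_elim (simp add: matrix_mul_assoc dilation_mult)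
  qed simp
  show ?thesis
  proof (cases "j \<ge> 0")
    case True
    then show ?thesis using nat[of "nat j"] by (simp add: power_int_def)
  next
    case False
    define n where "n = nat (- j)"
    have "AE a in lborel. Z (dilation k (2 ^ n) ** (dilation k (inverse (2 ^ n)) ** a)) = Z (dilation k (inverse (2 ^ n)) ** a)"
      by (rule AE_matrix_mult_left[OF _ nat]) (simp add: det_dilation)
    then have "AE a in lborel. Z (dilation k (inverse (2 ^ n)) ** a) = Z a"
      by eventually_elim (simp add: matrix_mul_assoc dilation_mult)
    moreover have "(2::real) powi j = inverse (2 ^ n)" using False by (simp add: power_int_def n_def power_one_over inverse_eq_divide)
    ultimately show ?thesis by simp
  qed
qed

lemma averaged_field_translate:
  assumes Z: "averaged_field k Z" and h: "det h = 1"
  shows "AE a in lborel. a \<in> GLpos \<longrightarrow> (\<forall>\<gamma>\<in>\<Gamma>. norm (Z (h ** a ** \<gamma>) - \<pi> (matrix_inv \<gamma>) (Z (h ** a))) \<le> \<delta>)"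
proof -
  have "AE a in lborel. h ** a \<in> GLpos \<longrightarrow> (\<forall>\<gamma>\<in>\<Gamma>. norm (Z (h ** a ** \<gamma>) - \<pi> (matrix_inv \<gamma>) (Z (h ** a))) \<le> \<delta>)"
    using h by (intro AE_matrix_mult_left[OF _ averaged_fieldD(5)[OF Z]]) simp
  then show ?thesis by eventually_elim (use h in \<open>auto simp: GLpos_mult\<close>)
qed

text \<open>The displacement by h is exactly invariant under the dilation, because h commutes with
  it, and invariant under the lattice up to 2\<delta>. Its mean is at most 3e + 2\<delta>: one e for
  the displacement of \<open>\<zeta>\<close>, two for exchanging \<open>Z\<close> with
  \<open>\<zeta>\<close>, and 2\<delta> for reducing the base point to \<open>Dom\<close>.
  Ergodicity adds twice 2\<delta>.\<close>

lemma averaged_field_commuting: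
  assumes Z: "averaged_field k Z" and e: "\<And>g. det g = 1 \<Longrightarrow> dist1 g \<le> e"
    and h: "det h = 1" and com: "\<And>j::int. dilation k (2 powi j) ** h = h ** dilation k (2 powi j)"
  shows "AE a in lborel. a \<in> GLpos \<longrightarrow> norm (Z (h ** a) - Z a) \<le> 3 * e + 6 * \<delta>"
proof -
  note [measurable] = averaged_fieldD(1)[OF Z]
  note tr = averaged_field_translate[OF Z h]
  have "AE a in lborel. a \<in> GLpos \<longrightarrow> norm (Z (h ** a) - Z a) \<le> (3 * e + 2 * \<delta>) + 2 * (2 * \<delta>)"
  proof (rule ergodic_upper_bound[where C = 2 and k = k])
    show "(\<lambda>a. norm (Z (h ** a) - Z a)) \<in> borel_measurable borel" by measurable
    show "\<bar>norm (Z (h ** a) - Z a)\<bar> \<le> 2" for a using averaged_field_norm_diff[OF Z Z] by simp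
    show "norm (Z (h ** (c *\<^sub>R a)) - Z (c *\<^sub>R a)) = norm (Z (h ** a) - Z a)" if "a \<in> GLpos" "c > 0" for a c
      using averaged_fieldD(3)[OF Z] that h by (simp add: scaleR_matrix_mult GLpos_mult)
    show "AE a in lborel. a \<in> GLpos \<longrightarrow> norm (Z (h ** (a ** \<gamma>)) - Z (a ** \<gamma>)) \<le> norm (Z (h ** a) - Z a) + 2 * \<delta>"
      if \<gamma>: "\<gamma> \<in> \<Gamma>" for \<gamma>
      using tr averaged_fieldD(5)[OF Z]
    proof eventually_elim
      case (elim a)
      show ?case
        using elim \<gamma> norm_isometry_shift_le(1)[OF \<pi>_linear[OF inv_in[OF \<gamma>]] \<pi>_norm[OF inv_in[OF \<gamma>]]]
        by (auto simp: matrix_mul_assoc)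
    qed
    fix j :: int
    let ?d = "dilation k (2 powi j) :: real^'n^'n"
    have "AE a in lborel. Z (?d ** (h ** a)) = Z (h ** a)"
      using h by (intro AE_matrix_mult_left[OF _ averaged_field_dilation[OF Z]]) simp
    with averaged_field_dilation[OF Z, of j]
    show "AE a in lborel. a \<in> GLpos \<longrightarrow> norm (Z (h ** (?d ** a)) - Z (?d ** a)) \<le> norm (Z (h ** a) - Z a) + 2 * \<delta>"
      by eventually_elim (use \<delta>_pos in \<open>simp add: matrix_mul_assoc com[symmetric]\<close>)
  next
    let ?f = "\<lambda>b. norm (Z b - \<zeta> b)"
    have tw: "twist (\<lambda>a. \<pi> (\<sigma> (h ** a))) (\<lambda>a. q (h ** a))" by (rule twist_translate[OF h])
    have i1: "integrable M (\<lambda>a. ?f (q (h ** a)))"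
    proof (rule integrable_bounded[where C = 2])
      show "\<bar>?f (q (h ** a))\<bar> \<le> 2" for a
        using norm_triangle_ineq4[of "Z (q (h ** a))" "\<zeta> (q (h ** a))"] averaged_fieldD(2)[OF Z, of "q (h ** a)"] by simp
    qed measurable
    have "(\<integral>a. norm (Z (h ** a) - Z a) \<partial>M) \<le> (\<integral>a. ?f (q (h ** a)) + 2 * \<delta> + norm (\<zeta> (h ** a) - \<zeta> a) + ?f a \<partial>M)"
    proof (rule integral_mono_AE)
      show "integrable M (\<lambda>a. norm (Z (h ** a) - Z a))"
        using averaged_field_norm_diff[OF Z Z] by (intro integrable_bounded[where C = 2]) auto
      show "integrable M (\<lambda>a. ?f (q (h ** a)) + 2 * \<delta> + norm (\<zeta> (h ** a) - \<zeta> a) + ?f a)"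
        using i1 dist1_integrable[of h] averaged_field_\<zeta>_integrable[OF Z] by auto
      show "AE a in M. norm (Z (h ** a) - Z a) \<le> ?f (q (h ** a)) + 2 * \<delta> + norm (\<zeta> (h ** a) - \<zeta> a) + ?f a"
        using AE_M[OF tr] AE_M_Dom
      proof eventually_elim
        case (elim a)
        then have a: "a \<in> GLpos" "h ** a \<in> GLpos" using h by (auto simp: Dom_def GLpos_mult)
        let ?s = "\<sigma> (h ** a)"
        have s: "?s \<in> \<Gamma>" by (rule \<sigma>_in)
        have "?f (h ** a) \<le> ?f (h ** a ** ?s) + 2 * \<delta>"
          using elim a s \<zeta>_mult[OF a(2) s]
          by (intro norm_isometry_shift_le(2)[OF \<pi>_linear[OF inv_in[OF s]] \<pi>_norm[OF inv_in[OF s]]]) auto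
        then have 1: "?f (h ** a) \<le> ?f (q (h ** a)) + 2 * \<delta>" by (simp add: q_def)
        have "Z (h ** a) - Z a = (Z (h ** a) - \<zeta> (h ** a)) + (\<zeta> (h ** a) - \<zeta> a) - (Z a - \<zeta> a)" by simp
        then have "norm (Z (h ** a) - Z a) \<le> norm ((Z (h ** a) - \<zeta> (h ** a)) + (\<zeta> (h ** a) - \<zeta> a)) + ?f a"
          by (metis norm_triangle_ineq4)
        then show ?case
          using 1 norm_triangle_ineq[of "Z (h ** a) - \<zeta> (h ** a)" "\<zeta> (h ** a) - \<zeta> a"] by linarith
      qed
    qed
    also have "\<dots> = (\<integral>a. ?f (q (h ** a)) \<partial>M) + 2 * \<delta> + dist1 h + (\<integral>a. ?f a \<partial>M)"
      unfolding dist1_def using i1 dist1_integrable[of h] averaged_field_\<zeta>_integrable[OF Z] by (simp add: prob_UNIV)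
    also have "(\<integral>a. ?f (q (h ** a)) \<partial>M) = (\<integral>a. ?f a \<partial>M)"
      by (rule integral_twist[OF tw, of ?f]) measurable
    also have "(\<integral>a. ?f a \<partial>M) + 2 * \<delta> + dist1 h + (\<integral>a. ?f a \<partial>M) \<le> e + 2 * \<delta> + e + e"
      by (intro add_mono e[OF h] averaged_fieldD(6)[OF Z e] order_refl)
    finally show "(\<integral>a. norm (Z (h ** a) - Z a) \<partial>M) \<le> 3 * e + 2 * \<delta>" by simp
  qed
  then show ?thesis by eventually_elim auto
qed

text \<open>\<open>Z\<close> is invariant under its own dilation, and \<open>Z'\<close> nearly so
  because diagonal matrices commute. The mean distance is at most 2e, as both fields are close to
  \<open>\<zeta>\<close>, and ergodicity adds 2 (3e + 6\<delta>).\<close>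

lemma averaged_fields_close:
  assumes Z: "averaged_field k Z" and Z': "averaged_field k' Z'" and e: "\<And>g. det g = 1 \<Longrightarrow> dist1 g \<le> e"
  shows "AE a in lborel. a \<in> GLpos \<longrightarrow> norm (Z a - Z' a) \<le> 8 * e + 12 * \<delta>"
proof -
  note [measurable] = averaged_fieldD(1)[OF Z] averaged_fieldD(1)[OF Z']
  have "0 \<le> dist1 (mat 1)" by (simp add: dist1_def)
  then have e0: "0 \<le> e" using e[of "mat 1"] by simp
  have "AE a in lborel. a \<in> GLpos \<longrightarrow> norm (Z a - Z' a) \<le> 2 * e + 2 * (3 * e + 6 * \<delta>)"
  proof (rule ergodic_upper_bound[where C = 2 and k = k])
    show "(\<lambda>a. norm (Z a - Z' a)) \<in> borel_measurable borel" by measurable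
    show "\<bar>norm (Z a - Z' a)\<bar> \<le> 2" for a using averaged_field_norm_diff[OF Z Z'] by simp
    show "norm (Z (c *\<^sub>R a) - Z' (c *\<^sub>R a)) = norm (Z a - Z' a)" if "a \<in> GLpos" "c > 0" for a c
      using averaged_fieldD(3)[OF Z] averaged_fieldD(3)[OF Z'] that by simp
    show "AE a in lborel. a \<in> GLpos \<longrightarrow> norm (Z (a ** \<gamma>) - Z' (a ** \<gamma>)) \<le> norm (Z a - Z' a) + (3 * e + 6 * \<delta>)"
      if \<gamma>: "\<gamma> \<in> \<Gamma>" for \<gamma>
      using averaged_fieldD(5)[OF Z] averaged_fieldD(5)[OF Z']
    proof eventually_elim
      case (elim a)
      show ?case
      proof
        assume "a \<in> GLpos"
        then have "norm (Z (a ** \<gamma>) - Z' (a ** \<gamma>)) \<le> norm (Z a - Z' a) + 2 * \<delta>"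
          using elim \<gamma> by (intro norm_isometry_shift_le(1)[OF \<pi>_linear[OF inv_in[OF \<gamma>]] \<pi>_norm[OF inv_in[OF \<gamma>]]]) auto
        then show "norm (Z (a ** \<gamma>) - Z' (a ** \<gamma>)) \<le> norm (Z a - Z' a) + (3 * e + 6 * \<delta>)"
          using e0 \<delta>_pos by linarith
      qed
    qed
    fix j :: int
    let ?d = "dilation k (2 powi j) :: real^'n^'n"
    have "AE a in lborel. a \<in> GLpos \<longrightarrow> norm (Z' (?d ** a) - Z' a) \<le> 3 * e + 6 * \<delta>"
      by (rule averaged_field_commuting[OF Z' e]) (simp_all add: det_dilation dilation_commute)
    with averaged_field_dilation[OF Z, of j]
    show "AE a in lborel. a \<in> GLpos \<longrightarrow> norm (Z (?d ** a) - Z' (?d ** a)) \<le> norm (Z a - Z' a) + (3 * e + 6 * \<delta>)"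
    proof eventually_elim
      case (elim a)
      have "Z a - Z' (?d ** a) = (Z a - Z' a) - (Z' (?d ** a) - Z' a)" by simp
      then have "norm (Z a - Z' (?d ** a)) \<le> norm (Z a - Z' a) + norm (Z' (?d ** a) - Z' a)"
        by (metis norm_triangle_ineq4)
      then show ?case using elim by auto
    qed
  next
    have "(\<integral>a. norm (Z a - Z' a) \<partial>M) \<le> (\<integral>a. norm (Z a - \<zeta> a) + norm (Z' a - \<zeta> a) \<partial>M)"
    proof (rule integral_mono)
      show "integrable M (\<lambda>a. norm (Z a - Z' a))"
        using averaged_field_norm_diff[OF Z Z'] by (intro integrable_bounded[where C = 2]) auto
      show "norm (Z a - Z' a) \<le> norm (Z a - \<zeta> a) + norm (Z' a - \<zeta> a)" for a
        using norm_triangle_ineq4[of "Z a - \<zeta> a" "Z' a - \<zeta> a"] by simp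
    qed (use averaged_field_\<zeta>_integrable[OF Z] averaged_field_\<zeta>_integrable[OF Z'] in simp)
    also have "\<dots> = (\<integral>a. norm (Z a - \<zeta> a) \<partial>M) + (\<integral>a. norm (Z' a - \<zeta> a) \<partial>M)"
      using averaged_field_\<zeta>_integrable[OF Z] averaged_field_\<zeta>_integrable[OF Z'] by simp
    also have "\<dots> \<le> e + e" by (intro add_mono averaged_fieldD(6)[OF Z e] averaged_fieldD(6)[OF Z' e])
    finally show "(\<integral>a. norm (Z a - Z' a) \<partial>M) \<le> 2 * e" by simp
  qed
  then show ?thesis by eventually_elim auto
qed

text \<open>A third index l gives a dilation that commutes with the transvection, so the field
  averaged along l is barely moved. Passing from \<open>Z\<close> to that field and back costs 2 (8e
  + 12\<delta>) on top of 3e + 6\<delta>.\<close>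

lemma averaged_field_transvection:
  assumes Z: "averaged_field k Z" and e: "\<And>g. det g = 1 \<Longrightarrow> dist1 g \<le> e" and ij: "i \<noteq> j"
  shows "AE a in lborel. a \<in> GLpos \<longrightarrow> norm (Z (transvection i j t ** a) - Z a) \<le> 19 * e + 30 * \<delta>"
proof -
  have "card {i, j} < CARD('n)" using card_n ij by simp
  then have "{i, j} \<noteq> UNIV" by (metis less_irrefl)
  then obtain l where l: "l \<noteq> i" "l \<noteq> j" by auto
  obtain Z' where Z': "averaged_field l Z'" using averaged_field_exists[of l] unfolding averaged_field_def by blast
  let ?T = "transvection i j t :: real^'n^'n"
  have T: "det ?T = 1" by (rule det_transvection[OF ij])
  have c: "AE a in lborel. a \<in> GLpos \<longrightarrow> norm (Z a - Z' a) \<le> 8 * e + 12 * \<delta>"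
    by (rule averaged_fields_close[OF Z Z' e])
  have "AE a in lborel. ?T ** a \<in> GLpos \<longrightarrow> norm (Z (?T ** a) - Z' (?T ** a)) \<le> 8 * e + 12 * \<delta>"
    using T by (intro AE_matrix_mult_left[OF _ c]) simp
  moreover have "AE a in lborel. a \<in> GLpos \<longrightarrow> norm (Z' (?T ** a) - Z' a) \<le> 3 * e + 6 * \<delta>"
    by (rule averaged_field_commuting[OF Z' e T]) (use l in \<open>simp_all add: dilation_transvection_commute\<close>)
  ultimately show ?thesis using c
  proof eventually_elim
    case (elim a)
    show ?case
    proof
      assume a: "a \<in> GLpos"
      have "Z (?T ** a) - Z a = (Z (?T ** a) - Z' (?T ** a)) + (Z' (?T ** a) - Z' a) - (Z a - Z' a)" by simp
      then have "norm (Z (?T ** a) - Z a) \<le> norm ((Z (?T ** a) - Z' (?T ** a)) + (Z' (?T ** a) - Z' a)) + norm (Z a - Z' a)"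
        by (metis norm_triangle_ineq4)
      moreover have "norm ((Z (?T ** a) - Z' (?T ** a)) + (Z' (?T ** a) - Z' a)) \<le> norm (Z (?T ** a) - Z' (?T ** a)) + norm (Z' (?T ** a) - Z' a)"
        by (rule norm_triangle_ineq)
      ultimately show "norm (Z (?T ** a) - Z a) \<le> 19 * e + 30 * \<delta>"
        using elim a GLpos_mult(2)[OF a T] by argo
    qed
  qed
qed

lemma averaged_field_words:
  fixes Z :: "real^'n^'n \<Rightarrow> 'v" and g :: "real^'n^'n"
  assumes tr: "\<And>i j t. i \<noteq> j \<Longrightarrow> AE a in lborel. a \<in> GLpos \<longrightarrow> norm (Z (transvection i j t ** a) - Z a) \<le> c"
    and "g \<in> transvection_words l"
  shows "det g = 1 \<and> (AE a in lborel. a \<in> GLpos \<longrightarrow> norm (Z (g ** a) - Z a) \<le> l * c)"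
  using assms(2)
proof (induction l arbitrary: g)
  case (Suc l)
  then obtain i j t h where g: "g = transvection i j t ** h" "i \<noteq> j" "h \<in> transvection_words l" by auto
  let ?T = "transvection i j t :: real^'n^'n"
  have h: "det h = 1" "AE a in lborel. a \<in> GLpos \<longrightarrow> norm (Z (h ** a) - Z a) \<le> l * c" using Suc.IH[OF g(3)] by auto
  have "AE a in lborel. h ** a \<in> GLpos \<longrightarrow> norm (Z (?T ** (h ** a)) - Z (h ** a)) \<le> c"
    using h by (intro AE_matrix_mult_left[OF _ tr[OF g(2)]]) simp
  with h(2) have "AE a in lborel. a \<in> GLpos \<longrightarrow> norm (Z (g ** a) - Z a) \<le> Suc l * c"
  proof eventually_elim
    case (elim a)
    show ?case
    proof
      assume a: "a \<in> GLpos"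
      have "norm (Z (g ** a) - Z a) \<le> norm (Z (?T ** (h ** a)) - Z (h ** a)) + norm (Z (h ** a) - Z a)"
        using norm_triangle_ineq[of "Z (?T ** (h ** a)) - Z (h ** a)" "Z (h ** a) - Z a"] by (simp add: g(1) matrix_mul_assoc)
      also have "\<dots> \<le> c + l * c" using elim a GLpos_mult(2)[OF a h(1)] by (intro add_mono) auto
      finally show "norm (Z (g ** a) - Z a) \<le> Suc l * c" by (simp add: algebra_simps)
    qed
  qed
  then show ?case using g h by (simp add: det_mul det_transvection)
qed simp

text \<open>The averaged field lies within c of a fixed vector w almost everywhere, and w lies
  within c + e of \<open>v\<close>. At almost every a, equivariance for the inverse of \<gamma>
  shows that \<open>\<pi> \<gamma>\<close> moves w by at most 2c + \<delta>. Returning to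
  \<open>v\<close> adds 2 (c + e).\<close>

lemma almost_invariant_of_dist1:
  assumes e: "\<And>g. det g = 1 \<Longrightarrow> dist1 g \<le> e" and \<gamma>: "\<gamma> \<in> \<Gamma>"
  defines "N \<equiv> real ((2 * CARD('n) + 2) * CARD('n))"
  shows "norm (\<pi> \<gamma> v - v) \<le> 4 * (N * (19 * e + 30 * \<delta>)) + 2 * e + \<delta>"
proof -
  \<comment> \<open>Any index serves for the dilation here.\<close>
  obtain Z where Z: "averaged_field undefined Z" using averaged_field_exists[of undefined] unfolding averaged_field_def by blast
  note [measurable] = averaged_fieldD(1)[OF Z]
  define c where "c = N * (19 * e + 30 * \<delta>)"
  have c: "AE a in lborel. a \<in> GLpos \<longrightarrow> norm (Z (g ** a) - Z a) \<le> c" if g: "det g = 1" for g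
    using averaged_field_words[OF averaged_field_transvection[OF Z e] SL_bounded_generation[OF g]] card_n
    by (simp add: c_def N_def)
  have "AE a in lborel. a \<in> GLpos \<longrightarrow> (AE b in lborel. b \<in> GLpos \<longrightarrow> norm (Z b - Z a) \<le> c)"
  proof (rule AE_constant[where R = "\<lambda>b a. norm (Z b - Z a) \<le> c"])
    have "Measurable.pred (borel \<Otimes>\<^sub>M borel) (\<lambda>p. norm (Z (fst p) - Z (snd p)) \<le> c)" by measurable
    then show "{p. norm (Z (fst p) - Z (snd p)) \<le> c} \<in> sets (borel \<Otimes>\<^sub>M borel)" by (simp add: pred_def space_pair_measure)
    show "AE a in lborel. a \<in> GLpos \<longrightarrow> norm (Z (g ** a) - Z a) \<le> c" if "det g = 1" for g by (rule c[OF that])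
    show "(norm (Z (s *\<^sub>R x) - Z y) \<le> c) = (norm (Z x - Z y) \<le> c)" if "x \<in> GLpos" "s > 0" for x y s
      using averaged_fieldD(3)[OF Z that] by simp
  qed
  from AE_GLpos_ex[OF this] obtain a0 where a0: "AE b in lborel. b \<in> GLpos \<longrightarrow> norm (Z b - Z a0) \<le> c" ..
  define w where "w = Z a0"
  have w: "AE b in lborel. b \<in> GLpos \<longrightarrow> norm (Z b - w) \<le> c" using a0 by (simp add: w_def)
  have "norm (w - v) \<le> c + e"
  proof -
    have "(\<integral>a. norm (w - v) \<partial>M) \<le> (\<integral>a. c + norm (Z a - \<zeta> a) \<partial>M)"
    proof (rule integral_mono_AE)
      show "AE a in M. norm (w - v) \<le> c + norm (Z a - \<zeta> a)"
        using AE_M[OF w] AE_M_Dom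
      proof eventually_elim
        case (elim a)
        then have "norm (Z a - w) \<le> c" "\<zeta> a = v" by (auto simp: \<zeta>_Dom Dom_def)
        then show ?case using norm_triangle_ineq4[of "Z a - v" "Z a - w"] by simp
      qed
    qed (use averaged_field_\<zeta>_integrable[OF Z] in auto)
    also have "\<dots> = c + (\<integral>a. norm (Z a - \<zeta> a) \<partial>M)"
      using averaged_field_\<zeta>_integrable[OF Z] by (simp add: prob_UNIV)
    also have "\<dots> \<le> c + e" using averaged_fieldD(6)[OF Z e] by simp
    finally show ?thesis by (simp add: prob_UNIV)
  qed
  moreover have "norm (\<pi> \<gamma> w - w) \<le> 2 * c + \<delta>"
  proof -
    let ?g = "matrix_inv \<gamma>"
    have g: "?g \<in> \<Gamma>" using \<gamma> by (rule inv_in)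
    have "AE a in lborel. a ** ?g \<in> GLpos \<longrightarrow> norm (Z (a ** ?g) - w) \<le> c"
      using g by (intro AE_matrix_mult_right[OF _ w]) (simp add: det_in)
    with w averaged_fieldD(5)[OF Z] have "AE a in lborel. a \<in> (GLpos :: (real^'n^'n) set) \<longrightarrow> norm (\<pi> \<gamma> w - w) \<le> 2 * c + \<delta>"
    proof eventually_elim
      case (elim a)
      show ?case
      proof
        assume a: "a \<in> GLpos"
        have 1: "norm (Z (a ** ?g) - \<pi> \<gamma> (Z a)) \<le> \<delta>" using elim(2) a g inv_inv[OF \<gamma>] by fastforce
        have 2: "norm (Z (a ** ?g) - w) \<le> c" using elim(3) GLpos_mult(1)[OF a] det_in[OF g] by simp
        have "norm (\<pi> \<gamma> (Z a) - \<pi> \<gamma> w) = norm (Z a - w)"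
          using \<pi>_norm[OF \<gamma>, of "Z a - w"] \<pi>_linear[OF \<gamma>] by (simp add: linear_diff)
        then have 3: "norm (\<pi> \<gamma> (Z a) - \<pi> \<gamma> w) \<le> c" using elim(1) a by simp
        have "\<pi> \<gamma> w - w = (Z (a ** ?g) - w) - (Z (a ** ?g) - \<pi> \<gamma> (Z a)) - (\<pi> \<gamma> (Z a) - \<pi> \<gamma> w)" by simp
        then have "norm (\<pi> \<gamma> w - w) \<le> norm ((Z (a ** ?g) - w) - (Z (a ** ?g) - \<pi> \<gamma> (Z a))) + norm (\<pi> \<gamma> (Z a) - \<pi> \<gamma> w)"
          by (metis norm_triangle_ineq4)
        then show "norm (\<pi> \<gamma> w - w) \<le> 2 * c + \<delta>"
          using 1 2 3 norm_triangle_ineq4[of "Z (a ** ?g) - w" "Z (a ** ?g) - \<pi> \<gamma> (Z a)"] by linarith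
      qed
    qed
    from AE_GLpos_ex[OF this] show ?thesis by blast
  qed
  moreover have "norm (\<pi> \<gamma> v - v) \<le> norm (\<pi> \<gamma> w - w) + 2 * norm (w - v)"
  proof -
    have 1: "norm (\<pi> \<gamma> w - \<pi> \<gamma> v) = norm (w - v)"
      using \<pi>_norm[OF \<gamma>, of "w - v"] \<pi>_linear[OF \<gamma>] by (simp add: linear_diff)
    have "\<pi> \<gamma> v - v = (\<pi> \<gamma> w - w) - (\<pi> \<gamma> w - \<pi> \<gamma> v) + (w - v)" by simp
    then have "norm (\<pi> \<gamma> v - v) \<le> norm ((\<pi> \<gamma> w - w) - (\<pi> \<gamma> w - \<pi> \<gamma> v)) + norm (w - v)" by (metis norm_triangle_ineq)
    then show ?thesis using 1 norm_triangle_ineq4[of "\<pi> \<gamma> w - w" "\<pi> \<gamma> w - \<pi> \<gamma> v"] by linarith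
  qed
  ultimately show ?thesis unfolding c_def by argo
qed

end

theorem (in SL_lattice) almost_invariant_vectors:
  assumes \<epsilon>: "\<epsilon> > 0"
  shows "\<exists>\<Phi> \<eta>. finite \<Phi> \<and> \<Phi> \<subseteq> \<Gamma> \<and> \<eta> > 0 \<and>
    (\<forall>(\<pi> :: real^'n^'n \<Rightarrow> 'v::euclidean_space \<Rightarrow> 'v) \<delta> v. near_rep \<Gamma> \<pi> \<delta> v \<and> \<delta> \<le> \<eta> \<and> (\<forall>\<gamma>\<in>\<Phi>. norm (\<pi> \<gamma> v - v) \<le> \<eta>)
      \<longrightarrow> (\<forall>\<gamma>\<in>\<Gamma>. norm (\<pi> \<gamma> v - v) \<le> \<epsilon>))"
proof -
  define N where "N = real ((2 * CARD('n) + 2) * CARD('n))"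
  have "1 \<le> (2 * CARD('n) + 2) * CARD('n)" using card_n by simp
  then have N: "1 \<le> N" unfolding N_def by (metis of_nat_1 of_nat_le_iff)
  \<comment> \<open>N enters squared because words are used twice, for \<open>dist1\<close> of an
    arbitrary matrix and for the oscillation of the averaged field. Once N is bounded by its square,
    the coefficients 228, 126 and 1 add up to 355.\<close>
  define t where "t = \<epsilon> / (355 * N\<^sup>2)"
  have t: "t > 0" using \<epsilon> N by (simp add: t_def)
  obtain \<Phi> \<eta> where \<Phi>: "finite \<Phi>" "\<Phi> \<subseteq> \<Gamma>" "\<eta> > 0"
    and small: "\<And>(\<pi> :: real^'n^'n \<Rightarrow> 'v \<Rightarrow> 'v) \<delta> v i j t'. near_rep \<Gamma> \<pi> \<delta> v \<Longrightarrow> \<delta> \<le> \<eta> \<Longrightarrow> \<forall>\<gamma>\<in>\<Phi>. norm (\<pi> \<gamma> v - v) \<le> \<eta>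
        \<Longrightarrow> i \<noteq> j \<Longrightarrow> near_rep.sqdist \<Gamma> \<pi> v (transvection i j t') \<le> t\<^sup>2"
    using sqdist_transvection_small[of "t\<^sup>2", where ?'v = 'v] t by (auto 0 0)
  show ?thesis
  proof (intro exI[of _ \<Phi>] exI[of _ "min \<eta> t"] conjI allI impI ballI)
    fix \<pi> :: "real^'n^'n \<Rightarrow> 'v \<Rightarrow> 'v" and \<delta> v \<gamma>
    assume as: "near_rep \<Gamma> \<pi> \<delta> v \<and> \<delta> \<le> min \<eta> t \<and> (\<forall>\<gamma>\<in>\<Phi>. norm (\<pi> \<gamma> v - v) \<le> min \<eta> t)" and \<gamma>: "\<gamma> \<in> \<Gamma>"
    interpret near_rep \<Gamma> \<pi> \<delta> v using as by blast
    have \<delta>: "\<delta> \<le> t" using as by simp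
    have d1: "dist1 (transvection i j s) \<le> t" if "i \<noteq> j" for i j s
    proof (rule dist1_le_sqdist[OF _ t])
      show "sqdist (transvection i j s) \<le> t\<^sup>2" using as that by (intro small) auto
    qed
    have "dist1 g \<le> N * (t + 2 * \<delta>)" if "det g = 1" for g
      using dist1_words[OF d1 SL_bounded_generation[OF that]] card_n by (simp add: N_def)
    from almost_invariant_of_dist1[OF this \<gamma>]
    have "norm (\<pi> \<gamma> v - v) \<le> 4 * (N * (19 * (N * (t + 2 * \<delta>)) + 30 * \<delta>)) + 2 * (N * (t + 2 * \<delta>)) + \<delta>"
      by (simp add: N_def)
    also have "\<dots> \<le> 4 * (N * (19 * (N * (t + 2 * t)) + 30 * t)) + 2 * (N * (t + 2 * t)) + t"
      using N \<delta> by (intro add_mono mult_left_mono) auto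
    also have "\<dots> = 228 * (N\<^sup>2 * t) + 126 * (N * t) + t" by (simp add: power2_eq_square algebra_simps)
    also have "\<dots> \<le> 228 * (N\<^sup>2 * t) + 126 * (N\<^sup>2 * t) + N\<^sup>2 * t"
    proof -
      have "N * 1 \<le> N * N" using N by (intro mult_left_mono) auto
      then have "1 \<le> N\<^sup>2" "N \<le> N\<^sup>2" using N unfolding power2_eq_square by linarith+
      then have "1 * t \<le> N\<^sup>2 * t" "N * t \<le> N\<^sup>2 * t"
        using t by (intro mult_right_mono; simp)+
      then show ?thesis by linarith
    qed
    also have "\<dots> = 355 * N\<^sup>2 * t" by simp
    also have "\<dots> = \<epsilon>" using N by (simp add: t_def)
    finally show "norm (\<pi> \<gamma> v - v) \<le> \<epsilon>" .
  qed (use \<Phi> t in auto)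
qed

section \<open>Unitary matrices\<close>

lemma adjoint_mat_mult: "adjoint_mat (A ** B) = adjoint_mat B ** adjoint_mat A"
  by (simp add: adjoint_mat_def matrix_matrix_mult_def vec_eq_iff cnj_sum mult.commute)

lemma adjoint_mat_adjoint_mat [simp]: "adjoint_mat (adjoint_mat A) = A"
  by (simp add: adjoint_mat_def vec_eq_iff)

lemma adjoint_mat_unitary: "U \<in> unitary_group \<Longrightarrow> adjoint_mat U \<in> unitary_group"
  by (simp add: unitary_group_def)

lemma linear_adjoint_mat: "linear adjoint_mat"
  by (rule linearI) (simp_all add: adjoint_mat_def vec_eq_iff)

lemma complex_matrix_mult_scaleR:
  fixes A B :: "complex^'d^'d"
  shows "(r *\<^sub>R A) ** B = r *\<^sub>R (A ** B)" "A ** (r *\<^sub>R B) = r *\<^sub>R (A ** B)"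
  by (simp_all add: matrix_matrix_mult_def vec_eq_iff scaleR_sum_right)

lemma linear_complex_matrix_mult:
  fixes A :: "complex^'d^'d"
  shows "linear (\<lambda>X :: complex^'d^'d. A ** X)" "linear (\<lambda>X :: complex^'d^'d. X ** A)"
proof -
  have "(B + C) ** A = B ** A + C ** A" for B C :: "complex^'d^'d"
    by (simp add: matrix_matrix_mult_def vec_eq_iff sum.distrib distrib_right)
  then show "linear (\<lambda>X :: complex^'d^'d. A ** X)" "linear (\<lambda>X :: complex^'d^'d. X ** A)"
    by (auto intro!: linearI simp: matrix_add_ldistrib complex_matrix_mult_scaleR)
qed

lemma bounded_bilinear_complex_matrix_mult:
  "bounded_bilinear (\<lambda>(A :: complex^'d^'d) (B :: complex^'d^'d). A ** B)"
  by (simp add: bilinear_def linear_complex_matrix_mult flip: bilinear_conv_bounded_bilinear)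

lemma trace_adjoint_mat_self: "trace (adjoint_mat X ** X) = complex_of_real ((norm X)\<^sup>2)"
proof -
  have "(norm X)\<^sup>2 = (\<Sum>i\<in>UNIV. \<Sum>j\<in>UNIV. (cmod (X $ i $ j))\<^sup>2)"
    by (simp add: norm_vec_def L2_set_def sum_nonneg)
  also have "\<dots> = (\<Sum>j\<in>UNIV. \<Sum>i\<in>UNIV. (cmod (X $ i $ j))\<^sup>2)" by (rule sum.swap)
  finally show ?thesis
    by (simp add: trace_def matrix_matrix_mult_def adjoint_mat_def complex_norm_square mult.commute del: of_real_power)
qed

lemma norm_unitary_mult:
  assumes "U \<in> unitary_group"
  shows "norm (U ** X) = norm X" "norm (X ** U) = norm X"
proof -
  have U: "adjoint_mat U ** U = mat 1" "U ** adjoint_mat U = mat 1" using assms by (simp_all add: unitary_group_def)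
  have "trace (adjoint_mat (U ** X) ** (U ** X)) = trace (adjoint_mat X ** ((adjoint_mat U ** U) ** X))"
    by (simp add: adjoint_mat_mult matrix_mul_assoc)
  then have "(norm (U ** X))\<^sup>2 = (norm X)\<^sup>2"
    unfolding U matrix_mul_lid trace_adjoint_mat_self of_real_eq_iff .
  then show "norm (U ** X) = norm X" by simp
  have "trace (adjoint_mat (X ** U) ** (X ** U)) = trace (adjoint_mat U ** (adjoint_mat X ** X ** U))"
    by (simp add: adjoint_mat_mult matrix_mul_assoc)
  also have "\<dots> = trace (adjoint_mat X ** X ** U ** adjoint_mat U)" by (rule trace_mul_sym)
  also have "\<dots> = trace (adjoint_mat X ** X ** (U ** adjoint_mat U))" by (simp add: matrix_mul_assoc)
  finally have "(norm (X ** U))\<^sup>2 = (norm X)\<^sup>2"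
    unfolding U matrix_mul_rid trace_adjoint_mat_self of_real_eq_iff .
  then show "norm (X ** U) = norm X" by simp
qed

lemma norm_le_op_norm: "norm (A :: complex^'d^'d) \<le> real (CARD('d)) ^ 2 * op_norm A"
proof -
  have "norm A \<le> (\<Sum>i\<in>UNIV. norm (A $ i))" unfolding norm_vec_def by (rule L2_set_le_sum) simp
  also have "\<dots> \<le> (\<Sum>i\<in>(UNIV::'d set). \<Sum>j\<in>(UNIV::'d set). op_norm A)"
  proof (rule sum_mono)
    fix i
    have "norm (A $ i) \<le> (\<Sum>j\<in>UNIV. norm (A $ i $ j))" unfolding norm_vec_def by (rule L2_set_le_sum) simp
    also have "\<dots> \<le> (\<Sum>j\<in>(UNIV::'d set). op_norm A)"
    proof (rule sum_mono)
      fix j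
      have "norm (A $ i $ j) = norm ((A *v axis j 1) $ i)"
        by (simp add: matrix_vector_mult_def axis_def if_distrib[of "\<lambda>x. _ * x"] cong: if_cong)
      also have "\<dots> \<le> norm (A *v axis j 1)" by (rule Finite_Cartesian_Product.norm_nth_le)
      also have "\<dots> \<le> onorm ((*v) A) * norm (axis j (1::complex) :: complex^'d)"
        by (rule onorm[OF matrix_vector_mul_bounded_linear])
      also have "\<dots> = op_norm A" by (simp add: op_norm_def norm_axis_eq)
      finally show "norm (A $ i $ j) \<le> op_norm A" .
    qed
    finally show "norm (A $ i) \<le> (\<Sum>j\<in>(UNIV::'d set). op_norm A)" .
  qed
  also have "\<dots> = real (CARD('d)) ^ 2 * op_norm A" by (simp add: power2_eq_square)
  finally show ?thesis .
qed

lemma op_norm_le_norm: "\<exists>K>0. \<forall>A :: complex^'d^'d. op_norm A \<le> K * norm A"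
proof -
  have "bilinear (\<lambda>(A :: complex^'d^'d) x. A *v x)"
    unfolding bilinear_def
  proof (intro conjI allI)
    show "linear (\<lambda>x. A *v x)" for A :: "complex^'d^'d"
      using matrix_vector_mul_bounded_linear[of A] by (simp add: linear_conv_bounded_linear)
    show "linear (\<lambda>A. A *v x)" for x :: "complex^'d"
      by (rule linearI) (simp_all add: matrix_vector_mult_def vec_eq_iff sum.distrib distrib_right scaleR_sum_right)
  qed
  then interpret bounded_bilinear "\<lambda>(A :: complex^'d^'d) x. A *v x" by (simp flip: bilinear_conv_bounded_bilinear)
  obtain K where K: "K > 0" "\<And>(A :: complex^'d^'d) x. norm (A *v x) \<le> norm A * norm x * K" using pos_bounded by blast
  have "op_norm A \<le> K * norm A" for A :: "complex^'d^'d"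
    unfolding op_norm_def using K by (intro onorm_le) (simp add: mult_ac)
  then show ?thesis using K(1) by blast
qed

section \<open>The stability theorem\<close>

context SL_lattice
begin

text \<open>Compactness of the unitary group: maps with defects tending to 0 have a subsequence
  converging at every element of the countable lattice, and the limit is a homomorphism. The
  convergence is not uniform over the lattice, so closeness is obtained on finite sets only.\<close>

lemma near_homomorphism_near_homomorphism_on_finite:
  assumes \<Phi>: "finite \<Phi>" "\<Phi> \<subseteq> \<Gamma>" and \<eta>: "\<eta> > 0"
  shows "\<exists>\<delta>>0. \<forall>\<mu> :: real^'n^'n \<Rightarrow> complex^'d^'d.
     (\<forall>g\<in>\<Gamma>. \<mu> g \<in> unitary_group) \<and> (\<forall>x\<in>\<Gamma>. \<forall>y\<in>\<Gamma>. op_norm (\<mu> (x ** y) - \<mu> x ** \<mu> y) \<le> \<delta>)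
     \<longrightarrow> (\<exists>\<nu> :: real^'n^'n \<Rightarrow> complex^'d^'d. (\<forall>g\<in>\<Gamma>. \<nu> g \<in> unitary_group)
        \<and> (\<forall>x\<in>\<Gamma>. \<forall>y\<in>\<Gamma>. \<nu> (x ** y) = \<nu> x ** \<nu> y) \<and> (\<forall>g\<in>\<Phi>. norm (\<mu> g - \<nu> g) \<le> \<eta>))"
  (is "\<exists>\<delta>>0. \<forall>\<mu>. ?near \<mu> \<delta> \<longrightarrow> (\<exists>\<nu>. ?hom \<nu> \<mu>)")
proof (rule ccontr)
  assume neg: "\<not> ?thesis"
  have "\<exists>\<mu>. ?near \<mu> (inverse (real (Suc m))) \<and> \<not> (\<exists>\<nu>. ?hom \<nu> \<mu>)" for m
  proof -
    have "inverse (real (Suc m)) > 0" by simp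
    then show ?thesis using neg by blast
  qed
  then obtain \<mu> where \<mu>: "\<And>m. ?near (\<mu> m) (inverse (real (Suc m)))" and no: "\<And>m. \<not> (\<exists>\<nu>. ?hom \<nu> (\<mu> m))"
    by metis
  have un: "\<mu> m g \<in> unitary_group" if "g \<in> \<Gamma>" for m g using \<mu> that by blast
  have "norm (\<mu> m g) \<le> norm (mat 1 :: complex^'d^'d)" if "g \<in> \<Gamma>" for m g
    using norm_unitary_mult(1)[OF un[OF that], of m "mat 1"] by simp
  then obtain r where r: "strict_mono (r :: nat \<Rightarrow> nat)" and "\<And>g. g \<in> \<Gamma> \<Longrightarrow> \<exists>l. (\<lambda>m. \<mu> (r m) g) \<longlonglongrightarrow> l"
    using function_convergent_subsequence[OF countable_lattice, of \<mu>] by blast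
  then obtain \<nu> where \<nu>: "\<And>g. g \<in> \<Gamma> \<Longrightarrow> (\<lambda>m. \<mu> (r m) g) \<longlonglongrightarrow> \<nu> g" by metis
  note mult = bounded_bilinear.tendsto[OF bounded_bilinear_complex_matrix_mult]
  note adj = bounded_linear.tendsto[OF linear_adjoint_mat[unfolded linear_conv_bounded_linear]]
  have "\<nu> g \<in> unitary_group" if g: "g \<in> \<Gamma>" for g
  proof -
    have "(\<lambda>m. \<mu> (r m) g ** adjoint_mat (\<mu> (r m) g)) \<longlonglongrightarrow> \<nu> g ** adjoint_mat (\<nu> g)"
      "(\<lambda>m. adjoint_mat (\<mu> (r m) g) ** \<mu> (r m) g) \<longlonglongrightarrow> adjoint_mat (\<nu> g) ** \<nu> g"
      by (intro mult adj \<nu> g)+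
    moreover have "\<mu> (r m) g ** adjoint_mat (\<mu> (r m) g) = mat 1" "adjoint_mat (\<mu> (r m) g) ** \<mu> (r m) g = mat 1" for m
      using un[OF g] by (auto simp: unitary_group_def)
    ultimately show ?thesis by (simp add: unitary_group_def LIMSEQ_const_iff)
  qed
  moreover have "\<nu> (x ** y) = \<nu> x ** \<nu> y" if x: "x \<in> \<Gamma>" and y: "y \<in> \<Gamma>" for x y
  proof -
    have "(\<lambda>m. \<mu> (r m) (x ** y) - \<mu> (r m) x ** \<mu> (r m) y) \<longlonglongrightarrow> \<nu> (x ** y) - \<nu> x ** \<nu> y"
      by (intro tendsto_diff mult \<nu> x y mult_in)
    moreover have "(\<lambda>m. \<mu> (r m) (x ** y) - \<mu> (r m) x ** \<mu> (r m) y) \<longlonglongrightarrow> 0"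
    proof (rule Lim_null_comparison)
      have "norm (\<mu> (r m) (x ** y) - \<mu> (r m) x ** \<mu> (r m) y) \<le> (real CARD('d))\<^sup>2 * inverse (real (Suc m))" for m
      proof -
        have "op_norm (\<mu> (r m) (x ** y) - \<mu> (r m) x ** \<mu> (r m) y) \<le> inverse (real (Suc (r m)))" using \<mu> x y by blast
        also have "\<dots> \<le> inverse (real (Suc m))"
          using strict_mono_imp_increasing[OF r, of m] by (intro le_imp_inverse_le) auto
        finally show ?thesis by (intro order_trans[OF norm_le_op_norm] mult_left_mono) auto
      qed
      then show "\<forall>\<^sub>F m in sequentially. norm (\<mu> (r m) (x ** y) - \<mu> (r m) x ** \<mu> (r m) y) \<le> (real CARD('d))\<^sup>2 * inverse (real (Suc m))"
        by simp
      show "(\<lambda>m. (real CARD('d))\<^sup>2 * inverse (real (Suc m))) \<longlonglongrightarrow> 0"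
        using tendsto_mult_left[OF LIMSEQ_inverse_real_of_nat, of "(real CARD('d))\<^sup>2"] by simp
    qed
    ultimately show ?thesis using LIMSEQ_unique by fastforce
  qed
  moreover have "\<forall>\<^sub>F m in sequentially. \<forall>g\<in>\<Phi>. norm (\<mu> (r m) g - \<nu> g) \<le> \<eta>"
  proof (rule eventually_ball_finite[OF \<Phi>(1)], rule ballI)
    fix g assume "g \<in> \<Phi>"
    then have "(\<lambda>m. \<mu> (r m) g) \<longlonglongrightarrow> \<nu> g" using \<Phi> \<nu> by blast
    from tendstoD[OF this \<eta>] show "\<forall>\<^sub>F m in sequentially. norm (\<mu> (r m) g - \<nu> g) \<le> \<eta>"
      by eventually_elim (simp add: dist_norm)
  qed
  then obtain m where "\<forall>g\<in>\<Phi>. norm (\<mu> (r m) g - \<nu> g) \<le> \<eta>" by (auto simp: eventually_sequentially)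
  ultimately have "?hom \<nu> (\<mu> (r m))" by blast
  then show False using no by blast
qed

text \<open>The right factor comes from an exact homomorphism and cancels, so the defect of the
  operators is the defect of \<mu> multiplied by a unitary matrix.\<close>

lemma conjugation_near_rep:
  fixes \<mu> \<nu> :: "real^'n^'n \<Rightarrow> complex^'d^'d"
  assumes \<mu>: "\<And>g. g \<in> \<Gamma> \<Longrightarrow> \<mu> g \<in> unitary_group" "\<mu> (mat 1) = mat 1"
    and \<nu>: "\<And>g. g \<in> \<Gamma> \<Longrightarrow> \<nu> g \<in> unitary_group" "\<And>x y. x \<in> \<Gamma> \<Longrightarrow> y \<in> \<Gamma> \<Longrightarrow> \<nu> (x ** y) = \<nu> x ** \<nu> y"
    and near: "\<And>x y (X :: complex^'d^'d). x \<in> \<Gamma> \<Longrightarrow> y \<in> \<Gamma> \<Longrightarrow> norm ((\<mu> (x ** y) - \<mu> x ** \<mu> y) ** X) \<le> \<delta> * norm X"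
    and \<delta>: "\<delta> > 0" and v: "norm v = 1"
  shows "near_rep \<Gamma> (\<lambda>g X. \<mu> g ** X ** adjoint_mat (\<nu> g)) \<delta> v"
proof (intro near_rep.intro near_rep_axioms.intro)
  have \<nu>': "adjoint_mat (\<nu> g) \<in> unitary_group" if "g \<in> \<Gamma>" for g using adjoint_mat_unitary[OF \<nu>(1)[OF that]] .
  show "linear (\<lambda>X. \<mu> g ** X ** adjoint_mat (\<nu> g))" for g
    by (rule linear_compose[OF linear_complex_matrix_mult(1) linear_complex_matrix_mult(2), unfolded o_def])
  show "norm (\<mu> g ** X ** adjoint_mat (\<nu> g)) = norm X" if "g \<in> \<Gamma>" for g X
    using norm_unitary_mult(2)[OF \<nu>'[OF that]] norm_unitary_mult(1)[OF \<mu>(1)[OF that]] by simp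
  show "norm (\<mu> (x ** y) ** X ** adjoint_mat (\<nu> (x ** y)) - \<mu> x ** (\<mu> y ** X ** adjoint_mat (\<nu> y)) ** adjoint_mat (\<nu> x)) \<le> \<delta> * norm X"
    if "x \<in> \<Gamma>" "y \<in> \<Gamma>" for x y X
  proof -
    have "\<mu> x ** (\<mu> y ** X ** adjoint_mat (\<nu> y)) ** adjoint_mat (\<nu> x) = (\<mu> x ** \<mu> y) ** X ** adjoint_mat (\<nu> (x ** y))"
      using that by (simp add: \<nu>(2) adjoint_mat_mult matrix_mul_assoc)
    then have "\<mu> (x ** y) ** X ** adjoint_mat (\<nu> (x ** y)) - \<mu> x ** (\<mu> y ** X ** adjoint_mat (\<nu> y)) ** adjoint_mat (\<nu> x)
        = ((\<mu> (x ** y) - \<mu> x ** \<mu> y) ** X) ** adjoint_mat (\<nu> (x ** y))"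
      by (simp add: linear_diff[OF linear_complex_matrix_mult(2)])
    then show ?thesis using near[OF that] norm_unitary_mult(2)[OF \<nu>'[OF mult_in[OF that]]] by simp
  qed
  have "\<nu> (mat 1) = \<nu> (mat 1) ** (\<nu> (mat 1) ** adjoint_mat (\<nu> (mat 1)))"
    using \<nu>(1)[OF one_in] by (simp add: unitary_group_def)
  also have "\<dots> = \<nu> (mat 1 ** mat 1) ** adjoint_mat (\<nu> (mat 1))" unfolding \<nu>(2)[OF one_in one_in] by (simp add: matrix_mul_assoc)
  also have "\<dots> = mat 1" using \<nu>(1)[OF one_in] by (simp add: unitary_group_def)
  finally have "adjoint_mat (\<nu> (mat 1)) = mat 1" using \<nu>(1)[OF one_in] by (simp add: unitary_group_def)
  then show "\<mu> (mat 1) ** X ** adjoint_mat (\<nu> (mat 1)) = X" for X using \<mu>(2) by simp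
qed (rule SL_lattice_axioms v \<delta>)+

end

theorem theorem0p4:
  fixes \<Gamma> :: "(real^'n^'n) set"
  assumes "CARD('n) \<ge> 3"
    and "lattice_SL \<Gamma>"
  shows "\<forall>\<epsilon>>0. \<exists>\<delta>>0. \<forall>\<mu> :: real^'n^'n \<Rightarrow> complex^'d^'d.
           (\<forall>g\<in>\<Gamma>. \<mu> g \<in> unitary_group) \<and> \<mu> (mat 1) = mat 1
           \<and> (\<forall>x\<in>\<Gamma>. \<forall>y\<in>\<Gamma>. op_norm (\<mu> (x ** y) - \<mu> x ** \<mu> y) \<le> \<delta>)
           \<longrightarrow> (\<exists>\<nu> :: real^'n^'n \<Rightarrow> complex^'d^'d.
                 (\<forall>g\<in>\<Gamma>. \<nu> g \<in> unitary_group)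
                 \<and> (\<forall>x\<in>\<Gamma>. \<forall>y\<in>\<Gamma>. \<nu> (x ** y) = \<nu> x ** \<nu> y)
                 \<and> (\<forall>g\<in>\<Gamma>. op_norm (\<mu> g - \<nu> g) \<le> \<epsilon>))"
proof (intro allI impI)
  fix \<epsilon> :: real assume \<epsilon>: "\<epsilon> > 0"
  interpret SL_lattice \<Gamma> using assms by unfold_locales
  \<comment> \<open>\<open>norm\<close> is the Frobenius norm, which makes matrices a Euclidean
    space. \<open>K\<close>, \<open>K1\<close> and \<open>K2\<close> are the dimension dependent
    prices for products and for passing to and from the operator norm.\<close>
  obtain K where K: "K > 0" "\<And>(A :: complex^'d^'d) (B :: complex^'d^'d). norm (A ** B) \<le> norm A * norm B * K"
    using bounded_bilinear.pos_bounded[OF bounded_bilinear_complex_matrix_mult] by blast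
  obtain K1 where K1: "K1 > 0" "\<And>A :: complex^'d^'d. op_norm A \<le> K1 * norm A" using op_norm_le_norm by blast
  define K2 where "K2 = (real CARD('d))\<^sup>2"
  have K2: "K2 > 0" "\<And>A :: complex^'d^'d. norm A \<le> K2 * op_norm A" using norm_le_op_norm by (auto simp: K2_def)
  define s where "s = norm (mat 1 :: complex^'d^'d)"
  have "mat 1 \<noteq> (0 :: complex^'d^'d)" by (simp add: vec_eq_iff mat_def)
  then have s: "s > 0" by (simp add: s_def)
  define v :: "complex^'d^'d" where "v = (1 / s) *\<^sub>R mat 1"
  have v: "norm v = 1" using s by (simp add: v_def s_def)
  have "\<epsilon> / (K1 * s) > 0" using \<epsilon> K1 s by simp
  from almost_invariant_vectors[OF this, where ?'v = "complex^'d^'d"]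
  obtain \<Phi> \<eta> where \<Phi>: "finite \<Phi>" "\<Phi> \<subseteq> \<Gamma>" and \<eta>: "\<eta> > 0"
    and inv: "\<And>(\<pi> :: real^'n^'n \<Rightarrow> complex^'d^'d \<Rightarrow> complex^'d^'d) \<delta> v. near_rep \<Gamma> \<pi> \<delta> v \<Longrightarrow> \<delta> \<le> \<eta>
        \<Longrightarrow> \<forall>\<gamma>\<in>\<Phi>. norm (\<pi> \<gamma> v - v) \<le> \<eta> \<Longrightarrow> \<forall>\<gamma>\<in>\<Gamma>. norm (\<pi> \<gamma> v - v) \<le> \<epsilon> / (K1 * s)"
    by (auto 0 0)
  have "\<eta> * s > 0" using \<eta> s by simp
  from near_homomorphism_near_homomorphism_on_finite[OF \<Phi> this, where ?'d = 'd]
  obtain \<delta>1 where \<delta>1: "\<delta>1 > 0" and fin: "\<And>\<mu> :: real^'n^'n \<Rightarrow> complex^'d^'d.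
     (\<forall>g\<in>\<Gamma>. \<mu> g \<in> unitary_group) \<and> (\<forall>x\<in>\<Gamma>. \<forall>y\<in>\<Gamma>. op_norm (\<mu> (x ** y) - \<mu> x ** \<mu> y) \<le> \<delta>1)
     \<Longrightarrow> (\<exists>\<nu> :: real^'n^'n \<Rightarrow> complex^'d^'d. (\<forall>g\<in>\<Gamma>. \<nu> g \<in> unitary_group)
        \<and> (\<forall>x\<in>\<Gamma>. \<forall>y\<in>\<Gamma>. \<nu> (x ** y) = \<nu> x ** \<nu> y) \<and> (\<forall>g\<in>\<Phi>. norm (\<mu> g - \<nu> g) \<le> \<eta> * s))"
    by (auto 0 0)
  define \<delta> where "\<delta> = min \<delta>1 (\<eta> / (K * K2))"
  have \<delta>: "\<delta> > 0" "\<delta> \<le> \<delta>1" "K * K2 * \<delta> \<le> \<eta>"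
    using \<delta>1 \<eta> K K2 by (auto simp: \<delta>_def min_def field_simps)
  show "\<exists>\<delta>>0. \<forall>\<mu> :: real^'n^'n \<Rightarrow> complex^'d^'d.
           (\<forall>g\<in>\<Gamma>. \<mu> g \<in> unitary_group) \<and> \<mu> (mat 1) = mat 1
           \<and> (\<forall>x\<in>\<Gamma>. \<forall>y\<in>\<Gamma>. op_norm (\<mu> (x ** y) - \<mu> x ** \<mu> y) \<le> \<delta>)
           \<longrightarrow> (\<exists>\<nu> :: real^'n^'n \<Rightarrow> complex^'d^'d.
                 (\<forall>g\<in>\<Gamma>. \<nu> g \<in> unitary_group)
                 \<and> (\<forall>x\<in>\<Gamma>. \<forall>y\<in>\<Gamma>. \<nu> (x ** y) = \<nu> x ** \<nu> y)
                 \<and> (\<forall>g\<in>\<Gamma>. op_norm (\<mu> g - \<nu> g) \<le> \<epsilon>))"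
  proof (intro exI[of _ \<delta>] conjI allI impI)
    fix \<mu> :: "real^'n^'n \<Rightarrow> complex^'d^'d"
    assume as: "(\<forall>g\<in>\<Gamma>. \<mu> g \<in> unitary_group) \<and> \<mu> (mat 1) = mat 1
           \<and> (\<forall>x\<in>\<Gamma>. \<forall>y\<in>\<Gamma>. op_norm (\<mu> (x ** y) - \<mu> x ** \<mu> y) \<le> \<delta>)"
    then have near: "op_norm (\<mu> (x ** y) - \<mu> x ** \<mu> y) \<le> \<delta>" if "x \<in> \<Gamma>" "y \<in> \<Gamma>" for x y using that by blast
    have "(\<forall>g\<in>\<Gamma>. \<mu> g \<in> unitary_group) \<and> (\<forall>x\<in>\<Gamma>. \<forall>y\<in>\<Gamma>. op_norm (\<mu> (x ** y) - \<mu> x ** \<mu> y) \<le> \<delta>1)"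
      using as near \<delta>(2) by (meson order_trans)
    from fin[OF this] obtain \<nu> :: "real^'n^'n \<Rightarrow> complex^'d^'d" where \<nu>: "\<forall>g\<in>\<Gamma>. \<nu> g \<in> unitary_group"
      "\<forall>x\<in>\<Gamma>. \<forall>y\<in>\<Gamma>. \<nu> (x ** y) = \<nu> x ** \<nu> y" and \<nu>\<Phi>: "\<forall>g\<in>\<Phi>. norm (\<mu> g - \<nu> g) \<le> \<eta> * s" by blast
    define \<pi> where "\<pi> g X = \<mu> g ** X ** adjoint_mat (\<nu> g)" for g X
    have rep: "near_rep \<Gamma> \<pi> (K * K2 * \<delta>) v"
      unfolding \<pi>_def[abs_def]
    proof (rule conjugation_near_rep)
      show "norm ((\<mu> (x ** y) - \<mu> x ** \<mu> y) ** X) \<le> K * K2 * \<delta> * norm X" if "x \<in> \<Gamma>" "y \<in> \<Gamma>" for x y and X :: "complex^'d^'d"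
      proof -
        let ?A = "\<mu> (x ** y) - \<mu> x ** \<mu> y"
        have "norm ?A \<le> K2 * \<delta>" using K2(2)[of ?A] mult_left_mono[OF near[OF that], of K2] K2(1) by linarith
        then have "norm ?A * norm X * K \<le> K2 * \<delta> * norm X * K" using K(1) by (intro mult_right_mono) auto
        then show ?thesis using K(2)[of ?A X] by (simp add: mult_ac)
      qed
    qed (use as \<nu> K K2 \<delta> v in auto)
    \<comment> \<open>Right multiplication by the unitary adjoint of \<open>\<nu> g\<close> is
      isometric, so the displacement of the normalised identity matrix is the distance between the
      two maps at g.\<close>
    have diff: "norm (\<pi> g v - v) = norm (\<mu> g - \<nu> g) / s" if "g \<in> \<Gamma>" for g
    proof -
      have u: "\<nu> g \<in> unitary_group" using \<nu> that by blast
      have "\<pi> g v - v = (1 / s) *\<^sub>R (\<mu> g ** adjoint_mat (\<nu> g) - mat 1)"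
        by (simp add: \<pi>_def v_def complex_matrix_mult_scaleR scaleR_diff_right)
      also have "\<mu> g ** adjoint_mat (\<nu> g) - mat 1 = (\<mu> g - \<nu> g) ** adjoint_mat (\<nu> g)"
        using u by (simp add: linear_diff[OF linear_complex_matrix_mult(2)] unitary_group_def)
      finally show ?thesis
        using s norm_unitary_mult(2)[OF adjoint_mat_unitary[OF u], of "\<mu> g - \<nu> g"] by simp
    qed
    have "\<forall>\<gamma>\<in>\<Phi>. norm (\<pi> \<gamma> v - v) \<le> \<eta>"
      using \<nu>\<Phi> \<Phi>(2) s by (auto simp: diff divide_le_eq)
    from inv[OF rep \<delta>(3) this] have fin: "norm (\<mu> g - \<nu> g) / s \<le> \<epsilon> / (K1 * s)" if "g \<in> \<Gamma>" for g
      using diff that by force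
    have "op_norm (\<mu> g - \<nu> g) \<le> \<epsilon>" if "g \<in> \<Gamma>" for g
    proof -
      have "norm (\<mu> g - \<nu> g) \<le> \<epsilon> / K1" using fin[OF that] s by (simp add: field_simps)
      then have "K1 * norm (\<mu> g - \<nu> g) \<le> \<epsilon>" using K1(1) by (simp add: field_simps)
      then show ?thesis using K1(2)[of "\<mu> g - \<nu> g"] by linarith
    qed
    then show "\<exists>\<nu> :: real^'n^'n \<Rightarrow> complex^'d^'d.
                 (\<forall>g\<in>\<Gamma>. \<nu> g \<in> unitary_group)
                 \<and> (\<forall>x\<in>\<Gamma>. \<forall>y\<in>\<Gamma>. \<nu> (x ** y) = \<nu> x ** \<nu> y)
                 \<and> (\<forall>g\<in>\<Gamma>. op_norm (\<mu> g - \<nu> g) \<le> \<epsilon>)" using \<nu> by blast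
  qed (rule \<delta>(1))
qed

end
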